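(* Let $f\colon\mathbb{R}\to\mathbb{R}$ be periodic of period $1$ and of class $C^{1+\delta}$ for some $\delta>0$, and let $c\in\mathbb{Z}$. Then for a generic set of $\alpha\in\mathbb{R}$ the homeomorphism $$T_{c,f}\colon\mathbb{T}^2\to\mathbb{T}^2,\qquad T_{c,f}(x,y)=(x+\alpha,\;y+cx+f(x))\pmod 1$$ is disjoint from the Möbius function $\mu$, that is, for every $z\in\mathbb{T}^2$ and every $g\in C(\mathbb{T}^2)$, $$\sum_{n\le N} g\big(T_{c,f}^n z\big)\,\mu(n)=o(N)\quad\text{as }N\to\infty.$$
   Context: $\mathbb{T}=\mathbb{R}/\mathbb{Z}$ is the additive circle. "Generic set of $\alpha$" means a residual set, i.e. one containing a countable intersection of dense open sets (the set is allowed to depend on $f$ and $c$). $\mu\colon\mathbb{N}\to\{-1,0,1\}$ is the Möbius function: $\mu(1)=1$, $\mu(p_1\cdots p_k)=(-1)^k$ for distinct primes $p_1,\dots,p_k$, and $\mu(n)=0$ otherwise. $C^{1+\delta}$ means differentiable with derivative Hölder continuous of exponent $\delta$. *)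

theory Defs
  imports "HOL-Analysis.Analysis" "HOL-Computational_Algebra.Squarefree" "HOL-Library.Landau_Symbols"
begin

quotient_type circle = real / "\<lambda>x y. x - y \<in> \<int>"
proof (intro equivpI reflpI sympI transpI)
  show "y - x \<in> \<int>" if "x - y \<in> \<int>" for x y :: real
    using Ints_minus[OF that] by simp
  show "x - z \<in> \<int>" if "x - y \<in> \<int>" "y - z \<in> \<int>" for x y z :: real
    using Ints_add[OF that] by simp
qed simp

instantiation circle :: topological_space
begin

definition open_circle :: "circle set \<Rightarrow> bool"
  where "open_circle U \<longleftrightarrow> open (abs_circle -` U)"

instance
proof
  show "open (UNIV :: circle set)"
    by (simp add: open_circle_def)
  show "open (S \<inter> T)" if "open S" "open T" for S T :: "circle set"
    using that by (simp add: open_circle_def open_Int)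
  show "open (\<Union>K)" if "\<forall>S\<in>K. open S" for K :: "circle set set"
    using that by (auto simp: open_circle_def vimage_Union)
qed

end

text \<open>
  For \<open>f\<close> of period 1 the choice of representatives made here is immaterial
  (\<open>skew_map_abs_circle\<close> below).
\<close>

definition skew_map :: "real \<Rightarrow> int \<Rightarrow> (real \<Rightarrow> real) \<Rightarrow> circle \<times> circle \<Rightarrow> circle \<times> circle"
  where "skew_map \<alpha> c f = (\<lambda>(X, Y).
    let x = rep_circle X; y = rep_circle Y
    in (abs_circle (x + \<alpha>), abs_circle (y + of_int c * x + f x)))"

definition moebius :: "nat \<Rightarrow> int"
  where "moebius n = (if squarefree n then (-1) ^ card (prime_factors n) else 0)"

definition moebius_disjoint :: "('a::topological_space \<Rightarrow> 'a) \<Rightarrow> bool"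
  where "moebius_disjoint T \<longleftrightarrow>
    (\<forall>z. \<forall>g :: 'a \<Rightarrow> complex. continuous_on UNIV g \<longrightarrow>
      (\<lambda>N. \<Sum>n = 1..N. g ((T ^^ n) z) * of_int (moebius n)) \<in> o(\<lambda>N. of_nat N))"

definition C1_Hoelder :: "real \<Rightarrow> (real \<Rightarrow> real) \<Rightarrow> bool"
  where "C1_Hoelder \<delta> f \<longleftrightarrow>
    (\<exists>f'. (\<forall>x. (f has_real_derivative f' x) (at x)) \<and>
      (\<exists>C. \<forall>x y. \<bar>f' x - f' y\<bar> \<le> C * \<bar>x - y\<bar> powr \<delta>))"

definition residual :: "'a::topological_space set \<Rightarrow> bool"
  where "residual S \<longleftrightarrow>
    (\<exists>\<U>. countable \<U> \<and> (\<forall>U\<in>\<U>. open U \<and> closure U = UNIV) \<and> \<Inter>\<U> \<subseteq> S)"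

lemma moebius_prod_primes:
  assumes "finite P" "\<And>p. p \<in> P \<Longrightarrow> prime p"
  shows "moebius (\<Prod>P) = (-1) ^ card P"
proof -
  have "prime_factorization (\<Prod>P) = mset_set P"
    using assms prime_factorization_prod_mset_primes[of "mset_set P"]
    by (simp add: prod_unfold_prod_mset)
  moreover from this have "prime_factors (\<Prod>P) = P"
    using assms by simp
  moreover have "squarefree (\<Prod>P)"
  proof (rule squarefree_prod_coprime)
    show "coprime p q" if "p \<in> P" "q \<in> P" "p \<noteq> q" for p q
      using that assms(2) primes_coprime by blast
    show "squarefree p" if "p \<in> P" for p
      using that assms(2) squarefree_prime by blast
  qed
  ultimately show ?thesis by (simp add: moebius_def)
qed

lemma abs_circle_eq_iff: "abs_circle x = abs_circle y \<longleftrightarrow> x - y \<in> \<int>"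
  by (simp add: circle.abs_eq_iff)

lemma abs_rep_circle [simp]: "abs_circle (rep_circle X) = X"
  by (rule Quotient_abs_rep[OF Quotient_circle])

lemma periodic_of_int:
  fixes f :: "real \<Rightarrow> real"
  assumes "\<forall>x. f (x + 1) = f x"
  shows "f (x + of_int k) = f x"
proof (induction k rule: int_induct[where k = 0])
  case (step1 i)
  then show ?case using assms[rule_format, of "x + of_int i"] by (simp add: add.assoc)
next
  case (step2 i)
  then show ?case using assms[rule_format, of "x + of_int (i - 1)"] by (simp add: add.assoc)
qed simp

lemma skew_map_abs_circle:
  assumes "\<forall>x. f (x + 1) = f x"
  shows "skew_map \<alpha> c f (abs_circle x, abs_circle y) =
    (abs_circle (x + \<alpha>), abs_circle (y + of_int c * x + f x))"
proof -
  define x' y' where "x' = rep_circle (abs_circle x)" and "y' = rep_circle (abs_circle y)"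
  have "abs_circle x' = abs_circle x" "abs_circle y' = abs_circle y"
    by (simp_all add: x'_def y'_def)
  then obtain k l where kl: "x' - x = of_int k" "y' - y = of_int l"
    unfolding abs_circle_eq_iff by (auto elim!: Ints_cases)
  then have x': "x' = x + of_int k" and y': "y' = y + of_int l"
    by simp_all
  have "f x' = f x"
    unfolding x' by (rule periodic_of_int[OF assms])
  then have "y' + of_int c * x' + f x' - (y + of_int c * x + f x) = of_int (l + c * k)"
    by (simp add: x' y' algebra_simps)
  then have "abs_circle (y' + of_int c * x' + f x') = abs_circle (y + of_int c * x + f x)"
    unfolding abs_circle_eq_iff by (metis Ints_of_int)
  moreover have "abs_circle (x' + \<alpha>) = abs_circle (x + \<alpha>)"
    unfolding abs_circle_eq_iff by (simp add: x')
  ultimately show ?thesis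
    by (simp add: skew_map_def Let_def x'_def[symmetric] y'_def[symmetric])
qed

lemma continuous_on_abs_circle: "continuous_on UNIV abs_circle"
  by (simp add: continuous_on_open_vimage open_circle_def)

lemma open_abs_circle_image:
  assumes "open A"
  shows "open (abs_circle ` A)"
proof -
  have "abs_circle -` abs_circle ` A = (\<Union>k. (\<lambda>x. x + of_int k) ` A)"
  proof (intro set_eqI iffI)
    fix y assume "y \<in> abs_circle -` abs_circle ` A"
    then obtain x k where "x \<in> A" "y - x = of_int k"
      by (auto simp: abs_circle_eq_iff elim!: Ints_cases)
    then have "y = x + of_int k" by simp
    with \<open>x \<in> A\<close> show "y \<in> (\<Union>k. (\<lambda>x. x + of_int k) ` A)" by blast
  next
    fix y assume "y \<in> (\<Union>k. (\<lambda>x. x + of_int k) ` A)"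
    then obtain x k where x: "x \<in> A" "y = x + of_int k" by auto
    then have "abs_circle y = abs_circle x" by (simp add: abs_circle_eq_iff)
    with x show "y \<in> abs_circle -` abs_circle ` A" by auto
  qed
  moreover have "open ((\<lambda>x. x + of_int k) ` A)" for k
    using open_translation[OF assms, of "of_int k"] by (simp add: add.commute)
  ultimately show ?thesis by (auto simp: open_circle_def)
qed

lemma continuous_on_skew_map:
  assumes per: "\<forall>x. f (x + 1) = f x" and cont: "continuous_on UNIV f"
  shows "continuous_on UNIV (skew_map \<alpha> c f)"
proof -
  let ?\<pi> = "map_prod abs_circle abs_circle"
  let ?F = "\<lambda>p. (abs_circle (fst p + \<alpha>), abs_circle (snd p + of_int c * fst p + f (fst p)))"
  have F: "skew_map \<alpha> c f (?\<pi> p) = ?F p" for p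
    by (cases p) (simp add: skew_map_abs_circle[OF per])
  have contF: "continuous_on UNIV ?F"
    by (intro continuous_intros continuous_on_compose2[OF continuous_on_abs_circle]
        continuous_on_compose2[OF cont]) auto
  have open_img: "open (?\<pi> ` A)" if A: "open A" for A
    unfolding open_prod_def
  proof
    fix q assume "q \<in> ?\<pi> ` A"
    then obtain x y where xy: "(x, y) \<in> A" "q = (abs_circle x, abs_circle y)" by auto
    obtain B C where BC: "open B" "open C" "(x, y) \<in> B \<times> C" "B \<times> C \<subseteq> A"
      using open_prod_elim[OF A xy(1)] by metis
    have "abs_circle ` B \<times> abs_circle ` C = ?\<pi> ` (B \<times> C)" by force
    with BC xy have "q \<in> abs_circle ` B \<times> abs_circle ` C"
      "abs_circle ` B \<times> abs_circle ` C \<subseteq> ?\<pi> ` A" by auto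
    then show "\<exists>B C. open B \<and> open C \<and> q \<in> B \<times> C \<and> B \<times> C \<subseteq> ?\<pi> ` A"
      using open_abs_circle_image BC(1,2) by blast
  qed
  show ?thesis
  proof (subst continuous_on_open_vimage, simp, intro allI impI)
    fix U :: "(circle \<times> circle) set" assume U: "open U"
    have surj: "range ?\<pi> = UNIV"
      by (intro map_prod_surj surjI[where f = rep_circle] abs_rep_circle)
    have "skew_map \<alpha> c f -` U = ?\<pi> ` (?F -` U)"
    proof (intro set_eqI iffI)
      fix q assume "q \<in> skew_map \<alpha> c f -` U"
      moreover obtain p where "q = ?\<pi> p" using surjD[OF surj] by blast
      ultimately show "q \<in> ?\<pi> ` (?F -` U)" using F[of p] by auto
    next
      fix q assume "q \<in> ?\<pi> ` (?F -` U)"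
      then obtain p where "q = ?\<pi> p" "?F p \<in> U" by auto
      then show "q \<in> skew_map \<alpha> c f -` U" using F[of p] by simp
    qed
    moreover have "open (?F -` U)"
      using contF U by (simp add: continuous_on_open_vimage)
    ultimately show "open (skew_map \<alpha> c f -` U \<inter> UNIV)"
      by (simp add: open_img)
  qed
qed

lemma homeomorphism_skew_map:
  assumes per: "\<forall>x. f (x + 1) = f x" and cont: "continuous_on UNIV f"
  shows "homeomorphism UNIV UNIV (skew_map \<alpha> c f)
    (skew_map (- \<alpha>) (- c) (\<lambda>x. of_int c * \<alpha> - f (x - \<alpha>)))"
    (is "homeomorphism UNIV UNIV ?S ?S'")
proof -
  let ?f' = "\<lambda>x. of_int c * \<alpha> - f (x - \<alpha>)"
  have per': "\<forall>x. ?f' (x + 1) = ?f' x"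
  proof
    fix x show "?f' (x + 1) = ?f' x"
      using per[rule_format, of "x - \<alpha>"] by (simp add: algebra_simps)
  qed
  have cont': "continuous_on UNIV ?f'"
    by (intro continuous_intros continuous_on_compose2[OF cont]) auto
  have rep: "\<exists>x y. p = (abs_circle x, abs_circle y)" for p
    by (metis abs_rep_circle surj_pair)
  have 1: "?S' (?S p) = p" for p
  proof -
    obtain x y where "p = (abs_circle x, abs_circle y)" using rep by blast
    then show ?thesis
      by (simp only: skew_map_abs_circle[OF per] skew_map_abs_circle[OF per']) (simp add: algebra_simps)
  qed
  have 2: "?S (?S' p) = p" for p
  proof -
    obtain x y where "p = (abs_circle x, abs_circle y)" using rep by blast
    then show ?thesis
      by (simp only: skew_map_abs_circle[OF per] skew_map_abs_circle[OF per']) (simp add: algebra_simps)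
  qed
  show ?thesis
    by (rule homeomorphismI)
      (auto simp: 1 2 continuous_on_skew_map[OF per cont] continuous_on_skew_map[OF per' cont'])
qed

end

theory Submission
  imports Defs "HOL-Complex_Analysis.Complex_Analysis" "HOL-Number_Theory.Cong"
    "HOL-Real_Asymp.Real_Asymp"
begin

(*FILE dev/Base*)
definition ec :: "real \<Rightarrow> complex"
  where "ec x = cis (2 * pi * x)"

lemma ec_0 [simp]: "ec 0 = 1"
  by (simp add: ec_def)

lemma norm_ec [simp]: "cmod (ec x) = 1"
  by (simp add: ec_def)

lemma ec_add: "ec (x + y) = ec x * ec y"
  by (simp add: ec_def cis_mult algebra_simps)

lemma ec_diff: "ec (x - y) = ec x * ec (- y)"
  using ec_add[of x "- y"] by simp

lemma cnj_ec: "cnj (ec x) = ec (- x)"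
  by (simp add: ec_def cis_cnj)

lemma ec_neq_0 [simp]: "ec x \<noteq> 0"
  using norm_ec[of x] by (metis norm_zero zero_neq_one)

lemma ec_int [simp]: "x \<in> \<int> \<Longrightarrow> ec x = 1"
  by (simp add: ec_def)

lemma ec_power: "ec x ^ n = ec (of_nat n * x)"
  by (induction n) (simp_all add: ec_add algebra_simps)

lemma ec_eq_1_iff: "ec x = 1 \<longleftrightarrow> x \<in> \<int>"
proof
  assume "ec x = 1"
  then have "cos (2 * pi * x) = 1"
    by (simp add: ec_def complex_eq_iff)
  then obtain n :: int where "2 * pi * x = of_int n * 2 * pi"
    by (auto simp: cos_one_2pi_int)
  then have "x = of_int n" by simp
  then show "x \<in> \<int>" by simp
qed simp

lemma ec_cong_int: "x - y \<in> \<int> \<Longrightarrow> ec x = ec y"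
  using ec_add[of "x - y" y] by simp

lemma continuous_on_ec [continuous_intros]:
  "continuous_on A f \<Longrightarrow> continuous_on A (\<lambda>x. ec (f x))"
  unfolding ec_def by (intro continuous_intros)

lemma norm_ec_diff: "cmod (ec x - ec y) \<le> 2 * pi * \<bar>x - y\<bar>"
proof -
  have "cmod (cis a - cis b) \<le> \<bar>a - b\<bar>" for a b
  proof -
    have "cmod (cis a - cis b) \<le> 1 * cmod (of_real a - of_real b)"
      unfolding cis_conv_exp
    proof (rule field_differentiable_bound[of "{z :: complex. Im z = 0}"
          "\<lambda>z. exp (\<i> * z)" "\<lambda>z. \<i> * exp (\<i> * z)"])
      show "convex {z. Im z = 0}"
        by (auto simp: convex_def)
    qed (auto intro!: derivative_eq_intros simp: norm_mult)
    then show ?thesis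
      by (metis mult_1 norm_of_real of_real_diff)
  qed
  from this[of "2 * pi * x" "2 * pi * y"] show ?thesis
    by (simp add: ec_def abs_mult flip: right_diff_distrib)
qed

lemma norm_geometric_ec:
  assumes "ec x \<noteq> 1"
  shows "cmod (\<Sum>j<k. ec (of_nat j * x)) \<le> 2 / cmod (ec x - 1)"
proof -
  have "(\<Sum>j<k. ec (of_nat j * x)) = (ec x ^ k - 1) / (ec x - 1)"
    using geometric_sum[OF assms, of k] by (simp add: ec_power)
  moreover have "cmod (ec x ^ k - 1) \<le> 2"
    by (rule order_trans[OF norm_triangle_ineq4]) (simp add: norm_power)
  ultimately show ?thesis
    by (simp add: norm_divide divide_right_mono)
qed

definition mean_zero :: "(nat \<Rightarrow> complex) \<Rightarrow> bool"
  where "mean_zero a \<longleftrightarrow> (\<lambda>N. (\<Sum>n = 1..N. a n) / of_nat N) \<longlonglongrightarrow> 0"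

lemma mean_zero_iff:
  "mean_zero a \<longleftrightarrow> (\<forall>\<epsilon>>0. \<forall>\<^sub>F N in sequentially. cmod (\<Sum>n = 1..N. a n) \<le> \<epsilon> * real N)"
proof
  assume L: "mean_zero a"
  show "\<forall>\<epsilon>>0. \<forall>\<^sub>F N in sequentially. cmod (\<Sum>n = 1..N. a n) \<le> \<epsilon> * real N"
  proof (intro allI impI)
    fix \<epsilon> :: real assume "\<epsilon> > 0"
    then have "\<forall>\<^sub>F N in sequentially. cmod ((\<Sum>n = 1..N. a n) / of_nat N) < \<epsilon>"
      using L by (auto simp: mean_zero_def tendsto_iff)
    with eventually_gt_at_top[of "0 :: nat"]
    show "\<forall>\<^sub>F N in sequentially. cmod (\<Sum>n = 1..N. a n) \<le> \<epsilon> * real N"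
      by eventually_elim (simp add: norm_divide field_simps)
  qed
next
  assume R: "\<forall>\<epsilon>>0. \<forall>\<^sub>F N in sequentially. cmod (\<Sum>n = 1..N. a n) \<le> \<epsilon> * real N"
  show "mean_zero a"
    unfolding mean_zero_def tendsto_iff
  proof (intro allI impI)
    fix e :: real assume "e > 0"
    then have "\<forall>\<^sub>F N in sequentially. cmod (\<Sum>n = 1..N. a n) \<le> e / 2 * real N"
      using R half_gt_zero by blast
    with eventually_gt_at_top[of "0 :: nat"]
    show "\<forall>\<^sub>F N in sequentially. dist ((\<Sum>n = 1..N. a n) / of_nat N) 0 < e"
    proof eventually_elim
      case (elim N)
      then have "cmod (\<Sum>n = 1..N. a n) / N \<le> e / 2"
        by (simp add: field_simps)
      also have "e / 2 < e" using \<open>e > 0\<close> by simp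
      finally show ?case by (simp add: norm_divide)
    qed
  qed
qed

lemma mean_zero_add:
  "mean_zero a \<Longrightarrow> mean_zero b \<Longrightarrow> mean_zero (\<lambda>n. a n + b n)"
  unfolding mean_zero_def sum.distrib add_divide_distrib
  by (rule tendsto_add_zero)

lemma mean_zero_cmult: "mean_zero a \<Longrightarrow> mean_zero (\<lambda>n. c * a n)"
  unfolding mean_zero_def sum_distrib_left[symmetric] times_divide_eq_right[symmetric]
  by (rule tendsto_mult_right_zero)

lemma mean_zero_sum:
  "(\<And>i. i \<in> I \<Longrightarrow> mean_zero (a i)) \<Longrightarrow> mean_zero (\<lambda>n. \<Sum>i\<in>I. a i n)"
proof (induction I rule: infinite_finite_induct)
  case (insert x F)
  then show ?case
    by (simp add: mean_zero_add)
qed (simp_all add: mean_zero_def)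

lemma mean_zero_approx:
  assumes "\<And>\<epsilon>. \<epsilon> > 0 \<Longrightarrow> \<exists>b. mean_zero b \<and> (\<forall>n. cmod (a n - b n) \<le> \<epsilon>)"
  shows "mean_zero a"
  unfolding mean_zero_iff
proof (intro allI impI)
  fix \<epsilon> :: real assume "\<epsilon> > 0"
  then obtain b where b: "mean_zero b" "\<And>n. cmod (a n - b n) \<le> \<epsilon> / 2"
    using assms[of "\<epsilon> / 2"] by auto
  have "\<forall>\<^sub>F N in sequentially. cmod (\<Sum>n = 1..N. b n) \<le> \<epsilon> / 2 * real N"
    using b(1) \<open>\<epsilon> > 0\<close> half_gt_zero unfolding mean_zero_iff by blast
  then show "\<forall>\<^sub>F N in sequentially. cmod (\<Sum>n = 1..N. a n) \<le> \<epsilon> * real N"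
  proof eventually_elim
    case (elim N)
    have "cmod (\<Sum>n = 1..N. a n - b n) \<le> (\<Sum>n = 1..N. \<epsilon> / 2)"
      by (rule sum_norm_le) (use b in auto)
    then have "cmod (\<Sum>n = 1..N. a n - b n) \<le> \<epsilon> / 2 * real N"
      by (simp add: field_simps)
    moreover have "cmod (\<Sum>n = 1..N. a n)
        \<le> cmod (\<Sum>n = 1..N. a n - b n) + cmod (\<Sum>n = 1..N. b n)"
      using norm_triangle_ineq[of "\<Sum>n = 1..N. a n - b n" "\<Sum>n = 1..N. b n"]
      by (simp flip: sum.distrib)
    ultimately show ?case
      using elim by (simp add: algebra_simps)
  qed
qed

lemma moebius_1 [simp]: "moebius (Suc 0) = 1"
  by (simp add: moebius_def)

lemma abs_moebius_le: "\<bar>moebius n\<bar> \<le> 1"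
  by (simp add: moebius_def power_abs)

lemma norm_moebius_le: "cmod (of_int (moebius n)) \<le> 1"
  using abs_moebius_le[of n] by (metis norm_of_int of_int_1_le_iff of_int_abs of_int_le_1_iff)

lemma moebius_prime_mult:
  assumes "prime p" "\<not> p dvd m"
  shows "moebius (p * m) = - moebius m"
proof -
  have m: "m \<noteq> 0" using assms by (metis dvd_0_right)
  have cop: "coprime p m" using assms by (simp add: prime_imp_coprime)
  have "squarefree (p * m) \<longleftrightarrow> squarefree m"
    using cop squarefree_mult_coprime[OF cop] squarefree_prime[OF assms(1)] squarefree_multD(2) by blast
  moreover have "prime_factors (p * m) = insert p (prime_factors m)"
    using assms m by (auto simp: prime_factors_product prime_prime_factors)
  moreover have "p \<notin> prime_factors m"
    using assms by auto
  ultimately show ?thesis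
    by (simp add: moebius_def)
qed

lemma moebius_prime_square:
  assumes "prime p" "p dvd m"
  shows "moebius (p * m) = 0"
proof -
  have "p\<^sup>2 dvd p * m"
    using assms(2) by (simp add: power2_eq_square mult_dvd_mono)
  moreover have "\<not> is_unit p" using assms(1) not_prime_unit by blast
  ultimately have "\<not> squarefree (p * m)"
    unfolding squarefree_def by blast
  then show ?thesis by (simp add: moebius_def)
qed

lemma sum_moebius_divisors:
  assumes "n > 0"
  shows "(\<Sum>d | d dvd n. moebius d) = (if n = 1 then 1 else 0)"
proof (cases "n = 1")
  case False
  then obtain p where p: "prime p" "p dvd n"
    using prime_factor_nat by blast
  then obtain m where n: "n = p * m" by auto
  have fin: "finite {d. d dvd n}" "finite {d. d dvd m}"
    using assms n by auto
  have "{d. d dvd n} = {d. d dvd m \<and> \<not> p dvd d} \<union> (\<lambda>d. p * d) ` {d. d dvd m}"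
  proof -
    have "d dvd n \<longleftrightarrow> d dvd m" if "\<not> p dvd d" for d
      using p that unfolding n
      by (metis coprime_commute coprime_dvd_mult_right_iff prime_imp_coprime)
    moreover have "p * d dvd n \<longleftrightarrow> d dvd m" for d
      using p n by auto
    moreover have "d \<in> (\<lambda>d. p * d) ` {d. d dvd m}" if "p dvd d" "d dvd n" for d
      using that p n by (elim dvdE[of p]) auto
    ultimately show ?thesis
      by blast
  qed
  then have "(\<Sum>d | d dvd n. moebius d)
      = (\<Sum>d | d dvd m \<and> \<not> p dvd d. moebius d) + (\<Sum>d\<in>(\<lambda>d. p * d) ` {d. d dvd m}. moebius d)"
    using fin by (auto intro!: sum.union_disjoint)
  also have "(\<Sum>d\<in>(\<lambda>d. p * d) ` {d. d dvd m}. moebius d) = (\<Sum>d | d dvd m. moebius (p * d))"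
    using p by (subst sum.reindex) (auto intro!: inj_onI simp: o_def)
  also have "\<dots> = (\<Sum>d | d dvd m \<and> \<not> p dvd d. - moebius d)"
    using p fin by (intro sum.mono_neutral_cong_right)
      (auto simp: moebius_prime_mult moebius_prime_square)
  finally show ?thesis
    using False by (simp add: sum_negf)
qed (simp add: dvd_1_iff_1[unfolded One_nat_def] cong: conj_cong)

(*FILE dev/LSer*)
definition npow :: "nat \<Rightarrow> complex \<Rightarrow> complex"
  where "npow n s = exp (- (s * of_real (ln (real n))))"

lemma npow_1 [simp]: "npow (Suc 0) s = 1"
  by (simp add: npow_def)

lemma npow_mult: "m > 0 \<Longrightarrow> n > 0 \<Longrightarrow> npow (m * n) s = npow m s * npow n s"
  by (simp add: npow_def ln_mult algebra_simps flip: exp_add)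

lemma norm_npow: "n > 0 \<Longrightarrow> cmod (npow n s) = real n powr (- Re s)"
  by (simp add: npow_def powr_def)

lemma npow_at_1: "n > 0 \<Longrightarrow> npow n 1 = 1 / of_nat n"
  by (simp add: npow_def exp_minus exp_of_real inverse_eq_divide)

lemma npow_add: "npow n (s + t) = npow n s * npow n t"
  by (simp add: npow_def algebra_simps flip: exp_add)

lemma holomorphic_npow [holomorphic_intros]: "(\<lambda>s. npow n s) holomorphic_on U"
  unfolding npow_def by (intro holomorphic_intros)

lemma has_derivative_exp_Ln:
  assumes "Re z > 0"
  shows "((\<lambda>z. exp (c * Ln z)) has_field_derivative c * exp (c * Ln z) / z) (at z within S)"
proof -
  have "z \<notin> \<real>\<^sub>\<le>\<^sub>0"
    using assms complex_nonpos_Reals_iff by auto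
  then have "((\<lambda>z. c * Ln z) has_field_derivative c * inverse z) (at z within S)"
    by (intro DERIV_cmult has_field_derivative_at_within[OF has_field_derivative_Ln])
  then have "((\<lambda>z. exp (c * Ln z)) has_field_derivative exp (c * Ln z) * (c * inverse z)) (at z within S)"
    by (rule DERIV_chain'[where g = exp]) (rule DERIV_exp)
  then show ?thesis
    by (rule DERIV_cong) (simp add: divide_inverse)
qed

lemma mem_closed_segment_of_nat:
  assumes "w \<in> closed_segment (of_nat n) (of_nat (Suc n) :: complex)"
  obtains x where "w = of_real x" "real n \<le> x" "x \<le> real (Suc n)"
proof -
  have "w \<in> closed_segment (of_real (real n)) (of_real (real (Suc n)))"
    using assms by (simp only: of_real_of_nat_eq)
  then have "w \<in> of_real ` closed_segment (real n) (real (Suc n))"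
    by (simp only: closed_segment_of_real)
  then show ?thesis
    using that by (auto simp: closed_segment_eq_real_ivl)
qed

lemma exp_Ln_diff_bound:
  assumes n: "n > 0" and s: "Re s \<ge> 0"
    and z: "z \<in> closed_segment (of_nat n) (of_nat (Suc n))"
  shows "cmod (exp (- (s * Ln z)) - npow n s) \<le> cmod s * real n powr (- Re s - 1)"
proof -
  let ?I = "closed_segment (of_nat n :: complex) (of_nat (Suc n))"

  have "cmod (exp ((- s) * Ln z) - exp ((- s) * Ln (of_nat n))) \<le> cmod s * real n powr (- Re s - 1) * cmod (z - of_nat n)"
  proof (rule field_differentiable_bound[where S = ?I and f' = "\<lambda>z. (- s) * exp ((- s) * Ln z) / z"])
    fix w assume "w \<in> ?I"
    then obtain x where x: "w = of_real x" "real n \<le> x" by (rule mem_closed_segment_of_nat)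
    then have x0: "x > 0" using n by linarith
    then show "((\<lambda>z. exp ((- s) * Ln z)) has_field_derivative (- s) * exp ((- s) * Ln w) / w) (at w within ?I)"
      by (intro has_derivative_exp_Ln) (simp add: x)
    have "cmod ((- s) * exp ((- s) * Ln w) / w) = cmod s * x powr (- Re s - 1)"
      using x0 by (simp add: x Ln_of_real norm_mult norm_divide powr_def powr_diff exp_diff left_diff_distrib)
    also have "\<dots> \<le> cmod s * real n powr (- Re s - 1)"
      using x x0 n s by (intro mult_left_mono powr_mono2') auto
    finally show "cmod ((- s) * exp ((- s) * Ln w) / w) \<le> cmod s * real n powr (- Re s - 1)" .
  qed (use z in auto)
  moreover have "cmod (z - of_nat n) \<le> 1"
  proof -
    obtain x where x: "z = of_real x" "real n \<le> x" "x \<le> real (Suc n)"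
      using z by (rule mem_closed_segment_of_nat)
    then have "z - of_nat n = of_real (x - real n)" by simp
    then show ?thesis using x by (simp only: norm_of_real)
  qed
  ultimately have "cmod (exp ((- s) * Ln z) - exp ((- s) * Ln (of_nat n))) \<le> cmod s * real n powr (- Re s - 1)"
    by (elim order_trans) (simp add: mult_left_le)
  moreover have "exp ((- s) * Ln (of_nat n)) = npow n s"
    using n Ln_of_real[of "real n"] by (simp add: npow_def)
  ultimately show ?thesis by simp
qed

lemma npow_Suc_diff_bound:
  assumes "n > 0" "Re s \<ge> 0"
  shows "cmod (npow n s - npow (Suc n) s) \<le> cmod s * real n powr (- Re s - 1)"
proof -
  have "exp (- (s * Ln (of_nat (Suc n)))) = npow (Suc n) s"
    using Ln_of_real[of "real (Suc n)"] by (simp add: npow_def)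
  then show ?thesis
    using exp_Ln_diff_bound[OF assms, of "of_nat (Suc n)"] by (simp add: norm_minus_commute)
qed

text \<open>
  Comparison of one term of \<open>\<zeta>\<close> with the integral of \<open>x\<^sup>-\<^sup>s\<close> over \<open>[n, n + 1]\<close>, cleared of the
  denominator \<open>s - 1\<close>.
\<close>

lemma npow_integral_bound:
  assumes n: "n > 0" and s: "Re s \<ge> 0"
  shows "cmod ((s - 1) * npow n s + npow (Suc n) (s - 1) - npow n (s - 1))
    \<le> cmod (s - 1) * (cmod s * real n powr (- Re s - 1))"
proof -
  let ?I = "closed_segment (of_nat n :: complex) (of_nat (Suc n))"
  let ?g = "\<lambda>z. exp ((1 - s) * Ln z) - (1 - s) * npow n s * z"
  have "cmod (?g (of_nat (Suc n)) - ?g (of_nat n))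
      \<le> cmod (s - 1) * (cmod s * real n powr (- Re s - 1)) * cmod (of_nat (Suc n) - of_nat n :: complex)"
  proof (rule field_differentiable_bound[where S = ?I
        and f' = "\<lambda>z. (1 - s) * (exp (- (s * Ln z)) - npow n s)"])
    fix w assume w: "w \<in> ?I"
    obtain x where x: "w = of_real x" "x > 0"
      using mem_closed_segment_of_nat[OF w] n by (metis less_le_trans of_nat_0_less_iff)
    have "exp ((1 - s) * Ln w) / w = exp (- (s * Ln w))"
      using x by (simp add: left_diff_distrib exp_diff exp_minus divide_simps)
    then have "(1 - s) * exp ((1 - s) * Ln w) / w - (1 - s) * npow n s * 1
        = (1 - s) * (exp (- (s * Ln w)) - npow n s)"
      by (simp add: right_diff_distrib flip: times_divide_eq_right)
    moreover have "(?g has_field_derivative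
        (1 - s) * exp ((1 - s) * Ln w) / w - (1 - s) * npow n s * 1) (at w within ?I)"
      using x by (intro DERIV_diff has_derivative_exp_Ln DERIV_cmult DERIV_ident) simp
    ultimately show "(?g has_field_derivative (1 - s) * (exp (- (s * Ln w)) - npow n s)) (at w within ?I)"
      by simp
    show "cmod ((1 - s) * (exp (- (s * Ln w)) - npow n s))
        \<le> cmod (s - 1) * (cmod s * real n powr (- Re s - 1))"
      unfolding norm_mult norm_minus_commute[of 1 s]
      by (intro mult_left_mono exp_Ln_diff_bound n s w) auto
  qed auto
  moreover have exp_eq: "exp ((1 - s) * Ln (of_nat k)) = npow k (s - 1)" if "k > 0" for k
    using that Ln_of_real[of "real k"] by (simp add: npow_def algebra_simps)
  have "?g (of_nat (Suc n)) - ?g (of_nat n) = (s - 1) * npow n s + npow (Suc n) (s - 1) - npow n (s - 1)"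
    unfolding exp_eq[OF n] exp_eq[OF zero_less_Suc] by (simp add: algebra_simps)
  ultimately show ?thesis
    by simp
qed

lemma holomorphic_series_half_plane:
  fixes f :: "nat \<Rightarrow> complex \<Rightarrow> complex"
  assumes hol: "\<And>n. f n holomorphic_on {s. Re s > 0}"
    and bound: "\<And>n s. Re s > 0 \<Longrightarrow> cmod (f n s) \<le> K * (1 + cmod s)\<^sup>2 * real (Suc n) powr (- Re s - 1)"
  shows "(\<lambda>s. \<Sum>n. f n s) holomorphic_on {s. Re s > 0}"
    and "Re s > 0 \<Longrightarrow> summable (\<lambda>n. f n s)"
proof -
  have summ: "summable (\<lambda>n. real (Suc n) powr (- \<sigma> - 1))" if "\<sigma> > 0" for \<sigma>
    using that summable_Suc_iff[of "\<lambda>n. real n powr (- \<sigma> - 1)"] by (simp add: summable_real_powr_iff)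
  have K: "K \<ge> 0"
    using order_trans[OF norm_ge_zero bound[of 1 0]] by (simp add: zero_le_mult_iff)
  show "summable (\<lambda>n. f n s)" if "Re s > 0"
    by (rule summable_comparison_test'[where N = 0, OF summable_mult[OF summ[OF that]]])
      (use bound[OF that] in blast)
  show "(\<lambda>s. \<Sum>n. f n s) holomorphic_on {s. Re s > 0}"
  proof (rule holomorphic_uniform_sequence)
    show "open {s. Re s > 0}" by (rule open_halfspace_Re_gt)
    show "(\<lambda>s. \<Sum>n<N. f n s) holomorphic_on {s. Re s > 0}" for N
      by (intro holomorphic_intros hol)
    fix s assume "s \<in> {s. Re s > 0}"
    then have s: "Re s > 0" by simp
    define d where "d = Re s / 2"
    have d: "d > 0" "Re s = 2 * d" using s by (auto simp: d_def)
    have mem: "Re w \<ge> d" "cmod w \<le> cmod s + d" if "w \<in> cball s d" for w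
    proof -
      have "cmod (s - w) \<le> d" using that by (simp add: dist_norm)
      moreover have "Re (s - w) \<le> cmod (s - w)" by (rule complex_Re_le_cmod)
      moreover have "cmod w \<le> cmod s + cmod (s - w)"
        using norm_triangle_ineq4[of s "s - w"] by simp
      ultimately show "Re w \<ge> d" "cmod w \<le> cmod s + d" using d by auto
    qed
    have "uniform_limit (cball s d) (\<lambda>N w. \<Sum>n<N. f n w) (\<lambda>w. \<Sum>n. f n w) sequentially"
    proof (rule Weierstrass_m_test)
      show "summable (\<lambda>n. K * (1 + (cmod s + d))\<^sup>2 * real (Suc n) powr (- d - 1))"
        by (intro summable_mult summ d)
      fix n w assume w: "w \<in> cball s d"
      have "cmod (f n w) \<le> K * (1 + cmod w)\<^sup>2 * real (Suc n) powr (- Re w - 1)"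
        using mem(1)[OF w] d by (intro bound) simp
      also have "\<dots> \<le> K * (1 + (cmod s + d))\<^sup>2 * real (Suc n) powr (- d - 1)"
        using mem[OF w] K by (intro mult_mono mult_nonneg_nonneg power_mono powr_mono) auto
      finally show "cmod (f n w) \<le> K * (1 + (cmod s + d))\<^sup>2 * real (Suc n) powr (- d - 1)" .
    qed
    moreover have "cball s d \<subseteq> {s. Re s > 0}"
      using mem(1) d by fastforce
    ultimately show "\<exists>d>0. cball s d \<subseteq> {s. Re s > 0}
        \<and> uniform_limit (cball s d) (\<lambda>N s. \<Sum>n<N. f n s) (\<lambda>s. \<Sum>n. f n s) sequentially"
      using d by blast
  qed
qed

lemma tendsto_npow_0:
  assumes "Re s > 0"
  shows "(\<lambda>n. npow (Suc n) s) \<longlonglongrightarrow> 0"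
proof (rule tendsto_norm_zero_cancel)
  have "(\<lambda>n. real (Suc n) powr (- Re s)) \<longlonglongrightarrow> 0"
    using assms LIMSEQ_Suc[OF tendsto_neg_powr[OF _ filterlim_real_sequentially, of "- Re s"]] by simp
  then show "(\<lambda>n. cmod (npow (Suc n) s)) \<longlonglongrightarrow> 0"
    by (simp add: norm_npow)
qed

text \<open>
  A Dirichlet series whose coefficients have bounded partial sums, after subtraction of a mean
  value \<open>m\<close>, continues to the right half plane apart from a simple pole at 1.  Partial summation
  turns the difference from \<open>m \<zeta>(s)\<close> into an absolutely convergent series, and comparison with
  the integral does the same for \<open>(s - 1) \<zeta>(s)\<close>.
\<close>

lemma dirichlet_series_continuation:
  fixes a :: "nat \<Rightarrow> complex"
  assumes K: "\<And>n. cmod ((\<Sum>k = 1..n. a k) - of_nat n * m) \<le> K"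
  shows "\<exists>A. A holomorphic_on {s. Re s > 0}
    \<and> (\<forall>s. Re s > 1 \<longrightarrow> (\<lambda>n. a (Suc n) * npow (Suc n) s) sums (m / (s - 1) + A s))
    \<and> (m = 0 \<longrightarrow> (\<forall>s. Re s > 0 \<longrightarrow> (\<lambda>n. a (Suc n) * npow (Suc n) s) sums A s))"
proof -
  define c where "c n = (\<Sum>k = 1..n. a k) - of_nat n * m" for n
  have K0: "K \<ge> 0" using order_trans[OF norm_ge_zero K] .
  define f where "f n s = c (Suc n) * (npow (Suc n) s - npow (Suc (Suc n)) s)" for n s
  define e where "e n s = (s - 1) * npow (Suc n) s + npow (Suc (Suc n)) (s - 1) - npow (Suc n) (s - 1)" for n s
  define D where "D s = (\<Sum>n. f n s)" for s
  define E where "E s = (\<Sum>n. e n s)" for s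
  have fb: "cmod (f n s) \<le> K * (1 + cmod s)\<^sup>2 * real (Suc n) powr (- Re s - 1)" if "Re s > 0" for n s
  proof -
    have "cmod (f n s) \<le> K * (cmod s * real (Suc n) powr (- Re s - 1))"
      unfolding f_def norm_mult c_def using that K0
      by (intro mult_mono K npow_Suc_diff_bound) auto
    also have "\<dots> \<le> K * ((1 + cmod s)\<^sup>2 * real (Suc n) powr (- Re s - 1))"
      using K0 by (intro mult_left_mono mult_right_mono) (auto simp: power2_eq_square algebra_simps)
    finally show ?thesis by (simp add: mult_ac)
  qed
  have eb: "cmod (e n s) \<le> 1 * (1 + cmod s)\<^sup>2 * real (Suc n) powr (- Re s - 1)" if "Re s > 0" for n s
  proof -
    have "cmod (e n s) \<le> cmod (s - 1) * (cmod s * real (Suc n) powr (- Re s - 1))"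
      unfolding e_def using that by (intro npow_integral_bound) auto
    also have "\<dots> \<le> (1 + cmod s) * ((1 + cmod s) * real (Suc n) powr (- Re s - 1))"
      using norm_triangle_ineq4[of s 1] by (intro mult_mono) auto
    finally show ?thesis by (simp add: power2_eq_square mult_ac)
  qed
  have D: "D holomorphic_on {s. Re s > 0}"
    unfolding D_def by (rule holomorphic_series_half_plane(1)[OF _ fb])
      (auto simp: f_def intro!: holomorphic_intros)
  have Ds: "(\<lambda>n. f n s) sums D s" if "Re s > 0" for s
    unfolding D_def by (intro summable_sums holomorphic_series_half_plane(2)[OF _ fb that])
      (auto simp: f_def intro!: holomorphic_intros)
  have npow_hol: "(\<lambda>s. npow n (s - 1)) holomorphic_on U" for n U
    unfolding npow_def by (intro holomorphic_intros)
  have E: "E holomorphic_on {s. Re s > 0}"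
    unfolding E_def by (rule holomorphic_series_half_plane(1)[OF _ eb])
      (auto simp: e_def intro!: holomorphic_intros npow_hol)
  have Es: "(\<lambda>n. e n s) sums E s" if "Re s > 0" for s
    unfolding E_def by (intro summable_sums holomorphic_series_half_plane(2)[OF _ eb that])
      (auto simp: e_def intro!: holomorphic_intros npow_hol)
  have E1: "E 1 = 0"
    by (simp add: E_def e_def npow_def)
  define A0 where "A0 s = (if s = 1 then deriv E 1 else (E s - E 1) / (s - 1))" for s
  have A0: "A0 holomorphic_on {s. Re s > 0}"
    unfolding A0_def by (rule pole_lemma[OF E])
      (simp add: interior_open open_halfspace_Re_gt)
  have zeta: "(\<lambda>n. npow (Suc n) s) sums (1 / (s - 1) + A0 s)" if s: "Re s > 1" for s
  proof -
    have s1: "s \<noteq> 1" using s by auto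
    have "(\<lambda>n. npow (Suc n) (s - 1)) \<longlonglongrightarrow> 0"
      using s by (intro tendsto_npow_0) simp
    from telescope_sums[OF this]
    have "(\<lambda>n. npow (Suc (Suc n)) (s - 1) - npow (Suc n) (s - 1)) sums (- 1)"
      by simp
    then have "(\<lambda>n. e n s - (npow (Suc (Suc n)) (s - 1) - npow (Suc n) (s - 1))) sums (E s - (- 1))"
      using s by (intro sums_diff Es) auto
    then have "(\<lambda>n. (s - 1) * npow (Suc n) s) sums (E s + 1)"
      by (simp add: e_def)
    then have "(\<lambda>n. (s - 1) * npow (Suc n) s / (s - 1)) sums ((E s + 1) / (s - 1))"
      by (rule sums_divide)
    then show ?thesis
      using s1 E1 by (simp add: A0_def add_divide_distrib add.commute)
  qed
  have parts: "(\<Sum>n<N. (a (Suc n) - m) * npow (Suc n) s) = c N * npow (Suc N) s + (\<Sum>n<N. f n s)" for N s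
    by (induction N) (simp_all add: c_def f_def algebra_simps)
  have diff: "(\<lambda>n. (a (Suc n) - m) * npow (Suc n) s) sums D s" if s: "Re s > 0" for s
  proof -
    have "(\<lambda>N. c N * npow (Suc N) s) \<longlonglongrightarrow> 0"
    proof (rule tendsto_norm_zero_cancel, rule tendsto_sandwich[of "\<lambda>_. 0"])
      show "\<forall>\<^sub>F N in sequentially. cmod (c N * npow (Suc N) s) \<le> K * cmod (npow (Suc N) s)"
        unfolding norm_mult c_def by (intro always_eventually allI mult_right_mono K) auto
      show "(\<lambda>N. K * cmod (npow (Suc N) s)) \<longlonglongrightarrow> 0"
        using tendsto_norm_zero[OF tendsto_npow_0[OF s]] by (rule tendsto_mult_right_zero)
    qed auto
    from tendsto_add[OF this Ds[OF s, unfolded sums_def]] show ?thesis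
      unfolding sums_def parts by simp
  qed
  define A where "A s = m * A0 s + D s" for s
  have "A holomorphic_on {s. Re s > 0}"
    unfolding A_def using A0 D by (intro holomorphic_intros)
  moreover have "(\<lambda>n. a (Suc n) * npow (Suc n) s) sums (m / (s - 1) + A s)" if "Re s > 1" for s
  proof -
    have "(\<lambda>n. m * npow (Suc n) s + (a (Suc n) - m) * npow (Suc n) s) sums (m * (1 / (s - 1) + A0 s) + D s)"
      using that by (intro sums_add sums_mult zeta diff) auto
    then show ?thesis by (simp add: A_def algebra_simps)
  qed
  moreover have "(\<lambda>n. a (Suc n) * npow (Suc n) s) sums A s" if "m = 0" "Re s > 0" for s
    using diff[OF that(2)] that(1) by (simp add: A_def)
  ultimately show ?thesis by blast
qed

(*FILE dev/Newman*)
lemma cesaro_mean: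
  fixes T :: "nat \<Rightarrow> complex"
  assumes "T \<longlonglongrightarrow> L"
  shows "(\<lambda>N. (\<Sum>n<N. T n) / of_nat N) \<longlonglongrightarrow> L"
proof -
  have "mean_zero (\<lambda>n. T (n - 1) - L)"
    unfolding mean_zero_iff
  proof (intro allI impI)
    fix \<epsilon> :: real assume e: "\<epsilon> > 0"
    then obtain M where M: "\<And>n. n \<ge> M \<Longrightarrow> cmod (T n - L) < \<epsilon> / 2"
      using LIMSEQ_D[OF assms, of "\<epsilon> / 2"] by auto
    define B where "B = (\<Sum>n<M. cmod (T n - L))"
    show "\<forall>\<^sub>F N in sequentially. cmod (\<Sum>n = 1..N. T (n - 1) - L) \<le> \<epsilon> * real N"
    proof (rule eventually_sequentiallyI)
      fix N assume N: "max M (nat \<lceil>2 * B / \<epsilon>\<rceil>) \<le> N"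
      have "(\<Sum>n = 1..N. T (n - 1) - L) = (\<Sum>n<N. T n - L)"
        by (rule sum.reindex_bij_witness[of _ Suc "\<lambda>n. n - 1"]) auto
      also have "{..<N} = {..<M} \<union> {M..<N}" using N by auto
      also have "(\<Sum>n\<in>{..<M} \<union> {M..<N}. T n - L) = (\<Sum>n<M. T n - L) + (\<Sum>n = M..<N. T n - L)"
        by (rule sum.union_disjoint) auto
      finally have eq: "(\<Sum>n = 1..N. T (n - 1) - L) = (\<Sum>n<M. T n - L) + (\<Sum>n = M..<N. T n - L)" .
      have "cmod (\<Sum>n = M..<N. T n - L) \<le> (\<Sum>n = M..<N. \<epsilon> / 2)"
        by (rule sum_norm_le) (use M less_imp_le in auto)
      also have "\<dots> \<le> \<epsilon> / 2 * N" using e by (simp add: field_simps)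
      finally have 1: "cmod (\<Sum>n = M..<N. T n - L) \<le> \<epsilon> / 2 * N" .
      have "2 * B / \<epsilon> \<le> N" using N by linarith
      then have "B \<le> \<epsilon> / 2 * N" using e by (simp add: field_simps)
      moreover have "cmod (\<Sum>n<M. T n - L) \<le> B" unfolding B_def by (rule norm_sum)
      ultimately have 2: "cmod (\<Sum>n<M. T n - L) \<le> \<epsilon> / 2 * N" by linarith
      show "cmod (\<Sum>n = 1..N. T (n - 1) - L) \<le> \<epsilon> * real N"
        unfolding eq by (rule order_trans[OF norm_triangle_ineq]) (use 1 2 in linarith)
    qed
  qed
  then have "(\<lambda>N. (\<Sum>n = 1..N. T (n - 1) - L) / of_nat N + L) \<longlonglongrightarrow> 0 + L"
    unfolding mean_zero_def by (intro tendsto_intros)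
  moreover have "\<forall>\<^sub>F N in sequentially. (\<Sum>n = 1..N. T (n - 1) - L) / of_nat N + L = (\<Sum>n<N. T n) / of_nat N"
    using eventually_gt_at_top[of 0]
  proof eventually_elim
    case (elim N)
    have "(\<Sum>n = 1..N. T (n - 1) - L) = (\<Sum>n<N. T n - L)"
      by (rule sum.reindex_bij_witness[of _ Suc "\<lambda>n. n - 1"]) auto
    then show ?case using elim by (simp add: sum_subtractf diff_divide_distrib)
  qed
  ultimately show ?thesis
    by (simp add: tendsto_cong)
qed

text \<open>Kronecker's lemma for the weights \<open>1 / n\<close>.\<close>

lemma mean_zero_if_summable_div:
  assumes "summable (\<lambda>n. a (Suc n) / of_nat (Suc n))"
  shows "mean_zero a"
proof -
  define T where "T N = (\<Sum>n<N. a (Suc n) / of_nat (Suc n))" for N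
  obtain L where L: "T \<longlonglongrightarrow> L"
    using assms unfolding summable_def sums_def T_def by auto
  have "(\<Sum>n = 1..N. a n) = of_nat N * T N - (\<Sum>n<N. T n)" for N
  proof (induction N)
    case (Suc N)
    have "of_nat (Suc N) * T (Suc N) = of_nat N * T N + T N + a (Suc N)"
      by (simp add: T_def distrib_left del: of_nat_Suc) (simp add: algebra_simps)
    with Suc show ?case by simp
  qed simp
  then have "\<forall>\<^sub>F N in sequentially. T N - (\<Sum>n<N. T n) / of_nat N = (\<Sum>n = 1..N. a n) / of_nat N"
    by (intro eventually_sequentiallyI[of 1]) (simp add: field_simps)
  moreover have "(\<lambda>N. T N - (\<Sum>n<N. T n) / of_nat N) \<longlonglongrightarrow> L - L"
    by (intro tendsto_diff L cesaro_mean)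
  ultimately show ?thesis
    unfolding mean_zero_def by (simp add: tendsto_cong)
qed

lemma npow_tail_bound:
  assumes x: "x > 0" and N: "N > 0"
  shows "summable (\<lambda>n. real (Suc (n + N)) powr (- x - 1))"
    and "(\<Sum>n. real (Suc (n + N)) powr (- x - 1)) \<le> real N powr (- x) / x"
proof -
  have step: "x * real (Suc k) powr (- x - 1) \<le> real k powr (- x) - real (Suc k) powr (- x)" if k: "k > 0" for k
  proof -
    have "\<exists>z. real k < z \<and> z < real (Suc k) \<and>
        real (Suc k) powr (- x) - real k powr (- x) = (real (Suc k) - real k) * (- x * z powr (- x - 1))"
      using k by (intro MVT2) (auto intro!: derivative_eq_intros)
    then obtain z where z: "real k < z" "z < real (Suc k)"
      "real (Suc k) powr (- x) - real k powr (- x) = - x * z powr (- x - 1)" by auto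
    have "real (Suc k) powr (- x - 1) \<le> z powr (- x - 1)"
      using z x k by (intro powr_mono2') auto
    then have "x * real (Suc k) powr (- x - 1) \<le> x * z powr (- x - 1)"
      using x by simp
    with z(3) show ?thesis by simp
  qed
  have tele: "(\<lambda>n. real (n + N) powr (- x) - real (Suc n + N) powr (- x)) sums (real (0 + N) powr (- x) - 0)"
  proof (rule telescope_sums')
    have "(\<lambda>n. real n powr (- x)) \<longlonglongrightarrow> 0"
      using x by (intro tendsto_neg_powr filterlim_real_sequentially) auto
    then show "(\<lambda>n. real (n + N) powr (- x)) \<longlonglongrightarrow> 0"
      by (rule LIMSEQ_ignore_initial_segment)
  qed
  have le: "real (Suc (n + N)) powr (- x - 1) \<le> (real (n + N) powr (- x) - real (Suc n + N) powr (- x)) / x" for n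
    using step[of "n + N"] N x by (simp add: field_simps)
  have s: "(\<lambda>n. (real (n + N) powr (- x) - real (Suc n + N) powr (- x)) / x) sums (real N powr (- x) / x)"
    using sums_divide[OF tele, of x] by simp
  show 1: "summable (\<lambda>n. real (Suc (n + N)) powr (- x - 1))"
    by (rule summable_comparison_test'[where N = 0, OF sums_summable[OF s]]) (use le in simp)
  show "(\<Sum>n. real (Suc (n + N)) powr (- x - 1)) \<le> real N powr (- x) / x"
    using suminf_le[OF le 1 sums_summable[OF s]] sums_unique[OF s] by simp
qed

lemma sum_powr_bound:
  assumes y: "y > 0" and N: "N > 0"
  shows "(\<Sum>n = 1..N. real n powr (y - 1)) \<le> real N powr y * (1 / y + 1 / real N)"
proof -
  have "(\<Sum>n = 1..N. real n powr (y - 1)) \<le> real N powr y / y + real N powr (y - 1)"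
  proof (cases "y \<ge> 1")
    case True
    have step: "y * real k powr (y - 1) \<le> real (Suc k) powr y - real k powr y" for k
    proof (cases "k = 0")
      case False
      have "\<exists>z. real k < z \<and> z < real (Suc k) \<and>
          real (Suc k) powr y - real k powr y = (real (Suc k) - real k) * (y * z powr (y - 1))"
        using False by (intro MVT2) (auto intro!: derivative_eq_intros)
      then obtain z where z: "real k < z" "real (Suc k) powr y - real k powr y = y * z powr (y - 1)" by auto
      then show ?thesis using True y by (auto intro!: mult_left_mono powr_mono2)
    qed simp
    have "(\<Sum>n = 1..N. real n powr (y - 1)) = (\<Sum>n<N. real n powr (y - 1)) + real N powr (y - 1)"
    proof -
      have "(\<Sum>n<N. real n powr (y - 1)) + real N powr (y - 1) = (\<Sum>n\<le>N. real n powr (y - 1))"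
        by (simp add: lessThan_Suc_atMost[symmetric])
      also have "\<dots> = (\<Sum>n = 1..N. real n powr (y - 1))"
        by (intro sum.mono_neutral_right) auto
      finally show ?thesis by simp
    qed
    also have "(\<Sum>n<N. real n powr (y - 1)) \<le> (\<Sum>n<N. (real (Suc n) powr y - real n powr y) / y)"
      using step y by (intro sum_mono) (simp add: field_simps)
    also have "(\<Sum>n<N. (real (Suc n) powr y - real n powr y) / y) = real N powr y / y"
      by (subst sum_divide_distrib[symmetric], subst sum_lessThan_telescope) simp
    finally show ?thesis by simp
  next
    case False
    have step: "y * real (Suc k) powr (y - 1) \<le> real (Suc k) powr y - real k powr y" for k
    proof (cases "k = 0")
      case True
      then show ?thesis using False by simp
    next
      case k: False
      have "\<exists>z. real k < z \<and> z < real (Suc k) \<and>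
          real (Suc k) powr y - real k powr y = (real (Suc k) - real k) * (y * z powr (y - 1))"
        using k by (intro MVT2) (auto intro!: derivative_eq_intros)
      then obtain z where z: "real k < z" "z < real (Suc k)"
        "real (Suc k) powr y - real k powr y = y * z powr (y - 1)" by auto
      have "real (Suc k) powr (y - 1) \<le> z powr (y - 1)"
        using z False k by (intro powr_mono2') auto
      then show ?thesis using z(3) y by auto
    qed
    have "(\<Sum>n = 1..N. real n powr (y - 1)) = (\<Sum>n<N. real (Suc n) powr (y - 1))"
      by (rule sum.reindex_bij_witness[of _ Suc "\<lambda>n. n - 1"]) auto
    also have "\<dots> \<le> (\<Sum>n<N. (real (Suc n) powr y - real n powr y) / y)"
      using step y by (intro sum_mono) (simp add: field_simps)
    also have "(\<Sum>n<N. (real (Suc n) powr y - real n powr y) / y) = real N powr y / y"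
      by (subst sum_divide_distrib[symmetric], subst sum_lessThan_telescope) simp
    finally show ?thesis by (simp add: add_increasing2)
  qed
  also have "\<dots> = real N powr y * (1 / y + 1 / real N)"
    using N by (simp add: powr_diff field_simps)
  finally show ?thesis .
qed

(*FILE dev/Newman2*)
abbreviation segment_integral :: "complex \<Rightarrow> complex \<Rightarrow> (complex \<Rightarrow> complex) \<Rightarrow> complex"
  where "segment_integral a b \<equiv> contour_integral (linepath a b)"

definition right_integral :: "real \<Rightarrow> (complex \<Rightarrow> complex) \<Rightarrow> complex"
  where "right_integral R g = segment_integral (Complex 0 (-R)) (Complex R (-R)) g
    + segment_integral (Complex R (-R)) (Complex R R) g
    + segment_integral (Complex R R) (Complex 0 R) g"

definition left_integral :: "real \<Rightarrow> real \<Rightarrow> (complex \<Rightarrow> complex) \<Rightarrow> complex"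
  where "left_integral d R g = segment_integral (Complex 0 R) (Complex (-d) R) g
    + segment_integral (Complex (-d) R) (Complex (-d) (-R)) g
    + segment_integral (Complex (-d) (-R)) (Complex 0 (-R)) g"

lemma mem_horizontal_segment:
  "z \<in> closed_segment (Complex a c) (Complex b c) \<longleftrightarrow> Im z = c \<and> Re z \<in> closed_segment a b"
  by (simp add: closed_segment_same_Im)

lemma mem_vertical_segment:
  "z \<in> closed_segment (Complex c a) (Complex c b) \<longleftrightarrow> Re z = c \<and> Im z \<in> closed_segment a b"
  by (simp add: closed_segment_same_Re)

lemmas mem_segments = mem_horizontal_segment mem_vertical_segment closed_segment_eq_real_ivl

lemma cauchy_formula_rectangle:
  assumes dR: "d > 0" "R > 0" and V: "open V" "convex V" and f: "f holomorphic_on V"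
    and sub: "cbox (Complex (-d) (-R)) (Complex R R) \<subseteq> V"
  shows "right_integral R (\<lambda>z. f z / z) + left_integral d R (\<lambda>z. f z / z) = 2 * pi * \<i> * f 0"
proof -
  let ?g = "\<lambda>z. f z / z"
  have cont: "continuous_on (closed_segment a b) ?g"
    if "closed_segment a b \<subseteq> cbox (Complex (-d) (-R)) (Complex R R) - {0}" for a b
    by (intro continuous_intros continuous_on_subset[OF holomorphic_on_imp_continuous_on[OF f]])
      (use that sub in auto)
  have c: "continuous_on (closed_segment (Complex (-d) (-R)) (Complex R (-R))) ?g"
    "continuous_on (closed_segment (Complex R (-R)) (Complex R R)) ?g"
    "continuous_on (closed_segment (Complex R R) (Complex (-d) R)) ?g"
    "continuous_on (closed_segment (Complex (-d) R) (Complex (-d) (-R))) ?g"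
    by (rule cont; use dR in \<open>auto simp: mem_segments in_cbox_complex_iff\<close>)+
  have z0: "0 \<in> box (Complex (-d) (-R)) (Complex R R)"
    using dR by (simp add: in_box_complex_iff)
  have img: "path_image (rectpath (Complex (-d) (-R)) (Complex R R)) \<subseteq> V - {0}"
    using path_image_rectpath_subset_cbox[of "Complex (-d) (-R)" "Complex R R"]
      path_image_rectpath_inter_box[of "Complex (-d) (-R)" "Complex R R"] z0 sub dR by auto
  have "0 \<in> interior V"
    using z0 box_subset_cbox sub V(1) by (metis interior_open subsetD)
  from Cauchy_integral_formula_convex_simple[OF V(2) f this valid_path_rectpath img]
  have "((\<lambda>z. f z / (z - 0)) has_contour_integral
      (2 * pi * \<i> * winding_number (rectpath (Complex (-d) (-R)) (Complex R R)) 0 * f 0))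
      (rectpath (Complex (-d) (-R)) (Complex R R))" by simp
  then have "contour_integral (rectpath (Complex (-d) (-R)) (Complex R R)) ?g = 2 * pi * \<i> * f 0"
    using winding_number_rectpath[OF z0] by (simp add: contour_integral_unique)
  moreover have "contour_integral (rectpath (Complex (-d) (-R)) (Complex R R)) ?g
      = segment_integral (Complex (-d) (-R)) (Complex R (-R)) ?g
      + (segment_integral (Complex R (-R)) (Complex R R) ?g
      + (segment_integral (Complex R R) (Complex (-d) R) ?g
      + segment_integral (Complex (-d) R) (Complex (-d) (-R)) ?g))"
    using c[THEN contour_integrable_continuous_linepath] by (simp add: rectpath_def Let_def)
  moreover have "segment_integral (Complex (-d) (-R)) (Complex R (-R)) ?g
      = segment_integral (Complex (-d) (-R)) (Complex 0 (-R)) ?g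
      + segment_integral (Complex 0 (-R)) (Complex R (-R)) ?g"
    by (rule contour_integral_split_linepath[OF c(1)]) (use dR in \<open>auto simp: mem_segments\<close>)
  moreover have "segment_integral (Complex R R) (Complex (-d) R) ?g
      = segment_integral (Complex R R) (Complex 0 R) ?g
      + segment_integral (Complex 0 R) (Complex (-d) R) ?g"
    by (rule contour_integral_split_linepath[OF c(3)]) (use dR in \<open>auto simp: mem_segments\<close>)
  ultimately show ?thesis
    by (simp add: right_integral_def left_integral_def algebra_simps)
qed

lemma segment_integral_bound:
  assumes "continuous_on (closed_segment a b) f" "0 \<le> B" "\<And>z. z \<in> closed_segment a b \<Longrightarrow> cmod (f z) \<le> B"
  shows "cmod (segment_integral a b f) \<le> B * cmod (b - a)"
  by (rule contour_integral_bound_linepath[OF contour_integrable_continuous_linepath[OF assms(1)] assms(2,3)])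

lemma norm_Complex_diff [simp]:
  "cmod (Complex a b - Complex a d) = \<bar>b - d\<bar>" "cmod (Complex a b - Complex c b) = \<bar>a - c\<bar>"
  by (simp_all add: norm_complex_def complex_diff)

lemma right_integral_bound:
  assumes "R > 0" "0 \<le> B"
    and c: "continuous_on {z. Re z \<ge> 0 \<and> z \<noteq> 0} g"
    and B: "\<And>z. 0 \<le> Re z \<Longrightarrow> Re z \<le> R \<Longrightarrow> \<bar>Im z\<bar> = R \<Longrightarrow> cmod (g z) \<le> B"
      "\<And>z. Re z = R \<Longrightarrow> \<bar>Im z\<bar> \<le> R \<Longrightarrow> cmod (g z) \<le> B"
  shows "cmod (right_integral R g) \<le> 4 * R * B"
proof -
  have 1: "cmod (segment_integral (Complex 0 (-R)) (Complex R (-R)) g) \<le> B * cmod (Complex R (-R) - Complex 0 (-R))"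
    by (rule segment_integral_bound[OF continuous_on_subset[OF c]])
      (use assms(1,2) in \<open>auto simp: mem_segments intro!: B(1)\<close>)
  have 2: "cmod (segment_integral (Complex R (-R)) (Complex R R) g) \<le> B * cmod (Complex R R - Complex R (-R))"
    by (rule segment_integral_bound[OF continuous_on_subset[OF c]])
      (use assms(1,2) in \<open>auto simp: mem_segments intro!: B(2)\<close>)
  have 3: "cmod (segment_integral (Complex R R) (Complex 0 R) g) \<le> B * cmod (Complex 0 R - Complex R R)"
    by (rule segment_integral_bound[OF continuous_on_subset[OF c]])
      (use assms(1,2) in \<open>auto simp: mem_segments intro!: B(1)\<close>)
  have "cmod (right_integral R g) \<le> B * R + B * (2 * R) + B * R"
    unfolding right_integral_def
    by (intro norm_triangle_mono) (use 1 2 3 assms(1) in auto)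
  then show ?thesis by (simp add: mult_ac)
qed

lemma left_integral_bound:
  assumes "R > 0" "0 < d" "0 \<le> B" "0 \<le> B'"
    and c: "continuous_on {z. - d \<le> Re z \<and> Re z \<le> 0 \<and> \<bar>Im z\<bar> \<le> R \<and> z \<noteq> 0} g"
    and B: "\<And>z. - d \<le> Re z \<Longrightarrow> Re z \<le> 0 \<Longrightarrow> \<bar>Im z\<bar> = R \<Longrightarrow> cmod (g z) \<le> B"
      "\<And>z. Re z = - d \<Longrightarrow> \<bar>Im z\<bar> \<le> R \<Longrightarrow> cmod (g z) \<le> B'"
  shows "cmod (left_integral d R g) \<le> 2 * d * B + 2 * R * B'"
proof -
  have 1: "cmod (segment_integral (Complex 0 R) (Complex (-d) R) g) \<le> B * cmod (Complex (-d) R - Complex 0 R)"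
    by (rule segment_integral_bound[OF continuous_on_subset[OF c]])
      (use assms(1-3) in \<open>auto simp: mem_segments intro!: B(1)\<close>)
  have 2: "cmod (segment_integral (Complex (-d) R) (Complex (-d) (-R)) g) \<le> B' * cmod (Complex (-d) (-R) - Complex (-d) R)"
    by (rule segment_integral_bound[OF continuous_on_subset[OF c]])
      (use assms(1,2,4) in \<open>auto simp: mem_segments intro!: B(2)\<close>)
  have 3: "cmod (segment_integral (Complex (-d) (-R)) (Complex 0 (-R)) g) \<le> B * cmod (Complex 0 (-R) - Complex (-d) (-R))"
    by (rule segment_integral_bound[OF continuous_on_subset[OF c]])
      (use assms(1-3) in \<open>auto simp: mem_segments intro!: B(1)\<close>)
  have "cmod (left_integral d R g) \<le> B * d + B' * (2 * R) + B * d"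
    unfolding left_integral_def
    by (intro norm_triangle_mono) (use 1 2 3 assms(1,2) in auto)
  then show ?thesis by (simp add: algebra_simps)
qed

lemma newman_kernel_bound:
  assumes R: "R > 0" and x: "\<bar>Re z\<bar> \<le> R" and y: "\<bar>Im z\<bar> \<le> R"
    and bd: "\<bar>Re z\<bar> = R \<or> \<bar>Im z\<bar> = R"
  shows "cmod ((1 + z\<^sup>2 / of_real (R\<^sup>2)) / z) \<le> 3 * \<bar>Re z\<bar> / R\<^sup>2"
proof -
  have z: "cmod z \<ge> R" using bd abs_Re_le_cmod[of z] abs_Im_le_cmod[of z] by linarith
  have "(Re z)\<^sup>2 \<le> R\<^sup>2" "(Im z)\<^sup>2 \<le> R\<^sup>2"
    using x y by (metis abs_ge_zero power2_abs power_mono)+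
  then have z2: "(cmod z)\<^sup>2 \<le> 2 * R\<^sup>2" by (simp add: cmod_power2)
  have fac: "1 + z\<^sup>2 / of_real (R\<^sup>2) = (z - \<i> * of_real R) * (z + \<i> * of_real R) / of_real (R\<^sup>2)"
    using R by (simp add: field_simps power2_eq_square)
  have "cmod (1 + z\<^sup>2 / of_real (R\<^sup>2)) \<le> 3 * \<bar>Re z\<bar> / R"
  proof (cases "\<bar>Im z\<bar> = R")
    case True
    have zz: "cmod ((z - \<i> * of_real R) * (z + \<i> * of_real R)) \<le> \<bar>Re z\<bar> * (3 * R)"
    proof -
      have b: "cmod w \<le> 3 * R" if "Re w = Re z" "\<bar>Im w\<bar> \<le> 2 * R" for w
        using that x cmod_le[of w] by linarith
      consider "Im z = R" | "Im z = - R" using True by linarith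
      then show ?thesis
      proof cases
        case 1
        then have "z - \<i> * of_real R = of_real (Re z)" by (simp add: complex_eq_iff)
        then have "cmod (z - \<i> * of_real R) = \<bar>Re z\<bar>" by simp
        moreover have "cmod (z + \<i> * of_real R) \<le> 3 * R" using 1 R by (intro b) auto
        ultimately show ?thesis unfolding norm_mult by (intro mult_mono) auto
      next
        case 2
        then have "z + \<i> * of_real R = of_real (Re z)" by (simp add: complex_eq_iff)
        then have "cmod (z + \<i> * of_real R) = \<bar>Re z\<bar>" by simp
        moreover have "cmod (z - \<i> * of_real R) \<le> 3 * R" using 2 R by (intro b) auto
        ultimately show ?thesis unfolding norm_mult by (subst mult.commute, intro mult_mono) auto
      qed
    qed
    then have "cmod (1 + z\<^sup>2 / of_real (R\<^sup>2)) \<le> \<bar>Re z\<bar> * (3 * R) / R\<^sup>2"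
      unfolding fac norm_divide norm_of_real by (simp add: divide_right_mono)
    also have "\<dots> = 3 * \<bar>Re z\<bar> / R" using R by (simp add: power2_eq_square)
    finally show ?thesis .
  next
    case False
    then have x': "\<bar>Re z\<bar> = R" using bd by blast
    have "cmod (1 + z\<^sup>2 / of_real (R\<^sup>2)) \<le> 1 + (cmod z)\<^sup>2 / R\<^sup>2"
      by (rule order_trans[OF norm_triangle_ineq]) (simp add: norm_divide norm_power)
    also have "\<dots> \<le> 1 + 2 * R\<^sup>2 / R\<^sup>2"
      using z2 by (intro add_left_mono divide_right_mono) auto
    also have "\<dots> = 3 * \<bar>Re z\<bar> / R" using R x' by simp
    finally show ?thesis .
  qed
  then have "cmod (1 + z\<^sup>2 / of_real (R\<^sup>2)) / cmod z \<le> (3 * \<bar>Re z\<bar> / R) / R"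
    using z R by (intro frac_le) auto
  then show ?thesis
    by (simp add: norm_divide power2_eq_square)
qed

lemma sums_tail:
  fixes f :: "nat \<Rightarrow> 'a::real_normed_vector"
  assumes "f sums s"
  shows "(\<lambda>n. f (n + N)) sums (s - (\<Sum>n<N. f n))"
  using assms by (simp add: sums_iff_shift)

text \<open>
  Newman's Tauberian theorem.  Cauchy's formula expresses the remainder of the series at 1 through
  the values of the remainder on a large rectangle around 1.  The factor \<open>N\<^sup>z\<close> balances the size of
  the remainder on the right and of the partial sum on the left, and the factor
  \<open>1 + z\<^sup>2 / R\<^sup>2\<close> vanishes where the rectangle crosses the critical line and so absorbs the
  loss \<open>1 / \<bar>Re z\<bar>\<close>; both parts are \<open>O (1 / R)\<close>.  The contribution of the limit function on the
  left is taken over a thin rectangle and decays as \<open>N\<close> grows.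
\<close>

theorem newman_tauberian:
  fixes a :: "nat \<Rightarrow> complex"
  assumes a: "\<And>n. cmod (a n) \<le> 1"
    and U: "open U" "{s. Re s \<ge> 1} \<subseteq> U" and F: "F holomorphic_on U"
    and sums: "\<And>s. Re s > 1 \<Longrightarrow> (\<lambda>n. a (Suc n) * npow (Suc n) s) sums F s"
  shows "(\<lambda>n. a (Suc n) / of_nat (Suc n)) sums F 1"
proof -
  define G where "G z = F (1 + z)" for z
  have Re1: "- Re (1 + z) = - Re z - 1" for z by simp
  define S where "S N z = (\<Sum>n<N. a (Suc n) * npow (Suc n) (1 + z))" for N z
  define \<Phi> where "\<Phi> N R z = exp (z * of_real (ln (real N))) * (1 + z\<^sup>2 / of_real (R\<^sup>2))" for N :: nat and R :: real and z :: complex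
  have norm_exp: "cmod (exp (z * of_real (ln (real N)))) = real N powr Re z" if "N > 0" for z and N :: nat
    using that by (simp add: powr_def)
  have S_hol: "S N holomorphic_on V" for N V
    unfolding S_def npow_def by (intro holomorphic_intros)
  have \<Phi>_hol: "\<Phi> N R holomorphic_on V" for N R V
    unfolding \<Phi>_def by (intro holomorphic_intros) auto
  have open_G: "open ((+) 1 -` U)"
    using U(1) by (intro open_vimage continuous_intros)
  have G_hol: "G holomorphic_on ((+) 1 -` U)"
    unfolding G_def by (rule holomorphic_on_compose_gen[OF _ F, of "\<lambda>z. 1 + z", unfolded o_def])
      (auto intro!: holomorphic_intros)
  have nonneg: "z \<in> (+) 1 -` U" if "Re z \<ge> 0" for z
    using U(2) that by auto
  have tail: "cmod (G z - S N z) * real N powr Re z \<le> 1 / Re z" if z: "Re z > 0" and N: "N > 0" for z N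
  proof -
    have "(\<lambda>n. a (Suc (n + N)) * npow (Suc (n + N)) (1 + z)) sums (G z - S N z)"
      unfolding G_def S_def using sums_tail[OF sums[of "1 + z"], of N] z by simp
    moreover have le: "cmod (a (Suc (n + N)) * npow (Suc (n + N)) (1 + z)) \<le> real (Suc (n + N)) powr (- Re z - 1)" for n
    proof -
      have "cmod (npow (Suc (n + N)) (1 + z)) = real (Suc (n + N)) powr (- Re z - 1)"
        by (simp only: norm_npow[OF zero_less_Suc] Re1)
      then show ?thesis
        unfolding norm_mult using mult_right_mono[OF a[of "Suc (n + N)"], of "real (Suc (n + N)) powr (- Re z - 1)"] by simp
    qed
    ultimately have "cmod (G z - S N z) \<le> (\<Sum>n. real (Suc (n + N)) powr (- Re z - 1))"
      using norm_suminf_le[OF le npow_tail_bound(1)[OF z N]] by (simp add: sums_iff)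
    also have "\<dots> \<le> real N powr (- Re z) / Re z"
      by (rule npow_tail_bound(2)[OF z N])
    finally have "cmod (G z - S N z) * real N powr Re z \<le> real N powr (- Re z) / Re z * real N powr Re z"
      by (intro mult_right_mono) auto
    also have "\<dots> = 1 / Re z" using N by (simp add: powr_minus)
    finally show ?thesis .
  qed
  have part: "cmod (S N z) * real N powr Re z \<le> 1 / \<bar>Re z\<bar> + 1 / real N" if z: "Re z < 0" and N: "N > 0" for z N
  proof -
    have "cmod (S N z) \<le> (\<Sum>n<N. real (Suc n) powr (- Re z - 1))"
      unfolding S_def
    proof (rule sum_norm_le)
      fix n
      have "cmod (npow (Suc n) (1 + z)) = real (Suc n) powr (- Re z - 1)"
        by (simp only: norm_npow[OF zero_less_Suc] Re1)
      then show "cmod (a (Suc n) * npow (Suc n) (1 + z)) \<le> real (Suc n) powr (- Re z - 1)"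
        unfolding norm_mult using mult_right_mono[OF a[of "Suc n"], of "real (Suc n) powr (- Re z - 1)"] by simp
    qed
    also have "\<dots> = (\<Sum>n = 1..N. real n powr (- Re z - 1))"
      by (rule sum.reindex_bij_witness[of _ "\<lambda>n. n - 1" Suc]) auto
    also have "\<dots> \<le> real N powr (- Re z) * (1 / (- Re z) + 1 / real N)"
      using sum_powr_bound[of "- Re z" N] z N by simp
    finally have "cmod (S N z) * real N powr Re z \<le> real N powr (- Re z) * (1 / (- Re z) + 1 / real N) * real N powr Re z"
      by (intro mult_right_mono) auto
    also have "\<dots> = 1 / \<bar>Re z\<bar> + 1 / real N" using N z by (simp add: powr_minus)
    finally show ?thesis .
  qed
  have right: "cmod (right_integral R (\<lambda>z. (G z - S N z) * \<Phi> N R z / z)) \<le> 12 / R" if R: "R > 0" and N: "N > 0" for R N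
  proof -
    have B: "cmod ((G z - S N z) * \<Phi> N R z / z) \<le> 3 / R\<^sup>2"
      if "0 \<le> Re z" "Re z \<le> R" "\<bar>Im z\<bar> \<le> R" "\<bar>Re z\<bar> = R \<or> \<bar>Im z\<bar> = R" for z
    proof -
      have k: "cmod ((1 + z\<^sup>2 / of_real (R\<^sup>2)) / z) \<le> 3 * \<bar>Re z\<bar> / R\<^sup>2"
        using that by (intro newman_kernel_bound R) auto
      have "cmod ((G z - S N z) * \<Phi> N R z / z)
          = (cmod (G z - S N z) * real N powr Re z) * cmod ((1 + z\<^sup>2 / of_real (R\<^sup>2)) / z)"
        by (simp add: \<Phi>_def norm_mult norm_divide norm_exp[OF N] del: norm_exp_eq_Re)
      also have "\<dots> \<le> 3 / R\<^sup>2"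
      proof (cases "Re z = 0")
        case True
        then have k0: "cmod ((1 + z\<^sup>2 / of_real (R\<^sup>2)) / z) = 0"
          using k order_antisym[OF _ norm_ge_zero] by simp
        show ?thesis unfolding k0 by simp
      next
        case False
        then have "(cmod (G z - S N z) * real N powr Re z) * cmod ((1 + z\<^sup>2 / of_real (R\<^sup>2)) / z)
            \<le> (1 / Re z) * (3 * \<bar>Re z\<bar> / R\<^sup>2)"
          using that by (intro mult_mono tail k N) auto
        then show ?thesis using False that by simp
      qed
      finally show ?thesis .
    qed
    have "cmod (right_integral R (\<lambda>z. (G z - S N z) * \<Phi> N R z / z)) \<le> 4 * R * (3 / R\<^sup>2)"
    proof (rule right_integral_bound[OF R])
      show "continuous_on {z. 0 \<le> Re z \<and> z \<noteq> 0} (\<lambda>z. (G z - S N z) * \<Phi> N R z / z)"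
        by (intro continuous_intros holomorphic_on_imp_continuous_on S_hol \<Phi>_hol
            holomorphic_on_subset[OF G_hol]) (use nonneg in auto)
    qed (use B R in auto)
    then show ?thesis using R by (simp add: power2_eq_square)
  qed
  have leftS: "cmod (left_integral R R (\<lambda>z. S N z * \<Phi> N R z / z)) \<le> 12 / R + 12 / N" if R: "R > 0" and N: "N > 0" for R N
  proof -
    have B: "cmod (S N z * \<Phi> N R z / z) \<le> 3 / R\<^sup>2 + 3 / (R * N)"
      if "Re z \<le> 0" "- R \<le> Re z" "\<bar>Im z\<bar> \<le> R" "\<bar>Re z\<bar> = R \<or> \<bar>Im z\<bar> = R" for z
    proof -
      have k: "cmod ((1 + z\<^sup>2 / of_real (R\<^sup>2)) / z) \<le> 3 * \<bar>Re z\<bar> / R\<^sup>2"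
        using that by (intro newman_kernel_bound R) auto
      have "cmod (S N z * \<Phi> N R z / z)
          = (cmod (S N z) * real N powr Re z) * cmod ((1 + z\<^sup>2 / of_real (R\<^sup>2)) / z)"
        by (simp add: \<Phi>_def norm_mult norm_divide norm_exp[OF N] del: norm_exp_eq_Re)
      also have "\<dots> \<le> 3 / R\<^sup>2 + 3 / (R * N)"
      proof (cases "Re z = 0")
        case True
        then have k0: "cmod ((1 + z\<^sup>2 / of_real (R\<^sup>2)) / z) = 0"
          using k order_antisym[OF _ norm_ge_zero] by simp
        show ?thesis unfolding k0 using R by simp
      next
        case False
        then have "(cmod (S N z) * real N powr Re z) * cmod ((1 + z\<^sup>2 / of_real (R\<^sup>2)) / z)
            \<le> (1 / \<bar>Re z\<bar> + 1 / N) * (3 * \<bar>Re z\<bar> / R\<^sup>2)"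
          using that by (intro mult_mono part k N add_nonneg_nonneg) auto
        also have "\<dots> = 3 / R\<^sup>2 + 3 / (R * N) * (\<bar>Re z\<bar> / R)"
          using False R N by (simp add: field_simps power2_eq_square)
        also have "\<dots> \<le> 3 / R\<^sup>2 + 3 / (R * N)"
        proof (intro add_left_mono mult_left_le)
          have "\<bar>Re z\<bar> \<le> R" using that by linarith
          then show "\<bar>Re z\<bar> / R \<le> 1" using R by simp
        qed (use R in simp)
        finally show ?thesis .
      qed
      finally show ?thesis .
    qed
    have "cmod (left_integral R R (\<lambda>z. S N z * \<Phi> N R z / z))
        \<le> 2 * R * (3 / R\<^sup>2 + 3 / (R * N)) + 2 * R * (3 / R\<^sup>2 + 3 / (R * N))"
    proof (rule left_integral_bound[OF R R])
      show "continuous_on {z. - R \<le> Re z \<and> Re z \<le> 0 \<and> \<bar>Im z\<bar> \<le> R \<and> z \<noteq> 0} (\<lambda>z. S N z * \<Phi> N R z / z)"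
        by (intro continuous_intros holomorphic_on_imp_continuous_on S_hol \<Phi>_hol) auto
    qed (use B R in auto)
    also have "\<dots> = 12 / R + 12 / N" using R N by (simp add: power2_eq_square field_simps)
    finally show ?thesis .
  qed
  have "(\<lambda>N. S N 0) \<longlonglongrightarrow> G 0"
  proof (rule LIMSEQ_I)
    fix \<epsilon> :: real assume \<epsilon>: "\<epsilon> > 0"
    define R where "R = 24 / \<epsilon>"
    have R: "R > 0" "24 / R = \<epsilon>" using \<epsilon> by (auto simp: R_def)
    have "compact (closed_segment (Complex 0 (-R-1)) (Complex 0 (R+1)))" by simp
    moreover have "closed_segment (Complex 0 (-R-1)) (Complex 0 (R+1)) \<subseteq> (+) 1 -` U"
      using nonneg by (auto simp: mem_segments)
    ultimately obtain d0 where d0: "d0 > 0"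
      and ball: "(\<Union>z\<in>closed_segment (Complex 0 (-R-1)) (Complex 0 (R+1)). ball z d0) \<subseteq> (+) 1 -` U"
      using compact_subset_open_imp_ball_epsilon_subset[OF _ open_G] by metis
    define V where "V = {z. - d0 < Re z} \<inter> ({z. - R - 1 < Im z} \<inter> {z. Im z < R + 1})"
    have VU: "V \<subseteq> (+) 1 -` U"
    proof
      fix z assume z: "z \<in> V"
      show "z \<in> (+) 1 -` U"
      proof (cases "Re z \<ge> 0")
        case False
        have "dist (Complex 0 (Im z)) z = \<bar>Re z\<bar>"
          using norm_Complex_diff(2)[of 0 "Im z" "Re z"] by (simp add: dist_norm)
        then have "z \<in> ball (Complex 0 (Im z)) d0"
          using False z by (simp add: V_def)
        moreover have "Complex 0 (Im z) \<in> closed_segment (Complex 0 (-R-1)) (Complex 0 (R+1))"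
          using z R by (auto simp: mem_segments V_def)
        ultimately show ?thesis using ball by blast
      qed (rule nonneg)
    qed
    have V: "open V" "convex V"
      unfolding V_def by (intro open_Int open_halfspace_Re_gt open_halfspace_Im_gt open_halfspace_Im_lt
        convex_Int convex_halfspace_Re_gt convex_halfspace_Im_gt convex_halfspace_Im_lt)+
    define Q where "Q = cbox (Complex (- d0 / 2) (- R)) (Complex 0 R)"
    have "compact (G ` Q)"
      unfolding Q_def by (intro compact_continuous_image compact_cbox
          continuous_on_subset[OF holomorphic_on_imp_continuous_on[OF G_hol]] subset_trans[OF _ VU])
        (use d0 R in \<open>auto simp: in_cbox_complex_iff V_def\<close>)
    then obtain C where C: "C > 0" "\<And>z. z \<in> Q \<Longrightarrow> cmod (G z) \<le> C"
      using compact_imp_bounded bounded_pos by (metis (no_types, lifting) image_eqI)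
    define C1 where "C1 = C * (3 / R)"
    have C1: "C1 > 0" using C R by (simp add: C1_def)
    define d where "d = min (min (d0 / 2) R) (\<epsilon> / (2 * C1))"
    have "d \<le> \<epsilon> / (2 * C1)" unfolding d_def by (rule min.cobounded2)
    then have dC: "2 * d * C1 \<le> \<epsilon>" using C1 by (simp add: field_simps)
    have d: "d > 0" "d \<le> d0 / 2" "d \<le> R" "2 * d * C1 \<le> \<epsilon>"
      using d0 R \<epsilon> C1 dC by (auto simp: d_def)
    define C2 where "C2 = C * (3 / d)"
    have C2: "C2 > 0" using C d by (simp add: C2_def)
    have leftG: "cmod (left_integral d R (\<lambda>z. G z * \<Phi> N R z / z)) \<le> 2 * d * C1 + 2 * R * (C2 * real N powr (- d))"
      if N: "N > 0" for N
    proof (rule left_integral_bound)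
      show "continuous_on {z. - d \<le> Re z \<and> Re z \<le> 0 \<and> \<bar>Im z\<bar> \<le> R \<and> z \<noteq> 0} (\<lambda>z. G z * \<Phi> N R z / z)"
        by (intro continuous_intros holomorphic_on_imp_continuous_on \<Phi>_hol
            holomorphic_on_subset[OF G_hol] subset_trans[OF _ VU]) (use d d0 in \<open>auto simp: V_def\<close>)
      fix z assume z: "- d \<le> Re z" "Re z \<le> 0" "\<bar>Im z\<bar> = R"
      have "cmod ((1 + z\<^sup>2 / of_real (R\<^sup>2)) / z) \<le> 3 * \<bar>Re z\<bar> / R\<^sup>2"
        using z d by (intro newman_kernel_bound R) auto
      also have "\<dots> \<le> 3 * R / R\<^sup>2"
        using z d by (intro divide_right_mono mult_left_mono) auto
      finally have k: "cmod ((1 + z\<^sup>2 / of_real (R\<^sup>2)) / z) \<le> 3 / R"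
        using R by (simp add: power2_eq_square)
      have G: "cmod (G z) \<le> C"
        using z d by (intro C) (auto simp: Q_def in_cbox_complex_iff)
      have "cmod (G z * \<Phi> N R z / z) = real N powr Re z * (cmod (G z) * cmod ((1 + z\<^sup>2 / of_real (R\<^sup>2)) / z))"
        by (simp add: \<Phi>_def norm_mult norm_divide norm_exp[OF N] del: norm_exp_eq_Re)
      also have "\<dots> \<le> 1 * (C * (3 / R))"
      proof (intro mult_mono G k)
        show "real N powr Re z \<le> 1" using powr_mono[of "Re z" 0 "real N"] z N by simp
      qed (use C R in auto)
      finally show "cmod (G z * \<Phi> N R z / z) \<le> C1" by (simp add: C1_def)
    next
      fix z assume z: "Re z = - d" "\<bar>Im z\<bar> \<le> R"
      have G: "cmod (G z) \<le> C"
        using z d by (intro C) (auto simp: Q_def in_cbox_complex_iff)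
      have "(Re z)\<^sup>2 \<le> R\<^sup>2" "(Im z)\<^sup>2 \<le> R\<^sup>2"
        using z d by (metis abs_ge_zero abs_minus_cancel abs_of_pos power2_abs power_mono)+
      then have "(cmod z)\<^sup>2 \<le> 2 * R\<^sup>2" by (simp add: cmod_power2)
      then have "(cmod z)\<^sup>2 / R\<^sup>2 \<le> 2" using R by (simp add: divide_le_eq)
      then have "cmod (1 + z\<^sup>2 / of_real (R\<^sup>2)) \<le> 3"
        by (intro order_trans[OF norm_triangle_ineq]) (simp add: norm_divide norm_power)
      moreover have "cmod z \<ge> d" using abs_Re_le_cmod[of z] z d by simp
      ultimately have k: "cmod ((1 + z\<^sup>2 / of_real (R\<^sup>2)) / z) \<le> 3 / d"
        unfolding norm_divide[of "_ + _"] using d by (intro frac_le) auto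
      have "cmod (G z * \<Phi> N R z / z) = real N powr Re z * (cmod (G z) * cmod ((1 + z\<^sup>2 / of_real (R\<^sup>2)) / z))"
        by (simp add: \<Phi>_def norm_mult norm_divide norm_exp[OF N] del: norm_exp_eq_Re)
      also have "\<dots> \<le> real N powr (- d) * (C * (3 / d))"
        unfolding z(1) using C d by (intro mult_mono G k) auto
      finally show "cmod (G z * \<Phi> N R z / z) \<le> C2 * real N powr (- d)" by (simp add: C2_def mult_ac)
    qed (use R d C1 C2 in auto)
    have main: "cmod (G 0 - S N 0) * (2 * pi) \<le> 2 * \<epsilon> + 12 / N + 2 * R * (C2 * real N powr (- d))"
      if N: "N > 0" for N
    proof -
      have \<Phi>0: "\<Phi> N R 0 = 1" by (simp add: \<Phi>_def)
      have e1: "right_integral R (\<lambda>z. G z * \<Phi> N R z / z) + left_integral d R (\<lambda>z. G z * \<Phi> N R z / z)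
          = 2 * pi * \<i> * (G 0 * \<Phi> N R 0)"
        by (rule cauchy_formula_rectangle[OF d(1) R(1) V])
          (intro holomorphic_intros \<Phi>_hol holomorphic_on_subset[OF G_hol VU],
            use d d0 in \<open>auto simp: in_cbox_complex_iff V_def\<close>)
      have e2: "right_integral R (\<lambda>z. S N z * \<Phi> N R z / z) + left_integral R R (\<lambda>z. S N z * \<Phi> N R z / z)
          = 2 * pi * \<i> * (S N 0 * \<Phi> N R 0)"
        by (rule cauchy_formula_rectangle[OF R(1) R(1) open_UNIV convex_UNIV])
          (auto intro!: holomorphic_intros \<Phi>_hol S_hol)
      have e3: "right_integral R (\<lambda>z. (G z - S N z) * \<Phi> N R z / z)
          = right_integral R (\<lambda>z. G z * \<Phi> N R z / z) - right_integral R (\<lambda>z. S N z * \<Phi> N R z / z)"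
      proof -
        have cont: "continuous_on {z. 0 \<le> Re z \<and> z \<noteq> 0} (\<lambda>z. h z * \<Phi> N R z / z)"
          if "h = G \<or> h = S N" for h
          by (intro continuous_intros holomorphic_on_imp_continuous_on \<Phi>_hol)
            (use that holomorphic_on_subset[OF G_hol, of "{z. 0 \<le> Re z \<and> z \<noteq> 0}"] S_hol nonneg in auto)
        have seg_diff: "segment_integral a b (\<lambda>z. (G z - S N z) * \<Phi> N R z / z)
            = segment_integral a b (\<lambda>z. G z * \<Phi> N R z / z) - segment_integral a b (\<lambda>z. S N z * \<Phi> N R z / z)"
          if "closed_segment a b \<subseteq> {z. 0 \<le> Re z \<and> z \<noteq> 0}" for a b
          unfolding left_diff_distrib diff_divide_distrib
          by (intro contour_integral_diff contour_integrable_continuous_linepath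
              continuous_on_subset[OF cont that]) auto
        have "closed_segment (Complex 0 (-R)) (Complex R (-R)) \<subseteq> {z. 0 \<le> Re z \<and> z \<noteq> 0}"
          "closed_segment (Complex R (-R)) (Complex R R) \<subseteq> {z. 0 \<le> Re z \<and> z \<noteq> 0}"
          "closed_segment (Complex R R) (Complex 0 R) \<subseteq> {z. 0 \<le> Re z \<and> z \<noteq> 0}"
          using R(1) by (auto simp: mem_segments)
        from this[THEN seg_diff] show ?thesis by (simp add: right_integral_def)
      qed
      have alg: "x - y = e + b - d" if "a + b = x" "c + d = y" "e = a - c" for a b c d e x y :: complex
        using that by (auto simp: algebra_simps)
      have "2 * pi * \<i> * (G 0 - S N 0) = right_integral R (\<lambda>z. (G z - S N z) * \<Phi> N R z / z)
          + left_integral d R (\<lambda>z. G z * \<Phi> N R z / z) - left_integral R R (\<lambda>z. S N z * \<Phi> N R z / z)"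
        using alg[OF e1 e2 e3] by (simp add: \<Phi>0 right_diff_distrib)
      then have "cmod (2 * pi * \<i> * (G 0 - S N 0)) \<le> 12 / R
          + (2 * d * C1 + 2 * R * (C2 * real N powr (- d))) + (12 / R + 12 / N)"
        by (simp only:) (intro norm_triangle_le_diff add_mono norm_triangle_le right leftG leftS R N)
      moreover have "cmod (2 * pi * \<i> * (G 0 - S N 0)) = cmod (G 0 - S N 0) * (2 * pi)"
        by (simp add: norm_mult)
      ultimately show ?thesis using d(4) R(2) by linarith
    qed
    have "(\<lambda>N. 12 / real N + 2 * R * (C2 * real N powr (- d))) \<longlonglongrightarrow> 0 + 2 * R * (C2 * 0)"
      using d by (intro tendsto_intros tendsto_neg_powr filterlim_real_sequentially lim_const_over_n) auto
    then have "\<forall>\<^sub>F N in sequentially. 12 / real N + 2 * R * (C2 * real N powr (- d)) < \<epsilon>"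
      using \<epsilon> by (intro order_tendstoD) auto
    then have "\<forall>\<^sub>F N in sequentially. cmod (S N 0 - G 0) < \<epsilon>"
      using eventually_gt_at_top[of 0]
    proof eventually_elim
      case (elim N)
      have "cmod (G 0 - S N 0) * (2 * pi) < 3 * \<epsilon>"
        using main[OF elim(2)] elim(1) by linarith
      also have "3 * \<epsilon> < \<epsilon> * (2 * pi)" using \<epsilon> pi_gt3 by simp
      finally show ?case by (simp add: norm_minus_commute)
    qed
    then show "\<exists>no. \<forall>N\<ge>no. cmod (S N 0 - G 0) < \<epsilon>"
      by (simp add: eventually_sequentially)
  qed
  then show ?thesis
    unfolding sums_def S_def G_def by (simp add: npow_at_1)
qed

(*FILE dev/Char*)
definition completely_multiplicative :: "(nat \<Rightarrow> complex) \<Rightarrow> bool"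
  where "completely_multiplicative g \<longleftrightarrow> g 1 = 1 \<and> (\<forall>m>0. \<forall>n>0. g (m * n) = g m * g n)"

lemma summable_on_positive:
  fixes g :: "nat \<Rightarrow> 'a::banach"
  assumes "summable (\<lambda>n. norm (g (Suc n)))"
  shows "g summable_on {0<..}" and "(\<lambda>n. g (Suc n)) sums infsum g {0<..}"
proof -
  have bij: "bij_betw Suc UNIV {0<..}"
    by (rule bij_betwI[of _ _ _ "\<lambda>n. n - 1"]) auto
  have 1: "(\<lambda>n. g (Suc n)) summable_on UNIV"
    using assms by (rule norm_summable_imp_summable_on)
  then show "g summable_on {0<..}"
    using summable_on_reindex_bij_betw[OF bij, of g] by simp
  show "(\<lambda>n. g (Suc n)) sums infsum g {0<..}"
    using has_sum_imp_sums[OF has_sum_infsum[OF 1]] infsum_reindex_bij_betw[OF bij, of g] by simp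
qed

lemma sieve_step:
  fixes x a i c :: "'a::comm_ring_1"
  assumes "x = a + i" "i = c * x"
  shows "a = x * (1 - c)"
proof -
  have "a = x - i" unfolding assms(1) by simp
  also have "\<dots> = x - c * x" by (subst assms(2)) (rule refl)
  finally show ?thesis by (simp add: algebra_simps)
qed

text \<open>
  Multiplication by \<open>1 - g p\<close> deletes the terms divisible by \<open>p\<close>.
\<close>

lemma euler_sieve:
  assumes g: "completely_multiplicative g" "g summable_on {0<..}"
    and P: "finite P" "\<And>p. p \<in> P \<Longrightarrow> prime p"
  shows "infsum g {0<..} * (\<Prod>p\<in>P. 1 - g p) = infsum g {n. n > 0 \<and> (\<forall>p\<in>P. \<not> p dvd n)}"
  using P
proof (induction P)
  case (insert p P)
  let ?A = "\<lambda>P. {n. n > 0 \<and> (\<forall>p\<in>P. \<not> p dvd n)} :: nat set"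
  have p: "prime p" "p > 0" using insert.prems prime_gt_0_nat by auto
  have sub: "g summable_on B" if "B \<subseteq> {0<..}" for B
    using summable_on_subset_banach[OF g(2) that] .
  have split: "?A P = ?A (insert p P) \<union> (\<lambda>n. p * n) ` ?A P"
  proof -
    have "p' dvd p * n \<longleftrightarrow> p' dvd n" if "p' \<in> P" for p' n
    proof -
      have "coprime p' p" using that insert.hyps(2) insert.prems primes_coprime by blast
      then show ?thesis by (rule coprime_dvd_mult_right_iff)
    qed
    moreover have "n \<in> (\<lambda>n. p * n) ` ?A P" if n: "n \<in> ?A P" "p dvd n" for n
    proof -
      obtain k where k: "n = p * k" using n(2) by (rule dvdE)
      then have "k \<in> ?A P" using n(1) by (auto intro: dvd_mult)
      then show ?thesis using k by blast
    qed
    ultimately show ?thesis using p(2) by auto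
  qed
  have un: "infsum g (?A P) = infsum g (?A (insert p P)) + infsum g ((\<lambda>n. p * n) ` ?A P)"
    by (rule trans[OF arg_cong[OF split, of "infsum g"]], rule infsum_Un_disjoint)
      (use p(2) in \<open>auto intro!: sub\<close>)
  have "infsum g ((\<lambda>n. p * n) ` ?A P) = infsum (\<lambda>n. g (p * n)) (?A P)"
    using p(2) by (subst infsum_reindex) (auto intro!: inj_onI simp: o_def)
  also have "\<dots> = infsum (\<lambda>n. g p * g n) (?A P)"
    using g(1) p(2) by (intro infsum_cong) (auto simp: completely_multiplicative_def)
  also have "\<dots> = g p * infsum g (?A P)" by (rule infsum_cmult_right')
  finally have "infsum g (?A (insert p P)) = infsum g (?A P) * (1 - g p)"
    by (rule sieve_step[OF un])
  with insert show ?case by (simp add: mult_ac)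
qed (simp add: greaterThan_def)

lemma euler_product:
  assumes g: "completely_multiplicative g" and s: "summable (\<lambda>n. cmod (g (Suc n)))"
  shows "(\<lambda>N. infsum g {0<..} * (\<Prod>p | prime p \<and> p \<le> N. 1 - g p)) \<longlonglongrightarrow> 1"
proof -
  have sg: "g summable_on {0<..}" by (rule summable_on_positive(1)[OF s])
  have sn: "(\<lambda>n. norm (g n)) summable_on B" if "B \<subseteq> {0<..}" for B
    using summable_on_subset_banach[OF sg that] by (simp add: summable_on_iff_abs_summable_on_complex)
  define T where "T N = infsum (\<lambda>n. norm (g n)) {N<..}" for N
  have sums: "(\<lambda>n. cmod (g (Suc n))) sums infsum (\<lambda>n. cmod (g n)) {0<..}"
    by (rule summable_on_positive(2)) (use s in simp)
  have T: "T N = infsum (\<lambda>n. cmod (g n)) {0<..} - (\<Sum>n<N. cmod (g (Suc n)))" for N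
  proof -
    have un: "{0<..} = {1..N} \<union> {N<..}" by auto
    have "infsum (\<lambda>n. cmod (g n)) ({1..N} \<union> {N<..}) = infsum (\<lambda>n. cmod (g n)) {1..N} + T N"
      unfolding T_def by (rule infsum_Un_disjoint) (auto intro!: sn)
    moreover have "(\<Sum>n = 1..N. cmod (g n)) = (\<Sum>n<N. cmod (g (Suc n)))"
      by (rule sum.reindex_bij_witness[of _ Suc "\<lambda>n. n - 1"]) auto
    ultimately show ?thesis unfolding un by simp
  qed
  have "T \<longlonglongrightarrow> infsum (\<lambda>n. cmod (g n)) {0<..} - infsum (\<lambda>n. cmod (g n)) {0<..}"
    unfolding T using sums unfolding sums_def by (intro tendsto_diff tendsto_const)
  then have T0: "T \<longlonglongrightarrow> 0" by simp
  have bound: "cmod (infsum g {0<..} * (\<Prod>p | prime p \<and> p \<le> N. 1 - g p) - 1) \<le> T N" for N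
  proof -
    let ?A = "{n. n > 0 \<and> (\<forall>p\<in>{p. prime p \<and> p \<le> N}. \<not> p dvd n)}"
    have "infsum g {0<..} * (\<Prod>p | prime p \<and> p \<le> N. 1 - g p) = infsum g ?A"
      by (rule euler_sieve[OF g sg]) auto
    also have "?A = {1} \<union> (?A - {1})" by auto
    also have "infsum g \<dots> = infsum g {1} + infsum g (?A - {1})"
      by (rule infsum_Un_disjoint) (auto intro!: summable_on_subset_banach[OF sg])
    also have "infsum g {1} = 1" using g by (simp add: completely_multiplicative_def)
    finally have eq: "infsum g {0<..} * (\<Prod>p | prime p \<and> p \<le> N. 1 - g p) - 1 = infsum g (?A - {1})" by simp
    have sub: "?A - {1} \<subseteq> {N<..}"
    proof
      fix n assume n: "n \<in> ?A - {1}"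
      then obtain p where p: "prime p" "p dvd n"
        using prime_factor_nat[of n] by auto
      then have "p > N" using n by auto
      moreover have "p \<le> n" using p n by (auto dest: dvd_imp_le)
      ultimately show "n \<in> {N<..}" by simp
    qed
    have "cmod (infsum g (?A - {1})) \<le> infsum (\<lambda>n. cmod (g n)) (?A - {1})"
      by (rule norm_infsum_bound) (rule sn, auto)
    also have "\<dots> \<le> T N"
      unfolding T_def by (rule infsum_mono_neutral) (use sub in \<open>auto intro!: sn\<close>)
    finally show ?thesis unfolding eq .
  qed
  have "(\<lambda>N. infsum g {0<..} * (\<Prod>p | prime p \<and> p \<le> N. 1 - g p) - 1) \<longlonglongrightarrow> 0"
    by (rule Lim_null_comparison[OF _ T0]) (use bound in auto)
  then show ?thesis by (simp add: LIM_zero_iff)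
qed

lemma infsum_collect_products:
  fixes F :: "nat \<Rightarrow> nat \<Rightarrow> 'a::banach"
  assumes sF: "(\<lambda>(m, k). F m k) summable_on ({0<..} \<times> {0<..})"
  shows "(\<Sum>\<^sub>\<infinity>m\<in>{0<..}. \<Sum>\<^sub>\<infinity>k\<in>{0<..}. F m k) = (\<Sum>\<^sub>\<infinity>n\<in>{0<..}. \<Sum>m | m dvd n. F m (n div m))"
    and "(\<lambda>n. \<Sum>m | m dvd n. F m (n div m)) summable_on {0<..}"
proof -
  let ?S = "SIGMA n:{0::nat<..}. {m. m dvd n}"
  let ?H = "\<lambda>(n, m). F m (n div m)"
  have bij: "bij_betw (\<lambda>(m, k). (m * k, m)) ({0<..} \<times> {0<..}) ?S"
    by (rule bij_betwI[of _ _ _ "\<lambda>(n, m). (m, n div m :: nat)"]) (auto elim!: dvdE)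
  have eq: "?H ((\<lambda>(m, k). (m * k, m)) x) = (\<lambda>(m, k). F m k) x" if "x \<in> {0<..} \<times> {0<..}" for x
    using that by auto
  have "(\<lambda>x. ?H ((\<lambda>(m, k). (m * k, m)) x)) summable_on ({0<..} \<times> {0<..})"
    by (rule iffD2[OF summable_on_cong[OF eq] sF])
  then have sH: "?H summable_on ?S"
    by (rule iffD1[OF summable_on_reindex_bij_betw[OF bij]])
  have fin: "(\<Sum>\<^sub>\<infinity>m\<in>{m. m dvd n}. ?H (n, m)) = (\<Sum>m | m dvd n. F m (n div m))" if "n \<in> {0<..}" for n
    using that by (subst infsum_finite) auto
  have "(\<Sum>\<^sub>\<infinity>m\<in>{0<..}. \<Sum>\<^sub>\<infinity>k\<in>{0<..}. F m k) = infsum (\<lambda>(m, k). F m k) ({0<..} \<times> {0<..})"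
    using infsum_Sigma_banach[OF sF] by simp
  also have "\<dots> = infsum (\<lambda>x. ?H ((\<lambda>(m, k). (m * k, m)) x)) ({0<..} \<times> {0<..})"
    by (intro infsum_cong eq[symmetric])
  also have "\<dots> = infsum ?H ?S"
    by (rule infsum_reindex_bij_betw[OF bij])
  also have "\<dots> = (\<Sum>\<^sub>\<infinity>n\<in>{0<..}. \<Sum>\<^sub>\<infinity>m\<in>{m. m dvd n}. ?H (n, m))"
    by (rule infsum_Sigma_banach[OF sH, symmetric])
  also have "\<dots> = (\<Sum>\<^sub>\<infinity>n\<in>{0<..}. \<Sum>m | m dvd n. F m (n div m))"
    by (rule infsum_cong[OF fin])
  finally show "(\<Sum>\<^sub>\<infinity>m\<in>{0<..}. \<Sum>\<^sub>\<infinity>k\<in>{0<..}. F m k) = (\<Sum>\<^sub>\<infinity>n\<in>{0<..}. \<Sum>m | m dvd n. F m (n div m))" .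
  have "(\<lambda>n. \<Sum>\<^sub>\<infinity>m\<in>{m. m dvd n}. F m (n div m)) summable_on {0<..}"
    by (rule summable_on_Sigma_banach[OF sH])
  moreover have "(\<lambda>n. \<Sum>\<^sub>\<infinity>m\<in>{m. m dvd n}. F m (n div m)) summable_on {0<..}
      \<longleftrightarrow> (\<lambda>n. \<Sum>m | m dvd n. F m (n div m)) summable_on {0<..}"
    by (rule summable_on_cong) (use fin in simp)
  ultimately show "(\<lambda>n. \<Sum>m | m dvd n. F m (n div m)) summable_on {0<..}" by simp
qed

lemma moebius_dirichlet_inverse:
  assumes g: "completely_multiplicative g" and s: "summable (\<lambda>n. cmod (g (Suc n)))"
  shows "infsum (\<lambda>n. of_int (moebius n) * g n) {0<..} * infsum g {0<..} = 1"
proof -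
  let ?f = "\<lambda>n. of_int (moebius n) * g n"
  have sg: "(\<lambda>n. norm (g n)) summable_on {0<..}"
    using summable_on_positive(1)[OF s] by (simp add: summable_on_iff_abs_summable_on_complex)
  have sf: "(\<lambda>n. norm (?f n)) summable_on {0<..}"
  proof (rule summable_on_comparison_test[OF sg])
    show "norm (?f n) \<le> norm (g n)" for n
      using mult_right_mono[OF norm_moebius_le[of n], of "norm (g n)"] by (simp add: norm_mult)
  qed simp
  let ?F = "\<lambda>(m, k). ?f m * g k"
  have "(\<lambda>x. norm (?F x)) summable_on ({0<..} \<times> {0<..})"
    unfolding Infinite_Sum.abs_summable_on_Sigma_iff
  proof (intro conjI ballI)
    show "(\<lambda>k. norm (case (m, k) of (m, k) \<Rightarrow> ?f m * g k)) summable_on {0<..}" for m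
      using summable_on_cmult_right[OF sg, of "norm (?f m)"] by (simp add: norm_mult)
    show "(\<lambda>m. norm (\<Sum>\<^sub>\<infinity>k\<in>{0<..}. norm (case (m, k) of (m, k) \<Rightarrow> ?f m * g k))) summable_on {0<..}"
      using summable_on_cmult_left[OF sf, of "infsum (\<lambda>n. norm (g n)) {0<..}"]
      by (simp add: norm_mult[of "?f _"] infsum_cmult_right' infsum_nonneg)
  qed
  then have sF: "?F summable_on ({0<..} \<times> {0<..})"
    by (simp add: summable_on_iff_abs_summable_on_complex)
  have 1: "infsum ?f {0<..} * infsum g {0<..} = (\<Sum>\<^sub>\<infinity>m\<in>{0<..}. \<Sum>\<^sub>\<infinity>k\<in>{0<..}. ?f m * g k)"
    by (simp add: infsum_cmult_right' infsum_cmult_left')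
  have "(\<Sum>\<^sub>\<infinity>m\<in>{0<..}. \<Sum>\<^sub>\<infinity>k\<in>{0<..}. ?f m * g k) = (\<Sum>\<^sub>\<infinity>n\<in>{0<..}. \<Sum>m | m dvd n. ?f m * g (n div m))"
    by (rule infsum_collect_products(1)[OF sF])
  also have "\<dots> = (\<Sum>\<^sub>\<infinity>n\<in>{0::nat<..}. if n = 1 then 1 else 0)"
  proof (rule infsum_cong)
    fix n :: nat assume "n \<in> {0<..}"
    then have n: "n > 0" by simp
    have "(\<Sum>m | m dvd n. ?f m * g (n div m)) = (\<Sum>m | m dvd n. of_int (moebius m) * g n)"
      by (rule sum.cong[OF refl]) (use n g in \<open>auto simp: completely_multiplicative_def mult.assoc elim!: dvdE\<close>)
    also have "\<dots> = of_int (\<Sum>m | m dvd n. moebius m) * g n"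
      by (simp add: sum_distrib_right)
    also have "\<dots> = (if n = 1 then 1 else 0)"
      using sum_moebius_divisors[OF n] g by (simp add: completely_multiplicative_def)
    finally show "(\<Sum>m | m dvd n. ?f m * g (n div m)) = (if n = 1 then 1 else 0)" .
  qed
  also have "\<dots> = (\<Sum>\<^sub>\<infinity>n\<in>{1 :: nat}. 1)"
    by (rule infsum_cong_neutral) auto
  finally show ?thesis
    using 1 by simp
qed

lemma mertens_local_inequality:
  fixes x c :: real
  assumes x: "0 \<le> x" and c: "\<bar>c\<bar> \<le> 1"
  shows "((1 - x)\<^sup>2)^3 * (1 - 2 * x * c + x\<^sup>2)^4 * (1 - 2 * x * (2 * c\<^sup>2 - 1) + x\<^sup>2) \<le> (1 + x\<^sup>2)^8"
proof -
  have amgm: "u * v \<le> ((u + v) / 2)\<^sup>2" for u v :: real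
    using sum_squares_ge_zero[of "u - v" 0] by (simp add: power2_eq_square field_simps)
  define A where "A = (1 - x)\<^sup>2"
  define B where "B = 1 - 2 * x * c + x\<^sup>2"
  define C where "C = 1 - 2 * x * (2 * c\<^sup>2 - 1) + x\<^sup>2"
  have A: "A \<ge> 0" by (simp add: A_def)
  have quad: "1 - 2 * x * d + x\<^sup>2 \<ge> 0" if "\<bar>d\<bar> \<le> 1" for d
  proof -
    have "x * d \<le> x * 1" using that x by (intro mult_left_mono) auto
    then show ?thesis using zero_le_power2[of "1 - x"] by (simp add: power2_eq_square algebra_simps)
  qed
  have B: "B \<ge> 0" unfolding B_def by (rule quad[OF c])
  have "c\<^sup>2 \<le> 1" using c by (simp add: abs_square_le_1)
  then have C: "C \<ge> 0" unfolding C_def by (intro quad) (auto simp: abs_le_iff)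
  have 1: "A * C * (A * A) \<le> ((3 * A + C) / 4)^4"
  proof -
    have "A * C * (A * A) \<le> ((A + C) / 2)\<^sup>2 * A\<^sup>2"
      using A C by (intro mult_mono amgm) (auto simp: power2_eq_square)
    also have "\<dots> = ((A + C) / 2 * A)\<^sup>2" by (simp only: power_mult_distrib)
    also have "\<dots> \<le> ((((A + C) / 2 + A) / 2)\<^sup>2)\<^sup>2"
      using A C by (intro power_mono amgm) auto
    also have "\<dots> = ((3 * A + C) / 4)^4" by (simp add: field_simps)
    finally show ?thesis .
  qed
  have "A^3 * B^4 * C = (A * C * (A * A)) * B^4" by (simp add: power3_eq_cube mult_ac)
  also have "\<dots> \<le> ((3 * A + C) / 4)^4 * B^4" using B by (intro mult_right_mono 1) auto
  also have "\<dots> = ((3 * A + C) / 4 * B)^4" by (simp only: power_mult_distrib)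
  also have "\<dots> \<le> ((((3 * A + C) / 4 + B) / 2)\<^sup>2)^4"
    using A B C by (intro power_mono amgm) auto
  also have "\<dots> = ((3 * A + 4 * B + C) / 8)^8"
    unfolding power_mult[symmetric] by (simp add: field_simps)
  also have "\<dots> \<le> (1 + x\<^sup>2)^8"
  proof (rule power_mono)
    have "(3 * A + 4 * B + C) / 8 = 1 + x\<^sup>2 - x / 2 * (1 + c)\<^sup>2"
      by (simp add: A_def B_def C_def power2_eq_square field_simps)
    then show "(3 * A + 4 * B + C) / 8 \<le> 1 + x\<^sup>2" using x by simp
  qed (use A B C in auto)
  finally show ?thesis by (simp add: A_def B_def C_def)
qed

(*FILE dev2/Char2*)
definition dirichlet_character :: "nat \<Rightarrow> (nat \<Rightarrow> complex) \<Rightarrow> bool"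
  where "dirichlet_character q \<psi> \<longleftrightarrow> q > 0 \<and> \<psi> 1 = 1 \<and> (\<forall>m n. \<psi> (m * n) = \<psi> m * \<psi> n)
    \<and> (\<forall>n. \<psi> (n + q) = \<psi> n) \<and> (\<forall>n. \<psi> n = 0 \<longleftrightarrow> \<not> coprime n q)"

lemma periodic_mod:
  assumes "\<And>n. a (n + q) = a (n :: nat)"
  shows "a (n mod q) = a n"
proof -
  have "a (r + k * q) = a r" for r k
  proof (induction k)
    case (Suc k)
    have "r + Suc k * q = (r + k * q) + q" by simp
    then show ?case using assms Suc by metis
  qed simp
  from this[of "n mod q" "n div q"] show ?thesis by simp
qed

lemma coprime_power_cong_1:
  fixes n q :: nat
  assumes "coprime n q" "q > 0"
  obtains k where "k > 0" "[n ^ k = 1] (mod q)"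
proof -
  have "finite (range (\<lambda>i :: nat. n ^ i mod q))"
    by (rule finite_subset[of _ "{..<q}"]) (use assms in auto)
  then have "\<not> inj (\<lambda>i :: nat. n ^ i mod q)"
    using finite_imageD by blast
  then obtain i j where ij: "i < j" "n ^ i mod q = n ^ j mod q"
    unfolding inj_def by (metis nat_neq_iff)
  have "[n ^ i * n ^ (j - i) = n ^ i * 1] (mod q)"
    using ij by (simp add: cong_def flip: power_add)
  then have "[n ^ (j - i) = 1] (mod q)"
    by (subst (asm) cong_mult_lcancel_nat) (use assms in auto)
  then show ?thesis using that[of "j - i"] ij by simp
qed

lemma periodic_partial_sums_bounded:
  fixes a :: "nat \<Rightarrow> complex"
  assumes q: "q > 0" and per: "\<And>n. a (n + q) = a n"
  defines "m \<equiv> (\<Sum>k = 1..q. a k) / of_nat q"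
  obtains K where "\<And>n. cmod ((\<Sum>k = 1..n. a k) - of_nat n * m) \<le> K"
proof -
  define c where "c n = (\<Sum>k = 1..n. a k) - of_nat n * m" for n
  have step: "(\<Sum>k = 1..n + q. a k) = (\<Sum>k = 1..n. a k) + (\<Sum>k = 1..q. a k)" for n
  proof (induction n)
    case (Suc n)
    have "(\<Sum>k = 1..Suc n + q. a k) = (\<Sum>k = 1..n + q. a k) + a (Suc n + q)" by simp
    then show ?case using Suc per[of "Suc n"] by simp
  qed simp
  have "c (n + q) = c n" for n
    unfolding c_def step using q by (simp add: m_def field_simps)
  then have "c n = c (n mod q)" for n
    by (rule periodic_mod[symmetric])
  moreover have "cmod (c (n mod q)) \<le> (\<Sum>r<q. cmod (c r))" for n
    using q by (intro member_le_sum) auto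
  ultimately show ?thesis using that[of "\<Sum>r<q. cmod (c r)"] by (simp add: c_def)
qed

context
  fixes q :: nat and \<psi> :: "nat \<Rightarrow> complex"
  assumes \<psi>: "dirichlet_character q \<psi>"
begin

lemma character_basic:
  shows modulus_pos: "q > 0" and character_1 [simp]: "\<psi> (Suc 0) = 1"
    and character_mult: "\<psi> (m * n) = \<psi> m * \<psi> n"
    and character_periodic: "\<psi> (n + q) = \<psi> n"
    and character_eq_0_iff: "\<psi> n = 0 \<longleftrightarrow> \<not> coprime n q"
  using \<psi> by (auto simp: dirichlet_character_def)

lemma character_cong: "[m = n] (mod q) \<Longrightarrow> \<psi> m = \<psi> n"
  using periodic_mod[of \<psi> q, OF character_periodic] unfolding cong_def by metis

lemma character_power: "\<psi> (n ^ k) = \<psi> n ^ k"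
  by (induction k) (simp_all add: character_mult)

lemma norm_character: "cmod (\<psi> n) = (if coprime n q then 1 else 0)"
proof (cases "coprime n q")
  case True
  then obtain k where k: "k > 0" "[n ^ k = 1] (mod q)"
    using coprime_power_cong_1 modulus_pos by blast
  have "\<psi> n ^ k = 1"
    using character_cong[OF k(2)] by (simp add: character_power)
  then have "cmod (\<psi> n) ^ k = 1" by (metis norm_one norm_power)
  then have "cmod (\<psi> n) = 1"
    using k(1) power_eq_imp_eq_base[of "cmod (\<psi> n)" k 1] by simp
  then show ?thesis using True by simp
qed (use character_eq_0_iff in simp)

lemma norm_character_le: "cmod (\<psi> n) \<le> 1"
  by (simp add: norm_character)

text \<open>The mean value vanishes unless \<open>\<psi>\<close> is principal, because multiplication by a unit permutes the residues.\<close>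

lemma nonprincipal_mean_zero:
  assumes "coprime g q" "\<psi> g \<noteq> 1"
  shows "(\<Sum>k = 1..q. \<psi> k) = 0"
proof -
  have eq: "(\<Sum>k = 1..q. \<psi> k) = (\<Sum>k<q. \<psi> k)"
  proof -
    have "(\<Sum>k = 1..q. \<psi> k) = (\<Sum>k<q. \<psi> (Suc k))"
      by (rule sum.reindex_bij_witness[of _ Suc "\<lambda>n. n - 1"]) auto
    also have "\<dots> = (\<Sum>k<q. \<psi> k) + \<psi> q - \<psi> 0"
      by (induction q) simp_all
    finally show ?thesis using character_periodic[of 0] by simp
  qed
  have inj: "inj_on (\<lambda>k. g * k mod q) {..<q}"
  proof (rule inj_onI)
    fix i j assume ij: "i \<in> {..<q}" "j \<in> {..<q}" "g * i mod q = g * j mod q"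
    then have "[i = j] (mod q)"
      using assms(1) by (simp add: cong_def[symmetric] cong_mult_lcancel_nat)
    then show "i = j" using ij by (simp add: cong_def)
  qed
  moreover have "(\<lambda>k. g * k mod q) ` {..<q} \<subseteq> {..<q}" using modulus_pos by auto
  ultimately have "bij_betw (\<lambda>k. g * k mod q) {..<q} {..<q}"
    by (simp add: bij_betw_def endo_inj_surj)
  then have "(\<Sum>k<q. \<psi> k) = (\<Sum>k<q. \<psi> (g * k mod q))"
    by (rule sum.reindex_bij_betw[symmetric])
  also have "\<dots> = (\<Sum>k<q. \<psi> (g * k))"
    by (simp add: periodic_mod[of \<psi> q, OF character_periodic])
  also have "\<dots> = \<psi> g * (\<Sum>k<q. \<psi> k)" by (simp add: character_mult sum_distrib_left)
  finally have "(\<psi> g - 1) * (\<Sum>k<q. \<psi> k) = 0" by (simp add: algebra_simps)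
  then show ?thesis using assms(2) eq by simp
qed

lemma completely_multiplicative_twist: "completely_multiplicative (\<lambda>n. \<psi> n * npow n s)"
  by (auto simp: completely_multiplicative_def character_mult npow_mult)

lemma summable_twist:
  assumes "Re s > 1"
  shows "summable (\<lambda>n. cmod (\<psi> (Suc n) * npow (Suc n) s))"
proof (rule summable_comparison_test'[where N = 0])
  show "summable (\<lambda>n. real (Suc n) powr (- Re s))"
    using assms summable_Suc_iff[of "\<lambda>n. real n powr (- Re s)"] by (simp add: summable_real_powr_iff)
  show "norm (cmod (\<psi> (Suc n) * npow (Suc n) s)) \<le> real (Suc n) powr (- Re s)" for n
    using mult_right_mono[OF norm_character_le[of "Suc n"], of "real (Suc n) powr (- Re s)"]
    by (simp add: norm_mult norm_npow)
qed

end

definition dirichlet_L :: "(nat \<Rightarrow> complex) \<Rightarrow> complex \<Rightarrow> complex"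
  where "dirichlet_L \<psi> s = (\<Sum>\<^sub>\<infinity>n\<in>{0<..}. \<psi> n * npow n s)"

lemma dirichlet_character_norm:
  "dirichlet_character q \<psi> \<Longrightarrow> dirichlet_character q (\<lambda>n. of_real (cmod (\<psi> n)))"
  by (simp add: dirichlet_character_def norm_mult)

lemma dirichlet_character_square:
  "dirichlet_character q \<psi> \<Longrightarrow> dirichlet_character q (\<lambda>n. (\<psi> n)\<^sup>2)"
  by (simp add: dirichlet_character_def power_mult_distrib)

lemma dirichlet_L_continuation:
  assumes \<psi>: "dirichlet_character q \<psi>"
  defines "m \<equiv> (\<Sum>k = 1..q. \<psi> k) / of_nat q"
  obtains A where "A holomorphic_on {s. Re s > 0}"
    "\<And>s. Re s > 1 \<Longrightarrow> dirichlet_L \<psi> s = m / (s - 1) + A s"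
    "\<And>s. m = 0 \<Longrightarrow> Re s > 0 \<Longrightarrow> (\<lambda>n. \<psi> (Suc n) * npow (Suc n) s) sums A s"
proof -
  obtain K where "\<And>n. cmod ((\<Sum>k = 1..n. \<psi> k) - of_nat n * m) \<le> K"
    using periodic_partial_sums_bounded[where a = \<psi>, OF modulus_pos[OF \<psi>] character_periodic[OF \<psi>]]
    unfolding m_def by metis
  from dirichlet_series_continuation[OF this] obtain A where A: "A holomorphic_on {s. Re s > 0}"
    "\<And>s. Re s > 1 \<Longrightarrow> (\<lambda>n. \<psi> (Suc n) * npow (Suc n) s) sums (m / (s - 1) + A s)"
    "\<And>s. m = 0 \<Longrightarrow> Re s > 0 \<Longrightarrow> (\<lambda>n. \<psi> (Suc n) * npow (Suc n) s) sums A s" by blast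
  moreover have "dirichlet_L \<psi> s = m / (s - 1) + A s" if "Re s > 1" for s
    using sums_unique2[OF summable_on_positive(2)[OF summable_twist[OF \<psi> that]] A(2)[OF that]]
    by (simp add: dirichlet_L_def)
  ultimately show ?thesis using that by blast
qed

lemma prod_one_plus_le_exp:
  "finite P \<Longrightarrow> (\<Prod>p\<in>P. 1 + (x p)\<^sup>2) \<le> exp (\<Sum>p\<in>P. (x p)\<^sup>2)" for x :: "nat \<Rightarrow> real"
  unfolding exp_sum by (rule prod_mono) (auto intro: exp_ge_add_one_self)

text \<open>
  The combination of three L-values whose Euler factors have non-negative logarithms up to a
  summable error.
\<close>

lemma mertens_three_four_one:
  assumes \<psi>: "dirichlet_character q \<psi>"
  obtains B where "\<And>\<sigma> t. \<sigma> > 1 \<Longrightarrow>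
    1 \<le> cmod (dirichlet_L (\<lambda>n. of_real (cmod (\<psi> n))) (of_real \<sigma>))^6
      * cmod (dirichlet_L \<psi> (of_real \<sigma> + \<i> * of_real t))^8
      * (cmod (dirichlet_L (\<lambda>n. (\<psi> n)\<^sup>2) (of_real \<sigma> + 2 * (\<i> * of_real t))))\<^sup>2 * B"
proof -
  define C where "C = (\<Sum>n. 1 / (real n)\<^sup>2)"
  have summ: "summable (\<lambda>n. 1 / (real n)\<^sup>2)"
    using inverse_power_summable[of 2, where 'a = real] by (simp add: inverse_eq_divide)
  have "1 \<le> cmod (dirichlet_L (\<lambda>n. of_real (cmod (\<psi> n))) (of_real \<sigma>))^6
      * cmod (dirichlet_L \<psi> (of_real \<sigma> + \<i> * of_real t))^8
      * (cmod (dirichlet_L (\<lambda>n. (\<psi> n)\<^sup>2) (of_real \<sigma> + 2 * (\<i> * of_real t))))\<^sup>2 * (exp C)^8"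
    if \<sigma>: "\<sigma> > 1" for \<sigma> t
  proof -
    define g0 where "g0 = (\<lambda>n. of_real (cmod (\<psi> n)) * npow n (of_real \<sigma>))"
    define g1 where "g1 = (\<lambda>n. \<psi> n * npow n (of_real \<sigma> + \<i> * of_real t))"
    define g2 where "g2 = (\<lambda>n. (\<psi> n)\<^sup>2 * npow n (of_real \<sigma> + 2 * (\<i> * of_real t)))"
    let ?P = "\<lambda>g N. \<Prod>p | prime p \<and> p \<le> N. cmod (1 - g p)"
    let ?X = "cmod (infsum g0 {0<..})^6 * cmod (infsum g1 {0<..})^8 * (cmod (infsum g2 {0<..}))\<^sup>2"
    have lim: "(\<lambda>N. cmod (infsum g {0<..}) * ?P g N) \<longlonglongrightarrow> 1"
      if "completely_multiplicative g" "summable (\<lambda>n. cmod (g (Suc n)))" for g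
      using tendsto_norm[OF euler_product[OF that]] by (simp add: norm_mult prod_norm)
    have l0: "(\<lambda>N. cmod (infsum g0 {0<..}) * ?P g0 N) \<longlonglongrightarrow> 1"
      unfolding g0_def using \<sigma>
      by (intro lim completely_multiplicative_twist[OF dirichlet_character_norm[OF \<psi>]]
          summable_twist[OF dirichlet_character_norm[OF \<psi>]]) auto
    have l1: "(\<lambda>N. cmod (infsum g1 {0<..}) * ?P g1 N) \<longlonglongrightarrow> 1"
      unfolding g1_def using \<sigma>
      by (intro lim completely_multiplicative_twist[OF \<psi>] summable_twist[OF \<psi>]) auto
    have l2: "(\<lambda>N. cmod (infsum g2 {0<..}) * ?P g2 N) \<longlonglongrightarrow> 1"
      unfolding g2_def using \<sigma>
      by (intro lim completely_multiplicative_twist[OF dirichlet_character_square[OF \<psi>]]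
          summable_twist[OF dirichlet_character_square[OF \<psi>]]) auto
    have "(\<lambda>N. (cmod (infsum g0 {0<..}) * ?P g0 N)^6 * (cmod (infsum g1 {0<..}) * ?P g1 N)^8
        * (cmod (infsum g2 {0<..}) * ?P g2 N)\<^sup>2) \<longlonglongrightarrow> 1^6 * 1^8 * 1\<^sup>2"
      by (intro tendsto_intros l0 l1 l2)
    then have lim1: "(\<lambda>N. ?X * ((?P g0 N)^6 * (?P g1 N)^8 * (?P g2 N)\<^sup>2)) \<longlonglongrightarrow> 1"
      by (simp add: power_mult_distrib mult_ac)
    have le: "?X * ((?P g0 N)^6 * (?P g1 N)^8 * (?P g2 N)\<^sup>2) \<le> ?X * (exp C)^8" for N
    proof (rule mult_left_mono)
      let ?S = "{p. prime p \<and> p \<le> N}"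
      have fin: "finite ?S" by (rule finite_subset[of _ "{..N}"]) auto
      have "(?P g0 N)^6 * (?P g1 N)^8 * (?P g2 N)\<^sup>2
          = (\<Prod>p\<in>?S. cmod (1 - g0 p)^6 * cmod (1 - g1 p)^8 * (cmod (1 - g2 p))\<^sup>2)"
        by (simp add: prod.distrib prod_power_distrib)
      also have "\<dots> \<le> (\<Prod>p\<in>?S. (1 + (1 / real p)\<^sup>2)^8)"
      proof (rule prod_mono, intro conjI)
        fix p assume "p \<in> ?S"
        then have p: "p > 0" using prime_gt_0_nat by blast
        define x where "x = real p powr (- \<sigma>)"
        have x: "0 < x" "x \<le> 1 / real p"
        proof -
          show "0 < x" using p by (simp add: x_def)
          have "real p powr (- \<sigma>) \<le> real p powr (- 1)" using p \<sigma> by (intro powr_mono) auto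
          then show "x \<le> 1 / real p" using p by (simp add: x_def powr_minus inverse_eq_divide)
        qed
        have npow_x: "npow p (of_real \<sigma>) = of_real x"
          using p by (simp add: npow_def x_def powr_def flip: exp_of_real)
        have "cmod (1 - g0 p)^6 * cmod (1 - g1 p)^8 * (cmod (1 - g2 p))\<^sup>2 \<le> (1 + x\<^sup>2)^8"
        proof (cases "coprime p q")
          case True
          define z where "z = \<psi> p * npow p (\<i> * of_real t)"
          have z: "cmod z = 1"
            using True p by (simp add: z_def norm_mult norm_character[OF \<psi>] norm_npow)
          have npow_double: "npow p (2 * w) = (npow p w)\<^sup>2" for w
            unfolding mult_2 npow_add power2_eq_square ..
          have g: "g0 p = of_real x" "g1 p = of_real x * z" "g2 p = of_real x * z\<^sup>2"
            using True unfolding g0_def g1_def g2_def npow_add npow_double npow_x z_def power_mult_distrib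
            by (simp_all add: norm_character[OF \<psi>])
          have n2: "(cmod (1 - of_real x * w))\<^sup>2 = 1 - 2 * x * Re w + x\<^sup>2" if "cmod w = 1" for w
          proof -
            have "(Re w)\<^sup>2 + (Im w)\<^sup>2 = 1" using that by (metis cmod_power2 one_power2)
            then have "x\<^sup>2 * ((Re w)\<^sup>2 + (Im w)\<^sup>2) = x\<^sup>2" by simp
            then show ?thesis
              by (simp add: cmod_power2 power2_diff power_mult_distrib algebra_simps)
          qed
          have "Re (z\<^sup>2) = 2 * (Re z)\<^sup>2 - 1"
          proof -
            have "(Re z)\<^sup>2 + (Im z)\<^sup>2 = 1" using z by (metis cmod_power2 one_power2)
            then show ?thesis by (simp add: power2_eq_square)
          qed
          then have e2: "(cmod (1 - g2 p))\<^sup>2 = 1 - 2 * x * (2 * (Re z)\<^sup>2 - 1) + x\<^sup>2"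
            unfolding g using n2[of "z\<^sup>2"] z by (simp add: norm_power)
          have e1: "cmod (1 - g1 p)^8 = (1 - 2 * x * Re z + x\<^sup>2)^4"
            unfolding g using n2[OF z] power_mult[of "cmod (1 - of_real x * z)" 2 4] by simp
          have e0: "cmod (1 - g0 p)^6 = ((1 - x)\<^sup>2)^3"
          proof -
            have "cmod (1 - g0 p) = \<bar>1 - x\<bar>"
              unfolding g by (metis norm_of_real of_real_1 of_real_diff)
            then show ?thesis using power_mult[of "\<bar>1 - x\<bar>" 2 3] by simp
          qed
          have "\<bar>Re z\<bar> \<le> 1" using abs_Re_le_cmod[of z] z by simp
          with x show ?thesis unfolding e0 e1 e2 by (intro mertens_local_inequality) auto
        next
          case False
          then have "\<psi> p = 0" using character_eq_0_iff[OF \<psi>] by simp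
          then show ?thesis by (simp add: g0_def g1_def g2_def)
        qed
        also have "\<dots> \<le> (1 + (1 / real p)\<^sup>2)^8"
          using x by (intro power_mono add_left_mono) auto
        finally show "cmod (1 - g0 p)^6 * cmod (1 - g1 p)^8 * (cmod (1 - g2 p))\<^sup>2 \<le> (1 + (1 / real p)\<^sup>2)^8" .
      qed auto
      also have "\<dots> = (\<Prod>p\<in>?S. 1 + (1 / real p)\<^sup>2)^8" by (simp add: prod_power_distrib)
      also have "\<dots> \<le> (exp C)^8"
      proof (rule power_mono)
        have "(\<Prod>p\<in>?S. 1 + (1 / real p)\<^sup>2) \<le> exp (\<Sum>p\<in>?S. (1 / real p)\<^sup>2)"
          by (rule prod_one_plus_le_exp[OF fin])
        also have "(\<Sum>p\<in>?S. (1 / real p)\<^sup>2) \<le> C"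
          unfolding C_def power_divide power_one using summ fin by (intro sum_le_suminf) auto
        finally show "(\<Prod>p\<in>?S. 1 + (1 / real p)\<^sup>2) \<le> exp C" by simp
      qed (auto intro: prod_nonneg)
      finally show "(?P g0 N)^6 * (?P g1 N)^8 * (?P g2 N)\<^sup>2 \<le> (exp C)^8" .
    qed simp
    have "1 \<le> ?X * (exp C)^8"
      by (rule LIMSEQ_le_const2[OF lim1]) (use le in blast)
    then show ?thesis by (simp add: dirichlet_L_def g0_def g1_def g2_def)
  qed
  then show ?thesis using that by blast
qed

(*FILE dev2/Char3*)
lemma sum_divisors_prime_power_mult:
  fixes F :: "nat \<Rightarrow> 'a::comm_monoid_add"
  assumes p: "prime p" "\<not> p dvd m" "m > 0"
  shows "(\<Sum>d | d dvd p ^ e * m. F d) = (\<Sum>i\<le>e. \<Sum>d | d dvd m. F (p ^ i * d))"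
proof -
  let ?h = "\<lambda>(i, d). p ^ i * d"
  have eq: "{d. d dvd p ^ e * m} = ?h ` ({..e} \<times> {d. d dvd m})"
  proof (intro equalityI subsetI)
    fix d assume "d \<in> {d. d dvd p ^ e * m}"
    then obtain a b where ab: "d = a * b" "a dvd p ^ e" "b dvd m"
      using division_decomp[of d "p ^ e" m] by auto
    then obtain i where "i \<le> e" "a = p ^ i"
      using divides_primepow_nat[OF p(1)] by auto
    then show "d \<in> ?h ` ({..e} \<times> {d. d dvd m})"
      using ab by (auto intro!: image_eqI[of _ _ "(i, b)"])
  next
    fix d assume "d \<in> ?h ` ({..e} \<times> {d. d dvd m})"
    then show "d \<in> {d. d dvd p ^ e * m}"
      by (auto intro!: mult_dvd_mono le_imp_power_dvd)
  qed
  have inj: "inj_on ?h ({..e} \<times> {d. d dvd m})"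
  proof (rule inj_onI)
    fix x y assume xy: "x \<in> {..e} \<times> {d. d dvd m}" "y \<in> {..e} \<times> {d. d dvd m}" "?h x = ?h y"
    obtain i d j d' where x: "x = (i, d)" and y: "y = (j, d')" by (cases x, cases y)
    have nd: "\<not> p dvd d" "\<not> p dvd d'" using xy p x y by (auto dest: dvd_trans)
    have e: "p ^ i * d = p ^ j * d'" using xy x y by simp
    have p0: "p > 0" using p(1) prime_gt_0_nat by blast
    have "i = j"
    proof (rule ccontr)
      assume "i \<noteq> j"
      then consider "i < j" | "j < i" by linarith
      then show False
      proof cases
        case 1
        then have "p ^ j = p ^ i * p ^ (j - i)" by (simp flip: power_add)
        then have "d = p ^ (j - i) * d'" using e p0 by simp
        then have "p dvd d" using 1 by (simp add: dvd_mult2 dvd_power)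
        then show False using nd by blast
      next
        case 2
        then have "p ^ i = p ^ j * p ^ (i - j)" by (simp flip: power_add)
        then have "d' = p ^ (i - j) * d" using e p0 by simp
        then have "p dvd d'" using 2 by (simp add: dvd_mult2 dvd_power)
        then show False using nd by blast
      qed
    qed
    then show "x = y" using e p0 x y by simp
  qed
  show ?thesis
    unfolding eq by (subst sum.reindex[OF inj]) (simp add: o_def case_prod_unfold sum.cartesian_product)
qed

text \<open>
  For a real character the divisor sum is multiplicative with non-negative values, and it is at
  least 1 at squares.
\<close>

lemma real_character_divisor_sums:
  fixes v :: "nat \<Rightarrow> real"
  assumes v1: "v 1 = 1" and vm: "\<And>m n. v (m * n) = v m * v n" and vr: "\<And>n. v n \<in> {-1, 0, 1}"
  shows "n > 0 \<Longrightarrow> (\<Sum>d | d dvd n. v d) \<ge> 0" and "n > 0 \<Longrightarrow> (\<Sum>d | d dvd n\<^sup>2. v d) \<ge> 1"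
proof -
  have vp: "v (p ^ i) = v p ^ i" for p i
    using v1 by (induction i) (simp_all add: vm)
  have step: "(\<Sum>d | d dvd p ^ e * m. v d) = (\<Sum>i\<le>e. v p ^ i) * (\<Sum>d | d dvd m. v d)"
    if "prime p" "\<not> p dvd m" "m > 0" for p m e
    by (simp add: sum_divisors_prime_power_mult[OF that] vm vp sum_product)
  have geo: "(\<Sum>i\<le>e. v p ^ i) \<ge> 0" "even e \<Longrightarrow> (\<Sum>i\<le>e. v p ^ i) \<ge> 1" for e p
  proof -
    consider "v p = -1" | "v p = 0" | "v p = 1" using vr[of p] by auto
    then have "(\<Sum>i\<le>e. v p ^ i) \<ge> 0 \<and> (even e \<longrightarrow> (\<Sum>i\<le>e. v p ^ i) \<ge> 1)"
    proof cases
      case 1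
      have "(\<Sum>i\<le>e. (-1 :: real) ^ i) = (if even e then 1 else 0)" by (induction e) auto
      then show ?thesis using 1 by simp
    next
      case 2
      have "(\<Sum>i\<le>e. (0 :: real) ^ i) = 1" by (induction e) auto
      then show ?thesis using 2 by simp
    qed simp
    then show "(\<Sum>i\<le>e. v p ^ i) \<ge> 0" "even e \<Longrightarrow> (\<Sum>i\<le>e. v p ^ i) \<ge> 1" by auto
  qed
  have ex: "\<exists>p f m. prime p \<and> n = p ^ f * m \<and> \<not> p dvd m \<and> m > 0 \<and> m < n" if n1: "n > 1" for n :: nat
  proof -
    obtain p where p: "prime p" "p dvd n" using prime_factor_nat[of n] n1 by auto
    obtain m where m: "n = p ^ multiplicity p n * m" "\<not> p dvd m"
    proof (rule multiplicity_decompose'[of n p])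
      show "n \<noteq> 0" "\<not> is_unit p" using n1 p(1) not_prime_unit by auto
    qed blast
    define e where "e = multiplicity p n"
    have "e \<noteq> 0"
    proof
      assume "e = 0"
      then have "n = m" using m(1) by (simp add: e_def)
      then show False using m(2) p(2) by simp
    qed
    then have "1 < p ^ e" using prime_gt_1_nat[OF p(1)] by (intro one_less_power) auto
    moreover have "m > 0" using m n1 by (cases m) auto
    ultimately have "1 * m < p ^ e * m" by (intro mult_strict_right_mono)
    then have "m < n" using m(1) by (simp add: e_def)
    then show ?thesis using m p(1) \<open>m > 0\<close> by blast
  qed
  show "n > 0 \<Longrightarrow> (\<Sum>d | d dvd n. v d) \<ge> 0"
  proof (induction n rule: less_induct)
    case (less n)
    show ?case
    proof (cases "n = 1")
      case False
      then obtain p f m where "prime p" "n = p ^ f * m" "\<not> p dvd m" "m > 0" "m < n"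
        using ex[of n] less.prems by auto
      then show ?thesis using less.IH[of m] geo(1) step by simp
    qed (simp add: v1[unfolded One_nat_def])
  qed
  show "n > 0 \<Longrightarrow> (\<Sum>d | d dvd n\<^sup>2. v d) \<ge> 1"
  proof (induction n rule: less_induct)
    case (less n)
    show ?case
    proof (cases "n = 1")
      case False
      then obtain p f m where n: "prime p" "n = p ^ f * m" "\<not> p dvd m" "m > 0" "m < n"
        using ex[of n] less.prems by auto
      have "n\<^sup>2 = p ^ (2 * f) * m\<^sup>2" using n(2) by (simp add: power_mult_distrib power_mult mult.commute)
      moreover have "\<not> p dvd m\<^sup>2" using n by (simp add: prime_dvd_power_iff)
      ultimately have "(\<Sum>d | d dvd n\<^sup>2. v d) = (\<Sum>i\<le>2 * f. v p ^ i) * (\<Sum>d | d dvd m\<^sup>2. v d)"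
        using n step by simp
      then show ?thesis
        using mult_mono[of 1 "\<Sum>i\<le>2 * f. v p ^ i" 1 "\<Sum>d | d dvd m\<^sup>2. v d"] less.IH[of m] n geo by auto
    qed (simp add: v1[unfolded One_nat_def])
  qed
qed

lemma geometric_sum_amgm:
  fixes y :: real
  assumes "y \<ge> 0"
  shows "real n * y ^ (n - 1) \<le> (\<Sum>i<n. y ^ (2 * i))"
proof -
  have "2 * y ^ (n - 1) \<le> y ^ (2 * i) + y ^ (2 * (n - 1 - i))" if "i < n" for i
  proof -
    have "0 \<le> (y ^ i - y ^ (n - 1 - i))\<^sup>2" by simp
    also have "\<dots> = y ^ (2 * i) + y ^ (2 * (n - 1 - i)) - 2 * y ^ (i + (n - 1 - i))"
      by (simp only: power2_diff power_add power_mult[symmetric] mult.commute[of _ 2] mult.assoc)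
    also have "i + (n - 1 - i) = n - 1" using that by simp
    finally show ?thesis by simp
  qed
  then have "(\<Sum>i<n. 2 * y ^ (n - 1)) \<le> (\<Sum>i<n. y ^ (2 * i) + y ^ (2 * (n - 1 - i)))"
    by (intro sum_mono) auto
  also have "\<dots> = (\<Sum>i<n. y ^ (2 * i)) + (\<Sum>i<n. y ^ (2 * (n - Suc i)))"
    by (simp add: sum.distrib)
  also have "(\<Sum>i<n. y ^ (2 * (n - Suc i))) = (\<Sum>i<n. y ^ (2 * i))"
    by (rule sum.nat_diff_reindex)
  finally show ?thesis by simp
qed

definition monsky_weight :: "real \<Rightarrow> nat \<Rightarrow> real"
  where "monsky_weight x n = 1 / (real n * (1 - x)) - x ^ n / (1 - x ^ n)"

lemma monsky_weight_bounds:
  assumes x: "0 < x" "x < 1" and n: "n > 0"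
  shows "monsky_weight x (Suc n) \<le> monsky_weight x n" and "0 \<le> monsky_weight x n"
proof -
  define g where "g n = (\<Sum>i<n. x ^ i)" for n
  have geo: "1 - x ^ n = (1 - x) * g n" for n
    unfolding g_def using one_diff_power_eq[of x n] by simp
  have gpos: "g n > 0" if "n > 0" for n
    unfolding g_def using x that by (intro sum_pos) auto
  define y where "y = sqrt x"
  have y: "y \<ge> 0" "y\<^sup>2 = x" "y \<le> 1" using x by (auto simp: y_def)
  have gy: "real n * y ^ (n - 1) \<le> g n" for n
    using geometric_sum_amgm[OF y(1), of n] unfolding g_def y(2)[symmetric] by (simp add: power_mult)
  show "0 \<le> monsky_weight x n"
  proof -
    have "real n * x ^ n \<le> g n"
    proof -
      have "(\<Sum>i<n. x ^ n) \<le> g n"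
        unfolding g_def using x by (intro sum_mono power_decreasing) auto
      then show ?thesis by simp
    qed
    then have "x ^ n / g n \<le> 1 / real n"
      using gpos[OF n] n by (simp add: field_simps)
    then have "(x ^ n / g n) / (1 - x) \<le> (1 / real n) / (1 - x)"
      using x by (intro divide_right_mono) auto
    then show ?thesis
      unfolding monsky_weight_def geo by (simp add: mult.commute)
  qed
  have key: "x ^ n / (g n * g (Suc n)) \<le> 1 / (real n * real (Suc n))"
  proof -
    have "real n * y ^ (n - 1) * (real (Suc n) * y ^ n) \<le> g n * g (Suc n)"
      using gy[of n] gy[of "Suc n"] gpos[OF n] y by (intro mult_mono) auto
    moreover have "y ^ (n - 1) * y ^ n = y ^ (2 * n - 1)"
      using n by (simp add: mult_2 flip: power_add)
    moreover have "x ^ n \<le> y ^ (2 * n - 1)"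
      unfolding y(2)[symmetric] power_mult[symmetric] using y by (intro power_decreasing) auto
    ultimately have "real n * real (Suc n) * x ^ n \<le> g n * g (Suc n)"
      by (smt (verit, best) mult.assoc mult.commute mult_left_mono of_nat_0_le_iff)
    then have "x ^ n \<le> g n * g (Suc n) / (real n * real (Suc n))"
      using n by (simp add: pos_le_divide_eq mult.commute del: of_nat_Suc)
    then have "x ^ n / (g n * g (Suc n)) \<le> g n * g (Suc n) / (real n * real (Suc n)) / (g n * g (Suc n))"
      using gpos[OF n] gpos[of "Suc n"] by (intro divide_right_mono) auto
    also have "\<dots> = 1 / (real n * real (Suc n))"
      using gpos[OF n] gpos[of "Suc n"] by simp
    finally show ?thesis .
  qed
  have scale: "(1 - x) * monsky_weight x k = 1 / real k - x ^ k / g k" for k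
  proof -
    have "u * (1 / (a * u) - b / (u * c)) = 1 / a - b / c" if "u \<noteq> 0" for a b c u :: real
      using that by (simp add: right_diff_distrib)
    then show ?thesis using x unfolding monsky_weight_def geo by simp
  qed
  have "(1 - x) * (monsky_weight x n - monsky_weight x (Suc n))
      = (1 / real n - 1 / real (Suc n)) - (x ^ n / g n - x ^ Suc n / g (Suc n))"
    unfolding right_diff_distrib scale by simp
  also have "1 / real n - 1 / real (Suc n) = 1 / (real n * real (Suc n))"
    using n by (simp add: field_simps)
  also have "x ^ n / g n - x ^ Suc n / g (Suc n) = x ^ n / (g n * g (Suc n))"
  proof -
    have "g (Suc n) - x * g n = 1"
      unfolding g_def sum.lessThan_Suc_shift by (simp add: sum_distrib_left)
    then have "x ^ n * (g (Suc n) - x * g n) = x ^ n" by simp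
    then show ?thesis using gpos[OF n] gpos[of "Suc n"] by (simp add: field_simps)
  qed
  finally have "(1 - x) * (monsky_weight x n - monsky_weight x (Suc n)) \<ge> 0"
    using key by simp
  then show "monsky_weight x (Suc n) \<le> monsky_weight x n"
    using x by (simp add: zero_le_mult_iff)
qed

lemma monsky_weight_1: "0 < x \<Longrightarrow> x < 1 \<Longrightarrow> monsky_weight x (Suc 0) = 1"
  by (simp add: monsky_weight_def field_simps)

(*FILE dev3/Char4*)
text \<open>
  Monsky's argument: if \<open>\<Sum> \<psi>(n) / n\<close> vanished, the Lambert series \<open>\<Sum> \<psi>(n) x\<^sup>n / (1 - x\<^sup>n)\<close> would
  stay bounded as \<open>x\<close> tends to 1, since it would differ by a factor -1 from a sum of \<open>\<psi>\<close> against decreasing weights.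
  But its power series has the non-negative coefficients \<open>\<Sum>\<^bsub>d | n\<^esub> \<psi>(d)\<close>, which are at least 1 at squares.
\<close>

lemma real_character_L1_nonzero:
  assumes \<psi>: "dirichlet_character q \<psi>" and real: "\<And>n. coprime n q \<Longrightarrow> (\<psi> n)\<^sup>2 = 1"
    and mean: "(\<Sum>k = 1..q. \<psi> k) = 0"
  shows "\<not> (\<lambda>n. \<psi> (Suc n) / of_nat (Suc n)) sums 0"
proof
  assume L1: "(\<lambda>n. \<psi> (Suc n) / of_nat (Suc n)) sums 0"
  define v where "v n = Re (\<psi> n)" for n
  have cases: "\<psi> n = 1 \<or> \<psi> n = 0 \<or> \<psi> n = -1" for n
    using real[of n] character_eq_0_iff[OF \<psi>, of n] by (auto simp: power2_eq_1_iff)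
  have v: "\<psi> n = of_real (v n)" "v n \<in> {-1, 0, 1}" for n
    using cases[of n] by (auto simp: v_def complex_eq_iff)
  have v1: "v 1 = 1" using character_1[OF \<psi>] by (simp add: v_def)
  have vm: "v (m * n) = v m * v n" for m n
    using character_mult[OF \<psi>, of m n] by (simp add: v flip: of_real_mult)
  have vle: "\<bar>v n\<bar> \<le> 1" for n using v(2)[of n] by auto
  have L1': "(\<lambda>n. v (Suc n) / real (Suc n)) sums 0"
  proof -
    have "(\<lambda>n. complex_of_real (v (Suc n) / real (Suc n))) sums complex_of_real 0"
      using L1 by (simp add: v(1) del: of_nat_Suc)
    then show ?thesis by (simp only: sums_of_real_iff)
  qed
  obtain K where "\<And>n. cmod ((\<Sum>k = 1..n. \<psi> k) - of_nat n * ((\<Sum>k = 1..q. \<psi> k) / of_nat q)) \<le> K"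
    using periodic_partial_sums_bounded[where a = \<psi>, OF modulus_pos[OF \<psi>] character_periodic[OF \<psi>]] by metis
  then have "cmod (of_real (\<Sum>k = 1..n. v k)) \<le> K" for n
    unfolding mean by (simp add: v(1))
  then have K: "\<bar>\<Sum>k = 1..n. v k\<bar> \<le> K" for n
    unfolding norm_of_real .
  have K0: "K \<ge> 0" using order_trans[OF abs_ge_zero K[of 0]] .
  have bound: "(\<Sum>l = 1..M. x ^ (l\<^sup>2)) \<le> K" if x: "0 < x" "x < 1" for x M
  proof -
    define b where "b n = monsky_weight x (Suc n)" for n
    have b: "b (Suc n) \<le> b n" "0 \<le> b n" for n
      unfolding b_def using monsky_weight_bounds[OF x, of "Suc n"] by simp_all
    have T: "\<bar>\<Sum>n<N. v (Suc n) * b n\<bar> \<le> K" for N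
    proof -
      have "(\<Sum>n<N. v (Suc n) * b n) = (\<Sum>k = 1..N. v k) * b N + (\<Sum>n<N. (\<Sum>k = 1..Suc n. v k) * (b n - b (Suc n)))"
        by (induction N) (simp_all add: algebra_simps)
      also have "\<bar>\<dots>\<bar> \<le> K * b N + (\<Sum>n<N. K * (b n - b (Suc n)))"
      proof (rule order_trans[OF abs_triangle_ineq], rule add_mono)
        show "\<bar>(\<Sum>k = 1..N. v k) * b N\<bar> \<le> K * b N"
          using b(2)[of N] mult_right_mono[OF K[of N] b(2)[of N]] by (simp add: abs_mult)
        show "\<bar>\<Sum>n<N. (\<Sum>k = 1..Suc n. v k) * (b n - b (Suc n))\<bar> \<le> (\<Sum>n<N. K * (b n - b (Suc n)))"
        proof (rule order_trans[OF sum_abs], rule sum_mono)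
          fix n
          show "\<bar>(\<Sum>k = 1..Suc n. v k) * (b n - b (Suc n))\<bar> \<le> K * (b n - b (Suc n))"
            using b(1)[of n] mult_right_mono[OF K[of "Suc n"], of "b n - b (Suc n)"] by (simp add: abs_mult)
        qed
      qed
      also have "\<dots> = K * b 0"
        unfolding sum_distrib_left[symmetric] sum_lessThan_telescope' by (simp add: algebra_simps)
      also have "b 0 = 1" unfolding b_def by (rule monsky_weight_1[OF x])
      finally show ?thesis by simp
    qed
    define F where "F m k = v m * x ^ (m * k)" for m k :: nat
    have xm: "0 < x ^ m" "x ^ m \<le> x" "x ^ m < 1" if "m > 0" for m
    proof -
      show "x ^ m \<le> x" using power_decreasing[of 1 m x] that x by simp
      then show "0 < x ^ m" "x ^ m < 1" using x by auto
    qed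
    have geo: "((\<lambda>k. x ^ (m * k)) has_sum (x ^ m / (1 - x ^ m))) {0<..}" if "m > 0" for m
    proof -
      have "{0 :: nat<..} = {1..}" by auto
      then show ?thesis
        using has_sum_geometric_from_1[of "x ^ m"] xm[OF that] by (simp add: power_mult)
    qed
    have "(\<lambda>p. norm ((\<lambda>(m, k). F m k) p)) summable_on ({0<..} \<times> {0<..})"
      unfolding Infinite_Sum.abs_summable_on_Sigma_iff
    proof (intro conjI ballI)
      fix m :: nat assume "m \<in> {0<..}"
      then have m: "m > 0" by simp
      have "norm (case (m, k) of (m, k) \<Rightarrow> F m k) = \<bar>v m\<bar> * x ^ (m * k)" for k
        using x by (simp add: F_def abs_mult)
      then show "(\<lambda>k. norm (case (m, k) of (m, k) \<Rightarrow> F m k)) summable_on {0<..}"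
        using has_sum_imp_summable[OF has_sum_cmult_right[OF geo[OF m], of "\<bar>v m\<bar>"]] by simp
    next
      have le: "norm (\<Sum>\<^sub>\<infinity>k\<in>{0<..}. norm (case (m, k) of (m, k) \<Rightarrow> F m k)) \<le> x ^ m * (1 / (1 - x))"
        if "m \<in> {0<..}" for m
      proof -
        have m: "m > 0" using that by simp
        have "(\<Sum>\<^sub>\<infinity>k\<in>{0<..}. norm (case (m, k) of (m, k) \<Rightarrow> F m k)) = (\<Sum>\<^sub>\<infinity>k\<in>{0<..}. \<bar>v m\<bar> * x ^ (m * k))"
          using x by (intro infsum_cong) (simp add: F_def abs_mult)
        also have "\<dots> = \<bar>v m\<bar> * (x ^ m / (1 - x ^ m))"
          by (rule infsumI[OF has_sum_cmult_right[OF geo[OF m]]])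
        finally have eq: "(\<Sum>\<^sub>\<infinity>k\<in>{0<..}. norm (case (m, k) of (m, k) \<Rightarrow> F m k)) = \<bar>v m\<bar> * (x ^ m / (1 - x ^ m))" .
        have "\<bar>v m\<bar> * (x ^ m / (1 - x ^ m)) \<le> 1 * (x ^ m / (1 - x))"
          using xm[OF m] x vle by (intro mult_mono frac_le) auto
        then show ?thesis unfolding eq using xm[OF m] by simp
      qed
      have sm: "(\<lambda>m. x ^ m * (1 / (1 - x))) summable_on {0<..}"
        using has_sum_imp_summable[OF has_sum_cmult_left[OF geo[of 1], of "1 / (1 - x)"]] by simp
      show "(\<lambda>m. norm (\<Sum>\<^sub>\<infinity>k\<in>{0<..}. norm (case (m, k) of (m, k) \<Rightarrow> F m k))) summable_on {0<..}"
        by (rule summable_on_comparison_test[OF sm le]) simp_all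
    qed
    then have sF: "(\<lambda>(m, k). F m k) summable_on ({0<..} \<times> {0<..})"
      by (rule Infinite_Sum.abs_summable_summable)
    define u where "u m = v m * (x ^ m / (1 - x ^ m))" for m
    have inner: "(\<Sum>\<^sub>\<infinity>k\<in>{0<..}. F m k) = u m" if "m > 0" for m
      unfolding F_def u_def by (rule infsumI[OF has_sum_cmult_right[OF geo[OF that]]])
    define r where "r n = (\<Sum>d | d dvd n. v d)" for n
    have rF: "(\<Sum>m | m dvd n. F m (n div m)) = r n * x ^ n" for n
      unfolding r_def sum_distrib_right F_def by (rule sum.cong) auto
    have rsum: "(\<lambda>n. r n * x ^ n) summable_on {0<..}"
      using infsum_collect_products(2)[OF sF] unfolding rF .
    have "(\<Sum>\<^sub>\<infinity>n\<in>{0<..}. r n * x ^ n) = (\<Sum>\<^sub>\<infinity>m\<in>{0<..}. \<Sum>\<^sub>\<infinity>k\<in>{0<..}. F m k)"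
      using infsum_collect_products(1)[OF sF] unfolding rF by (rule sym)
    also have "\<dots> = (\<Sum>\<^sub>\<infinity>m\<in>{0<..}. u m)"
      by (intro infsum_cong inner) simp
    finally have S: "(\<Sum>\<^sub>\<infinity>n\<in>{0<..}. r n * x ^ n) = infsum u {0<..}" .
    have "summable (\<lambda>n. norm (u (Suc n)))"
    proof (rule summable_comparison_test'[where N = 0])
      show "summable (\<lambda>n. x ^ Suc n * (1 / (1 - x)))"
        using x by (intro summable_mult2 summable_mult summable_geometric) (simp add: summable_Suc_iff summable_geometric)
      fix n
      have "norm (u (Suc n)) = \<bar>v (Suc n)\<bar> * (x ^ Suc n / (1 - x ^ Suc n))"
        unfolding u_def using xm[of "Suc n"] by (simp add: abs_mult)
      also have "\<dots> \<le> 1 * (x ^ Suc n / (1 - x))"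
        using xm[of "Suc n"] x vle by (intro mult_mono frac_le) auto
      finally show "norm (norm (u (Suc n))) \<le> x ^ Suc n * (1 / (1 - x))" by simp
    qed
    from summable_on_positive(2)[OF this]
    have usums: "(\<lambda>n. u (Suc n)) sums infsum u {0<..}" .
    have "infsum u {0<..} \<le> K"
    proof -
      have ueq: "u (Suc n) = v (Suc n) / real (Suc n) * (1 / (1 - x)) - v (Suc n) * b n" for n
        by (simp add: u_def b_def monsky_weight_def right_diff_distrib)
      have "(\<Sum>n<N. u (Suc n)) = (\<Sum>n<N. v (Suc n) / real (Suc n)) * (1 / (1 - x)) - (\<Sum>n<N. v (Suc n) * b n)" for N
        by (simp only: ueq sum_subtractf sum_distrib_right)
      then have le: "(\<Sum>n<N. u (Suc n)) \<le> (\<Sum>n<N. v (Suc n) / real (Suc n)) * (1 / (1 - x)) + K" for N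
        using T[of N] by (simp add: abs_le_iff)
      have "(\<lambda>N. (\<Sum>n<N. v (Suc n) / real (Suc n)) * (1 / (1 - x)) + K) \<longlonglongrightarrow> 0 * (1 / (1 - x)) + K"
        using L1' unfolding sums_def by (intro tendsto_intros)
      from LIMSEQ_le[OF usums[unfolded sums_def] this] le show ?thesis by auto
    qed
    moreover have "(\<Sum>l = 1..M. x ^ (l\<^sup>2)) \<le> (\<Sum>\<^sub>\<infinity>n\<in>{0<..}. r n * x ^ n)"
    proof -
      have r0: "r n \<ge> 0" if "n > 0" for n
        unfolding r_def by (rule real_character_divisor_sums(1)[OF v1 vm v(2) that])
      have r1: "r (n\<^sup>2) \<ge> 1" if "n > 0" for n
        unfolding r_def by (rule real_character_divisor_sums(2)[OF v1 vm v(2) that])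
      have "(\<Sum>l = 1..M. x ^ (l\<^sup>2)) \<le> (\<Sum>l = 1..M. r (l\<^sup>2) * x ^ (l\<^sup>2))"
      proof (rule sum_mono)
        fix l assume "l \<in> {1..M}"
        then show "x ^ (l\<^sup>2) \<le> r (l\<^sup>2) * x ^ (l\<^sup>2)"
          using mult_right_mono[OF r1[of l], of "x ^ (l\<^sup>2)"] x by simp
      qed
      also have "\<dots> = (\<Sum>n\<in>(\<lambda>l. l\<^sup>2) ` {1..M}. r n * x ^ n)"
        by (subst sum.reindex) (auto intro!: inj_onI)
      also have "\<dots> = (\<Sum>\<^sub>\<infinity>n\<in>(\<lambda>l. l\<^sup>2) ` {1..M}. r n * x ^ n)"
        by (rule infsum_finite[symmetric]) simp
      also have "\<dots> \<le> (\<Sum>\<^sub>\<infinity>n\<in>{0<..}. r n * x ^ n)"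
        by (rule infsum_mono_neutral) (use rsum r0 x in auto)
      finally show ?thesis .
    qed
    ultimately show ?thesis using S by simp
  qed
  define M where "M = nat \<lceil>K\<rceil> + 1"
  have "((\<lambda>x :: real. \<Sum>l = 1..M. x ^ (l\<^sup>2)) \<longlongrightarrow> (\<Sum>l = 1..M. 1 ^ (l\<^sup>2))) (at_left 1)"
    by (intro tendsto_intros)
  moreover have "\<forall>\<^sub>F x in at_left (1 :: real). (\<Sum>l = 1..M. x ^ (l\<^sup>2)) \<le> K"
    by (rule eventually_mono[OF eventually_at_left_real[of 0]]) (use bound in auto)
  ultimately have "(\<Sum>l = 1..M. (1 :: real) ^ (l\<^sup>2)) \<le> K"
    by (rule tendsto_upperbound) simp
  then have "real M \<le> K" by simp
  moreover have "real M > K" unfolding M_def using K0 by linarith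
  ultimately show False by simp
qed

text \<open>
  Non-vanishing on the line \<open>Re s = 1\<close>.  A zero at \<open>1 + i t\<close> would enter the inequality for the
  three L-values to the power 8, the pole of the principal one at 1 only to the power 6, so the
  third factor must have a pole as well.  This happens only for a real character at
  \<open>t = 0\<close>, which is the case treated above.
\<close>

theorem dirichlet_L_nonvanishing:
  assumes \<psi>: "dirichlet_character q \<psi>"
  defines "m \<equiv> (\<Sum>k = 1..q. \<psi> k) / of_nat q"
  assumes A: "A holomorphic_on {s. Re s > 0}"
    and L: "\<And>s. Re s > 1 \<Longrightarrow> dirichlet_L \<psi> s = m / (s - 1) + A s"
    and sumsA: "\<And>s. m = 0 \<Longrightarrow> Re s > 0 \<Longrightarrow> (\<lambda>n. \<psi> (Suc n) * npow (Suc n) s) sums A s"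
    and s: "Re s = 1" "s \<noteq> 1 \<or> m = 0"
  shows "m / (s - 1) + A s \<noteq> 0"
proof
  define f where "f s = m / (s - 1) + A s" for s
  assume "m / (s - 1) + A s = 0"
  then have zero: "f s = 0" by (simp add: f_def)
  define t where "t = Im s"
  have st: "s = 1 + \<i> * of_real t" using s(1) by (simp add: complex_eq_iff t_def)
  define \<psi>0 where "\<psi>0 = (\<lambda>n. complex_of_real (cmod (\<psi> n)))"
  define \<psi>2 where "\<psi>2 = (\<lambda>n. (\<psi> n)\<^sup>2)"
  have c0: "dirichlet_character q \<psi>0" unfolding \<psi>0_def by (rule dirichlet_character_norm[OF \<psi>])
  have c2: "dirichlet_character q \<psi>2" unfolding \<psi>2_def by (rule dirichlet_character_square[OF \<psi>])
  define m0 where "m0 = (\<Sum>k = 1..q. \<psi>0 k) / of_nat q"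
  define m2 where "m2 = (\<Sum>k = 1..q. \<psi>2 k) / of_nat q"
  obtain A0 where A0: "A0 holomorphic_on {s. Re s > 0}"
    "\<And>s. Re s > 1 \<Longrightarrow> dirichlet_L \<psi>0 s = m0 / (s - 1) + A0 s"
    using dirichlet_L_continuation[OF c0] unfolding m0_def by metis
  obtain A2 where A2: "A2 holomorphic_on {s. Re s > 0}"
    "\<And>s. Re s > 1 \<Longrightarrow> dirichlet_L \<psi>2 s = m2 / (s - 1) + A2 s"
    using dirichlet_L_continuation[OF c2] unfolding m2_def by metis
  have cont: "isCont g z" if "g holomorphic_on {s. Re s > 0}" "Re z > 0" for g z
    using that holomorphic_on_imp_continuous_on[OF that(1)] open_halfspace_Re_gt[of 0]
    by (simp add: continuous_on_eq_continuous_at)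
  have "t \<noteq> 0 \<or> m2 = 0"
  proof (rule ccontr)
    assume "\<not> (t \<noteq> 0 \<or> m2 = 0)"
    then have t: "t = 0" and m2: "m2 \<noteq> 0" by auto
    have s1: "s = 1" using st t by simp
    then have m: "m = 0" using s(2) by simp
    then have mean: "(\<Sum>k = 1..q. \<psi> k) = 0" using modulus_pos[OF \<psi>] by (simp add: m_def)
    have "(\<psi> n)\<^sup>2 = 1" if "coprime n q" for n
      using nonprincipal_mean_zero[OF c2 that] m2 by (auto simp: m2_def \<psi>2_def)
    from real_character_L1_nonzero[OF \<psi> this mean]
    have "\<not> (\<lambda>n. \<psi> (Suc n) / of_nat (Suc n)) sums 0" by blast
    moreover have "(\<lambda>n. \<psi> (Suc n) / of_nat (Suc n)) sums A 1"
      using sumsA[OF m, of 1] by (simp add: npow_at_1 del: of_nat_Suc)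
    moreover have "A 1 = 0" using zero s1 m by (simp add: f_def)
    ultimately show False by simp
  qed
  then have s2: "1 + 2 * (\<i> * of_real t) \<noteq> 1 \<or> m2 = 0" by (simp add: complex_eq_iff)
  obtain B where B: "\<And>\<sigma> t. \<sigma> > 1 \<Longrightarrow>
    1 \<le> cmod (dirichlet_L \<psi>0 (of_real \<sigma>))^6
      * cmod (dirichlet_L \<psi> (of_real \<sigma> + \<i> * of_real t))^8
      * (cmod (dirichlet_L \<psi>2 (of_real \<sigma> + 2 * (\<i> * of_real t))))\<^sup>2 * B"
    using mertens_three_four_one[OF \<psi>] unfolding \<psi>0_def \<psi>2_def by blast
  have to1: "((\<lambda>\<sigma>. complex_of_real \<sigma>) \<longlongrightarrow> 1) (at_right 1)"
    using tendsto_of_real[OF tendsto_ident_at, of 1 "{1<..}", where 'a = complex] by simp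
  have gt1: "\<forall>\<^sub>F \<sigma> in at_right (1 :: real). \<sigma> > 1"
    by (rule eventually_at_right_less)
  have lim0: "((\<lambda>\<sigma>. (of_real \<sigma> - 1) * dirichlet_L \<psi>0 (of_real \<sigma>)) \<longlongrightarrow> m0) (at_right 1)"
  proof -
    have "((\<lambda>\<sigma>. m0 + (of_real \<sigma> - 1) * A0 (of_real \<sigma>)) \<longlongrightarrow> m0 + (1 - 1) * A0 1) (at_right 1)"
      by (intro tendsto_intros to1 isCont_tendsto_compose[OF cont[OF A0(1)]]) auto
    then have *: "((\<lambda>\<sigma>. m0 + (of_real \<sigma> - 1) * A0 (of_real \<sigma>)) \<longlongrightarrow> m0) (at_right 1)" by simp
    show ?thesis
    proof (rule Lim_transform_eventually[OF *])
      show "\<forall>\<^sub>F \<sigma> in at_right 1. m0 + (of_real \<sigma> - 1) * A0 (of_real \<sigma>) = (of_real \<sigma> - 1) * dirichlet_L \<psi>0 (of_real \<sigma>)"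
        using gt1
      proof eventually_elim
        case (elim \<sigma>)
        have "complex_of_real \<sigma> - 1 \<noteq> 0" using elim by (simp add: complex_eq_iff)
        then show ?case using elim A0(2)[of "of_real \<sigma>"] by (simp add: distrib_left)
      qed
    qed
  qed
  obtain D where D: "(f has_field_derivative D) (at s)"
  proof -
    have "A field_differentiable (at s)"
      using A s(1) by (intro holomorphic_on_imp_differentiable_at[OF A]) (auto simp: open_halfspace_Re_gt)
    moreover have "(\<lambda>s. m / (s - 1)) field_differentiable (at s)"
    proof (cases "m = 0")
      case False
      then have "s - 1 \<noteq> 0" using s(2) by simp
      then show ?thesis by (intro derivative_intros)
    qed simp
    ultimately have "f field_differentiable (at s)"
      unfolding f_def by (intro field_differentiable_add)
    then show ?thesis using that field_differentiable_def by blast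
  qed
  have lim1: "((\<lambda>\<sigma>. dirichlet_L \<psi> (of_real \<sigma> + \<i> * of_real t) / (of_real \<sigma> - 1)) \<longlongrightarrow> D) (at_right 1)"
  proof -
    have "((\<lambda>z. (f z - f s) / (z - s)) \<longlongrightarrow> D) (at s)"
      using D by (simp add: has_field_derivative_iff)
    moreover have "filterlim (\<lambda>\<sigma>. of_real \<sigma> + \<i> * of_real t) (at s) (at_right 1)"
      unfolding filterlim_at
    proof
      show "\<forall>\<^sub>F \<sigma> in at_right 1. of_real \<sigma> + \<i> * of_real t \<in> UNIV \<and> of_real \<sigma> + \<i> * of_real t \<noteq> s"
        using gt1 by eventually_elim (simp add: st complex_eq_iff)
      show "((\<lambda>\<sigma>. of_real \<sigma> + \<i> * of_real t) \<longlongrightarrow> s) (at_right 1)"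
        unfolding st by (intro tendsto_intros to1)
    qed
    ultimately have *: "((\<lambda>\<sigma>. (f (of_real \<sigma> + \<i> * of_real t) - f s) / (of_real \<sigma> + \<i> * of_real t - s)) \<longlongrightarrow> D) (at_right 1)"
      by (rule filterlim_compose)
    show ?thesis
    proof (rule Lim_transform_eventually[OF *])
      show "\<forall>\<^sub>F \<sigma> in at_right 1. (f (of_real \<sigma> + \<i> * of_real t) - f s) / (of_real \<sigma> + \<i> * of_real t - s)
          = dirichlet_L \<psi> (of_real \<sigma> + \<i> * of_real t) / (of_real \<sigma> - 1)"
        using gt1 by eventually_elim (simp add: L f_def zero[unfolded f_def], simp add: st)
    qed
  qed
  have lim2: "((\<lambda>\<sigma>. dirichlet_L \<psi>2 (of_real \<sigma> + 2 * (\<i> * of_real t))) \<longlongrightarrow> m2 / (2 * (\<i> * of_real t)) + A2 (1 + 2 * (\<i> * of_real t))) (at_right 1)"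
  proof -
    have "((\<lambda>\<sigma>. m2 / (of_real \<sigma> + 2 * (\<i> * of_real t) - 1)) \<longlongrightarrow> m2 / (1 + 2 * (\<i> * of_real t) - 1)) (at_right 1)"
    proof (cases "m2 = 0")
      case False
      then show ?thesis using s2 by (intro tendsto_intros to1) auto
    qed simp
    moreover have "((\<lambda>\<sigma>. A2 (of_real \<sigma> + 2 * (\<i> * of_real t))) \<longlongrightarrow> A2 (1 + 2 * (\<i> * of_real t))) (at_right 1)"
      by (rule isCont_tendsto_compose[OF cont[OF A2(1)]]) (auto intro!: tendsto_intros to1)
    ultimately have *: "((\<lambda>\<sigma>. m2 / (of_real \<sigma> + 2 * (\<i> * of_real t) - 1) + A2 (of_real \<sigma> + 2 * (\<i> * of_real t)))
        \<longlongrightarrow> m2 / (2 * (\<i> * of_real t)) + A2 (1 + 2 * (\<i> * of_real t))) (at_right 1)"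
      by (auto dest: tendsto_add)
    show ?thesis
      by (rule Lim_transform_eventually[OF *]) (use gt1 in \<open>eventually_elim, simp add: A2(2)\<close>)
  qed
  have "((\<lambda>\<sigma>. cmod ((of_real \<sigma> - 1) * dirichlet_L \<psi>0 (of_real \<sigma>))^6
      * cmod (dirichlet_L \<psi> (of_real \<sigma> + \<i> * of_real t) / (of_real \<sigma> - 1))^8
      * (cmod (dirichlet_L \<psi>2 (of_real \<sigma> + 2 * (\<i> * of_real t))))\<^sup>2 * B * (cmod (of_real \<sigma> - 1))\<^sup>2)
    \<longlongrightarrow> cmod m0^6 * cmod D^8 * (cmod (m2 / (2 * (\<i> * of_real t)) + A2 (1 + 2 * (\<i> * of_real t))))\<^sup>2 * B
      * (cmod (1 - 1))\<^sup>2) (at_right 1)"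
    by (intro tendsto_intros lim0 lim1 lim2 to1)
  moreover have "\<forall>\<^sub>F \<sigma> in at_right 1. 1 \<le> cmod ((of_real \<sigma> - 1) * dirichlet_L \<psi>0 (of_real \<sigma>))^6
      * cmod (dirichlet_L \<psi> (of_real \<sigma> + \<i> * of_real t) / (of_real \<sigma> - 1))^8
      * (cmod (dirichlet_L \<psi>2 (of_real \<sigma> + 2 * (\<i> * of_real t))))\<^sup>2 * B * (cmod (of_real \<sigma> - 1))\<^sup>2"
    using gt1
  proof eventually_elim
    case (elim \<sigma>)
    have nz: "cmod (complex_of_real \<sigma> - 1) \<noteq> 0" using elim by (simp add: complex_eq_iff)
    have alg: "(x * u)^6 * (y / u)^(8::nat) * z\<^sup>2 * B * u\<^sup>2 = x^6 * y^8 * z\<^sup>2 * B" if "u \<noteq> 0" for x y z u :: real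
    proof -
      have "u^8 = u^6 * u\<^sup>2" by (simp flip: power_add)
      moreover have "x^6 * y^8 * z\<^sup>2 * B = x^6 * ((y / u) * u)^8 * z\<^sup>2 * B" using that by simp
      ultimately show ?thesis by (simp only: power_mult_distrib mult_ac)
    qed
    show ?case
      using B[OF elim, of t] unfolding norm_mult norm_divide mult.commute[of "cmod (complex_of_real \<sigma> - 1)"]
        alg[OF nz] .
  qed
  ultimately have "1 \<le> cmod m0^6 * cmod D^8 * (cmod (m2 / (2 * (\<i> * of_real t)) + A2 (1 + 2 * (\<i> * of_real t))))\<^sup>2 * B
      * (cmod (1 - 1))\<^sup>2"
    by (rule tendsto_lowerbound) simp
  then show False by simp
qed

(*FILE dev4/Char5*)
theorem character_moebius_mean_zero:
  assumes \<psi>: "dirichlet_character q \<psi>"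
  shows "mean_zero (\<lambda>n. \<psi> n * of_int (moebius n))"
proof -
  define m where "m = (\<Sum>k = 1..q. \<psi> k) / of_nat q"
  obtain A where A: "A holomorphic_on {s. Re s > 0}"
    "\<And>s. Re s > 1 \<Longrightarrow> dirichlet_L \<psi> s = m / (s - 1) + A s"
    "\<And>s. m = 0 \<Longrightarrow> Re s > 0 \<Longrightarrow> (\<lambda>n. \<psi> (Suc n) * npow (Suc n) s) sums A s"
    by (rule dirichlet_L_continuation[OF \<psi>, folded m_def], rule that)
  \<comment> \<open>\<open>u / W\<close> is the reciprocal of the L-function, holomorphic also at a pole of the latter.\<close>
  define u where "u s = (if m = 0 then 1 else s - 1)" for s :: complex
  define W where "W s = (if m = 0 then A s else m + (s - 1) * A s)" for s
  have u_hol: "u holomorphic_on V" for V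
    unfolding u_def by (cases "m = 0") (auto intro!: holomorphic_intros)
  have W_hol: "W holomorphic_on {s. Re s > 0}"
    unfolding W_def using A(1) by (cases "m = 0") (auto intro!: holomorphic_intros)
  have uW: "u s * (m / (s - 1) + A s) = W s" "u s \<noteq> 0" if "s \<noteq> 1 \<or> m = 0" for s
    using that by (auto simp: u_def W_def distrib_left)
  have recip: "x = 1 / l" if "x * l = 1" for x l :: complex
  proof -
    have "l \<noteq> 0" using that by auto
    then show ?thesis using that by (simp add: nonzero_eq_divide_eq)
  qed
  have W0: "W s \<noteq> 0" if "Re s \<ge> 1" for s
  proof (cases "s \<noteq> 1 \<or> m = 0")
    case True
    have "m / (s - 1) + A s \<noteq> 0"
    proof (cases "Re s = 1")
      case eq: True
      show ?thesis
        using dirichlet_L_nonvanishing[OF \<psi>, folded m_def, OF A eq True] .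
    next
      case False
      then have s: "Re s > 1" using that by simp
      have "infsum (\<lambda>n. of_int (moebius n) * (\<psi> n * npow n s)) {0<..} * dirichlet_L \<psi> s = 1"
        unfolding dirichlet_L_def
        by (rule moebius_dirichlet_inverse[OF completely_multiplicative_twist[OF \<psi>] summable_twist[OF \<psi> s]])
      then show ?thesis using A(2)[OF s] by auto
    qed
    then show ?thesis using uW[OF True] by (metis mult_eq_0_iff)
  next
    case False
    then show ?thesis by (simp add: W_def)
  qed
  define U where "U = {s. Re s > 0} \<inter> W -` (- {0})"
  have "open U"
    unfolding U_def
    by (intro continuous_open_preimage holomorphic_on_imp_continuous_on W_hol open_halfspace_Re_gt) auto
  moreover have "{s. Re s \<ge> 1} \<subseteq> U"
    using W0 by (auto simp: U_def)
  moreover have "(\<lambda>s. u s / W s) holomorphic_on U"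
    by (intro holomorphic_on_divide u_hol holomorphic_on_subset[OF W_hol]) (auto simp: U_def)
  moreover have "(\<lambda>n. \<psi> (Suc n) * of_int (moebius (Suc n)) * npow (Suc n) s) sums (u s / W s)" if s: "Re s > 1" for s
  proof -
    have "summable (\<lambda>n. norm (of_int (moebius (Suc n)) * (\<psi> (Suc n) * npow (Suc n) s)))"
    proof (rule summable_comparison_test'[OF summable_twist[OF \<psi> s], where N = 0])
      show "norm (norm (of_int (moebius (Suc n)) * (\<psi> (Suc n) * npow (Suc n) s))) \<le> cmod (\<psi> (Suc n) * npow (Suc n) s)" for n
        using mult_right_mono[OF norm_moebius_le[of "Suc n"], of "cmod (\<psi> (Suc n) * npow (Suc n) s)"]
        unfolding norm_mult[of "of_int _"] by simp
    qed
    from summable_on_positive(2)[OF this]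
    have "(\<lambda>n. \<psi> (Suc n) * of_int (moebius (Suc n)) * npow (Suc n) s)
        sums infsum (\<lambda>n. of_int (moebius n) * (\<psi> n * npow n s)) {0<..}"
      by (simp add: mult_ac)
    moreover have "infsum (\<lambda>n. of_int (moebius n) * (\<psi> n * npow n s)) {0<..} * dirichlet_L \<psi> s = 1"
      unfolding dirichlet_L_def
      by (rule moebius_dirichlet_inverse[OF completely_multiplicative_twist[OF \<psi>] summable_twist[OF \<psi> s]])
    then have "infsum (\<lambda>n. of_int (moebius n) * (\<psi> n * npow n s)) {0<..} = 1 / dirichlet_L \<psi> s"
      by (rule recip)
    moreover have "1 / dirichlet_L \<psi> s = u s / W s"
    proof -
      have s1: "s \<noteq> 1 \<or> m = 0" using s by auto
      show ?thesis using uW[OF s1] A(2)[OF s] by (simp flip: uW(1)[OF s1])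
    qed
    ultimately show ?thesis by simp
  qed
  moreover have "cmod (\<psi> n * of_int (moebius n)) \<le> 1" for n
    using mult_mono[OF norm_character_le[OF \<psi>] norm_moebius_le, of n n] by (simp add: norm_mult)
  ultimately have "(\<lambda>n. \<psi> (Suc n) * of_int (moebius (Suc n)) / of_nat (Suc n)) sums (u 1 / W 1)"
    by (intro newman_tauberian[of "\<lambda>n. \<psi> n * of_int (moebius n)" U "\<lambda>s. u s / W s"])
  then show ?thesis
    by (intro mean_zero_if_summable_div) (rule sums_summable)
qed

lemma prime_reciprocals_unbounded:
  "\<exists>P. finite P \<and> (\<forall>p\<in>P. prime p) \<and> B \<le> (\<Sum>p\<in>P. 1 / real p)"
proof (rule ccontr)
  assume neg: "\<nexists>P. finite P \<and> (\<forall>p\<in>P. prime p) \<and> B \<le> (\<Sum>p\<in>P. 1 / real p)"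
  have c: "dirichlet_character 1 (\<lambda>_. 1)" by (simp add: dirichlet_character_def)
  have m1: "(\<Sum>k = 1..1 :: nat. 1 :: complex) / of_nat 1 = 1" by simp
  obtain A where A: "A holomorphic_on {s. Re s > 0}"
    "\<And>s. Re s > 1 \<Longrightarrow> dirichlet_L (\<lambda>_. 1) s = 1 / (s - 1) + A s"
    by (rule dirichlet_L_continuation[OF c, unfolded m1], rule that)
  have bound: "cmod (dirichlet_L (\<lambda>_. 1) (of_real \<sigma>)) \<le> exp (2 * B)" if \<sigma>: "\<sigma> > 1" for \<sigma>
  proof -
    define g where "g = (\<lambda>n. (1 :: complex) * npow n (of_real \<sigma>))"
    have s: "Re (complex_of_real \<sigma>) > 1" using \<sigma> by simp
    have lim: "(\<lambda>N. cmod (infsum g {0<..} * (\<Prod>p | prime p \<and> p \<le> N. 1 - g p))) \<longlonglongrightarrow> cmod 1"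
      unfolding g_def
      by (intro tendsto_norm euler_product completely_multiplicative_twist[OF c] summable_twist[OF c s])
    have "cmod (infsum g {0<..}) * exp (- 2 * B) \<le> cmod (infsum g {0<..} * (\<Prod>p | prime p \<and> p \<le> N. 1 - g p))" for N
    proof -
      let ?P = "{p. prime p \<and> p \<le> N}"
      have fin: "finite ?P" by (rule finite_subset[of _ "{..N}"]) auto
      then have "(\<Sum>p\<in>?P. 1 / real p) < B" using neg by (auto simp: not_le)
      then have "exp (- 2 * B) \<le> exp (\<Sum>p\<in>?P. - 2 / real p)"
        by (simp add: sum_divide_distrib sum_distrib_left sum_negf flip: sum_divide_distrib)
          (use sum_distrib_left[of 2 "\<lambda>p. 1 / real p" ?P] in simp)
      also have "\<dots> = (\<Prod>p\<in>?P. exp (- 2 / real p))" by (rule exp_sum[OF fin])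
      also have "\<dots> \<le> (\<Prod>p\<in>?P. cmod (1 - g p))"
      proof (rule prod_mono, intro conjI)
        fix p assume "p \<in> ?P"
        then have p: "p \<ge> 2" using prime_ge_2_nat by blast
        define y where "y = real p powr (- \<sigma>)"
        have "real p powr (- \<sigma>) \<le> real p powr (- 1)" using p \<sigma> by (intro powr_mono) auto
        then have y: "0 < y" "y \<le> 1 / real p" "1 / real p \<le> 1 / 2"
          using p by (auto simp: y_def powr_minus inverse_eq_divide field_simps)
        have gp: "g p = of_real y"
          using p by (simp add: g_def npow_def y_def powr_def flip: exp_of_real)
        have "- y - 2 * y\<^sup>2 \<le> ln (1 - y)" using y by (intro ln_one_minus_pos_lower_bound) auto
        moreover have "2 * y\<^sup>2 \<le> y" using mult_right_mono[of "2 * y" 1 y] y by (simp add: power2_eq_square)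
        ultimately have "- 2 / real p \<le> ln (1 - y)" using y by simp
        then have "exp (- 2 / real p) \<le> exp (ln (1 - y))" by simp
        also have "\<dots> = 1 - y" using y by simp
        also have "1 - y = cmod (1 - g p)"
        proof -
          have "1 - g p = of_real (1 - y)" unfolding gp by simp
          then show ?thesis using y by (simp only: norm_of_real)
        qed
        finally show "exp (- 2 / real p) \<le> cmod (1 - g p)" .
      qed simp
      finally show ?thesis by (simp add: norm_mult prod_norm mult_left_mono)
    qed
    then have "cmod (infsum g {0<..}) * exp (- 2 * B) \<le> cmod 1"
      by (intro LIMSEQ_le_const[OF lim]) blast
    then have "cmod (infsum g {0<..}) \<le> exp (2 * B)"
      by (simp add: exp_minus field_simps)
    then show ?thesis by (simp add: dirichlet_L_def g_def)
  qed
  have to1: "((\<lambda>\<sigma>. complex_of_real \<sigma>) \<longlongrightarrow> 1) (at_right 1)"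
    using tendsto_of_real[OF tendsto_ident_at, of 1 "{1<..}", where 'a = complex] by simp
  have gt1: "\<forall>\<^sub>F \<sigma> in at_right (1 :: real). \<sigma> > 1"
    by (rule eventually_at_right_less)
  have "isCont A 1"
    using holomorphic_on_imp_continuous_on[OF A(1)] open_halfspace_Re_gt[of 0]
    by (simp add: continuous_on_eq_continuous_at)
  then have "((\<lambda>\<sigma>. 1 + (of_real \<sigma> - 1) * A (of_real \<sigma>)) \<longlongrightarrow> 1 + (1 - 1) * A 1) (at_right 1)"
    by (intro tendsto_intros to1 isCont_tendsto_compose[of 1 A])
  then have *: "((\<lambda>\<sigma>. cmod (1 + (of_real \<sigma> - 1) * A (of_real \<sigma>))) \<longlongrightarrow> 1) (at_right 1)"
    using tendsto_norm by fastforce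
  have "\<forall>\<^sub>F \<sigma> in at_right (1 :: real). cmod (1 + (of_real \<sigma> - 1) * A (of_real \<sigma>)) \<le> cmod (of_real \<sigma> - 1) * exp (2 * B)"
    using gt1
  proof eventually_elim
    case (elim \<sigma>)
    then have "complex_of_real \<sigma> - 1 \<noteq> 0" by (simp add: complex_eq_iff)
    then have "1 + (of_real \<sigma> - 1) * A (of_real \<sigma>) = (of_real \<sigma> - 1) * dirichlet_L (\<lambda>_. 1) (of_real \<sigma>)"
      using A(2)[of "of_real \<sigma>"] elim by (simp add: distrib_left)
    then show ?case using bound[OF elim] by (simp add: norm_mult mult_left_mono)
  qed
  moreover have "((\<lambda>\<sigma>. cmod (complex_of_real \<sigma> - 1) * exp (2 * B)) \<longlongrightarrow> cmod (1 - 1) * exp (2 * B)) (at_right 1)"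
    by (intro tendsto_intros to1)
  ultimately have "1 \<le> cmod (1 - 1 :: complex) * exp (2 * B)"
    using * by (intro tendsto_le[OF _ _ *]) auto
  then show False by simp
qed

lemma sum_ec_roots_of_unity:
  assumes "q > 0"
  shows "(\<Sum>j<q. ec (of_nat j * (of_int n / of_nat q))) = (if int q dvd n then of_nat q else 0)"
proof (cases "int q dvd n")
  case True
  then obtain k where "n = int q * k" by auto
  then have "of_int n / of_nat q = (of_int k :: real)" using assms by simp
  then show ?thesis using True by simp
next
  case False
  define x where "x = (of_int n / of_nat q :: real)"
  have "x \<notin> \<int>"
  proof
    assume "x \<in> \<int>"
    then obtain k where "x = of_int k" by (auto elim: Ints_cases)
    then have "real_of_int n = of_int (int q * k)" using assms by (simp add: x_def field_simps)
    then have "n = int q * k" by (simp only: of_int_eq_iff)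
    then show False using False by simp
  qed
  then have "ec x \<noteq> 1" by (simp add: ec_eq_1_iff)
  moreover have "ec x ^ q = 1"
    using assms by (simp add: ec_power x_def)
  ultimately show ?thesis
    using geometric_sum[of "ec x" q] False unfolding x_def[symmetric] by (simp add: ec_power)
qed

text \<open>
  A function on the residues prime to \<open>q\<close> is a combination of characters: multiplication by the
  various \<open>g\<close> are commuting operators of finite order, and averaging against roots of unity
  projects onto their eigenspaces.  Functions that are eigenvectors of all of them are
  multiples of characters.
\<close>

definition unit_eigenfunction :: "nat \<Rightarrow> nat set \<Rightarrow> (nat \<Rightarrow> complex) \<Rightarrow> bool"
  where "unit_eigenfunction q S a \<longleftrightarrow> (\<forall>n. a (n + q) = a n) \<and> (\<forall>n. \<not> coprime n q \<longrightarrow> a n = 0)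
    \<and> (\<forall>g\<in>S. \<exists>\<omega>. \<forall>n. a (g * n) = \<omega> * a n)"

lemma unit_eigenfunction_projection:
  assumes a: "unit_eigenfunction q S a" and q: "q > 0" and g: "coprime g q"
  obtains k :: nat and b where "\<And>j. unit_eigenfunction q (insert g S) (b j)" "\<And>n. a n = (\<Sum>j<k. b j n)"
proof -
  obtain k where k: "k > 0" "[g ^ k = 1] (mod q)" using coprime_power_cong_1[OF g q] .
  have per: "a (n + q) = a n" for n using a by (simp add: unit_eigenfunction_def)
  have cong: "a m = a n" if "[m = n] (mod q)" for m n
    using periodic_mod[of a q, OF per] that unfolding cong_def by metis
  define b where "b j n = (\<Sum>i<k. ec (of_nat i * (of_int (- int j) / of_nat k)) * a (g ^ i * n)) / of_nat k" for j n :: nat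
  have "unit_eigenfunction q (insert g S) (b j)" for j
    unfolding unit_eigenfunction_def
  proof (intro conjI allI impI ballI)
    fix n
    show "b j (n + q) = b j n"
    proof -
      have "a (g ^ i * (n + q)) = a (g ^ i * n)" for i
        by (rule cong) (simp add: cong_def distrib_left)
      then show ?thesis by (simp add: b_def)
    qed
    show "b j n = 0" if "\<not> coprime n q"
    proof -
      have "a (g ^ i * n) = 0" for i
        using a that by (simp add: unit_eigenfunction_def)
      then show ?thesis by (simp add: b_def)
    qed
  next
    fix h assume "h \<in> insert g S"
    then show "\<exists>\<omega>. \<forall>n. b j (h * n) = \<omega> * b j n"
    proof
      assume h: "h = g"
      have "b j (g * n) = ec (of_nat j / of_nat k) * b j n" for n
      proof -
        define G where "G i = ec (of_nat i * (of_int (- int j) / of_nat k)) * a (g ^ i * n)" for i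
        have G: "ec (of_nat i * (of_int (- int j) / of_nat k)) * a (g ^ i * (g * n)) = ec (of_nat j / of_nat k) * G (Suc i)" for i
        proof -
          have "ec (of_nat i * (of_int (- int j) / of_nat k)) = ec (of_nat j / of_nat k) * ec (of_nat (Suc i) * (of_int (- int j) / of_nat k))"
            unfolding ec_add[symmetric] using k(1) by (intro arg_cong[of _ _ ec]) (simp add: field_simps)
          then show ?thesis by (simp add: G_def mult_ac)
        qed
        have "(\<Sum>i<k. G (Suc i)) = (\<Sum>i<k. G i) + G k - G 0"
          by (induction k) simp_all
        moreover have "G k = G 0"
        proof -
          have "a (g ^ k * n) = a (g ^ 0 * n)"
            using cong_scalar_right[OF k(2), of n] by (intro cong) simp
          then show ?thesis using k(1) by (simp add: G_def)
        qed
        ultimately have "(\<Sum>i<k. G (Suc i)) = (\<Sum>i<k. G i)" by simp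
        then show ?thesis
          unfolding b_def G sum_distrib_left[symmetric] by (simp add: G_def)
      qed
      then show ?thesis using h by blast
    next
      assume "h \<in> S"
      then obtain \<omega> where \<omega>: "\<And>n. a (h * n) = \<omega> * a n"
        using a unfolding unit_eigenfunction_def by blast
      have "b j (h * n) = \<omega> * b j n" for n
      proof -
        have "a (g ^ i * (h * n)) = \<omega> * a (g ^ i * n)" for i
          using \<omega>[of "g ^ i * n"] by (simp add: mult_ac)
        then show ?thesis by (simp add: b_def sum_distrib_left mult_ac)
      qed
      then show ?thesis by blast
    qed
  qed
  moreover have "a n = (\<Sum>j<k. b j n)" for n
  proof -
    have inner: "(\<Sum>j<k. ec (of_nat i * (of_int (- int j) / of_nat k))) = (if i = 0 then of_nat k else 0)" if "i < k" for i
    proof -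
      have "(\<Sum>j<k. ec (of_nat i * (of_int (- int j) / of_nat k))) = (\<Sum>j<k. ec (of_nat j * (of_int (- int i) / of_nat k)))"
        by (simp add: mult.commute)
      also have "\<dots> = (if int k dvd - int i then of_nat k else 0)"
        by (rule sum_ec_roots_of_unity[OF k(1)])
      also have "int k dvd - int i \<longleftrightarrow> i = 0"
        using that by (auto dest: dvd_imp_le)
      finally show ?thesis .
    qed
    have "(\<Sum>j<k. b j n) = (\<Sum>i<k. (\<Sum>j<k. ec (of_nat i * (of_int (- int j) / of_nat k))) * a (g ^ i * n)) / of_nat k"
      unfolding b_def sum_divide_distrib[symmetric] by (subst sum.swap) (simp add: sum_distrib_right)
    also have "\<dots> = (\<Sum>i<k. if i = 0 then of_nat k * a n else 0) / of_nat k"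
    proof (rule arg_cong[of _ _ "\<lambda>z. z / of_nat k"], rule sum.cong[OF refl])
      fix i assume "i \<in> {..<k}"
      then show "(\<Sum>j<k. ec (of_nat i * (of_int (- int j) / of_nat k))) * a (g ^ i * n)
          = (if i = 0 then of_nat k * a n else 0)"
        by (subst inner) auto
    qed
    also have "\<dots> = a n" using k(1) by simp
    finally show ?thesis by simp
  qed
  ultimately show ?thesis by (rule that[where b = b and k = k])
qed

lemma unit_eigenfunction_character:
  assumes a: "unit_eigenfunction q {g. g < q \<and> coprime g q} a" and q: "q > 0"
  shows "a = (\<lambda>n. 0) \<or> dirichlet_character q (\<lambda>n. a n / a 1)"
proof -
  have per: "a (n + q) = a n" for n using a by (simp add: unit_eigenfunction_def)
  have cong: "a m = a n" if "[m = n] (mod q)" for m n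
    using periodic_mod[of a q, OF per] that unfolding cong_def by metis
  have supp: "a n = 0" if "\<not> coprime n q" for n using a that by (simp add: unit_eigenfunction_def)
  have mult: "a (m * n) * a 1 = a m * a n" for m n
  proof (cases "coprime m q")
    case True
    then have "m mod q \<in> {g. g < q \<and> coprime g q}" using q by simp
    then obtain \<omega> where \<omega>: "\<And>n. a (m mod q * n) = \<omega> * a n"
      using a unfolding unit_eigenfunction_def by blast
    have "a (m * n) = \<omega> * a n" for n
      unfolding \<omega>[symmetric] by (rule cong) (simp add: cong_def mod_mult_left_eq)
    from this[of n] this[of 1] show ?thesis by simp
  next
    case False
    then show ?thesis using supp[of m] supp[of "m * n"] by simp
  qed
  show ?thesis
  proof (cases "a 1 = 0")
    case True
    have "a n = 0" for n
    proof (cases "coprime n q")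
      case True
      then have "n mod q \<in> {g. g < q \<and> coprime g q}" using q by simp
      then obtain \<omega> where \<omega>: "\<And>k. a (n mod q * k) = \<omega> * a k"
        using a unfolding unit_eigenfunction_def by blast
      have "a n = a (n mod q * 1)" by (rule cong) (simp add: cong_def)
      then show ?thesis using \<omega>[of 1] \<open>a 1 = 0\<close> by simp
    qed (rule supp)
    then show ?thesis by blast
  next
    case False
    have nz: "a n \<noteq> 0" if n: "coprime n q" for n
    proof
      assume "a n = 0"
      obtain k where k: "k > 0" "[n ^ k = 1] (mod q)" using coprime_power_cong_1[OF n q] .
      have "a (n * n ^ (k - 1)) * a 1 = 0" using mult \<open>a n = 0\<close> by simp
      moreover have "n * n ^ (k - 1) = n ^ k" using k(1) by (simp flip: power_Suc)
      ultimately show False using cong[OF k(2)] False by simp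
    qed
    have "dirichlet_character q (\<lambda>n. a n / a 1)"
      unfolding dirichlet_character_def using q False per nz supp mult
      by (auto simp: field_simps)
    then show ?thesis by blast
  qed
qed

lemma periodic_coprime_moebius_mean_zero:
  assumes q: "q > 0" and per: "\<And>n. a (n + q) = a n" and supp: "\<And>n. \<not> coprime n q \<Longrightarrow> a n = 0"
  shows "mean_zero (\<lambda>n. a n * of_int (moebius n))"
proof -
  have "mean_zero (\<lambda>n. a n * of_int (moebius n))"
    if "finite T" "T \<subseteq> {g. g < q \<and> coprime g q}" "unit_eigenfunction q ({g. g < q \<and> coprime g q} - T) a" for T a
    using that
  proof (induction T arbitrary: a)
    case empty
    then consider "a = (\<lambda>n. 0)" | "dirichlet_character q (\<lambda>n. a n / a 1)"
      using unit_eigenfunction_character q by fastforce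
    then show ?case
    proof cases
      case 1
      then show ?thesis by (simp add: mean_zero_def)
    next
      case 2
      have "a 1 \<noteq> 0" using character_1[OF 2] by auto
      then show ?thesis
        using mean_zero_cmult[OF character_moebius_mean_zero[OF 2], of "a 1"] by simp
    qed
  next
    case (insert g T)
    have g: "coprime g q" using insert.prems(1) by auto
    obtain k :: nat and b where b: "\<And>j. unit_eigenfunction q (insert g ({g. g < q \<and> coprime g q} - insert g T)) (b j)"
      "\<And>n. a n = (\<Sum>j<k. b j n)"
      by (rule unit_eigenfunction_projection[OF insert.prems(2) q g], rule that)
    have "insert g ({g. g < q \<and> coprime g q} - insert g T) = {g. g < q \<and> coprime g q} - T"
      using insert.hyps insert.prems(1) by auto
    then have "mean_zero (\<lambda>n. b j n * of_int (moebius n))" for j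
      using insert.IH[of "b j"] insert.prems(1) b(1) by simp
    then have "mean_zero (\<lambda>n. \<Sum>j<k. b j n * of_int (moebius n))"
      by (intro mean_zero_sum)
    then show ?case by (simp add: b(2) sum_distrib_right)
  qed
  from this[of "{g. g < q \<and> coprime g q}" a] show ?thesis
    using per supp by (simp add: unit_eigenfunction_def)
qed

(*FILE dev4/Katai*)
lemma real_div_le: "real (n div d) \<le> real n / real d"
  by (rule of_nat_div_le_of_nat)

lemma real_div_ge: "real n / real d - 1 \<le> real (n div d)"
  using real_of_int_div3[of "int n" "int d"] by (simp flip: zdiv_int)

lemma card_multiples:
  "card {n \<in> {1..N}. d dvd n} = N div d" if "d > 0" for d N :: nat
proof -
  have "{n \<in> {1..N}. d dvd n} = (\<lambda>m. d * m) ` {1..N div d}"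
    using that by (auto simp: image_iff less_eq_div_iff_mult_less_eq mult.commute elim!: dvdE)
  then show ?thesis
    using that by (simp add: card_image inj_on_def)
qed

lemma sum_over_multiples:
  fixes f :: "nat \<Rightarrow> 'a::comm_monoid_add"
  assumes "d > 0"
  shows "(\<Sum>n | n \<in> {1..N} \<and> d dvd n. f n) = (\<Sum>m = 1..N div d. f (d * m))"
proof -
  have "{n \<in> {1..N}. d dvd n} = (\<lambda>m. d * m) ` {1..N div d}"
    using assms by (auto simp: image_iff less_eq_div_iff_mult_less_eq mult.commute elim!: dvdE)
  then show ?thesis
    using assms by (simp add: sum.reindex inj_on_def)
qed

text \<open>
  The variance bound of Turan and Kubilius for a finite set \<open>P\<close> of primes: the number of
  elements of \<open>P\<close> that divide \<open>n\<close> has mean value \<open>S\<close>, and its variance is again about \<open>S\<close>,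
  because divisibility by distinct primes is independent.
\<close>

lemma turan_kubilius:
  fixes P :: "nat set"
  assumes fin: "finite P" and prime: "\<And>p. p \<in> P \<Longrightarrow> prime p"
  defines "S \<equiv> \<Sum>p\<in>P. 1 / real p"
  shows "(\<Sum>n = 1..N. (real (card {p \<in> P. p dvd n}) - S)\<^sup>2) \<le> real N * S + 2 * S * real (card P)"
proof -
  let ?w = "\<lambda>n. real (card {p \<in> P. p dvd n})"
  have pos: "p > 0" if "p \<in> P" for p using prime[OF that] prime_gt_0_nat by blast
  have S: "S \<ge> 0" unfolding S_def by (simp add: sum_nonneg)
  have w: "?w n = (\<Sum>p\<in>P. if p dvd n then 1 else 0)" for n
    using fin by (simp add: sum.If_cases Int_def)
  have cnt: "(\<Sum>n = 1..N. if d dvd n then 1 else 0) = real (N div d)" if "d > 0" for d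
    using card_multiples[OF that, of N] by (simp add: sum.If_cases Int_def)
  have sumw: "(\<Sum>n = 1..N. ?w n) = (\<Sum>p\<in>P. real (N div p))"
    unfolding w by (subst sum.swap) (rule sum.cong, use pos cnt in auto)
  have lower: "(\<Sum>n = 1..N. ?w n) \<ge> real N * S - real (card P)"
  proof -
    have "real (N div p) \<ge> real N / real p - 1" if "p \<in> P" for p
      by (rule real_div_ge)
    then have "(\<Sum>p\<in>P. real N / real p - 1) \<le> (\<Sum>p\<in>P. real (N div p))"
      by (rule sum_mono)
    then show ?thesis
      unfolding sumw by (simp add: S_def sum_subtractf sum_distrib_left)
  qed
  have upper: "(\<Sum>n = 1..N. (?w n)\<^sup>2) \<le> real N * S + real N * S\<^sup>2"
  proof -
    have "(\<Sum>n = 1..N. (?w n)\<^sup>2)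
        = (\<Sum>n = 1..N. \<Sum>p\<in>P. \<Sum>p'\<in>P. if p dvd n \<and> p' dvd n then 1 else 0)"
      unfolding w power2_eq_square sum_product by (intro sum.cong refl) auto
    also have "\<dots> = (\<Sum>p\<in>P. \<Sum>p'\<in>P. \<Sum>n = 1..N. if p dvd n \<and> p' dvd n then 1 else 0)"
      by (subst sum.swap, rule sum.cong[OF refl], rule sum.swap)
    also have "\<dots> \<le> (\<Sum>p\<in>P. \<Sum>p'\<in>P. (if p = p' then real N / p else 0) + real N / (real p * real p'))"
    proof (intro sum_mono)
      fix p p' assume pp: "p \<in> P" "p' \<in> P"
      show "(\<Sum>n = 1..N. if p dvd n \<and> p' dvd n then 1 else 0)
          \<le> (if p = p' then real N / p else 0) + real N / (real p * real p')"
      proof (cases "p = p'")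
        case True
        then show ?thesis
          using cnt[OF pos[OF pp(1)]] real_div_le[of N p] by (simp add: add_increasing2)
      next
        case False
        then have "coprime p p'"
          using prime pp primes_coprime by blast
        then have "p dvd n \<and> p' dvd n \<longleftrightarrow> p * p' dvd n" for n
          by (meson divides_mult dvd_mult_left dvd_mult_right)
        then show ?thesis
          using False cnt[of "p * p'"] pos[OF pp(1)] pos[OF pp(2)] real_div_le[of N "p * p'"]
          by simp
      qed
    qed
    also have "\<dots> = real N * S + real N * S\<^sup>2"
      using fin by (simp add: sum.distrib S_def power2_eq_square sum_product sum_distrib_left mult_ac
          flip: sum_divide_distrib)
    finally show ?thesis .
  qed
  have "(\<Sum>n = 1..N. (?w n - S)\<^sup>2) = (\<Sum>n = 1..N. (?w n)\<^sup>2) - 2 * S * (\<Sum>n = 1..N. ?w n) + real N * S\<^sup>2"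
    by (simp add: power2_diff sum.distrib sum_subtractf sum_distrib_left algebra_simps)
  also have "\<dots> \<le> real N * S + real N * S\<^sup>2 - 2 * S * (real N * S - real (card P)) + real N * S\<^sup>2"
    using upper mult_left_mono[OF lower, of "2 * S"] S by linarith
  also have "\<dots> = real N * S + 2 * S * real (card P)"
    by (simp add: algebra_simps power2_eq_square)
  finally show ?thesis .
qed

lemma norm_sum_le_sqrt:
  fixes a :: "nat \<Rightarrow> complex" and x :: "nat \<Rightarrow> real"
  assumes "\<And>n. n \<in> A \<Longrightarrow> cmod (a n) \<le> \<bar>x n\<bar>"
  shows "cmod (\<Sum>n\<in>A. a n) \<le> sqrt (real (card A) * (\<Sum>n\<in>A. (x n)\<^sup>2))"
proof -
  have "cmod (\<Sum>n\<in>A. a n) \<le> (\<Sum>n\<in>A. 1 * \<bar>x n\<bar>)"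
    using sum_norm_le[of A a "\<lambda>n. \<bar>x n\<bar>"] assms by simp
  also have "\<dots> \<le> sqrt ((\<Sum>n\<in>A. 1\<^sup>2) * (\<Sum>n\<in>A. \<bar>x n\<bar>\<^sup>2))"
    by (rule real_le_rsqrt, rule Cauchy_Schwarz_ineq_sum)
  finally show ?thesis by simp
qed

text \<open>
  Katai's inequality in finite form.  Replacing the weight \<open>S\<close> by the number of divisors in \<open>P\<close>
  costs little by the variance bound.  Since \<open>\<mu>(pm) = - \<mu>(m)\<close> for most \<open>m\<close>, the resulting double sum
  is a sum over \<open>m\<close> with inner sums over \<open>p\<close>, and Cauchy-Schwarz removes the factor
  \<open>\<mu>(m)\<close> altogether, leaving correlations of \<open>n \<mapsto> F (p n)\<close> and \<open>n \<mapsto> F (p' n)\<close>.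
\<close>

lemma katai_inequality:
  fixes F :: "nat \<Rightarrow> complex" and P :: "nat set" and S :: real and R :: "nat \<Rightarrow> real" and N :: nat
  assumes fin: "finite P" and prime: "\<And>p. p \<in> P \<Longrightarrow> prime p"
    and F: "\<And>n. cmod (F n) \<le> 1"
  defines "S \<equiv> \<Sum>p\<in>P. 1 / real p"
  defines "R \<equiv> \<lambda>N. \<Sum>p\<in>P. \<Sum>p'\<in>P - {p}.
      cmod (\<Sum>m = 1..min (N div p) (N div p'). F (p * m) * cnj (F (p' * m)))"
  shows "S * cmod (\<Sum>n = 1..N. F n * of_int (moebius n))
    \<le> sqrt (N * (N * S + 2 * S * card P)) + N * (\<Sum>p\<in>P. 1 / (real p)\<^sup>2) + sqrt (N * (N * S + R N))"
proof -
  let ?w = "\<lambda>n. real (card {p \<in> P. p dvd n})"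
  let ?a = "\<lambda>n. F n * of_int (moebius n)"
  have S: "S \<ge> 0" unfolding S_def by (simp add: sum_nonneg)
  have pos: "p > 0" if "p \<in> P" for p using prime[OF that] prime_gt_0_nat by blast
  have a: "cmod (?a n) \<le> 1" for n
    using mult_mono[OF F norm_moebius_le] by (simp add: norm_mult)
  have w: "of_real (?w n) * ?a n = (\<Sum>p\<in>P. if p dvd n then ?a n else 0)" for n
    using fin by (simp add: sum.If_cases Int_def)
  have A: "cmod (\<Sum>n = 1..N. of_real (S - ?w n) * ?a n) \<le> sqrt (N * (N * S + 2 * S * card P))"
  proof -
    have "cmod (\<Sum>n = 1..N. of_real (S - ?w n) * ?a n) \<le> sqrt (card {1..N} * (\<Sum>n = 1..N. (?w n - S)\<^sup>2))"
    proof (rule norm_sum_le_sqrt)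
      fix n
      have "cmod (of_real (S - ?w n) * ?a n) \<le> cmod (of_real (S - ?w n)) * 1"
        unfolding norm_mult[of "of_real (S - ?w n)"] by (rule mult_left_mono[OF a]) simp
      then show "cmod (of_real (S - ?w n) * ?a n) \<le> \<bar>?w n - S\<bar>"
        by (simp only: norm_of_real mult_1_right abs_minus_commute)
    qed
    also have "\<dots> \<le> sqrt (N * (N * S + 2 * S * card P))"
      using turan_kubilius[OF fin prime, of N]
      by (intro real_sqrt_le_mono) (auto intro!: mult_left_mono simp: S_def)
    finally show ?thesis .
  qed
  have swap: "(\<Sum>n = 1..N. of_real (?w n) * ?a n) = (\<Sum>p\<in>P. \<Sum>m = 1..N div p. ?a (p * m))"
  proof -
    have "(\<Sum>n = 1..N. of_real (?w n) * ?a n) = (\<Sum>p\<in>P. \<Sum>n = 1..N. if p dvd n then ?a n else 0)"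
      unfolding w by (rule sum.swap)
    also have "\<dots> = (\<Sum>p\<in>P. \<Sum>n | n \<in> {1..N} \<and> p dvd n. ?a n)"
      by (intro sum.cong refl sum.inter_filter[symmetric]) simp
    also have "\<dots> = (\<Sum>p\<in>P. \<Sum>m = 1..N div p. ?a (p * m))"
      by (intro sum.cong refl sum_over_multiples pos)
    finally show ?thesis .
  qed
  have B: "cmod ((\<Sum>p\<in>P. \<Sum>m = 1..N div p. ?a (p * m)) +
      (\<Sum>p\<in>P. \<Sum>m = 1..N div p. F (p * m) * of_int (moebius m))) \<le> N * (\<Sum>p\<in>P. 1 / (real p)\<^sup>2)"
  proof -
    have "cmod (\<Sum>m = 1..N div p. ?a (p * m) + F (p * m) * of_int (moebius m)) \<le> N / (real p)\<^sup>2"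
      if p: "p \<in> P" for p
    proof -
      have "cmod (?a (p * m) + F (p * m) * of_int (moebius m)) \<le> (if p dvd m then 1 else 0)" for m
      proof (cases "p dvd m")
        case True
        then show ?thesis
          using moebius_prime_square[OF prime[OF p] True] mult_mono[OF F norm_moebius_le]
          by (simp add: norm_mult)
      next
        case False
        then show ?thesis
          using moebius_prime_mult[OF prime[OF p] False] by simp
      qed
      then have "cmod (\<Sum>m = 1..N div p. ?a (p * m) + F (p * m) * of_int (moebius m))
          \<le> (\<Sum>m = 1..N div p. if p dvd m then 1 else 0)"
        by (rule sum_norm_le)
      also have "\<dots> = real (N div p div p)"
        using card_multiples[OF pos[OF p], of "N div p"] by (simp add: sum.If_cases Int_def)
      also have "\<dots> \<le> N / (real p)\<^sup>2"
        using real_div_le[of N "p * p"] by (simp add: div_mult2_eq power2_eq_square)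
      finally show ?thesis .
    qed
    then show ?thesis
      by (simp add: sum_distrib_left flip: sum.distrib) (rule sum_norm_le)
  qed
  let ?G = "\<lambda>m. \<Sum>p | p \<in> P \<and> m \<le> N div p. F (p * m)"
  have C: "cmod (\<Sum>p\<in>P. \<Sum>m = 1..N div p. F (p * m) * of_int (moebius m)) \<le> sqrt (N * (N * S + R N))"
  proof -
    have ex: "(\<Sum>m = 1..K. g m) = (\<Sum>m = 1..N. if m \<le> K then g m else 0)" if "K \<le> N"
      for g :: "nat \<Rightarrow> complex" and K
      using that by (intro sum.mono_neutral_cong_left) auto
    have "(\<Sum>p\<in>P. \<Sum>m = 1..N div p. F (p * m) * of_int (moebius m))
        = (\<Sum>p\<in>P. \<Sum>m = 1..N. if m \<le> N div p then F (p * m) * of_int (moebius m) else 0)"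
      by (intro sum.cong refl ex) simp
    also have "\<dots> = (\<Sum>m = 1..N. \<Sum>p\<in>P. if m \<le> N div p then F (p * m) * of_int (moebius m) else 0)"
      by (rule sum.swap)
    also have "\<dots> = (\<Sum>m = 1..N. ?G m * of_int (moebius m))"
      using fin by (auto simp: sum.inter_filter sum_distrib_right intro!: sum.cong)
    finally have eq: "(\<Sum>p\<in>P. \<Sum>m = 1..N div p. F (p * m) * of_int (moebius m))
        = (\<Sum>m = 1..N. ?G m * of_int (moebius m))" .
    have le: "cmod (\<Sum>m = 1..N. ?G m * of_int (moebius m)) \<le> sqrt (card {1..N} * (\<Sum>m = 1..N. (cmod (?G m))\<^sup>2))"
    proof (rule norm_sum_le_sqrt)
      fix m
      show "cmod (?G m * of_int (moebius m)) \<le> \<bar>cmod (?G m)\<bar>"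
        using mult_left_mono[OF norm_moebius_le[of m], of "cmod (?G m)"] by (simp add: norm_mult)
    qed
    have "complex_of_real (\<Sum>m = 1..N. (cmod (?G m))\<^sup>2) = (\<Sum>m = 1..N. \<Sum>p\<in>P. \<Sum>p'\<in>P.
        if m \<le> min (N div p) (N div p') then F (p * m) * cnj (F (p' * m)) else 0)"
      unfolding of_real_sum complex_norm_square cnj_sum
        sum.inter_filter[OF fin] sum_product
      by (intro sum.cong refl) (auto simp: min_def)
    also have "\<dots> = (\<Sum>p\<in>P. \<Sum>p'\<in>P. \<Sum>m = 1..N.
        if m \<le> min (N div p) (N div p') then F (p * m) * cnj (F (p' * m)) else 0)"
      by (subst sum.swap, rule sum.cong[OF refl], rule sum.swap)
    also have "\<dots> = (\<Sum>p\<in>P. \<Sum>p'\<in>P. \<Sum>m = 1..min (N div p) (N div p'). F (p * m) * cnj (F (p' * m)))"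
      by (intro sum.cong refl ex[symmetric]) (simp add: min.coboundedI1)
    finally have sq: "complex_of_real (\<Sum>m = 1..N. (cmod (?G m))\<^sup>2) = \<dots>" .
    have "cmod (complex_of_real (\<Sum>m = 1..N. (cmod (?G m))\<^sup>2)) \<le> (\<Sum>p\<in>P. N / p + (\<Sum>p'\<in>P - {p}.
        cmod (\<Sum>m = 1..min (N div p) (N div p'). F (p * m) * cnj (F (p' * m)))))"
      unfolding sq
    proof (rule sum_norm_le)
      fix p assume p: "p \<in> P"
      let ?c = "\<lambda>p'. \<Sum>m = 1..min (N div p) (N div p'). F (p * m) * cnj (F (p' * m))"
      have "cmod (?c p) \<le> (\<Sum>m = 1..N div p. 1)"
        by (simp, rule order_trans[OF sum_norm_le[where g = "\<lambda>_. 1"]])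
          (use mult_mono[OF F F] in \<open>auto simp: norm_mult\<close>)
      then have "cmod (?c p) \<le> N / p"
        using real_div_le[of N p] by simp
      then show "cmod (\<Sum>p'\<in>P. ?c p') \<le> N / p + (\<Sum>p'\<in>P - {p}. cmod (?c p'))"
        unfolding sum.remove[OF fin p, of ?c]
        by (intro norm_triangle_le add_mono norm_sum)
    qed
    also have "\<dots> = N * S + R N"
      unfolding sum.distrib R_def S_def sum_distrib_left times_divide_eq_right mult_1_right ..
    finally have "cmod (complex_of_real (\<Sum>m = 1..N. (cmod (?G m))\<^sup>2)) \<le> N * S + R N" .
    then have "(\<Sum>m = 1..N. (cmod (?G m))\<^sup>2) \<le> N * S + R N"
      unfolding norm_of_real by linarith
    then show ?thesis
      unfolding eq using le
      by (elim order_trans) (auto intro!: real_sqrt_le_mono mult_left_mono)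
  qed
  have "of_real S * (\<Sum>n = 1..N. ?a n) = (\<Sum>n = 1..N. of_real (S - ?w n) * ?a n)
     + (\<Sum>n = 1..N. of_real (?w n) * ?a n)"
    by (simp add: sum_distrib_left algebra_simps flip: sum.distrib)
  then have eq: "of_real S * (\<Sum>n = 1..N. ?a n) = (\<Sum>n = 1..N. of_real (S - ?w n) * ?a n)
     + ((\<Sum>p\<in>P. \<Sum>m = 1..N div p. ?a (p * m)) +
        (\<Sum>p\<in>P. \<Sum>m = 1..N div p. F (p * m) * of_int (moebius m)))
     - (\<Sum>p\<in>P. \<Sum>m = 1..N div p. F (p * m) * of_int (moebius m))"
    unfolding swap by simp
  have "S * cmod (\<Sum>n = 1..N. ?a n) = cmod (of_real S * (\<Sum>n = 1..N. ?a n))"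
    unfolding norm_mult norm_of_real using S by simp
  also have "\<dots> \<le> sqrt (N * (N * S + 2 * S * card P)) + N * (\<Sum>p\<in>P. 1 / (real p)\<^sup>2) + sqrt (N * (N * S + R N))"
    unfolding eq by (rule order_trans[OF norm_triangle_ineq4]) (intro add_mono norm_triangle_le A B C)
  finally show ?thesis .
qed

text \<open>
  Katai's criterion.  By the inequality above, \<open>S\<close> times the mean of \<open>F \<mu>\<close> is at most of order
  \<open>\<surd>S\<close> for large \<open>N\<close>, and \<open>S\<close> can be taken arbitrarily large.
\<close>

theorem katai_criterion:
  fixes F :: "nat \<Rightarrow> complex"
  assumes F: "\<And>n. cmod (F n) \<le> 1"
    and cor: "\<And>p p'. prime p \<Longrightarrow> prime p' \<Longrightarrow> p \<noteq> p' \<Longrightarrow> mean_zero (\<lambda>n. F (p * n) * cnj (F (p' * n)))"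
  shows "mean_zero (\<lambda>n. F n * of_int (moebius n))"
  unfolding mean_zero_iff
proof (intro allI impI)
  fix \<epsilon> :: real assume \<epsilon>: "\<epsilon> > 0"
  define C where "C = (\<Sum>n. 1 / (real n)\<^sup>2)"
  have summ: "summable (\<lambda>n. 1 / (real n)\<^sup>2)"
    using inverse_power_summable[of 2, where 'a = real] by (simp add: inverse_eq_divide)
  obtain P where P: "finite P" "\<And>p. p \<in> P \<Longrightarrow> prime p"
    and big: "max 1 (max (32 / \<epsilon>\<^sup>2) (2 * C / \<epsilon>)) \<le> (\<Sum>p\<in>P. 1 / real p)"
    using prime_reciprocals_unbounded[of "max 1 (max (32 / \<epsilon>\<^sup>2) (2 * C / \<epsilon>))"] by metis
  define S where "S = (\<Sum>p\<in>P. 1 / real p)"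
  have S: "1 \<le> S" "32 / \<epsilon>\<^sup>2 \<le> S" "2 * C / \<epsilon> \<le> S"
    using big by (auto simp: S_def)
  define R where "R N = (\<Sum>p\<in>P. \<Sum>p'\<in>P - {p}.
      cmod (\<Sum>m = 1..min (N div p) (N div p'). F (p * m) * cnj (F (p' * m))))" for N
  have sq: "(\<Sum>p\<in>P. 1 / (real p)\<^sup>2) \<le> C"
    unfolding C_def using P(1) summ by (intro sum_le_suminf) auto
  have pair: "\<forall>\<^sub>F N in sequentially.
      cmod (\<Sum>m = 1..min (N div p) (N div p'). F (p * m) * cnj (F (p' * m))) \<le> N / (real (card P))\<^sup>2"
    if p: "p \<in> P" "p' \<in> P - {p}" for p p'
  proof -
    define \<delta> where "\<delta> = 1 / (real (card P))\<^sup>2"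
    have "card P > 0" using p P(1) card_gt_0_iff by blast
    then have \<delta>: "\<delta> > 0" by (simp add: \<delta>_def)
    have "p > 0" "p' > 0" using p P(2) prime_gt_0_nat by blast+
    then have "filterlim (\<lambda>N. min (N div p) (N div p')) at_top at_top"
      unfolding filterlim_at_top
    proof (intro allI)
      fix Z
      show "\<forall>\<^sub>F N in at_top. Z \<le> min (N div p) (N div p')"
        using eventually_ge_at_top[of "Z * p + Z * p'"]
        by eventually_elim (use \<open>p > 0\<close> \<open>p' > 0\<close> in \<open>simp add: less_eq_div_iff_mult_less_eq\<close>)
    qed
    moreover have "\<forall>\<^sub>F M in sequentially. cmod (\<Sum>m = 1..M. F (p * m) * cnj (F (p' * m))) \<le> \<delta> * real M"
      using cor[OF P(2)[OF p(1)] P(2)[of p']] p \<delta> unfolding mean_zero_iff by auto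
    ultimately have "\<forall>\<^sub>F N in sequentially.
        cmod (\<Sum>m = 1..min (N div p) (N div p'). F (p * m) * cnj (F (p' * m)))
          \<le> \<delta> * real (min (N div p) (N div p'))"
      by (rule eventually_compose_filterlim[rotated])
    then show ?thesis
    proof eventually_elim
      case (elim N)
      have "real (min (N div p) (N div p')) \<le> N"
        using div_le_dividend[of N p] by linarith
      from mult_left_mono[OF this, of \<delta>] elim \<delta> show ?case
        by (simp add: \<delta>_def)
    qed
  qed
  have "\<forall>\<^sub>F N in sequentially. \<forall>p\<in>P. \<forall>p'\<in>P - {p}.
      cmod (\<Sum>m = 1..min (N div p) (N div p'). F (p * m) * cnj (F (p' * m))) \<le> N / (real (card P))\<^sup>2"
    using P(1) pair by (intro eventually_ball_finite ballI) auto
  moreover have "\<forall>\<^sub>F N in sequentially. 2 * S * card P \<le> real N"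
    by (rule eventually_sequentiallyI[of "nat \<lceil>2 * S * card P\<rceil>"]) linarith
  ultimately show "\<forall>\<^sub>F N in sequentially. cmod (\<Sum>n = 1..N. F n * of_int (moebius n)) \<le> \<epsilon> * real N"
  proof eventually_elim
    case (elim N)
    have "R N \<le> (\<Sum>p\<in>P. \<Sum>p'\<in>P - {p}. N / (real (card P))\<^sup>2)"
      unfolding R_def using elim(1) by (intro sum_mono) blast
    also have "\<dots> \<le> (\<Sum>p\<in>P. \<Sum>p'\<in>P. N / (real (card P))\<^sup>2)"
      using P(1) by (intro sum_mono sum_mono2) auto
    also have "\<dots> \<le> N"
      by (simp add: power2_eq_square)
    finally have R: "R N \<le> N" .
    have "S * cmod (\<Sum>n = 1..N. F n * of_int (moebius n))
        \<le> sqrt (N * (N * S + 2 * S * card P)) + N * (\<Sum>p\<in>P. 1 / (real p)\<^sup>2) + sqrt (N * (N * S + R N))"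
      using katai_inequality[OF P F, where N = N] by (simp add: S_def R_def)
    also have "\<dots> \<le> sqrt (N * (N * S + N)) + N * C + sqrt (N * (N * S + N))"
      by (intro add_mono real_sqrt_le_mono mult_left_mono sq R elim(2) order_refl) auto
    also have "\<dots> = N * (2 * sqrt (S + 1) + C)"
    proof -
      have "sqrt (N * (N * S + N)) = N * sqrt (S + 1)"
        using real_sqrt_mult[of "(real N)\<^sup>2" "S + 1"] by (simp add: power2_eq_square algebra_simps)
      then show ?thesis by (simp add: algebra_simps)
    qed
    also have "\<dots> \<le> N * (\<epsilon> * S)"
    proof (rule mult_left_mono)
      have "2 * sqrt (S + 1) \<le> \<epsilon> * S / 2"
      proof (rule power2_le_imp_le)
        have "32 \<le> \<epsilon>\<^sup>2 * S" using S(2) \<epsilon> by (simp add: field_simps)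
        then have "32 * S \<le> \<epsilon>\<^sup>2 * S * S" using S(1) by (intro mult_right_mono) auto
        moreover have "16 * (S + 1) \<le> 32 * S" using S(1) by simp
        ultimately have "16 * (S + 1) \<le> \<epsilon>\<^sup>2 * S * S" by (rule order_trans[rotated])
        moreover have "(2 * sqrt (S + 1))\<^sup>2 = 4 * (S + 1)"
          using S(1) by (simp add: power_mult_distrib)
        moreover have "(\<epsilon> * S / 2)\<^sup>2 = \<epsilon>\<^sup>2 * S * S / 4"
          by (simp add: power2_eq_square)
        ultimately show "(2 * sqrt (S + 1))\<^sup>2 \<le> (\<epsilon> * S / 2)\<^sup>2" by simp
      qed (use \<epsilon> S in auto)
      moreover have "C \<le> \<epsilon> * S / 2"
        using S(3) \<epsilon> by (simp add: field_simps)
      ultimately show "2 * sqrt (S + 1) + C \<le> \<epsilon> * S" by linarith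
    qed simp
    finally have "S * cmod (\<Sum>n = 1..N. F n * of_int (moebius n)) \<le> S * (\<epsilon> * N)"
      by (simp add: mult_ac)
    then show ?case using S(1) by simp
  qed
qed

(*FILE dev4/Char6*)
lemma mean_zero_dilate:
  assumes "mean_zero b" "d > 0"
  shows "mean_zero (\<lambda>n. if d dvd n then b (n div d) else 0)"
  unfolding mean_zero_iff
proof (intro allI impI)
  fix \<epsilon> :: real assume e: "\<epsilon> > 0"
  have "filterlim (\<lambda>N. N div d) at_top at_top"
    unfolding filterlim_at_top
  proof (intro allI)
    fix Z
    show "\<forall>\<^sub>F N in at_top. Z \<le> N div d"
      using eventually_ge_at_top[of "Z * d"]
      by eventually_elim (use assms(2) in \<open>simp add: less_eq_div_iff_mult_less_eq\<close>)
  qed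
  moreover have "\<forall>\<^sub>F M in sequentially. cmod (\<Sum>n = 1..M. b n) \<le> \<epsilon> * real M"
    using assms(1) e unfolding mean_zero_iff by blast
  ultimately have "\<forall>\<^sub>F N in sequentially. cmod (\<Sum>n = 1..N div d. b n) \<le> \<epsilon> * real (N div d)"
    by (rule eventually_compose_filterlim[rotated])
  then show "\<forall>\<^sub>F N in sequentially. cmod (\<Sum>n = 1..N. if d dvd n then b (n div d) else 0) \<le> \<epsilon> * real N"
  proof eventually_elim
    case (elim N)
    have "(\<Sum>n = 1..N. if d dvd n then b (n div d) else 0) = (\<Sum>n | n \<in> {1..N} \<and> d dvd n. b (n div d))"
      by (rule sum.inter_filter[symmetric]) simp
    also have "\<dots> = (\<Sum>m = 1..N div d. b m)"
      using sum_over_multiples[OF assms(2), where N = N and f = "\<lambda>n. b (n div d)"] assms(2) by simp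
    finally have eq: "(\<Sum>n = 1..N. if d dvd n then b (n div d) else 0) = (\<Sum>m = 1..N div d. b m)" .
    have "\<epsilon> * real (N div d) \<le> \<epsilon> * real N"
      using e by (intro mult_left_mono) auto
    then show ?case using elim unfolding eq by linarith
  qed
qed

lemma moebius_mult_coprime:
  assumes "coprime d m" "d > 0" "m > 0"
  shows "moebius (d * m) = moebius d * moebius m"
proof -
  have "squarefree (d * m) \<longleftrightarrow> squarefree d \<and> squarefree m"
    using assms squarefree_mult_coprime squarefree_multD by blast
  moreover have "prime_factors (d * m) = prime_factors d \<union> prime_factors m"
    using assms by (simp add: prime_factors_product)
  moreover have "prime_factors d \<inter> prime_factors m = {}"
  proof (rule ccontr)
    assume "prime_factors d \<inter> prime_factors m \<noteq> {}"
    then obtain p where "p \<in> prime_factors d" "p \<in> prime_factors m" by blast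
    then have "prime p" "p dvd d" "p dvd m" by auto
    then show False using coprime_common_divisor[OF assms(1)] not_prime_unit by blast
  qed
  ultimately show ?thesis
    by (simp add: moebius_def card_Un_disjoint power_add)
qed

lemma moebius_mult_not_coprime:
  assumes "\<not> coprime d m" "d > 0"
  shows "moebius (d * m) = 0"
proof -
  obtain p where p: "prime p" "p dvd d" "p dvd m"
    using assms prime_factor_nat[of "gcd d m"] by (auto simp: coprime_iff_gcd_eq_1)
  then obtain e where "d = p * e" by blast
  then show ?thesis
    using moebius_prime_square[OF p(1), of "e * m"] p(3) by (simp add: mult.assoc)
qed

text \<open>
  The Moebius function is orthogonal to every periodic function: sort the arguments by their
  greatest common divisor with the period.
\<close>

theorem periodic_moebius_mean_zero:
  assumes q: "q > 0" and per: "\<And>n. a (n + q) = a n"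
  shows "mean_zero (\<lambda>n. a n * of_int (moebius n))"
proof -
  define b where "b d m = (if gcd (d * m) q = d \<and> coprime d m then a (d * m) * of_int (moebius d) else 0)" for d m
  have "mean_zero (\<lambda>n. if d dvd n then b d (n div d) * of_int (moebius (n div d)) else 0)" if d: "d dvd q" for d
  proof (rule mean_zero_dilate)
    show d0: "d > 0" using d q by (auto intro: gcd_nat.not_eq_order_implies_strict dvd_pos_nat)
    show "mean_zero (\<lambda>m. b d m * of_int (moebius m))"
    proof (rule periodic_coprime_moebius_mean_zero[OF q])
      fix m
      have "coprime d (m + q) \<longleftrightarrow> coprime d m"
        using d by (metis coprime_iff_gcd_eq_1 dvd_def gcd_add_mult mult.commute add.commute)
      moreover have "gcd (d * (m + q)) q = gcd (d * m) q"
        by (metis distrib_left gcd.commute gcd_add_mult add.commute)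
      moreover have "a (d * (m + q)) = a (d * m)"
      proof -
        have "(d * (m + q)) mod q = (d * m) mod q" by (simp add: distrib_left)
        then show ?thesis using periodic_mod[of a q, OF per] by metis
      qed
      ultimately show "b d (m + q) = b d m" by (simp add: b_def)
      show "b d m = 0" if "\<not> coprime m q"
      proof (rule ccontr)
        assume "b d m \<noteq> 0"
        then have g: "gcd (d * m) q = d" and c: "coprime d m" by (auto simp: b_def split: if_splits)
        obtain e where e: "q = d * e" using d by blast
        have "gcd m e = 1" using g d0 unfolding e by (simp add: gcd_mult_distrib_nat[symmetric])
        then have "coprime m e" by (simp add: coprime_iff_gcd_eq_1)
        moreover have "coprime m d" using c by (simp add: coprime_commute)
        ultimately have "coprime m q" unfolding e by simp
        with that show False by simp
      qed
    qed
  qed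
  then have "mean_zero (\<lambda>n. \<Sum>d | d dvd q. if d dvd n then b d (n div d) * of_int (moebius (n div d)) else 0)"
    by (intro mean_zero_sum) simp
  moreover have "(\<Sum>d | d dvd q. if d dvd n then b d (n div d) * of_int (moebius (n div d)) else 0)
      = a n * of_int (moebius n)" if n: "n > 0" for n
  proof -
    have fin: "finite {d. d dvd q}" using q by simp
    have "(if d dvd n then b d (n div d) * of_int (moebius (n div d)) else 0)
        = (if d = gcd n q then a n * of_int (moebius n) else 0)" if "d dvd q" for d
    proof (cases "d dvd n")
      case True
      then obtain m where m: "n = d * m" by blast
      then have pos: "d > 0" "m > 0" using n by auto
      show ?thesis
        using pos moebius_mult_coprime[of d m] moebius_mult_not_coprime[of d m]
        by (auto simp: m b_def)
    qed auto
    then have "(\<Sum>d | d dvd q. if d dvd n then b d (n div d) * of_int (moebius (n div d)) else 0)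
        = (\<Sum>d | d dvd q. if d = gcd n q then a n * of_int (moebius n) else 0)"
      by (intro sum.cong) auto
    also have "\<dots> = a n * of_int (moebius n)"
      using fin by simp
    finally show ?thesis .
  qed
  ultimately show ?thesis
    unfolding mean_zero_def by (simp cong: sum.cong_simp)
qed

lemma mean_zero_ec:
  assumes "x \<notin> \<int>"
  shows "mean_zero (\<lambda>n. ec (of_nat n * x))"
proof -
  have ne: "ec x \<noteq> 1" using assms by (simp add: ec_eq_1_iff)
  define C where "C = 2 / cmod (ec x - 1)"
  have "cmod (\<Sum>n = 1..N. ec (of_nat n * x)) \<le> C" for N
  proof -
    have "(\<Sum>n = 1..N. ec (of_nat n * x)) = (\<Sum>n<N. ec (of_nat (Suc n) * x))"
      by (rule sum.reindex_bij_witness[of _ Suc "\<lambda>n. n - 1"]) auto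
    also have "\<dots> = ec x * (\<Sum>n<N. ec (of_nat n * x))"
      by (simp add: sum_distrib_left distrib_right ec_add)
    finally show ?thesis
      using norm_geometric_ec[OF ne, of N] by (simp add: norm_mult C_def)
  qed
  then have "cmod ((\<Sum>n = 1..N. ec (of_nat n * x)) / of_nat N) \<le> C / real N" for N
    by (simp add: norm_divide divide_right_mono)
  then show ?thesis
    unfolding mean_zero_def
    by (intro Lim_null_comparison[OF always_eventually lim_const_over_n]) blast
qed

text \<open>
  For rational frequency this is orthogonality to periodic functions.  For irrational frequency
  Katai's criterion applies, since the correlations are again exponentials of irrational frequency.
\<close>

theorem moebius_ec_mean_zero: "mean_zero (\<lambda>n. ec (of_nat n * \<theta>) * of_int (moebius n))"
proof (cases "\<theta> \<in> \<rat>")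
  case True
  then obtain k :: int and q :: nat where kq: "q \<noteq> 0" "\<theta> = of_int k / of_nat q"
    unfolding Rats_eq_int_div_nat by auto
  have "ec (of_nat (n + q) * \<theta>) = ec (of_nat n * \<theta>)" for n
    by (rule ec_cong_int) (use kq in \<open>simp add: field_simps\<close>)
  then show ?thesis
    using kq(1) by (intro periodic_moebius_mean_zero[of q]) auto
next
  case False
  show ?thesis
  proof (rule katai_criterion)
    fix p p' :: nat assume p: "prime p" "prime p'" "p \<noteq> p'"
    have "(of_nat p - of_nat p') * \<theta> \<notin> \<int>"
    proof
      assume "(of_nat p - of_nat p') * \<theta> \<in> \<int>"
      then obtain k where k: "(of_nat p - of_nat p') * \<theta> = of_int k" by (auto elim: Ints_cases)
      have "real p - real p' \<noteq> 0" using p(3) by simp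
      then have "\<theta> = of_int k / (of_nat p - of_nat p')" using k by (simp add: field_simps)
      then have "\<theta> \<in> \<rat>" by simp
      then show False using False by simp
    qed
    from mean_zero_ec[OF this]
    show "mean_zero (\<lambda>n. ec (of_nat (p * n) * \<theta>) * cnj (ec (of_nat (p' * n) * \<theta>)))"
      unfolding cnj_ec ec_add[symmetric] by (simp add: algebra_simps)
  qed simp
qed

(*FILE dev5/Torus*)
inductive trig_poly2 :: "(real \<Rightarrow> real \<Rightarrow> complex) \<Rightarrow> bool" where
  trig_poly2_char: "trig_poly2 (\<lambda>x y. c * ec (of_int a * x + of_int b * y))"
| trig_poly2_add: "trig_poly2 g \<Longrightarrow> trig_poly2 h \<Longrightarrow> trig_poly2 (\<lambda>x y. g x y + h x y)"

lemma trig_poly2_mult: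
  assumes "trig_poly2 g" "trig_poly2 h"
  shows "trig_poly2 (\<lambda>x y. g x y * h x y)"
  using assms(1)
proof induction
  case (trig_poly2_char c a b)
  show ?case
    using assms(2)
  proof induction
    case (trig_poly2_char c' a' b')
    have "c * ec (of_int a * x + of_int b * y) * (c' * ec (of_int a' * x + of_int b' * y))
        = (c * c') * ec (of_int (a + a') * x + of_int (b + b') * y)" for x y
    proof -
      have "of_int (a + a') * x + of_int (b + b') * y
          = (of_int a * x + of_int b * y) + (of_int a' * x + of_int b' * y)"
        by (simp add: algebra_simps)
      then show ?thesis by (simp only: ec_add mult_ac)
    qed
    then show ?case using trig_poly2.trig_poly2_char[of "c * c'" "a + a'" "b + b'"] by (simp only:)
  next
    case (trig_poly2_add g h)
    show ?case unfolding distrib_left by (rule trig_poly2.trig_poly2_add[OF trig_poly2_add.IH])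
  qed
next
  case (trig_poly2_add g h)
  show ?case unfolding distrib_right by (rule trig_poly2.trig_poly2_add[OF trig_poly2_add.IH])
qed

lemma trig_poly2_Re_Im:
  "trig_poly2 (\<lambda>x y. of_real (Re (ec (of_int a * x + of_int b * y))) * c)"
  "trig_poly2 (\<lambda>x y. of_real (Im (ec (of_int a * x + of_int b * y))) * c)"
proof -
  have neg: "of_int (- a) * x + of_int (- b) * y = - (of_int a * x + of_int b * y)" for x y :: real
    by simp
  have re: "complex_of_real (Re (ec t)) * c = c / 2 * ec t + c / 2 * ec (- t)" for t
    unfolding cnj_ec[symmetric] distrib_left[symmetric] complex_add_cnj by simp
  have im: "complex_of_real (Im (ec t)) * c = (- \<i> * c / 2) * ec t + (\<i> * c / 2) * ec (- t)" for t
    by (simp add: complex_eq_iff ec_def field_simps)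
  show "trig_poly2 (\<lambda>x y. of_real (Re (ec (of_int a * x + of_int b * y))) * c)"
    unfolding re neg[symmetric] by (intro trig_poly2_add trig_poly2_char)
  show "trig_poly2 (\<lambda>x y. of_real (Im (ec (of_int a * x + of_int b * y))) * c)"
    unfolding im neg[symmetric] by (intro trig_poly2_add trig_poly2_char)
qed

lemma trig_poly2_real_polynomial:
  assumes "real_polynomial_function p"
  shows "trig_poly2 (\<lambda>x y. of_real (p (ec x, ec y)))"
  using assms
proof induction
  case (linear f)
  interpret bounded_linear f by (rule linear)
  have lin: "f (z, w) = Re z * f (1, 0) + Im z * f (\<i>, 0) + Re w * f (0, 1) + Im w * f (0, \<i>)" for z w
  proof -
    have "(z, w) = Re z *\<^sub>R (1, 0) + Im z *\<^sub>R (\<i>, 0) + Re w *\<^sub>R (0, 1) + Im w *\<^sub>R (0, \<i>)"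
      by (simp add: complex_eq_iff)
    then show ?thesis by (simp only: add scaleR real_scaleR_def)
  qed
  have "trig_poly2 (\<lambda>x y. (of_real (Re (ec (of_int 1 * x + of_int 0 * y))) * of_real (f (1, 0))
      + of_real (Im (ec (of_int 1 * x + of_int 0 * y))) * of_real (f (\<i>, 0)))
    + (of_real (Re (ec (of_int 0 * x + of_int 1 * y))) * of_real (f (0, 1))
      + of_real (Im (ec (of_int 0 * x + of_int 1 * y))) * of_real (f (0, \<i>))))"
    by (intro trig_poly2_add trig_poly2_Re_Im)
  moreover have "(of_real (Re (ec (of_int 1 * x + of_int 0 * y))) * of_real (f (1, 0))
      + of_real (Im (ec (of_int 1 * x + of_int 0 * y))) * of_real (f (\<i>, 0)))
    + (of_real (Re (ec (of_int 0 * x + of_int 1 * y))) * of_real (f (0, 1))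
      + of_real (Im (ec (of_int 0 * x + of_int 1 * y))) * of_real (f (0, \<i>))) = complex_of_real (f (ec x, ec y))" for x y
    unfolding lin[of "ec x" "ec y"] by simp
  ultimately show ?case by (simp only:)
next
  case (const c)
  show ?case using trig_poly2_char[of "of_real c" 0 0] by simp
next
  case (add f g)
  show ?case unfolding of_real_add by (rule trig_poly2_add[OF add.IH])
next
  case (mult f g)
  show ?case unfolding of_real_mult by (rule trig_poly2_mult[OF mult.IH])
qed

lemma periodic_int_shift:
  fixes g :: "real \<Rightarrow> 'a"
  assumes "\<And>x. g (x + 1) = g x"
  shows "g (x + of_int k) = g x"
proof (induction k rule: int_induct[where k = 0])
  case (step1 i)
  then show ?case using assms[of "x + of_int i"] by (simp add: add.assoc)
next
  case (step2 i)
  then show ?case using assms[of "x + of_int (i - 1)"] by (simp add: add.assoc)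
qed simp

lemma ec_eq_iff: "ec x = ec y \<longleftrightarrow> x - y \<in> \<int>"
proof -
  have "ec x = ec y \<longleftrightarrow> ec (x - y) * ec y = ec y" by (simp flip: ec_add)
  then show ?thesis by (simp add: ec_eq_1_iff)
qed

text \<open>Trigonometric polynomials are dense: Stone-Weierstrass on the torus inside \<open>\<complex> \<times> \<complex>\<close>.\<close>

lemma trig_poly2_dense:
  fixes G :: "real \<Rightarrow> real \<Rightarrow> complex"
  assumes cont: "continuous_on UNIV (\<lambda>p. G (fst p) (snd p))"
    and per1: "\<And>x y. G (x + 1) y = G x y" and per2: "\<And>x y. G x (y + 1) = G x y"
    and e: "\<epsilon> > 0"
  shows "\<exists>h. trig_poly2 h \<and> (\<forall>x y. cmod (G x y - h x y) \<le> \<epsilon>)"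
proof -
  define E where "E p = (ec (fst p), ec (snd p))" for p :: "real \<times> real"
  define S where "S = cbox (0 :: real, 0 :: real) (1, 1)"
  define K where "K = E ` S"
  have Ec: "continuous_on A E" for A
    unfolding E_def by (intro continuous_intros)
  have K: "compact K" unfolding K_def S_def by (intro compact_continuous_image Ec compact_cbox)
  have mem_K: "(ec x, ec y) \<in> K" for x y
  proof -
    have "E (frac x, frac y) = (ec x, ec y)"
      unfolding E_def fst_conv snd_conv by (intro arg_cong2[of _ _ _ _ Pair] ec_cong_int) (simp_all add: frac_def)
    moreover have "(frac x, frac y) \<in> S"
      using frac_lt_1[of x] frac_lt_1[of y] by (simp add: S_def cbox_Pair_eq less_imp_le)
    ultimately show ?thesis unfolding K_def by (metis imageI)
  qed
  define G' where "G' z = (let p = (SOME p. E p = z) in G (fst p) (snd p))" for z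
  have G'E: "G' (E p) = G (fst p) (snd p)" for p
  proof -
    define p' where "p' = (SOME p'. E p' = E p)"
    have "E p' = E p" unfolding p'_def by (rule someI[of _ p]) simp
    then obtain k l where "fst p' - fst p = of_int k" "snd p' - snd p = of_int l"
      by (auto simp: E_def ec_eq_iff elim!: Ints_cases)
    then have kl: "fst p' = fst p + of_int k" "snd p' = snd p + of_int l" by simp_all
    have "G (fst p') (snd p') = G (fst p) (snd p)"
      unfolding kl using periodic_int_shift[of "\<lambda>x. G x (snd p + of_int l)", OF per1]
        periodic_int_shift[of "\<lambda>y. G (fst p) y", OF per2] by simp
    then show ?thesis by (simp add: G'_def p'_def Let_def)
  qed
  have "continuous_on K G'"
    unfolding continuous_on_closed_vimage[OF compact_imp_closed[OF K]]
  proof (intro allI impI)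
    fix B :: "complex set" assume "closed B"
    then have "closed ((\<lambda>p. G (fst p) (snd p)) -` B)"
      using cont by (simp add: continuous_on_closed_vimage)
    then have "compact (S \<inter> (\<lambda>p. G (fst p) (snd p)) -` B)"
      unfolding S_def by (intro compact_Int_closed compact_cbox)
    then have "closed (E ` (S \<inter> (\<lambda>p. G (fst p) (snd p)) -` B))"
      by (intro compact_imp_closed compact_continuous_image Ec)
    also have "E ` (S \<inter> (\<lambda>p. G (fst p) (snd p)) -` B) = G' -` B \<inter> K"
      unfolding K_def using G'E by auto
    finally show "closed (G' -` B \<inter> K)" .
  qed
  then have "continuous_on K (\<lambda>z. Re (G' z))" "continuous_on K (\<lambda>z. Im (G' z))"
    by (auto intro: continuous_intros)
  then obtain g1 g2 where g: "real_polynomial_function g1" "\<And>z. z \<in> K \<Longrightarrow> \<bar>Re (G' z) - g1 z\<bar> < \<epsilon> / 2"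
    "real_polynomial_function g2" "\<And>z. z \<in> K \<Longrightarrow> \<bar>Im (G' z) - g2 z\<bar> < \<epsilon> / 2"
    using Stone_Weierstrass_real_polynomial_function[OF K] half_gt_zero[OF e] by metis
  define h where "h = (\<lambda>x y. complex_of_real (g1 (ec x, ec y)) + (\<lambda>x y. \<i> * ec (of_int 0 * x + of_int 0 * y)) x y * complex_of_real (g2 (ec x, ec y)))"
  have "trig_poly2 h"
    unfolding h_def by (intro trig_poly2_add trig_poly2_mult trig_poly2_char trig_poly2_real_polynomial g)
  moreover have "cmod (G x y - h x y) \<le> \<epsilon>" for x y
  proof -
    have eq: "G' (ec x, ec y) = G x y" using G'E[of "(x, y)"] by (simp add: E_def)
    have "cmod (G x y - h x y) \<le> \<bar>Re (G x y - h x y)\<bar> + \<bar>Im (G x y - h x y)\<bar>" by (rule cmod_le)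
    also have "\<dots> \<le> \<epsilon> / 2 + \<epsilon> / 2"
      using g(2)[OF mem_K, of x y] g(4)[OF mem_K, of x y] by (intro add_mono) (simp_all add: eq h_def)
    finally show ?thesis by simp
  qed
  ultimately show ?thesis by blast
qed

lemma torus_function_induct:
  fixes G :: "real \<Rightarrow> real \<Rightarrow> complex"
  assumes cont: "continuous_on UNIV (\<lambda>p. G (fst p) (snd p))"
    and per: "\<And>x y. G (x + 1) y = G x y" "\<And>x y. G x (y + 1) = G x y"
    and char: "\<And>c a b. P (\<lambda>x y. c * ec (of_int a * x + of_int b * y))"
    and add: "\<And>g h. P g \<Longrightarrow> P h \<Longrightarrow> P (\<lambda>x y. g x y + h x y)"
    and limit: "(\<And>\<epsilon>. \<epsilon> > 0 \<Longrightarrow> \<exists>h. P h \<and> (\<forall>x y. cmod (G x y - h x y) \<le> \<epsilon>)) \<Longrightarrow> P G"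
  shows "P G"
proof (rule limit)
  have "P h" if "trig_poly2 h" for h
    using that by induction (auto intro: char add)
  then show "\<exists>h. P h \<and> (\<forall>x y. cmod (G x y - h x y) \<le> \<epsilon>)" if "\<epsilon> > 0" for \<epsilon>
    using trig_poly2_dense[OF cont per that] by blast
qed

lemma circle_function_induct:
  fixes g :: "real \<Rightarrow> complex"
  assumes cont: "continuous_on UNIV g" and per: "\<And>x. g (x + 1) = g x"
    and char: "\<And>c a. P (\<lambda>x. c * ec (of_int a * x))"
    and add: "\<And>g h. P g \<Longrightarrow> P h \<Longrightarrow> P (\<lambda>x. g x + h x)"
    and limit: "(\<And>\<epsilon>. \<epsilon> > 0 \<Longrightarrow> \<exists>h. P h \<and> (\<forall>x. cmod (g x - h x) \<le> \<epsilon>)) \<Longrightarrow> P g"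
  shows "P g"
proof (rule torus_function_induct[where G = "\<lambda>x y. g x" and P = "\<lambda>G. P (\<lambda>x. G x 0)"])
  show "continuous_on UNIV (\<lambda>p :: real \<times> real. g (fst p))"
    by (intro continuous_on_compose2[OF cont] continuous_intros) auto
  show "P (\<lambda>x. c * ec (real_of_int a * x + real_of_int b * 0))" for c a b
    using char[of c a] by simp
  show "P g" if *: "\<And>\<epsilon>. \<epsilon> > 0 \<Longrightarrow> \<exists>h. P (\<lambda>x. h x 0) \<and> (\<forall>x y. cmod (g x - h x y) \<le> \<epsilon>)"
  proof (rule limit)
    fix \<epsilon> :: real assume "\<epsilon> > 0"
    then show "\<exists>h. P h \<and> (\<forall>x. cmod (g x - h x) \<le> \<epsilon>)" using * by blast
  qed
qed (auto intro: per add)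

lemma has_integral_ec:
  "((\<lambda>x. ec (of_int a * x + s)) has_integral (if a = 0 then ec s else 0)) {0..1}"
proof (cases "a = 0")
  case True
  then show ?thesis using has_integral_const_real[of "ec s" 0 1] by simp
next
  case False
  define F where "F x = ec (of_int a * x + s) / (2 * pi * \<i> * of_int a)" for x
  have d: "(F has_vector_derivative ec (of_int a * x + s)) (at x within {0..1})" for x
  proof -
    have cis: "(cis has_vector_derivative \<i> * cis y) (at y within T)" for y T
    proof -
      have "((\<lambda>y. exp (\<i> * of_real y)) has_vector_derivative \<i> * exp (\<i> * of_real y)) (at y within T)"
        by (auto intro!: derivative_eq_intros has_vector_derivative_real_field[where f = "\<lambda>z. exp (\<i> * z)"])
      then show ?thesis by (simp only: cis_conv_exp[symmetric])
    qed
    have "((\<lambda>x. 2 * pi * (of_int a * x + s)) has_vector_derivative (2 * pi * of_int a)) (at x within {0..1})"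
      by (auto intro!: derivative_eq_intros simp flip: has_real_derivative_iff_has_vector_derivative)
    from vector_diff_chain_within[OF this cis]
    have "((\<lambda>x. ec (of_int a * x + s)) has_vector_derivative (2 * pi * of_int a) *\<^sub>R (\<i> * ec (of_int a * x + s))) (at x within {0..1})"
      by (simp add: o_def ec_def)
    from has_vector_derivative_divide[OF this, of "2 * pi * \<i> * of_int a"]
    show ?thesis unfolding F_def using False by (simp add: scaleR_conv_of_real)
  qed
  have "((\<lambda>x. ec (of_int a * x + s)) has_integral (F 1 - F 0)) {0..1}"
    by (rule fundamental_theorem_of_calculus) (use d in auto)
  moreover have "F 1 - F 0 = 0"
  proof -
    have "ec (of_int a * 1 + s) = ec (of_int a * 0 + s)" by (rule ec_cong_int) simp
    then show ?thesis by (simp add: F_def)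
  qed
  ultimately show ?thesis using False by simp
qed

definition circle_mean :: "(real \<Rightarrow> complex) \<Rightarrow> complex"
  where "circle_mean g = integral {0..1} g"

lemma circle_mean_ec: "circle_mean (\<lambda>x. c * ec (of_int a * x + s)) = (if a = 0 then c * ec s else 0)"
  unfolding circle_mean_def using has_integral_mult_right[OF has_integral_ec[of a s], of c]
  by (auto dest: integral_unique)

lemma integrable_circle: "continuous_on UNIV g \<Longrightarrow> g integrable_on {0..1 :: real}" for g :: "real \<Rightarrow> complex"
  by (rule integrable_continuous_real) (rule continuous_on_subset, auto)

lemma circle_mean_add:
  "continuous_on UNIV g \<Longrightarrow> continuous_on UNIV h \<Longrightarrow> circle_mean (\<lambda>x. g x + h x) = circle_mean g + circle_mean h"
  unfolding circle_mean_def by (rule integral_add) (rule integrable_circle, assumption)+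

lemma circle_mean_cmult: "circle_mean (\<lambda>x. c * g x) = c * circle_mean g"
  unfolding circle_mean_def by (rule integral_mult_right)

lemma norm_circle_mean_le:
  assumes "continuous_on UNIV g" "\<And>x. cmod (g x) \<le> B"
  shows "cmod (circle_mean g) \<le> B"
proof -
  have "cmod (integral {0..1} g) \<le> integral {0..1} (\<lambda>_ :: real. B)"
    by (rule integral_norm_bound_integral) (use assms integrable_circle in auto)
  then show ?thesis by (simp add: circle_mean_def)
qed

lemma circle_mean_diff_le:
  assumes "continuous_on UNIV g" "continuous_on UNIV h" "\<And>x. cmod (g x - h x) \<le> B"
  shows "cmod (circle_mean g - circle_mean h) \<le> B"
proof -
  have "circle_mean g - circle_mean h = circle_mean (\<lambda>x. g x - h x)"
    unfolding circle_mean_def by (rule integral_diff[symmetric]) (rule integrable_circle, rule assms)+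
  then show ?thesis
    using norm_circle_mean_le[of "\<lambda>x. g x - h x" B] assms by (simp add: continuous_on_diff)
qed

lemma circle_mean_affine:
  fixes g :: "real \<Rightarrow> complex"
  assumes "continuous_on UNIV g" "\<And>x. g (x + 1) = g x" "k \<noteq> 0"
  shows "circle_mean (\<lambda>x. g (of_int k * x + s)) = circle_mean g"
proof -
  let ?P = "\<lambda>g. continuous_on UNIV g \<and> circle_mean (\<lambda>x. g (of_int k * x + s)) = circle_mean g"
  have cs: "continuous_on UNIV (\<lambda>x. g (of_int k * x + s))" if "continuous_on UNIV g" for g :: "real \<Rightarrow> complex"
    by (intro continuous_on_compose2[OF that] continuous_intros) auto
  have "?P g"
  proof (rule circle_function_induct[OF assms(1,2)])
    show "?P (\<lambda>x. c * ec (of_int a * x))" for c a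
    proof
      have "circle_mean (\<lambda>x. c * ec (of_int a * (of_int k * x + s))) = circle_mean (\<lambda>x. c * ec (of_int (a * k) * x + of_int a * s))"
        by (simp add: algebra_simps)
      also have "\<dots> = (if a = 0 then c else 0)"
        unfolding circle_mean_ec using assms(3) by simp
      also have "\<dots> = circle_mean (\<lambda>x. c * ec (of_int a * x))"
        using circle_mean_ec[of c a 0] by simp
      finally show "circle_mean (\<lambda>x. c * ec (of_int a * (of_int k * x + s))) = circle_mean (\<lambda>x. c * ec (of_int a * x))" .
    qed (intro continuous_intros)
    show "?P (\<lambda>x. g x + h x)" if "?P g" "?P h" for g h
      using that by (simp add: circle_mean_add cs continuous_on_add)
    show "?P g" if *: "\<And>\<epsilon>. \<epsilon> > 0 \<Longrightarrow> \<exists>h. ?P h \<and> (\<forall>x. cmod (g x - h x) \<le> \<epsilon>)"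
    proof
      have "cmod (circle_mean (\<lambda>x. g (of_int k * x + s)) - circle_mean g) \<le> 0 + \<epsilon>" if e: "\<epsilon> > 0" for \<epsilon>
      proof -
        obtain h where h: "?P h" "\<And>x. cmod (g x - h x) \<le> \<epsilon> / 2" using *[of "\<epsilon> / 2"] e by auto
        have "cmod (circle_mean (\<lambda>x. g (of_int k * x + s)) - circle_mean (\<lambda>x. h (of_int k * x + s))) \<le> \<epsilon> / 2"
          by (rule circle_mean_diff_le) (use h assms(1) cs in auto)
        moreover have "cmod (circle_mean g - circle_mean h) \<le> \<epsilon> / 2"
          by (rule circle_mean_diff_le) (use h assms(1) in auto)
        ultimately show ?thesis
          using h(1) norm_triangle_ineq4[of "circle_mean (\<lambda>x. g (of_int k * x + s)) - circle_mean (\<lambda>x. h (of_int k * x + s))" "circle_mean g - circle_mean h"]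
          by simp
      qed
      then have "cmod (circle_mean (\<lambda>x. g (of_int k * x + s)) - circle_mean g) \<le> 0" by (rule field_le_epsilon)
      then show "circle_mean (\<lambda>x. g (of_int k * x + s)) = circle_mean g" by simp
    qed (rule assms(1))
  qed
  then show ?thesis by blast
qed

text \<open>Weyl equidistribution, uniformly in the starting point.\<close>

theorem weyl_equidistribution:
  fixes g :: "real \<Rightarrow> complex"
  assumes \<alpha>: "\<alpha> \<notin> \<rat>" and g: "continuous_on UNIV g" "\<And>x. g (x + 1) = g x" and e: "\<epsilon> > 0"
  shows "\<forall>\<^sub>F N in sequentially. \<forall>x. cmod ((\<Sum>n<N. g (x + of_nat n * \<alpha>)) - of_nat N * circle_mean g) \<le> \<epsilon> * real N"
proof -
  let ?P = "\<lambda>g. continuous_on UNIV g \<and> (\<forall>\<epsilon>>0. \<forall>\<^sub>F N in sequentially. \<forall>x.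
      cmod ((\<Sum>n<N. g (x + of_nat n * \<alpha>)) - of_nat N * circle_mean g) \<le> \<epsilon> * real N)"
  have "?P g"
  proof (rule circle_function_induct[OF g])
    fix c and a :: int
    let ?g = "\<lambda>x. c * ec (of_int a * x)"
    have cm: "circle_mean ?g = (if a = 0 then c else 0)" using circle_mean_ec[of c a 0] by simp
    show "?P ?g"
    proof (cases "a = 0")
      case True
      then show ?thesis unfolding cm by (auto intro!: continuous_intros)
    next
      case False
      have "of_int a * \<alpha> \<notin> \<int>"
      proof
        assume "of_int a * \<alpha> \<in> \<int>"
        then obtain k where "of_int a * \<alpha> = of_int k" by (auto elim: Ints_cases)
        then have "\<alpha> = of_int k / of_int a" using False by (simp add: field_simps)
        then show False using \<alpha> by simp
      qed
      then have ne: "ec (of_int a * \<alpha>) \<noteq> 1" by (simp add: ec_eq_1_iff)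
      define C where "C = cmod c * (2 / cmod (ec (of_int a * \<alpha>) - 1))"
      have C: "cmod (\<Sum>n<N. ?g (x + of_nat n * \<alpha>)) \<le> C" for N x
      proof -
        have "(\<Sum>n<N. ?g (x + of_nat n * \<alpha>)) = (c * ec (of_int a * x)) * (\<Sum>n<N. ec (of_nat n * (of_int a * \<alpha>)))"
          by (simp add: sum_distrib_left ec_add distrib_left mult_ac)
        then show ?thesis
          using mult_left_mono[OF norm_geometric_ec[OF ne, of N], of "cmod c"] by (simp add: norm_mult C_def)
      qed
      have "\<forall>\<^sub>F N in sequentially. \<forall>x. cmod ((\<Sum>n<N. ?g (x + of_nat n * \<alpha>)) - of_nat N * circle_mean ?g) \<le> \<epsilon> * real N"
        if e: "\<epsilon> > 0" for \<epsilon>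
      proof (rule eventually_sequentiallyI[of "nat \<lceil>C / \<epsilon>\<rceil>"], rule allI)
        fix N x assume "nat \<lceil>C / \<epsilon>\<rceil> \<le> N"
        then have "C / \<epsilon> \<le> N" by linarith
        then have "C \<le> \<epsilon> * N" using e by (simp add: field_simps)
        then show "cmod ((\<Sum>n<N. ?g (x + of_nat n * \<alpha>)) - of_nat N * circle_mean ?g) \<le> \<epsilon> * real N"
          using C[where N = N and x = x] unfolding cm using False by simp
      qed
      then show ?thesis by (auto intro!: continuous_intros)
    qed
  next
    fix g h assume gh: "?P g" "?P h"
    show "?P (\<lambda>x. g x + h x)"
    proof (intro conjI allI impI)
      show "continuous_on UNIV (\<lambda>x. g x + h x)" using gh by (intro continuous_intros) auto
      fix \<epsilon> :: real assume "\<epsilon> > 0"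
      then have "\<epsilon> / 2 > 0" by simp
      with gh have "\<forall>\<^sub>F N in sequentially. \<forall>x. cmod ((\<Sum>n<N. g (x + of_nat n * \<alpha>)) - of_nat N * circle_mean g) \<le> \<epsilon> / 2 * real N"
        "\<forall>\<^sub>F N in sequentially. \<forall>x. cmod ((\<Sum>n<N. h (x + of_nat n * \<alpha>)) - of_nat N * circle_mean h) \<le> \<epsilon> / 2 * real N"
        by blast+
      then show "\<forall>\<^sub>F N in sequentially. \<forall>x. cmod ((\<Sum>n<N. g (x + of_nat n * \<alpha>) + h (x + of_nat n * \<alpha>))
          - of_nat N * circle_mean (\<lambda>x. g x + h x)) \<le> \<epsilon> * real N"
      proof eventually_elim
        case (elim N)
        show ?case
        proof
          fix x
          have "(\<Sum>n<N. g (x + of_nat n * \<alpha>) + h (x + of_nat n * \<alpha>)) - of_nat N * circle_mean (\<lambda>x. g x + h x)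
              = ((\<Sum>n<N. g (x + of_nat n * \<alpha>)) - of_nat N * circle_mean g) + ((\<Sum>n<N. h (x + of_nat n * \<alpha>)) - of_nat N * circle_mean h)"
            using gh by (simp add: circle_mean_add sum.distrib algebra_simps)
          also have "cmod \<dots> \<le> \<epsilon> / 2 * N + \<epsilon> / 2 * N"
            by (rule norm_triangle_mono) (use elim in blast)+
          finally show "cmod ((\<Sum>n<N. g (x + of_nat n * \<alpha>) + h (x + of_nat n * \<alpha>))
              - of_nat N * circle_mean (\<lambda>x. g x + h x)) \<le> \<epsilon> * real N" by simp
        qed
      qed
    qed
  next
    assume *: "\<And>\<epsilon>. \<epsilon> > 0 \<Longrightarrow> \<exists>h. ?P h \<and> (\<forall>x. cmod (g x - h x) \<le> \<epsilon>)"
    show "?P g"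
    proof (intro conjI allI impI)
      fix \<epsilon> :: real assume e: "\<epsilon> > 0"
      then obtain h where h: "?P h" "\<And>x. cmod (g x - h x) \<le> \<epsilon> / 3" using *[of "\<epsilon> / 3"] by auto
      have cm: "cmod (circle_mean g - circle_mean h) \<le> \<epsilon> / 3"
        by (rule circle_mean_diff_le) (use h g in auto)
      have "\<forall>\<^sub>F N in sequentially. \<forall>x. cmod ((\<Sum>n<N. h (x + of_nat n * \<alpha>)) - of_nat N * circle_mean h) \<le> \<epsilon> / 3 * real N"
      proof -
        have "\<epsilon> / 3 > 0" using e by simp
        with h(1) show ?thesis by blast
      qed
      then show "\<forall>\<^sub>F N in sequentially. \<forall>x. cmod ((\<Sum>n<N. g (x + of_nat n * \<alpha>)) - of_nat N * circle_mean g) \<le> \<epsilon> * real N"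
      proof eventually_elim
        case (elim N)
        show ?case
        proof
          fix x
          have 1: "cmod (\<Sum>n<N. g (x + of_nat n * \<alpha>) - h (x + of_nat n * \<alpha>)) \<le> \<epsilon> / 3 * N"
            using sum_norm_le[of "{..<N}" "\<lambda>n. g (x + of_nat n * \<alpha>) - h (x + of_nat n * \<alpha>)" "\<lambda>_. \<epsilon> / 3"] h(2)
            by (simp add: mult.commute)
          have 2: "cmod (of_nat N * (circle_mean g - circle_mean h)) \<le> \<epsilon> / 3 * N"
            using mult_left_mono[OF cm, of "real N"] by (simp add: norm_mult mult.commute)
          have eq: "(\<Sum>n<N. g (x + of_nat n * \<alpha>)) - of_nat N * circle_mean g
              = ((\<Sum>n<N. g (x + of_nat n * \<alpha>) - h (x + of_nat n * \<alpha>)) + ((\<Sum>n<N. h (x + of_nat n * \<alpha>)) - of_nat N * circle_mean h))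
                - of_nat N * (circle_mean g - circle_mean h)"
            by (simp add: sum_subtractf algebra_simps)
          have "cmod ((\<Sum>n<N. g (x + of_nat n * \<alpha>)) - of_nat N * circle_mean g) \<le> (\<epsilon> / 3 * N + \<epsilon> / 3 * N) + \<epsilon> / 3 * N"
            unfolding eq
            by (rule norm_triangle_le_diff, rule add_mono[OF _ 2], rule norm_triangle_le, rule add_mono[OF 1])
              (use elim in blast)
          then show "cmod ((\<Sum>n<N. g (x + of_nat n * \<alpha>)) - of_nat N * circle_mean g) \<le> \<epsilon> * real N" by simp
        qed
      qed
    qed (rule g)
  qed
  then show ?thesis using e by blast
qed

(*FILE dev6/Dyn*)
definition birkhoff_sum :: "(real \<Rightarrow> real) \<Rightarrow> real \<Rightarrow> nat \<Rightarrow> real \<Rightarrow> real"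
  where "birkhoff_sum f \<alpha> n x = (\<Sum>j<n. f (x + of_nat j * \<alpha>))"

lemma birkhoff_sum_add:
  "birkhoff_sum f \<alpha> (m + n) x = birkhoff_sum f \<alpha> m x + birkhoff_sum f \<alpha> n (x + of_nat m * \<alpha>)"
  by (induction n) (simp_all add: birkhoff_sum_def algebra_simps)

lemma birkhoff_sum_periodic:
  "(\<And>x. f (x + 1) = f x) \<Longrightarrow> birkhoff_sum f \<alpha> n (x + of_int k) = birkhoff_sum f \<alpha> n x"
proof -
  assume per: "\<And>x. f (x + 1) = f x"
  have "x + of_int k + of_nat j * \<alpha> = (x + of_nat j * \<alpha>) + of_int k" for j by simp
  then show ?thesis
    unfolding birkhoff_sum_def by (simp only: periodic_int_shift[of f, OF per])
qed

lemma skew_map_iterate: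
  assumes per: "\<forall>x. f (x + 1) = f x"
  shows "(skew_map \<alpha> c f ^^ n) (abs_circle x, abs_circle y)
    = (abs_circle (x + of_nat n * \<alpha>), abs_circle (y + birkhoff_sum (\<lambda>t. of_int c * t + f t) \<alpha> n x))"
  by (induction n) (simp_all add: birkhoff_sum_def skew_map_abs_circle[OF per] algebra_simps)

lemma abs_circle_add_1: "abs_circle (x + 1) = abs_circle x"
  by (simp add: abs_circle_eq_iff)

text \<open>By density of trigonometric polynomials it suffices to test characters of the torus.\<close>

lemma moebius_disjoint_skew_mapI:
  assumes per: "\<forall>x. f (x + 1) = f x"
    and char: "\<And>a b x y. mean_zero (\<lambda>n. ec (of_int a * (x + of_nat n * \<alpha>)
      + of_int b * (y + birkhoff_sum (\<lambda>t. of_int c * t + f t) \<alpha> n x)) * of_int (moebius n))"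
  shows "moebius_disjoint (skew_map \<alpha> c f)"
  unfolding moebius_disjoint_def
proof (intro allI impI)
  fix z :: "circle \<times> circle" and g :: "circle \<times> circle \<Rightarrow> complex"
  assume g: "continuous_on UNIV g"
  obtain x y where z: "z = (abs_circle x, abs_circle y)"
    by (metis abs_rep_circle surj_pair)
  define X where "X n = x + of_nat n * \<alpha>" for n
  define Y where "Y n = y + birkhoff_sum (\<lambda>t. of_int c * t + f t) \<alpha> n x" for n
  let ?P = "\<lambda>G. mean_zero (\<lambda>n. G (X n) (Y n) * of_int (moebius n))"
  have "?P (\<lambda>x y. g (abs_circle x, abs_circle y))"
  proof (rule torus_function_induct[where P = ?P])
    show "continuous_on UNIV (\<lambda>p. g (abs_circle (fst p), abs_circle (snd p)))"
      by (intro continuous_on_compose2[OF g] continuous_intros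
          continuous_on_compose2[OF continuous_on_abs_circle]) auto
    show "?P (\<lambda>x y. c * ec (of_int a * x + of_int b * y))" for c a b
      using mean_zero_cmult[OF char[of a x b y], of c] by (simp add: X_def Y_def mult.assoc)
    show "?P (\<lambda>x y. G x y + H x y)" if "?P G" "?P H" for G H
      using mean_zero_add[OF that] by (simp add: distrib_right)
    show "?P (\<lambda>x y. g (abs_circle x, abs_circle y))"
      if *: "\<And>\<epsilon>. \<epsilon> > 0 \<Longrightarrow> \<exists>h. ?P h \<and> (\<forall>x y. cmod (g (abs_circle x, abs_circle y) - h x y) \<le> \<epsilon>)"
    proof (rule mean_zero_approx)
      fix \<epsilon> :: real assume "\<epsilon> > 0"
      then obtain h where h: "?P h" "\<And>x y. cmod (g (abs_circle x, abs_circle y) - h x y) \<le> \<epsilon>"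
        using * by blast
      have "cmod (g (abs_circle (X n), abs_circle (Y n)) * of_int (moebius n) - h (X n) (Y n) * of_int (moebius n)) \<le> \<epsilon>" for n
      proof -
        have "cmod ((g (abs_circle (X n), abs_circle (Y n)) - h (X n) (Y n)) * of_int (moebius n)) \<le> \<epsilon> * 1"
          unfolding norm_mult by (rule mult_mono[OF h(2) norm_moebius_le]) (use \<open>\<epsilon> > 0\<close> in auto)
        then show ?thesis by (simp add: left_diff_distrib)
      qed
      then show "\<exists>b. mean_zero b \<and> (\<forall>n. cmod (g (abs_circle (X n), abs_circle (Y n)) * of_int (moebius n) - b n) \<le> \<epsilon>)"
        using h(1) by blast
    qed
  qed (simp_all add: abs_circle_add_1)
  then have "mean_zero (\<lambda>n. g ((skew_map \<alpha> c f ^^ n) z) * of_int (moebius n))"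
    unfolding z skew_map_iterate[OF per] by (simp add: X_def Y_def)
  then show "(\<lambda>N. \<Sum>n = 1..N. g ((skew_map \<alpha> c f ^^ n) z) * of_int (moebius n)) \<in> o(\<lambda>N. of_nat N)"
    unfolding mean_zero_def
    by (intro smalloI_tendsto eventually_sequentiallyI[of 1]) auto
qed

lemma sum_shift_bound:
  fixes w :: "nat \<Rightarrow> complex"
  assumes "\<And>n. cmod (w n) \<le> 1"
  shows "cmod ((\<Sum>n = 1..N. w (n + k)) - (\<Sum>n = 1..N. w n)) \<le> 2 * real k"
proof (induction k)
  case (Suc k)
  have "(\<Sum>n = 1..N. w (n + Suc k)) = (\<Sum>n = 1..N. w (n + k)) + (w (N + Suc k) - w (Suc k))"
    by (induction N) simp_all
  then have eq: "(\<Sum>n = 1..N. w (n + Suc k)) - (\<Sum>n = 1..N. w n)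
      = ((\<Sum>n = 1..N. w (n + k)) - (\<Sum>n = 1..N. w n)) + (w (N + Suc k) - w (Suc k))" by simp
  have "cmod (w (N + Suc k) - w (Suc k)) \<le> 1 + 1"
    by (rule order_trans[OF norm_triangle_ineq4]) (intro add_mono assms)
  then show ?case
    unfolding eq by (intro order_trans[OF norm_triangle_ineq]) (use Suc in simp)
qed simp

text \<open>
  Van der Corput's inequality in qualitative form: a sequence has mean zero if its
  autocorrelations with large shifts are small.  One averages over the shifts
  \<open>0, L, 2 L, \<dots>\<close>, so that all differences of two of them are large.
\<close>

theorem van_der_corput:
  fixes v :: "nat \<Rightarrow> complex"
  assumes v: "\<And>n. cmod (v n) \<le> 1"
    and cor: "\<And>\<epsilon>. \<epsilon> > 0 \<Longrightarrow> \<exists>L. \<forall>h\<ge>L. \<forall>\<^sub>F N in sequentially. cmod (\<Sum>n = 1..N. v (n + h) * cnj (v n)) \<le> \<epsilon> * real N"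
  shows "mean_zero v"
  unfolding mean_zero_iff
proof (intro allI impI)
  fix \<epsilon> :: real assume e: "\<epsilon> > 0"
  define \<eta> where "\<eta> = \<epsilon>\<^sup>2 / 16"
  have \<eta>: "\<eta> > 0" using e by (simp add: \<eta>_def)
  obtain L where L: "\<And>h. h \<ge> L \<Longrightarrow> \<forall>\<^sub>F N in sequentially. cmod (\<Sum>n = 1..N. v (n + h) * cnj (v n)) \<le> \<eta> * real N"
    using cor[OF \<eta>] by blast
  define H where "H = nat \<lceil>1 / (2 * \<eta>)\<rceil> + 1"
  have H: "H > 0" "1 / real H \<le> 2 * \<eta>"
  proof -
    show H0: "H > 0" by (simp add: H_def)
    have "1 / (2 * \<eta>) \<le> real H" unfolding H_def by linarith
    then show "1 / real H \<le> 2 * \<eta>" using \<eta> H0 by (simp add: field_simps)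
  qed
  have prod1: "cmod (v m * cnj (v n)) \<le> 1" for m n
    using mult_mono[OF v v, of n m] by (simp add: norm_mult mult.commute)
  have "\<forall>\<^sub>F N in sequentially. \<forall>d\<in>{1..H}. cmod (\<Sum>n = 1..N. v (n + d * L) * cnj (v n)) \<le> \<eta> * real N"
    by (intro eventually_ball_finite ballI L) auto
  moreover have "\<forall>\<^sub>F N in sequentially. 2 * H * L \<le> \<eta> * real N"
    by (rule eventually_sequentiallyI[of "nat \<lceil>2 * H * L / \<eta>\<rceil>"]) (use \<eta> in \<open>simp add: field_simps nat_le_iff ceiling_le_iff\<close>)
  moreover have "\<forall>\<^sub>F N in sequentially. 2 * H * L \<le> \<epsilon> / 2 * real N"
    by (rule eventually_sequentiallyI[of "nat \<lceil>2 * H * L / (\<epsilon> / 2)\<rceil>"]) (use e in \<open>simp add: field_simps nat_le_iff ceiling_le_iff\<close>)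
  ultimately show "\<forall>\<^sub>F N in sequentially. cmod (\<Sum>n = 1..N. v n) \<le> \<epsilon> * real N"
  proof eventually_elim
    case (elim N)
    let ?V = "\<lambda>n. \<Sum>i<H. v (n + i * L)"
    have 1: "cmod ((\<Sum>n = 1..N. ?V n) - of_nat H * (\<Sum>n = 1..N. v n)) \<le> real H * (2 * H * L)"
    proof -
      have "(\<Sum>n = 1..N. ?V n) - of_nat H * (\<Sum>n = 1..N. v n) = (\<Sum>i<H. (\<Sum>n = 1..N. v (n + i * L)) - (\<Sum>n = 1..N. v n))"
        by (subst sum.swap) (simp add: sum_subtractf)
      also have "cmod (\<Sum>i<H. (\<Sum>n = 1..N. v (n + i * L)) - (\<Sum>n = 1..N. v n)) \<le> (\<Sum>i<H. 2 * real H * real L)"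
      proof (rule sum_norm_le)
        fix i assume "i \<in> {..<H}"
        then have "real (i * L) \<le> real (H * L)" by (intro of_nat_mono mult_right_mono) auto
        then have "2 * real (i * L) \<le> 2 * real H * real L" by simp
        with sum_shift_bound[where w = v and N = N and k = "i * L", OF v]
        show "cmod ((\<Sum>n = 1..N. v (n + i * L)) - (\<Sum>n = 1..N. v n)) \<le> 2 * real H * real L" by linarith
      qed
      finally show ?thesis by simp
    qed
    have pair: "cmod (\<Sum>n = 1..N. v (n + i * L) * cnj (v (n + j * L))) \<le> 2 * \<eta> * real N" if "j < i" "i < H" for i j
    proof -
      define w where "w n = v (n + (i - j) * L) * cnj (v n)" for n
      have weq: "w (n + j * L) = v (n + i * L) * cnj (v (n + j * L))" for n
      proof -
        have "n + j * L + (i - j) * L = n + (j + (i - j)) * L" by (simp only: distrib_right add.assoc)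
        also have "j + (i - j) = i" using that by simp
        finally show ?thesis unfolding w_def by (simp only:)
      qed
      have "cmod (w n) \<le> 1" for n unfolding w_def by (rule prod1)
      then have "cmod ((\<Sum>n = 1..N. w (n + j * L)) - (\<Sum>n = 1..N. w n)) \<le> 2 * real (j * L)"
        by (rule sum_shift_bound)
      then have "cmod ((\<Sum>n = 1..N. v (n + i * L) * cnj (v (n + j * L))) - (\<Sum>n = 1..N. w n)) \<le> 2 * real (j * L)"
        unfolding weq .
      moreover have "real (j * L) \<le> real (H * L)"
        using that by (intro of_nat_mono mult_right_mono) auto
      then have "2 * real (j * L) \<le> 2 * H * L" by simp
      moreover have "cmod (\<Sum>n = 1..N. w n) \<le> \<eta> * real N"
        unfolding w_def using that by (intro elim(1)[rule_format]) auto
      ultimately show ?thesis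
        using norm_triangle_sub[of "\<Sum>n = 1..N. v (n + i * L) * cnj (v (n + j * L))" "\<Sum>n = 1..N. w n"] elim(2)
        by linarith
    qed
    have pair': "cmod (\<Sum>n = 1..N. v (n + i * L) * cnj (v (n + j * L))) \<le> (if i = j then real N else 0) + 2 * \<eta> * real N"
      if "i < H" "j < H" for i j
    proof -
      consider "i = j" | "j < i" | "i < j" by linarith
      then show ?thesis
      proof cases
        case 1
        have "cmod (\<Sum>n = 1..N. v (n + i * L) * cnj (v (n + i * L))) \<le> (\<Sum>n = 1..N. 1)"
          by (rule sum_norm_le) (rule prod1)
        then show ?thesis using 1 \<eta> by (simp add: add_increasing2)
      next
        case 2
        then show ?thesis using pair[of j i] that by simp
      next
        case 3
        have "(\<Sum>n = 1..N. v (n + i * L) * cnj (v (n + j * L))) = cnj (\<Sum>n = 1..N. v (n + j * L) * cnj (v (n + i * L)))"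
          by (simp add: mult.commute)
        then show ?thesis using pair[of i j] that 3 by (simp only: complex_mod_cnj) simp
      qed
    qed
    have sq: "(\<Sum>n = 1..N. (cmod (?V n))\<^sup>2) \<le> (real H)\<^sup>2 * (real N * (4 * \<eta>))"
    proof -
      have "complex_of_real (\<Sum>n = 1..N. (cmod (?V n))\<^sup>2) = (\<Sum>n = 1..N. \<Sum>i<H. \<Sum>j<H. v (n + i * L) * cnj (v (n + j * L)))"
        unfolding of_real_sum complex_norm_square cnj_sum sum_product ..
      also have "\<dots> = (\<Sum>i<H. \<Sum>j<H. \<Sum>n = 1..N. v (n + i * L) * cnj (v (n + j * L)))"
        by (subst sum.swap, rule sum.cong[OF refl], rule sum.swap)
      finally have eq: "complex_of_real (\<Sum>n = 1..N. (cmod (?V n))\<^sup>2)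
          = (\<Sum>i<H. \<Sum>j<H. \<Sum>n = 1..N. v (n + i * L) * cnj (v (n + j * L)))" .
      have "cmod (complex_of_real (\<Sum>n = 1..N. (cmod (?V n))\<^sup>2)) \<le> (\<Sum>i<H. \<Sum>j<H. (if i = j then real N else 0) + 2 * \<eta> * real N)"
        unfolding eq by (intro sum_norm_le pair') auto
      also have "\<dots> = real H * real N + (real H)\<^sup>2 * (2 * \<eta> * real N)"
        by (simp add: sum.distrib power2_eq_square distrib_left)
      also have "\<dots> = (real H)\<^sup>2 * (real N * (1 / real H + 2 * \<eta>))"
        using H(1) by (simp add: power2_eq_square field_simps)
      also have "\<dots> \<le> (real H)\<^sup>2 * (real N * (4 * \<eta>))"
        using H(2) by (intro mult_left_mono) auto
      finally show ?thesis unfolding norm_of_real by linarith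
    qed
    have 2: "cmod (\<Sum>n = 1..N. ?V n) \<le> real H * (real N * (\<epsilon> / 2))"
    proof -
      have "cmod (\<Sum>n = 1..N. ?V n) \<le> sqrt (real (card {1..N}) * (\<Sum>n = 1..N. (cmod (?V n))\<^sup>2))"
        by (rule norm_sum_le_sqrt) simp
      also have "\<dots> \<le> sqrt (real N * ((real H)\<^sup>2 * (real N * (4 * \<eta>))))"
        using sq by (intro real_sqrt_le_mono) (simp add: mult_left_mono)
      also have "real N * ((real H)\<^sup>2 * (real N * (4 * \<eta>))) = (real H * (real N * (\<epsilon> / 2)))\<^sup>2"
        by (simp add: \<eta>_def power2_eq_square)
      also have "sqrt \<dots> = real H * (real N * (\<epsilon> / 2))" using e by simp
      finally show ?thesis .
    qed
    have "cmod (of_nat H * (\<Sum>n = 1..N. v n)) \<le> cmod (\<Sum>n = 1..N. ?V n) + cmod ((\<Sum>n = 1..N. ?V n) - of_nat H * (\<Sum>n = 1..N. v n))"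
      by (metis norm_triangle_sub norm_minus_commute)
    then have "real H * cmod (\<Sum>n = 1..N. v n) \<le> real H * (real N * (\<epsilon> / 2)) + real H * (2 * H * L)"
      using 1 2 by (simp add: norm_mult)
    also have "\<dots> \<le> real H * (real N * (\<epsilon> / 2)) + real H * (\<epsilon> / 2 * real N)"
      using elim(3) by (intro add_left_mono mult_left_mono) auto
    also have "\<dots> = real H * (\<epsilon> * real N)" by (simp add: field_simps)
    finally show ?case using H(1) by simp
  qed
qed

(*FILE dev6/Dyn2*)
text \<open>An oscillating integral is small if its amplitude varies little over half a period.\<close>

lemma circle_mean_half_period:
  fixes g :: "real \<Rightarrow> complex"
  assumes g: "continuous_on UNIV g" "\<And>x. g (x + 1) = g x" and M: "M \<noteq> 0"
    and B: "\<And>t. cmod (g t - g (t + 1 / (2 * of_int M))) \<le> B"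
  shows "cmod (circle_mean (\<lambda>t. ec (of_int M * t) * g t)) \<le> B / 2"
proof -
  let ?G = "\<lambda>t. ec (of_int M * t) * g t"
  define s where "s = 1 / (2 * of_int M :: real)"
  have cG: "continuous_on UNIV ?G" by (intro continuous_intros g)
  have cg: "continuous_on UNIV (\<lambda>t. g (t + s))"
    by (intro continuous_on_compose2[OF g(1)] continuous_intros) auto
  have half: "ec (1 / 2) = -1" by (simp add: ec_def)
  have "ec (of_int M * (t + s)) = - ec (of_int M * t)" for t
  proof -
    have "of_int M * (t + s) = of_int M * t + 1 / 2" using M by (simp add: s_def distrib_left)
    then show ?thesis by (simp add: ec_add half)
  qed
  then have shift: "?G (t + s) = ec (of_int M * t) * (- g (t + s))" for t by simp
  have perG: "?G (x + 1) = ?G x" for x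
  proof -
    have "ec (of_int M * (x + 1)) = ec (of_int M * x)" by (rule ec_cong_int) (simp add: distrib_left)
    then show ?thesis using g(2) by simp
  qed
  have "circle_mean ?G = circle_mean (\<lambda>t. ?G (t + s))"
    using circle_mean_affine[where g = ?G and k = 1 and s = s, OF cG perG] by simp
  then have "2 * circle_mean ?G = circle_mean ?G + circle_mean (\<lambda>t. ec (of_int M * t) * (- g (t + s)))"
    unfolding shift by simp
  also have "\<dots> = circle_mean (\<lambda>t. ?G t + ec (of_int M * t) * (- g (t + s)))"
    by (rule circle_mean_add[symmetric]) (intro cG continuous_intros cg)+
  finally have eq: "2 * circle_mean ?G = circle_mean (\<lambda>t. ?G t + ec (of_int M * t) * (- g (t + s)))" .
  have "cmod (circle_mean (\<lambda>t. ?G t + ec (of_int M * t) * (- g (t + s)))) \<le> B"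
  proof (rule norm_circle_mean_le)
    show "continuous_on UNIV (\<lambda>t. ?G t + ec (of_int M * t) * (- g (t + s)))"
      by (intro continuous_intros cG cg g)
    show "cmod (?G t + ec (of_int M * t) * (- g (t + s))) \<le> B" for t
    proof -
      have "?G t + ec (of_int M * t) * (- g (t + s)) = ec (of_int M * t) * (g t - g (t + s))"
        by (simp add: algebra_simps)
      then show ?thesis using B[of t] by (simp add: norm_mult s_def)
    qed
  qed
  then have "cmod (2 * circle_mean ?G) \<le> B" unfolding eq .
  then show ?thesis by (simp add: norm_mult)
qed

locale periodic_C1 =
  fixes f f' :: "real \<Rightarrow> real"
  assumes per: "\<And>x. f (x + 1) = f x"
    and deriv: "\<And>x. (f has_real_derivative f' x) (at x)"
    and cont_deriv: "continuous_on UNIV f'"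
begin

lemma cont: "continuous_on UNIV f"
  using deriv by (meson DERIV_isCont continuous_at_imp_continuous_on)

lemma per_deriv: "f' (x + 1) = f' x"
proof -
  have "((\<lambda>x. f (x + 1)) has_real_derivative f' (x + 1)) (at x)"
    using DERIV_shift[of f "f' (x + 1)" x 1] deriv by simp
  then show ?thesis using DERIV_unique[OF _ deriv[of x]] by (simp add: per)
qed

lemma deriv_mean: "circle_mean (\<lambda>x. of_real (f' x)) = 0"
proof -
  have "((\<lambda>x. complex_of_real (f x)) has_vector_derivative of_real (f' x)) (at x within {0..1})" for x
    using has_vector_derivative_of_real[OF has_field_derivative_at_within[OF deriv[of x], of "{0..1}"], where 'a = complex]
    by simp
  then have "((\<lambda>x. complex_of_real (f' x)) has_integral (of_real (f 1) - of_real (f 0))) {0..1}"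
    by (intro fundamental_theorem_of_calculus) auto
  moreover have "f 1 = f 0" using per[of 0] by simp
  ultimately show ?thesis unfolding circle_mean_def by (simp add: integral_unique)
qed

lemma birkhoff_sum_difference:
  assumes "\<And>t. \<bar>birkhoff_sum f' \<alpha> n t\<bar> \<le> B"
  shows "\<bar>birkhoff_sum f \<alpha> n x - birkhoff_sum f \<alpha> n y\<bar> \<le> B * \<bar>x - y\<bar>"
proof -
  have "((\<lambda>x. f (x + of_nat j * \<alpha>)) has_real_derivative f' (x + of_nat j * \<alpha>)) (at x)" for j x
    using DERIV_shift[of f "f' (x + of_nat j * \<alpha>)" x "of_nat j * \<alpha>"] deriv by simp
  then have "(birkhoff_sum f \<alpha> n has_real_derivative birkhoff_sum f' \<alpha> n t) (at t)" for t
    unfolding birkhoff_sum_def by (intro DERIV_sum)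
  then have "norm (birkhoff_sum f \<alpha> n x - birkhoff_sum f \<alpha> n y) \<le> B * norm (x - y)"
    using assms by (intro field_differentiable_bound[OF convex_UNIV]) (auto intro: has_field_derivative_at_within)
  then show ?thesis by simp
qed

lemma deriv_bounded: obtains B where "B > 0" "\<And>x. \<bar>f' x\<bar> \<le> B"
proof -
  have "compact (f' ` {0..1})"
    by (intro compact_continuous_image continuous_on_subset[OF cont_deriv]) auto
  then obtain B where B: "B > 0" "\<And>x. x \<in> {0..1} \<Longrightarrow> \<bar>f' x\<bar> \<le> B"
    using compact_imp_bounded bounded_pos by (metis (no_types, lifting) image_eqI real_norm_def)
  have "\<bar>f' x\<bar> \<le> B" for x
  proof -
    have "f' x = f' (frac x)"
      using periodic_int_shift[of f' "frac x" "\<lfloor>x\<rfloor>", OF per_deriv] by (simp add: frac_def)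
    moreover have "frac x \<in> {0..1}" using frac_lt_1[of x] by (simp add: less_imp_le)
    ultimately show ?thesis using B(2) by simp
  qed
  then show ?thesis using that B(1) by blast
qed

lemma lipschitz: obtains B where "B > 0" "\<And>x y. \<bar>f x - f y\<bar> \<le> B * \<bar>x - y\<bar>"
proof -
  obtain B where B: "B > 0" "\<And>x. \<bar>f' x\<bar> \<le> B" by (rule deriv_bounded, rule that)
  have "\<bar>f x - f y\<bar> \<le> B * \<bar>x - y\<bar>" for x y
    using birkhoff_sum_difference[where n = 1 and B = B and \<alpha> = 0, of x y] B(2) by (simp add: birkhoff_sum_def)
  then show ?thesis using that B(1) by blast
qed

text \<open>
  Derivatives of Birkhoff sums grow sublinearly, because \<open>f'\<close> has mean zero and the rotation is uniquely ergodic.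
\<close>

lemma birkhoff_sum_deriv_sublinear:
  assumes \<alpha>: "\<alpha> \<notin> \<rat>" and e: "\<epsilon> > 0"
  shows "\<forall>\<^sub>F n in sequentially. \<forall>x y. \<bar>birkhoff_sum f \<alpha> n x - birkhoff_sum f \<alpha> n y\<bar> \<le> \<epsilon> * real n * \<bar>x - y\<bar>"
proof -
  have "\<forall>\<^sub>F N in sequentially. \<forall>x. cmod ((\<Sum>n<N. complex_of_real (f' (x + of_nat n * \<alpha>)))
      - of_nat N * circle_mean (\<lambda>x. of_real (f' x))) \<le> \<epsilon> * real N"
    by (rule weyl_equidistribution[OF \<alpha> _ _ e]) (auto intro: continuous_intros cont_deriv simp: per_deriv)
  then show ?thesis
  proof eventually_elim
    case (elim N)
    have "\<bar>birkhoff_sum f' \<alpha> N t\<bar> \<le> \<epsilon> * real N" for t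
    proof -
      have "cmod (complex_of_real (birkhoff_sum f' \<alpha> N t)) \<le> \<epsilon> * real N"
        using elim by (simp add: deriv_mean birkhoff_sum_def)
      then show ?thesis unfolding norm_of_real .
    qed
    then show ?case using birkhoff_sum_difference by blast
  qed
qed

text \<open>
  For nonzero degree \<open>c\<close> every irrational rotation works.  In Katai's criterion the phase is
  quadratic plus a difference of Birkhoff sums; one van der Corput step turns its quadratic part
  into a winding of degree \<open>D h\<close> around the circle, and the Birkhoff sums, having slope
  \<open>o (h)\<close>, cannot undo the resulting cancellation.
\<close>

theorem nonzero_degree_mean_zero:
  fixes a b c :: int
  assumes \<alpha>: "\<alpha> \<notin> \<rat>" and bc: "b \<noteq> 0" "c \<noteq> 0"
  shows "mean_zero (\<lambda>n. ec (of_int a * (x + of_nat n * \<alpha>)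
      + of_int b * (y + birkhoff_sum (\<lambda>t. of_int c * t + f t) \<alpha> n x)) * of_int (moebius n))"
proof (rule katai_criterion)
  define \<phi> where "\<phi> n = of_int a * (x + of_nat n * \<alpha>)
      + of_int b * (y + birkhoff_sum (\<lambda>t. of_int c * t + f t) \<alpha> n x)" for n
  define \<kappa> where "\<kappa> k = of_int a * (of_nat k * \<alpha>) + of_int b * of_int c * (\<Sum>j<k. of_nat j * \<alpha>)" for k :: nat
  define \<Psi> where "\<Psi> k t = of_int (b * c * int k) * t + (of_int b * birkhoff_sum f \<alpha> k t + \<kappa> k)" for k t
  have \<phi>_add: "\<phi> (m + k) - \<phi> m = \<Psi> k (x + of_nat m * \<alpha>)" for m k
  proof -
    have "birkhoff_sum (\<lambda>t. of_int c * t + f t) \<alpha> k u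
        = of_int c * (of_nat k * u) + of_int c * (\<Sum>j<k. of_nat j * \<alpha>) + birkhoff_sum f \<alpha> k u" for u
      by (simp add: birkhoff_sum_def sum.distrib sum_distrib_left distrib_left)
    then show ?thesis
      unfolding \<phi>_def birkhoff_sum_add \<Psi>_def \<kappa>_def by (simp add: algebra_simps)
  qed
  fix p p' :: nat assume p: "prime p" "prime p'" "p \<noteq> p'"
  define v where "v n = ec (\<phi> (p * n) - \<phi> (p' * n))" for n
  define D where "D = b * c * (int p ^ 2 - int p' ^ 2)"
  have D: "D \<noteq> 0" using bc p(3) by (simp add: D_def power2_eq_iff)
  define Q where "Q h t = of_int b * (birkhoff_sum f \<alpha> (p * h) (x + of_int (int p) * t)
      - birkhoff_sum f \<alpha> (p' * h) (x + of_int (int p') * t))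
      + (of_int (b * c * (int p - int p') * int h) * x + \<kappa> (p * h) - \<kappa> (p' * h))" for h t
  have cor: "v (n + h) * cnj (v n) = ec (of_int (D * int h) * (of_nat n * \<alpha>)) * ec (Q h (of_nat n * \<alpha>))" for n h
  proof -
    have "v (n + h) * cnj (v n) = ec ((\<phi> (p * n + p * h) - \<phi> (p * n)) - (\<phi> (p' * n + p' * h) - \<phi> (p' * n)))"
      unfolding v_def cnj_ec ec_add[symmetric] by (simp add: distrib_left algebra_simps)
    also have "(\<phi> (p * n + p * h) - \<phi> (p * n)) - (\<phi> (p' * n + p' * h) - \<phi> (p' * n))
        = of_int (D * int h) * (of_nat n * \<alpha>) + Q h (of_nat n * \<alpha>)"
      unfolding \<phi>_add \<Psi>_def Q_def D_def by (simp add: algebra_simps power2_eq_square)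
    finally show ?thesis by (simp only: ec_add)
  qed
  have cont_b: "continuous_on UNIV (\<lambda>t. birkhoff_sum f \<alpha> k (g t))" if "continuous_on UNIV g" for k g
    unfolding birkhoff_sum_def
    by (intro continuous_on_sum continuous_on_compose2[OF cont] continuous_intros that) auto
  have cont_Q: "continuous_on UNIV (\<lambda>t. ec (Q h t))" for h
    unfolding Q_def by (intro continuous_intros cont_b)
  have per_Q: "Q h (t + 1) = Q h t" for h t
    using birkhoff_sum_periodic[of f \<alpha> "p * h" "x + of_int (int p) * t" "int p", OF per]
      birkhoff_sum_periodic[of f \<alpha> "p' * h" "x + of_int (int p') * t" "int p'", OF per]
    by (simp add: Q_def algebra_simps)
  have "mean_zero v"
  proof (rule van_der_corput)
    fix \<epsilon> :: real assume e: "\<epsilon> > 0"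
    define S where "S = real p ^ 2 + real p' ^ 2"
    have S: "S > 0" using p prime_gt_0_nat by (simp add: S_def add_pos_pos)
    define \<eta> where "\<eta> = \<epsilon> * \<bar>of_int D\<bar> / (pi * \<bar>of_int b\<bar> * S)"
    have \<eta>: "\<eta> > 0" using e D S bc by (simp add: \<eta>_def)
    obtain L where L: "\<And>n x y. n \<ge> L \<Longrightarrow> \<bar>birkhoff_sum f \<alpha> n x - birkhoff_sum f \<alpha> n y\<bar> \<le> \<eta> * real n * \<bar>x - y\<bar>"
      using birkhoff_sum_deriv_sublinear[OF \<alpha> \<eta>] unfolding eventually_sequentially by blast
    have "\<forall>\<^sub>F N in sequentially. cmod (\<Sum>n = 1..N. v (n + h) * cnj (v n)) \<le> \<epsilon> * real N" if h: "h \<ge> max 1 L" for h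
    proof -
      let ?g = "\<lambda>t. ec (of_int (D * int h) * t) * ec (Q h t)"
      have Dh: "D * int h \<noteq> 0" using D h by simp
      have "cmod (circle_mean ?g) \<le> \<epsilon> / 2"
      proof -
        define s where "s = 1 / (2 * of_int (D * int h) :: real)"
        have Qd: "\<bar>Q h t - Q h (t + s)\<bar> \<le> \<bar>of_int b\<bar> * (\<eta> * real h * S * \<bar>s\<bar>)" for t
        proof -
          have 1: "\<bar>birkhoff_sum f \<alpha> (k * h) (x + of_int (int k) * t) - birkhoff_sum f \<alpha> (k * h) (x + of_int (int k) * (t + s))\<bar>
              \<le> \<eta> * real h * real k ^ 2 * \<bar>s\<bar>" if "k > 0" for k
          proof -
            have "k * h \<ge> L" using h that by (metis max.bounded_iff mult_le_mono1 mult_1 order_trans Suc_leI One_nat_def)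
            from L[OF this, of "x + of_int (int k) * t" "x + of_int (int k) * (t + s)"]
            show ?thesis by (simp add: algebra_simps abs_mult power2_eq_square)
          qed
          have "Q h t - Q h (t + s) = of_int b *
              ((birkhoff_sum f \<alpha> (p * h) (x + of_int (int p) * t) - birkhoff_sum f \<alpha> (p * h) (x + of_int (int p) * (t + s)))
              - (birkhoff_sum f \<alpha> (p' * h) (x + of_int (int p') * t) - birkhoff_sum f \<alpha> (p' * h) (x + of_int (int p') * (t + s))))"
            unfolding Q_def by (simp only: right_diff_distrib)
          then have "\<bar>Q h t - Q h (t + s)\<bar> \<le> \<bar>of_int b\<bar> * (\<eta> * real h * real p ^ 2 * \<bar>s\<bar> + \<eta> * real h * real p' ^ 2 * \<bar>s\<bar>)"
            using 1[of p] 1[of p'] p prime_gt_0_nat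
            by (auto simp: abs_mult intro!: mult_left_mono order_trans[OF abs_triangle_ineq4] add_mono)
          then show ?thesis by (simp add: S_def algebra_simps)
        qed
        have val: "2 * pi * (\<bar>of_int b\<bar> * (\<eta> * real h * S * \<bar>s\<bar>)) = \<epsilon>"
          using S bc D h e by (simp add: \<eta>_def s_def abs_mult field_simps)
        have "cmod (circle_mean ?g) \<le> \<epsilon> / 2"
        proof (rule circle_mean_half_period[OF cont_Q _ Dh])
          show "ec (Q h (t + 1)) = ec (Q h t)" for t by (simp add: per_Q)
          show "cmod (ec (Q h t) - ec (Q h (t + 1 / (2 * of_int (D * int h))))) \<le> \<epsilon>" for t
          proof -
            have "cmod (ec (Q h t) - ec (Q h (t + s))) \<le> 2 * pi * \<bar>Q h t - Q h (t + s)\<bar>" by (rule norm_ec_diff)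
            also have "\<dots> \<le> 2 * pi * (\<bar>of_int b\<bar> * (\<eta> * real h * S * \<bar>s\<bar>))"
              by (intro mult_left_mono Qd) auto
            also have "\<dots> = \<epsilon>" by (rule val)
            finally show ?thesis by (simp add: s_def)
          qed
        qed
        then show ?thesis .
      qed
      moreover have "\<forall>\<^sub>F N in sequentially. \<forall>x. cmod ((\<Sum>n<N. ?g (x + of_nat n * \<alpha>)) - of_nat N * circle_mean ?g) \<le> \<epsilon> / 2 * real N"
      proof (rule weyl_equidistribution[OF \<alpha>])
        show "continuous_on UNIV ?g" by (intro continuous_intros cont_Q)
        show "?g (x + 1) = ?g x" for x
        proof -
          have "ec (of_int (D * int h) * (x + 1)) = ec (of_int (D * int h) * x)"
            by (rule ec_cong_int) (simp add: distrib_left)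
          then show ?thesis by (simp add: per_Q)
        qed
      qed (use e in simp)
      ultimately show ?thesis
      proof (elim eventually_mono)
        fix N assume *: "\<forall>x. cmod ((\<Sum>n<N. ?g (x + of_nat n * \<alpha>)) - of_nat N * circle_mean ?g) \<le> \<epsilon> / 2 * real N"
          and m: "cmod (circle_mean ?g) \<le> \<epsilon> / 2"
        have "(\<Sum>n = 1..N. v (n + h) * cnj (v n)) = (\<Sum>n<N. ?g (\<alpha> + of_nat n * \<alpha>))"
        proof -
          have "\<alpha> + of_nat n * \<alpha> = of_nat (Suc n) * \<alpha>" for n by (simp add: distrib_right)
          then show ?thesis
            unfolding cor by (simp only:) (rule sum.reindex_bij_witness[of _ Suc "\<lambda>n. n - 1"], auto)
        qed
        moreover have "cmod (\<Sum>n<N. ?g (\<alpha> + of_nat n * \<alpha>))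
            \<le> cmod (of_nat N * circle_mean ?g) + cmod ((\<Sum>n<N. ?g (\<alpha> + of_nat n * \<alpha>)) - of_nat N * circle_mean ?g)"
          by (rule norm_triangle_sub)
        moreover have "cmod (of_nat N * circle_mean ?g) \<le> \<epsilon> / 2 * real N"
          using mult_left_mono[OF m, of "real N"] by (simp add: norm_mult mult.commute)
        ultimately show "cmod (\<Sum>n = 1..N. v (n + h) * cnj (v n)) \<le> \<epsilon> * real N"
          using *[rule_format, of \<alpha>] by simp
      qed
    qed
    then show "\<exists>L. \<forall>h\<ge>L. \<forall>\<^sub>F N in sequentially. cmod (\<Sum>n = 1..N. v (n + h) * cnj (v n)) \<le> \<epsilon> * real N" by blast
  qed (simp add: v_def)
  moreover have "v = (\<lambda>n. ec (\<phi> (p * n)) * cnj (ec (\<phi> (p' * n))))"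
    by (rule ext) (simp only: v_def cnj_ec ec_diff)
  ultimately have "mean_zero (\<lambda>n. ec (\<phi> (p * n)) * cnj (ec (\<phi> (p' * n))))" by (simp only:)
  then show "mean_zero (\<lambda>n. ec (of_int a * (x + of_nat (p * n) * \<alpha>)
      + of_int b * (y + birkhoff_sum (\<lambda>t. of_int c * t + f t) \<alpha> (p * n) x))
    * cnj (ec (of_int a * (x + of_nat (p' * n) * \<alpha>)
      + of_int b * (y + birkhoff_sum (\<lambda>t. of_int c * t + f t) \<alpha> (p' * n) x))))"
    unfolding \<phi>_def .
qed simp

end

(*FILE dev7/Four*)
definition fourier_coeff :: "(real \<Rightarrow> complex) \<Rightarrow> int \<Rightarrow> complex"
  where "fourier_coeff g n = circle_mean (\<lambda>x. g x * ec (- (of_int n * x)))"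

lemma circle_mean_sum:
  "finite I \<Longrightarrow> (\<And>i. i \<in> I \<Longrightarrow> continuous_on UNIV (g i)) \<Longrightarrow> circle_mean (\<lambda>x. \<Sum>i\<in>I. g i x) = (\<Sum>i\<in>I. circle_mean (g i))"
  unfolding circle_mean_def by (rule integral_sum) (auto intro: integrable_circle)

lemma circle_mean_cnj:
  assumes "continuous_on UNIV g"
  shows "circle_mean (\<lambda>x. cnj (g x)) = cnj (circle_mean g)"
  unfolding circle_mean_def
  using integral_linear[OF integrable_circle[OF assms] bounded_linear_cnj] by (simp add: o_def)

lemma continuous_on_cnj' [continuous_intros]: "continuous_on A g \<Longrightarrow> continuous_on A (\<lambda>x. cnj (g x))"
  by (rule continuous_on_cnj)

lemma fourier_coeff_cnj:
  assumes "continuous_on UNIV g" "\<And>x. cnj (g x) = g x"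
  shows "fourier_coeff g (- n) = cnj (fourier_coeff g n)"
proof -
  have "cnj (fourier_coeff g n) = circle_mean (\<lambda>x. cnj (g x * ec (- (of_int n * x))))"
    unfolding fourier_coeff_def by (rule circle_mean_cnj[symmetric]) (intro continuous_intros assms)
  then show ?thesis by (simp add: fourier_coeff_def assms cnj_ec)
qed

lemma fourier_coeff_shift:
  assumes "continuous_on UNIV g" "\<And>x. g (x + 1) = g x"
  shows "fourier_coeff (\<lambda>x. g (x + s)) n = ec (of_int n * s) * fourier_coeff g n"
proof -
  let ?h = "\<lambda>x. g x * ec (- (of_int n * x))"
  have per: "?h (x + 1) = ?h x" for x
  proof -
    have "ec (- (of_int n * (x + 1))) = ec (- (of_int n * x))" by (rule ec_cong_int) (simp add: distrib_left)
    then show ?thesis using assms(2) by simp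
  qed
  have ch: "continuous_on UNIV ?h" by (intro continuous_intros assms(1))
  have "fourier_coeff (\<lambda>x. g (x + s)) n = circle_mean (\<lambda>x. ec (of_int n * s) * ?h (x + s))"
    unfolding fourier_coeff_def by (simp add: mult.left_commute flip: ec_add) (simp add: algebra_simps)
  also have "\<dots> = ec (of_int n * s) * circle_mean (\<lambda>x. ?h (x + s))" by (rule circle_mean_cmult)
  also have "circle_mean (\<lambda>x. ?h (x + s)) = circle_mean ?h"
    using circle_mean_affine[where g = ?h and k = 1 and s = s, OF ch per] by simp
  finally show ?thesis by (simp add: fourier_coeff_def)
qed

text \<open>Uniqueness: trigonometric polynomials are dense, so a function orthogonal to all characters is orthogonal to itself.\<close>

lemma fourier_unique:
  fixes g :: "real \<Rightarrow> complex"
  assumes g: "continuous_on UNIV g" "\<And>x. g (x + 1) = g x" and zero: "\<And>n. fourier_coeff g n = 0"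
  shows "g x = 0"
proof -
  let ?P = "\<lambda>h. continuous_on UNIV h \<and> circle_mean (\<lambda>x. g x * h x) = 0"
  obtain B where B: "B > 0" "\<And>x. cmod (g x) \<le> B"
  proof -
    have "compact (g ` {0..1})"
      by (intro compact_continuous_image continuous_on_subset[OF g(1)]) auto
    then obtain B where B: "B > 0" "\<And>x. x \<in> {0..1} \<Longrightarrow> cmod (g x) \<le> B"
      using compact_imp_bounded bounded_pos by (metis (no_types, lifting) image_eqI)
    have "cmod (g x) \<le> B" for x
    proof -
      have "g x = g (frac x)"
        using periodic_int_shift[of g "frac x" "\<lfloor>x\<rfloor>", OF g(2)] by (simp add: frac_def)
      moreover have "frac x \<in> {0..1}" using frac_lt_1[of x] by (simp add: less_imp_le)
      ultimately show ?thesis using B(2) by simp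
    qed
    then show thesis using that B(1) by blast
  qed
  have "?P (\<lambda>x. cnj (g x))"
  proof (rule circle_function_induct[where P = ?P])
    show "continuous_on UNIV (\<lambda>x. cnj (g x))" by (intro continuous_intros g)
    show "?P (\<lambda>x. c * ec (of_int a * x))" for c a
    proof
      have "circle_mean (\<lambda>x. g x * (c * ec (of_int a * x))) = circle_mean (\<lambda>x. c * (g x * ec (- (of_int (- a) * x))))"
        by (simp add: mult_ac)
      also have "\<dots> = 0" using zero[of "- a"] unfolding circle_mean_cmult fourier_coeff_def by simp
      finally show "circle_mean (\<lambda>x. g x * (c * ec (of_int a * x))) = 0" .
    qed (intro continuous_intros)
    show "?P (\<lambda>x. h1 x + h2 x)" if "?P h1" "?P h2" for h1 h2
      using that g(1) by (simp add: distrib_left circle_mean_add continuous_on_add continuous_on_mult)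
    show "?P (\<lambda>x. cnj (g x))" if *: "\<And>\<epsilon>. \<epsilon> > 0 \<Longrightarrow> \<exists>h. ?P h \<and> (\<forall>x. cmod (cnj (g x) - h x) \<le> \<epsilon>)"
    proof
      have "cmod (circle_mean (\<lambda>x. g x * cnj (g x))) \<le> 0 + \<epsilon>" if e: "\<epsilon> > 0" for \<epsilon>
      proof -
        obtain h where h: "?P h" "\<And>x. cmod (cnj (g x) - h x) \<le> \<epsilon> / B" using *[of "\<epsilon> / B"] e B(1) by auto
        have "cmod (circle_mean (\<lambda>x. g x * cnj (g x)) - circle_mean (\<lambda>x. g x * h x)) \<le> \<epsilon>"
        proof (rule circle_mean_diff_le)
          show "cmod (g x * cnj (g x) - g x * h x) \<le> \<epsilon>" for x
            using mult_mono[OF B(2)[of x] h(2)[of x]] B(1) by (simp add: norm_mult flip: right_diff_distrib)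
        qed (use h(1) in \<open>auto intro!: continuous_intros g\<close>)
        then show ?thesis using h(1) by simp
      qed
      then show "circle_mean (\<lambda>x. g x * cnj (g x)) = 0"
        using field_le_epsilon[of "cmod (circle_mean (\<lambda>x. g x * cnj (g x)))" 0] by simp
    qed (intro continuous_intros g)
  qed (simp add: g(2))
  then have "integral {0..1} (\<lambda>x. complex_of_real ((cmod (g x))\<^sup>2)) = 0"
    by (simp only: circle_mean_def complex_norm_square)
  moreover have cn: "continuous_on UNIV (\<lambda>x. (cmod (g x))\<^sup>2)" by (intro continuous_intros g)
  then have int: "(\<lambda>x. (cmod (g x))\<^sup>2) integrable_on {0..1}"
    by (intro integrable_continuous_real continuous_on_subset[OF cn]) auto
  ultimately have "integral {0..1} (\<lambda>x. (cmod (g x))\<^sup>2) = 0"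
    using integral_linear[OF int bounded_linear_of_real[where 'a = complex]] by (simp add: o_def)
  then have z: "(cmod (g x))\<^sup>2 = 0" if "x \<in> {0..1}" for x
    using integral_eq_0_iff[of 0 1 "\<lambda>x. (cmod (g x))\<^sup>2"] that continuous_on_subset[OF cn, of "{0..1}"] by auto
  have "g x = g (frac x)"
    using periodic_int_shift[of g "frac x" "\<lfloor>x\<rfloor>", OF g(2)] by (simp add: frac_def)
  moreover have "frac x \<in> {0..1}" using frac_lt_1[of x] by (simp add: less_imp_le)
  ultimately show ?thesis using z by simp
qed

lemma fourier_inversion:
  fixes g :: "real \<Rightarrow> complex"
  assumes g: "continuous_on UNIV g" "\<And>x. g (x + 1) = g x" and real: "\<And>x. cnj (g x) = g x"
    and summ: "summable (\<lambda>k. cmod (fourier_coeff g (int (Suc k))))"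
  defines "term \<equiv> \<lambda>k y. fourier_coeff g (int (Suc k)) * ec (of_int (int (Suc k)) * y)
      + cnj (fourier_coeff g (int (Suc k))) * ec (of_int (- int (Suc k)) * y)"
  shows "(\<lambda>k. term k y) sums (g y - fourier_coeff g 0)"
proof -
  define h where "h y = (\<Sum>k. term k y)" for y
  have tb: "cmod (term k y) \<le> 2 * cmod (fourier_coeff g (int (Suc k)))" for k y
    unfolding term_def by (rule order_trans[OF norm_triangle_ineq]) (simp add: norm_mult)
  have s2: "summable (\<lambda>k. 2 * cmod (fourier_coeff g (int (Suc k))))" by (rule summable_mult[OF summ])
  have ul: "uniform_limit UNIV (\<lambda>N y. \<Sum>k<N. term k y) h sequentially"
    unfolding h_def by (rule Weierstrass_m_test[OF tb s2])
  have ct: "continuous_on UNIV (term k)" for k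
    unfolding term_def by (intro continuous_intros)
  have cN: "continuous_on UNIV (\<lambda>y. \<Sum>k<N. term k y)" for N
    by (intro continuous_on_sum ct)
  have ch: "continuous_on UNIV h"
    by (rule uniform_limit_theorem[OF always_eventually ul]) (auto intro: cN)
  have pt: "term k (y + 1) = term k y" for k y
  proof -
    have "ec (of_int n * (y + 1)) = ec (of_int n * y)" for n
      by (rule ec_cong_int) (simp add: distrib_left)
    then show ?thesis by (simp only: term_def)
  qed
  define D where "D y = g y - fourier_coeff g 0 - h y" for y
  have cD: "continuous_on UNIV D" unfolding D_def by (intro continuous_intros g ch)
  have D0: "fourier_coeff D n = 0" for n
  proof -
    let ?e = "\<lambda>x. ec (- (of_int n * x))"
    have part: "circle_mean (\<lambda>x. (\<Sum>k<N. term k x) * ?e x) = fourier_coeff g n - (if n = 0 then fourier_coeff g 0 else 0)"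
      if N: "nat \<bar>n\<bar> \<le> N" for N
    proof -
      have cm: "circle_mean (\<lambda>x. c * ec (of_int m * x) * ?e x) = (if m = n then c else 0)" for c m
      proof -
        have "(\<lambda>x. c * ec (of_int m * x) * ?e x) = (\<lambda>x. c * ec (of_int (m - n) * x + 0))"
          by (rule ext) (simp add: mult.assoc left_diff_distrib flip: ec_add)
        then show ?thesis using circle_mean_ec[of c "m - n" 0] by simp
      qed
      have "circle_mean (\<lambda>x. (\<Sum>k<N. term k x) * ?e x) = (\<Sum>k<N. circle_mean (\<lambda>x. term k x * ?e x))"
        unfolding sum_distrib_right by (rule circle_mean_sum) (auto intro!: continuous_intros ct)
      also have "\<dots> = (\<Sum>k<N. (if int (Suc k) = n then fourier_coeff g (int (Suc k)) else 0)
          + (if - int (Suc k) = n then cnj (fourier_coeff g (int (Suc k))) else 0))"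
      proof (rule sum.cong[OF refl])
        fix k
        show "circle_mean (\<lambda>x. term k x * ?e x) = (if int (Suc k) = n then fourier_coeff g (int (Suc k)) else 0)
          + (if - int (Suc k) = n then cnj (fourier_coeff g (int (Suc k))) else 0)"
          unfolding term_def distrib_right
          by (subst circle_mean_add) (intro continuous_intros, intro continuous_intros, simp only: cm)
      qed
      also have "\<dots> = (\<Sum>k<N. if k = nat n - 1 \<and> n > 0 then fourier_coeff g n else 0)
          + (\<Sum>k<N. if k = nat (- n) - 1 \<and> n < 0 then fourier_coeff g n else 0)"
        unfolding sum.distrib
      proof (rule arg_cong2[of _ _ _ _ "(+)"]; rule sum.cong[OF refl])
        fix k
        show "(if int (Suc k) = n then fourier_coeff g (int (Suc k)) else 0) = (if k = nat n - 1 \<and> n > 0 then fourier_coeff g n else 0)"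
          by auto
        show "(if - int (Suc k) = n then cnj (fourier_coeff g (int (Suc k))) else 0) = (if k = nat (- n) - 1 \<and> n < 0 then fourier_coeff g n else 0)"
        proof (cases "- int (Suc k) = n")
          case True
          have "k = nat (- n) - 1 \<and> n < 0" using True by auto
          moreover have "fourier_coeff g n = cnj (fourier_coeff g (int (Suc k)))"
            unfolding True[symmetric] by (rule fourier_coeff_cnj[OF g(1) real])
          ultimately show ?thesis using True by simp
        next
          case False
          then have "\<not> (k = nat (- n) - 1 \<and> n < 0)" by auto
          then show ?thesis unfolding if_not_P[OF False] by (simp only: if_False)
        qed
      qed
      also have "\<dots> = fourier_coeff g n - (if n = 0 then fourier_coeff g 0 else 0)"
      proof -
        consider "n = 0" | "n > 0" | "n < 0" by linarith
        then show ?thesis by cases (use N in \<open>auto simp: sum.delta\<close>)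
      qed
      finally show ?thesis .
    qed
    have "circle_mean (\<lambda>x. h x * ?e x) = fourier_coeff g n - (if n = 0 then fourier_coeff g 0 else 0)"
    proof -
      have "cmod (circle_mean (\<lambda>x. h x * ?e x) - (fourier_coeff g n - (if n = 0 then fourier_coeff g 0 else 0))) \<le> 0 + \<epsilon>"
        if e: "\<epsilon> > 0" for \<epsilon>
      proof -
        have "\<forall>\<^sub>F N in sequentially. \<forall>x\<in>UNIV. dist (\<Sum>k<N. term k x) (h x) < \<epsilon>"
          using ul e unfolding uniform_limit_iff by blast
        then obtain N0 where N0: "\<And>N x. N \<ge> N0 \<Longrightarrow> dist (\<Sum>k<N. term k x) (h x) < \<epsilon>"
          unfolding eventually_sequentially by blast
        define N where "N = max N0 (nat \<bar>n\<bar>)"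
        have "cmod (circle_mean (\<lambda>x. h x * ?e x) - circle_mean (\<lambda>x. (\<Sum>k<N. term k x) * ?e x)) \<le> \<epsilon>"
        proof (rule circle_mean_diff_le)
          show "cmod (h x * ?e x - (\<Sum>k<N. term k x) * ?e x) \<le> \<epsilon>" for x
            using N0[of N x] by (simp add: N_def dist_norm norm_minus_commute norm_mult less_imp_le flip: left_diff_distrib)
        qed (intro continuous_intros ch cN)+
        then show ?thesis using part[of N] by (simp add: N_def)
      qed
      then show ?thesis
        using field_le_epsilon[of "cmod (circle_mean (\<lambda>x. h x * ?e x) - (fourier_coeff g n - (if n = 0 then fourier_coeff g 0 else 0)))" 0] by simp
    qed
    moreover have "circle_mean (\<lambda>x. fourier_coeff g 0 * ?e x) = (if n = 0 then fourier_coeff g 0 else 0)"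
      using circle_mean_ec[of "fourier_coeff g 0" "- n" 0] by simp
    moreover have "fourier_coeff D n = fourier_coeff g n - circle_mean (\<lambda>x. fourier_coeff g 0 * ?e x) - circle_mean (\<lambda>x. h x * ?e x)"
    proof -
      have "fourier_coeff D n = circle_mean (\<lambda>x. g x * ?e x + ((-1) * (fourier_coeff g 0 * ?e x) + (-1) * (h x * ?e x)))"
        unfolding fourier_coeff_def[of D] D_def by (simp add: left_diff_distrib algebra_simps)
      also have "\<dots> = circle_mean (\<lambda>x. g x * ?e x) + (circle_mean (\<lambda>x. (-1) * (fourier_coeff g 0 * ?e x)) + circle_mean (\<lambda>x. (-1) * (h x * ?e x)))"
        by (subst circle_mean_add, (intro continuous_intros g ch)+, subst circle_mean_add) (intro continuous_intros g ch refl)+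
      also have "\<dots> = fourier_coeff g n - circle_mean (\<lambda>x. fourier_coeff g 0 * ?e x) - circle_mean (\<lambda>x. h x * ?e x)"
        unfolding circle_mean_cmult by (simp add: fourier_coeff_def)
      finally show ?thesis .
    qed
    ultimately show ?thesis by simp
  qed
  have "D (x + 1) = D x" for x unfolding D_def h_def by (simp only: g(2) pt)
  then have "D y = 0" by (rule fourier_unique[OF cD _ D0])
  then have hy: "h y = g y - fourier_coeff g 0" by (simp add: D_def)
  have "summable (\<lambda>k. term k y)"
    by (rule summable_comparison_test'[OF s2, where N = 0]) (rule tb)
  then have "(\<lambda>k. term k y) sums h y" unfolding h_def by (rule summable_sums)
  then show ?thesis unfolding hy .
qed

(*FILE dev7/Four2*)
lemma real_function_fourier_bound:
  fixes g :: "real \<Rightarrow> complex"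
  assumes g: "continuous_on UNIV g" "\<And>x. g (x + 1) = g x" "\<And>x. cnj (g x) = g x"
    and s: "summable (\<lambda>k. cmod (fourier_coeff g (int (Suc k))))"
  shows "cmod (g y - fourier_coeff g 0) \<le> 2 * (\<Sum>k. cmod (fourier_coeff g (int (Suc k))))"
proof -
  let ?t = "\<lambda>k. fourier_coeff g (int (Suc k)) * ec (of_int (int (Suc k)) * y)
      + cnj (fourier_coeff g (int (Suc k))) * ec (of_int (- int (Suc k)) * y)"
  have tb: "cmod (?t k) \<le> 2 * cmod (fourier_coeff g (int (Suc k)))" for k
    by (rule order_trans[OF norm_triangle_ineq]) (simp add: norm_mult)
  have "cmod (\<Sum>k. ?t k) \<le> (\<Sum>k. 2 * cmod (fourier_coeff g (int (Suc k))))"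
    by (rule norm_suminf_le[OF tb summable_mult[OF s]])
  moreover have "(\<Sum>k. ?t k) = g y - fourier_coeff g 0"
    by (rule sums_unique[OF fourier_inversion[OF g s], symmetric])
  ultimately show ?thesis by (simp only: suminf_mult[OF s])
qed

lemma fourier_coeff_sum_shifts:
  fixes g :: "real \<Rightarrow> complex"
  assumes g: "continuous_on UNIV g" "\<And>x. g (x + 1) = g x" and q: "q > 0"
  shows "fourier_coeff (\<lambda>x. \<Sum>i<q. g (x + of_nat i / of_nat q)) n = (if int q dvd n then of_nat q * fourier_coeff g n else 0)"
proof -
  have cs: "continuous_on UNIV (\<lambda>x. g (x + s))" for s
    by (intro continuous_on_compose2[OF g(1)] continuous_intros) auto
  have "fourier_coeff (\<lambda>x. \<Sum>i<q. g (x + of_nat i / of_nat q)) n = (\<Sum>i<q. fourier_coeff (\<lambda>x. g (x + of_nat i / of_nat q)) n)"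
    unfolding fourier_coeff_def sum_distrib_right by (rule circle_mean_sum) (auto intro!: continuous_intros cs)
  also have "\<dots> = (\<Sum>i<q. ec (of_nat i * (of_int n / of_nat q)) * fourier_coeff g n)"
    by (simp add: fourier_coeff_shift[OF g] mult.commute)
  also have "\<dots> = (\<Sum>i<q. ec (of_nat i * (of_int n / of_nat q))) * fourier_coeff g n"
    by (rule sum_distrib_right[symmetric])
  finally show ?thesis unfolding sum_ec_roots_of_unity[OF q] by simp
qed

locale periodic_C1_Hoelder = periodic_C1 +
  fixes \<delta> C :: real
  assumes \<delta>: "\<delta> > 0" and Hoelder: "\<And>x y. \<bar>f' x - f' y\<bar> \<le> C * \<bar>x - y\<bar> powr \<delta>"
begin

abbreviation F :: "real \<Rightarrow> complex"
  where "F x \<equiv> of_real (f x)"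

abbreviation coeff :: "nat \<Rightarrow> complex"
  where "coeff n \<equiv> fourier_coeff F (int n)"

lemma cont_F: "continuous_on UNIV F"
  by (intro continuous_intros cont)

lemma per_F: "F (x + 1) = F x"
  by (simp add: per)

text \<open>Integration by parts, and the half-period shift applied to the Hoelder function \<open>f'\<close>.\<close>

lemma coeff_decay: "n > 0 \<Longrightarrow> cmod (coeff n) \<le> \<bar>C\<bar> * real n powr (- 1 - \<delta>)"
proof -
  assume n: "n > 0"
  let ?e = "\<lambda>x. ec (of_int (- int n) * x)"
  define c where "c = 2 * pi * \<i> * of_nat n"
  have cf': "continuous_on UNIV (\<lambda>x. complex_of_real (f' x))" by (intro continuous_intros cont_deriv)
  have "((\<lambda>x. F x * ?e x) has_vector_derivative (of_real (f' x) * ?e x - c * (F x * ?e x))) (at x within {0..1})" for x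
  proof -
    have 1: "(F has_vector_derivative of_real (f' x)) (at x within {0..1})"
      using has_vector_derivative_of_real[OF has_field_derivative_at_within[OF deriv[of x], of "{0..1}"], where 'a = complex]
      by simp
    have cis: "(cis has_vector_derivative \<i> * cis y) (at y within T)" for y T
    proof -
      have "((\<lambda>y. exp (\<i> * of_real y)) has_vector_derivative \<i> * exp (\<i> * of_real y)) (at y within T)"
        by (auto intro!: derivative_eq_intros has_vector_derivative_real_field[where f = "\<lambda>z. exp (\<i> * z)"])
      then show ?thesis by (simp only: cis_conv_exp[symmetric])
    qed
    have "((\<lambda>x. 2 * pi * (of_int (- int n) * x)) has_vector_derivative (2 * pi * of_int (- int n))) (at x within {0..1})"
      by (auto intro!: derivative_eq_intros simp flip: has_real_derivative_iff_has_vector_derivative)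
    from vector_diff_chain_within[OF this cis]
    have "(?e has_vector_derivative (2 * pi * of_int (- int n)) *\<^sub>R (\<i> * ?e x)) (at x within {0..1})"
      by (simp add: o_def ec_def)
    from has_vector_derivative_mult[OF 1 this] show ?thesis
      by (rule has_vector_derivative_eq_rhs) (simp add: c_def scaleR_conv_of_real algebra_simps)
  qed
  then have "((\<lambda>x. of_real (f' x) * ?e x - c * (F x * ?e x)) has_integral (F 1 * ?e 1 - F 0 * ?e 0)) {0..1}"
    by (intro fundamental_theorem_of_calculus) auto
  moreover have "F 1 * ?e 1 = F 0 * ?e 0" using per[of 0] by simp
  ultimately have "circle_mean (\<lambda>x. of_real (f' x) * ?e x - c * (F x * ?e x)) = 0"
    unfolding circle_mean_def by (simp add: integral_unique)
  moreover have "circle_mean (\<lambda>x. of_real (f' x) * ?e x + (- c) * (F x * ?e x))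
      = circle_mean (\<lambda>x. of_real (f' x) * ?e x) + circle_mean (\<lambda>x. (- c) * (F x * ?e x))"
    by (rule circle_mean_add) (intro continuous_intros cf' cont_F)+
  moreover have "circle_mean (\<lambda>x. F x * ?e x) = coeff n" by (simp add: fourier_coeff_def)
  ultimately have eq: "circle_mean (\<lambda>x. of_real (f' x) * ?e x) = c * coeff n"
    unfolding circle_mean_cmult by simp
  have "cmod (circle_mean (\<lambda>x. ?e x * of_real (f' x))) \<le> (\<bar>C\<bar> * real n powr (- \<delta>)) / 2"
  proof (rule circle_mean_half_period[OF cf'])
    show "complex_of_real (f' (x + 1)) = of_real (f' x)" for x by (simp add: per_deriv)
    show "- int n \<noteq> 0" using n by simp
    show "cmod (complex_of_real (f' t) - of_real (f' (t + 1 / (2 * of_int (- int n))))) \<le> \<bar>C\<bar> * real n powr (- \<delta>)" for t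
    proof -
      have "\<bar>f' t - f' (t + 1 / (2 * of_int (- int n)))\<bar> \<le> C * (1 / (2 * real n)) powr \<delta>"
        using Hoelder[of t "t + 1 / (2 * of_int (- int n))"] by simp
      also have "\<dots> \<le> \<bar>C\<bar> * (1 / real n) powr \<delta>"
        using n \<delta> by (intro mult_mono powr_mono2) (auto simp: field_simps)
      also have "(1 / real n) powr \<delta> = real n powr (- \<delta>)"
        using n by (simp add: powr_minus powr_divide inverse_eq_divide)
      finally show ?thesis by (metis norm_of_real of_real_diff)
    qed
  qed
  then have "cmod c * cmod (coeff n) \<le> \<bar>C\<bar> * real n powr (- \<delta>) / 2"
    using eq by (simp add: mult.commute norm_mult)
  moreover have "cmod c = 2 * pi * real n" by (simp add: c_def norm_mult)
  ultimately have "(4 * pi) * (real n * cmod (coeff n)) \<le> \<bar>C\<bar> * real n powr (- \<delta>)" by simp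
  moreover have "1 * (real n * cmod (coeff n)) \<le> (4 * pi) * (real n * cmod (coeff n))"
    using pi_gt3 by (intro mult_right_mono) auto
  ultimately have "real n * cmod (coeff n) \<le> \<bar>C\<bar> * real n powr (- \<delta>)" by linarith
  then have "cmod (coeff n) \<le> \<bar>C\<bar> * real n powr (- \<delta>) / real n" using n by (simp add: field_simps)
  also have "\<dots> = \<bar>C\<bar> * real n powr (- 1 - \<delta>)" using n by (simp add: powr_diff powr_minus field_simps)
  finally show ?thesis .
qed

lemma summable_coeff: "summable (\<lambda>k. cmod (coeff (Suc k)))"
proof (rule summable_comparison_test'[where N = 0])
  show "summable (\<lambda>k. \<bar>C\<bar> * real (Suc k) powr (- 1 - \<delta>))"
    using \<delta> summable_Suc_iff[of "\<lambda>n. real n powr (- 1 - \<delta>)"]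
    by (intro summable_mult) (simp add: summable_real_powr_iff)
  show "norm (cmod (coeff (Suc k))) \<le> \<bar>C\<bar> * real (Suc k) powr (- 1 - \<delta>)" for k
    using coeff_decay[of "Suc k"] by simp
qed

definition resonance_constant :: real
  where "resonance_constant = 2 * (\<Sum>k. real (Suc k) powr (- 1 - \<delta> / 2))"

definition resonant :: "nat \<Rightarrow> bool"
  where "resonant q \<longleftrightarrow> q > 0 \<and> coeff q \<noteq> 0
    \<and> (\<forall>y. \<bar>(\<Sum>i<q. f (y + of_nat i / of_nat q)) - of_nat q * Re (coeff 0)\<bar> \<le> resonance_constant * (of_nat q * cmod (coeff q)))"

lemma summable_resonance: "summable (\<lambda>k. real (Suc k) powr (- 1 - \<delta> / 2))"
  using \<delta> summable_Suc_iff[of "\<lambda>n. real n powr (- 1 - \<delta> / 2)"] by (simp add: summable_real_powr_iff)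

lemma resonance_constant_ge_1: "resonance_constant \<ge> 1"
proof -
  have "(\<Sum>k<1. real (Suc k) powr (- 1 - \<delta> / 2)) \<le> (\<Sum>k. real (Suc k) powr (- 1 - \<delta> / 2))"
    by (rule sum_le_suminf[OF summable_resonance]) auto
  then show ?thesis by (simp add: resonance_constant_def)
qed

text \<open>
  If \<open>f\<close> has infinitely many frequencies, infinitely many of them dominate all of their
  multiples: take \<open>q\<close> where \<open>n\<^bsup>1 + \<delta>/2\<^esup> |f^(n)|\<close> is maximal among \<open>n \<ge> q\<close>.  For such \<open>q\<close> the sum
  of \<open>f\<close> over the translates by multiples of \<open>1 / q\<close>, which only sees the frequencies divisible by
  \<open>q\<close>, is controlled by the single coefficient at \<open>q\<close>.
\<close>

lemma infinitely_many_resonant: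
  assumes inf: "\<And>j. \<exists>n\<ge>j. coeff n \<noteq> 0"
  shows "\<exists>q\<ge>j. resonant q"
proof -
  define \<tau> where "\<tau> n = real n powr (1 + \<delta> / 2) * cmod (coeff n)" for n
  have \<tau>_le: "\<tau> n \<le> \<bar>C\<bar> * real n powr (- (\<delta> / 2))" if "n > 0" for n
  proof -
    have "\<tau> n \<le> real n powr (1 + \<delta> / 2) * (\<bar>C\<bar> * real n powr (- 1 - \<delta>))"
      unfolding \<tau>_def using coeff_decay[OF that] by (rule mult_left_mono) simp
    also have "\<dots> = \<bar>C\<bar> * (real n powr (1 + \<delta> / 2) * real n powr (- 1 - \<delta>))" by simp
    also have "real n powr (1 + \<delta> / 2) * real n powr (- 1 - \<delta>) = real n powr (- (\<delta> / 2))"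
      unfolding powr_add[symmetric] by (simp add: field_simps)
    finally show ?thesis .
  qed
  have lim: "(\<lambda>n. \<bar>C\<bar> * real n powr (- (\<delta> / 2))) \<longlonglongrightarrow> 0"
    using \<delta> by (intro tendsto_mult_right_zero tendsto_neg_powr filterlim_real_sequentially) auto
  obtain n0 where n0: "n0 \<ge> max 1 j" "coeff n0 \<noteq> 0" using inf by blast
  then have "\<tau> n0 > 0" by (simp add: \<tau>_def)
  then have "\<forall>\<^sub>F n in sequentially. \<bar>C\<bar> * real n powr (- (\<delta> / 2)) < \<tau> n0"
    by (rule order_tendstoD(2)[OF lim])
  then obtain N where N: "\<And>n. n \<ge> N \<Longrightarrow> \<bar>C\<bar> * real n powr (- (\<delta> / 2)) < \<tau> n0"
    unfolding eventually_sequentially by blast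
  define S where "S = {n. n \<ge> max 1 j \<and> \<tau> n \<ge> \<tau> n0}"
  have "S \<subseteq> {..N}"
  proof
    fix n assume n: "n \<in> S"
    show "n \<in> {..N}"
    proof (rule ccontr)
      assume "n \<notin> {..N}"
      then have "\<tau> n < \<tau> n0" using N[of n] \<tau>_le[of n] n by (simp add: S_def)
      then show False using n by (simp add: S_def)
    qed
  qed
  then have "finite S" using finite_subset by blast
  moreover have "n0 \<in> S" using n0 by (simp add: S_def)
  ultimately obtain q where q: "q \<in> S" "\<And>n. n \<in> S \<Longrightarrow> \<tau> n \<le> \<tau> q"
    using Max_in[of "\<tau> ` S"] Max_ge[of "\<tau> ` S"] by (metis (no_types, lifting) empty_iff finite_imageI image_iff image_is_empty)
  have q0: "q > 0" "q \<ge> j" "\<tau> q \<ge> \<tau> n0" using q(1) by (auto simp: S_def)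
  have max: "\<tau> n \<le> \<tau> q" if "n \<ge> q" for n
  proof (cases "n \<in> S")
    case False
    then have "\<tau> n < \<tau> n0" using that q(1) by (auto simp: S_def)
    then show ?thesis using q0 by linarith
  qed (rule q(2))
  have mult: "cmod (coeff (q * Suc k)) \<le> cmod (coeff q) * real (Suc k) powr (- 1 - \<delta> / 2)" for k
  proof -
    have "\<tau> (q * Suc k) \<le> \<tau> q" by (rule max) simp
    then have "real q powr (1 + \<delta> / 2) * (real (Suc k) powr (1 + \<delta> / 2) * cmod (coeff (q * Suc k))) \<le> real q powr (1 + \<delta> / 2) * cmod (coeff q)"
      unfolding \<tau>_def of_nat_mult by (subst (asm) powr_mult) (auto simp: mult_ac)
    then have "real (Suc k) powr (1 + \<delta> / 2) * cmod (coeff (q * Suc k)) \<le> cmod (coeff q)"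
      using q0(1) by simp
    then have "cmod (coeff (q * Suc k)) \<le> cmod (coeff q) / real (Suc k) powr (1 + \<delta> / 2)"
      by (simp add: pos_le_divide_eq mult.commute del: of_nat_Suc)
    also have "\<dots> = cmod (coeff q) * real (Suc k) powr (- (1 + \<delta> / 2))"
      unfolding powr_minus_divide by simp
    finally show ?thesis by simp
  qed
  define \<psi> where "\<psi> y = (\<Sum>i<q. F (y + of_nat i / of_nat q))" for y
  have c\<psi>: "continuous_on UNIV \<psi>"
    unfolding \<psi>_def by (intro continuous_intros continuous_on_compose2[OF cont]) auto
  have p\<psi>: "\<psi> (y + 1) = \<psi> y" for y
  proof -
    have "F (y + 1 + s) = F (y + s)" for s using per_F[of "y + s"] by (simp only: add_ac)
    then show ?thesis unfolding \<psi>_def by simp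
  qed
  have r\<psi>: "cnj (\<psi> y) = \<psi> y" for y by (simp add: \<psi>_def)
  have co: "fourier_coeff \<psi> n = (if int q dvd n then of_nat q * fourier_coeff F n else 0)" for n
    unfolding \<psi>_def by (rule fourier_coeff_sum_shifts[OF cont_F per_F q0(1)])
  define w where "w n = (if n = 0 then 0 else cmod (fourier_coeff \<psi> (int n)))" for n :: nat
  have sm: "strict_mono (\<lambda>k. q * Suc k)" using q0(1) by (intro strict_monoI) simp
  have wz: "w n = 0" if "n \<notin> range (\<lambda>k. q * Suc k)" for n
  proof (cases "n = 0 \<or> \<not> q dvd n")
    case False
    then obtain k where "n = q * k" "k > 0" by auto
    then have "n = q * Suc (k - 1)" by simp
    then show ?thesis using that by blast
  qed (auto simp: w_def co)
  have wq: "w (q * Suc k) = real q * cmod (coeff (q * Suc k))" for k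
    using q0(1) by (simp add: w_def co norm_mult del: mult_Suc_right)
  have wb: "w (q * Suc k) \<le> (real q * cmod (coeff q)) * real (Suc k) powr (- 1 - \<delta> / 2)" for k
    unfolding wq using mult_left_mono[OF mult, of "real q" k] by (simp add: mult.assoc)
  have swq: "summable (\<lambda>k. w (q * Suc k))"
  proof (rule summable_comparison_test'[where N = 0])
    show "norm (w (q * Suc k)) \<le> (real q * cmod (coeff q)) * real (Suc k) powr (- 1 - \<delta> / 2)" for k
      using wb[of k] by (simp add: w_def)
    show "summable (\<lambda>k. (real q * cmod (coeff q)) * real (Suc k) powr (- 1 - \<delta> / 2))"
      by (intro summable_mult summable_resonance)
  qed
  have sums_w: "w sums (\<Sum>k. w (q * Suc k))"
    using sums_mono_reindex[OF sm, of w] wz summable_sums[OF swq] by blast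
  have "(\<lambda>n. w (Suc n)) sums ((\<Sum>k. w (q * Suc k)) - w 0)"
    using sums_w sums_Suc_iff[of w] by simp
  then have sums_w': "(\<lambda>n. cmod (fourier_coeff \<psi> (int (Suc n)))) sums (\<Sum>k. w (q * Suc k))"
    by (simp add: w_def)
  have total: "(\<Sum>k. w (q * Suc k)) \<le> (real q * cmod (coeff q)) * (\<Sum>k. real (Suc k) powr (- 1 - \<delta> / 2))"
    unfolding suminf_mult[OF summable_resonance, symmetric]
    by (rule suminf_le[OF wb swq]) (intro summable_mult summable_resonance)
  have "\<bar>(\<Sum>i<q. f (y + of_nat i / of_nat q)) - of_nat q * Re (coeff 0)\<bar> \<le> resonance_constant * (of_nat q * cmod (coeff q))" for y
  proof -
    have "cmod (\<psi> y - fourier_coeff \<psi> 0) \<le> 2 * (\<Sum>k. cmod (fourier_coeff \<psi> (int (Suc k))))"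
      by (rule real_function_fourier_bound[OF c\<psi> p\<psi> r\<psi> sums_summable[OF sums_w']])
    also have "\<dots> \<le> resonance_constant * (of_nat q * cmod (coeff q))"
      using total sums_unique[OF sums_w'] by (simp add: resonance_constant_def mult_ac)
    finally have "\<bar>Re (\<psi> y - fourier_coeff \<psi> 0)\<bar> \<le> resonance_constant * (of_nat q * cmod (coeff q))"
      using abs_Re_le_cmod order_trans by blast
    then show ?thesis by (simp add: \<psi>_def co)
  qed
  moreover have "coeff q \<noteq> 0"
  proof
    assume "coeff q = 0"
    then have "\<tau> q = 0" by (simp add: \<tau>_def)
    then show False using q0(3) \<open>\<tau> n0 > 0\<close> by simp
  qed
  ultimately show ?thesis using q0 by (auto simp: resonant_def)
qed

lemma coeff_times_tendsto_0: "(\<lambda>q. real q * cmod (coeff q)) \<longlonglongrightarrow> 0"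
proof (rule Lim_null_comparison)
  show "(\<lambda>n. \<bar>C\<bar> * real n powr (- \<delta>)) \<longlonglongrightarrow> 0"
    using \<delta> by (intro tendsto_mult_right_zero tendsto_neg_powr filterlim_real_sequentially) auto
  show "\<forall>\<^sub>F q in sequentially. norm (real q * cmod (coeff q)) \<le> \<bar>C\<bar> * real q powr (- \<delta>)"
    using eventually_gt_at_top[of 0]
  proof eventually_elim
    case (elim q)
    have "real q * cmod (coeff q) \<le> real q * (\<bar>C\<bar> * real q powr (- 1 - \<delta>))"
      using coeff_decay[OF elim] by (rule mult_left_mono) simp
    also have "\<dots> = \<bar>C\<bar> * real q powr (- \<delta>)" using elim by (simp add: powr_diff powr_minus field_simps)
    finally show ?case by simp
  qed
qed

text \<open>
  If \<open>f\<close> is a trigonometric polynomial, it is cohomologous to its mean over every irrational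
  rotation, so the phases are linear up to a continuous function on the circle.
\<close>

theorem trigonometric_polynomial_mean_zero:
  fixes a b :: int
  assumes \<alpha>: "\<alpha> \<notin> \<rat>" and fin: "\<And>n. n > J \<Longrightarrow> coeff n = 0"
  shows "mean_zero (\<lambda>n. ec (of_int a * (x + of_nat n * \<alpha>) + of_int b * (y + birkhoff_sum f \<alpha> n x)) * of_int (moebius n))"
proof -
  define m where "m = Re (coeff 0)"
  define w where "w k t = coeff (Suc k) * ec (of_int (int (Suc k)) * t)
      + cnj (coeff (Suc k)) * ec (of_int (- int (Suc k)) * t)" for k t
  have coeff0: "coeff 0 = of_real m"
    using fourier_coeff_cnj[OF cont_F, of 0] by (simp add: m_def complex_eq_iff)
  have F_eq: "F t = of_real m + (\<Sum>k<J. w k t)" for t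
  proof -
    have "(\<lambda>k. w k t) sums (F t - of_real m)"
    proof -
      have "(\<lambda>k. w k t) sums (F t - fourier_coeff F 0)"
        unfolding w_def by (rule fourier_inversion[OF cont_F per_F _ summable_coeff]) simp
      then show ?thesis using coeff0 by simp
    qed
    moreover have "(\<lambda>k. w k t) sums (\<Sum>k<J. w k t)"
    proof (rule sums_finite)
      fix k assume "k \<notin> {..<J}"
      then have "coeff (Suc k) = 0" by (intro fin) simp
      then show "w k t = 0" unfolding w_def by (simp only: complex_cnj_zero mult_zero_left add_0)
    qed simp
    ultimately show ?thesis using sums_unique2 by fastforce
  qed
  have ne: "ec (of_int n * \<alpha>) \<noteq> 1" if "n \<noteq> 0" for n :: int
  proof
    assume "ec (of_int n * \<alpha>) = 1"
    then obtain k where "of_int n * \<alpha> = of_int k" by (auto simp: ec_eq_1_iff elim: Ints_cases)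
    then have "\<alpha> = of_int k / of_int n" using that by (simp add: field_simps)
    then show False using \<alpha> by simp
  qed
  define g where "g k t = coeff (Suc k) / (ec (of_int (int (Suc k)) * \<alpha>) - 1) * ec (of_int (int (Suc k)) * t)
      + cnj (coeff (Suc k)) / (ec (of_int (- int (Suc k)) * \<alpha>) - 1) * ec (of_int (- int (Suc k)) * t)" for k t
  define h where "h t = Re (\<Sum>k<J. g k t)" for t
  have "g k (t + \<alpha>) - g k t = w k t" for k t
  proof -
    have "c / (ec (of_int n * \<alpha>) - 1) * ec (of_int n * (t + \<alpha>)) - c / (ec (of_int n * \<alpha>) - 1) * ec (of_int n * t) = c * ec (of_int n * t)"
      if "n \<noteq> 0" for n :: int and c
    proof -
      have "ec (of_int n * (t + \<alpha>)) = ec (of_int n * t) * ec (of_int n * \<alpha>)" by (simp add: distrib_left ec_add)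
      moreover have "c / (u - 1) * (v * u) - c / (u - 1) * v = c / (u - 1) * (u - 1) * v" for u v :: complex
        by (simp only: right_diff_distrib left_diff_distrib mult_1_right mult_1_left mult_ac)
      ultimately show ?thesis using ne[OF that] by simp
    qed
    from this[of "int (Suc k)" "coeff (Suc k)"] this[of "- int (Suc k)" "cnj (coeff (Suc k))"]
    show ?thesis unfolding g_def w_def by (simp add: algebra_simps)
  qed
  then have "(\<Sum>k<J. g k (t + \<alpha>)) - (\<Sum>k<J. g k t) = F t - of_real m" for t
    by (simp add: F_eq flip: sum_subtractf)
  then have "Re ((\<Sum>k<J. g k (t + \<alpha>)) - (\<Sum>k<J. g k t)) = Re (F t - of_real m)" for t by simp
  then have coh: "h (t + \<alpha>) - h t = f t - m" for t by (simp add: h_def)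
  have birk: "birkhoff_sum f \<alpha> n x = of_nat n * m + (h (x + of_nat n * \<alpha>) - h x)" for n
  proof (induction n)
    case (Suc n)
    then show ?case using coh[of "x + of_nat n * \<alpha>"] by (simp add: birkhoff_sum_def algebra_simps)
  qed (simp add: birkhoff_sum_def)
  have per_ec: "ec (of_int n * (t + 1)) = ec (of_int n * t)" for n t
    by (rule ec_cong_int) (simp add: distrib_left)
  have ch: "continuous_on UNIV h"
    unfolding h_def g_def by (intro continuous_intros)
  have ph: "h (t + 1) = h t" for t unfolding h_def g_def per_ec ..
  define H where "H t = ec (of_int a * t) * ec (of_int b * h t)" for t
  let ?P = "\<lambda>g. mean_zero (\<lambda>n. ec (of_nat n * (of_int b * m)) * g (x + of_nat n * \<alpha>) * of_int (moebius n))"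
  have "?P H"
  proof (rule circle_function_induct[where P = ?P])
    show "continuous_on UNIV H" unfolding H_def by (intro continuous_intros ch)
    show "H (t + 1) = H t" for t unfolding H_def per_ec ph ..
    show "?P (\<lambda>t. c * ec (of_int k * t))" for c k
    proof -
      have "ec (of_nat n * (of_int b * m)) * (c * ec (of_int k * (x + of_nat n * \<alpha>))) * of_int (moebius n)
          = (c * ec (of_int k * x)) * (ec (of_nat n * (of_int b * m + of_int k * \<alpha>)) * of_int (moebius n))" for n
        by (simp add: distrib_left ec_add mult_ac)
      then show ?thesis
        using mean_zero_cmult[OF moebius_ec_mean_zero, of "c * ec (of_int k * x)" "of_int b * m + of_int k * \<alpha>"] by (simp only:)
    qed
    show "?P (\<lambda>t. u t + v t)" if "?P u" "?P v" for u v
      using mean_zero_add[OF that] by (simp add: distrib_left distrib_right)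
    show "?P H" if *: "\<And>\<epsilon>. \<epsilon> > 0 \<Longrightarrow> \<exists>u. ?P u \<and> (\<forall>t. cmod (H t - u t) \<le> \<epsilon>)"
    proof (rule mean_zero_approx)
      fix \<epsilon> :: real assume "\<epsilon> > 0"
      then obtain u where u: "?P u" "\<And>t. cmod (H t - u t) \<le> \<epsilon>" using * by blast
      have "cmod (ec (of_nat n * (of_int b * m)) * H (x + of_nat n * \<alpha>) * of_int (moebius n)
          - ec (of_nat n * (of_int b * m)) * u (x + of_nat n * \<alpha>) * of_int (moebius n)) \<le> \<epsilon>" for n
      proof -
        have "cmod (ec (of_nat n * (of_int b * m)) * (H (x + of_nat n * \<alpha>) - u (x + of_nat n * \<alpha>)) * of_int (moebius n)) \<le> \<epsilon> * 1"
          unfolding norm_mult norm_ec mult_1 by (rule mult_mono[OF u(2) norm_moebius_le]) (use \<open>\<epsilon> > 0\<close> in auto)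
        then show ?thesis by (simp add: left_diff_distrib right_diff_distrib)
      qed
      then show "\<exists>v. mean_zero v \<and> (\<forall>n. cmod (ec (of_nat n * (of_int b * m)) * H (x + of_nat n * \<alpha>) * of_int (moebius n) - v n) \<le> \<epsilon>)"
        using u(1) by blast
    qed
  qed
  from mean_zero_cmult[OF this, of "ec (of_int b * y - of_int b * h x)"]
  show ?thesis
  proof (rule back_subst[where P = mean_zero], intro ext)
    fix n
    have "of_int a * (x + of_nat n * \<alpha>) + of_int b * (y + birkhoff_sum f \<alpha> n x)
        = (of_int b * y - of_int b * h x) + (of_nat n * (of_int b * m) + (of_int a * (x + of_nat n * \<alpha>) + of_int b * h (x + of_nat n * \<alpha>)))"
      unfolding birk by (simp add: algebra_simps)
    then show "ec (of_int b * y - of_int b * h x) * (ec (of_nat n * (of_int b * m)) * H (x + of_nat n * \<alpha>) * of_int (moebius n))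
        = ec (of_int a * (x + of_nat n * \<alpha>) + of_int b * (y + birkhoff_sum f \<alpha> n x)) * of_int (moebius n)"
      by (simp only: ec_add H_def mult_ac)
  qed
qed

end

(*FILE dev7/Cop*)
lemma legendre_sieve:
  fixes P :: "nat set"
  assumes "finite P" "\<And>p. p \<in> P \<Longrightarrow> prime p"
  shows "\<bar>real (card {n \<in> {1..X}. \<forall>p\<in>P. \<not> p dvd n}) - real X * (\<Prod>p\<in>P. 1 - 1 / real p)\<bar> \<le> 2 ^ card P - 1"
  using assms
proof (induction P arbitrary: X)
  case (insert p P)
  let ?A = "\<lambda>P X. {n \<in> {1..X}. \<forall>p\<in>P. \<not> p dvd n} :: nat set"
  let ?w = "\<Prod>p\<in>P. 1 - 1 / real p"
  have p: "prime p" "p > 0" using insert.prems prime_gt_0_nat by auto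
  have split: "?A P X = ?A (insert p P) X \<union> (\<lambda>n. p * n) ` ?A P (X div p)"
  proof -
    have "p' dvd p * n \<longleftrightarrow> p' dvd n" if "p' \<in> P" for p' n
    proof -
      have "coprime p' p" using that insert.hyps(2) insert.prems primes_coprime by blast
      then show ?thesis by (rule coprime_dvd_mult_right_iff)
    qed
    moreover have "n \<in> (\<lambda>n. p * n) ` ?A P (X div p)" if n: "n \<in> ?A P X" "p dvd n" for n
    proof -
      obtain k where k: "n = p * k" using n(2) by (rule dvdE)
      then have "k \<in> ?A P (X div p)"
        using n(1) p(2) by (auto intro: dvd_mult simp: less_eq_div_iff_mult_less_eq mult.commute)
      then show ?thesis using k by blast
    qed
    ultimately show ?thesis using p(2) by (auto simp: less_eq_div_iff_mult_less_eq mult.commute)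
  qed
  have "card (?A P X) = card (?A (insert p P) X) + card ((\<lambda>n. p * n) ` ?A P (X div p))"
    unfolding split by (rule card_Un_disjoint) auto
  also have "card ((\<lambda>n. p * n) ` ?A P (X div p)) = card (?A P (X div p))"
    using p(2) by (intro card_image inj_onI) auto
  finally have eq: "real (card (?A (insert p P) X)) = real (card (?A P X)) - real (card (?A P (X div p)))"
    by simp
  have IH: "\<bar>real (card (?A P Y)) - real Y * ?w\<bar> \<le> 2 ^ card P - 1" for Y
    using insert by auto
  have combine: "\<bar>(a - c) - (b - z)\<bar> \<le> B + B + 1" if "\<bar>a - b\<bar> \<le> B" "\<bar>c - e\<bar> \<le> B" "\<bar>z - e\<bar> \<le> 1"
    for a b c e z B :: real
    using that by linarith
  have w: "0 \<le> ?w" "?w \<le> 1"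
  proof -
    have "0 \<le> 1 - 1 / real p' \<and> 1 - 1 / real p' \<le> 1" if "p' \<in> P" for p'
      using insert.prems that prime_gt_0_nat[of p'] by simp
    then show "0 \<le> ?w" "?w \<le> 1" by (auto intro!: prod_nonneg prod_le_1)
  qed
  have "\<bar>(real X / real p - real (X div p)) * ?w\<bar> \<le> 1 * 1"
    unfolding abs_mult
  proof (rule mult_mono)
    show "\<bar>real X / real p - real (X div p)\<bar> \<le> 1"
      using real_div_le[of X p] real_div_ge[of X p] by (simp add: abs_le_iff)
  qed (use w in auto)
  moreover have "real X * (\<Prod>p\<in>insert p P. 1 - 1 / real p) = real X * ?w - (real X / real p) * ?w"
    using insert.hyps by (simp add: algebra_simps)
  ultimately have "\<bar>real (card (?A (insert p P) X)) - real X * (\<Prod>p\<in>insert p P. 1 - 1 / real p)\<bar>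
      \<le> (2 ^ card P - 1) + (2 ^ card P - 1) + 1"
    unfolding eq using combine[OF IH[of X] IH[of "X div p"]] by (simp only: left_diff_distrib)
  then show ?case using insert.hyps by simp
next
  case empty
  have "{n \<in> {1..X}. \<forall>p\<in>({} :: nat set). \<not> p dvd n} = {1..X}" by auto
  then show ?case by simp
qed

lemma real_sqrt_prod: "sqrt (\<Prod>i\<in>A. g i) = (\<Prod>i\<in>A. sqrt (g i))"
  by (induction A rule: infinite_finite_induct) (simp_all add: real_sqrt_mult)

lemma four_power_omega:
  assumes "q > 0"
  shows "4 ^ card (prime_factors q) \<le> 4 ^ 16 * sqrt (real q)"
proof -
  let ?P = "prime_factors q"
  let ?S = "?P \<inter> {..<16}" and ?L = "?P - {..<16}"
  have "(4 :: real) ^ card ?P = 4 ^ card ?S * 4 ^ card ?L"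
    by (subst power_add[symmetric], rule arg_cong[of _ _ "\<lambda>n. 4 ^ n"], subst card_Un_disjoint[symmetric])
      (auto intro!: arg_cong[of _ _ card])
  also have "(4 :: real) ^ card ?S \<le> 4 ^ 16"
  proof (rule power_increasing)
    have "card ?S \<le> card {..<16 :: nat}" by (rule card_mono) auto
    then show "card ?S \<le> 16" by simp
  qed simp
  also have "(4 :: real) ^ card ?L = (\<Prod>p\<in>?L. 4)" by simp
  also have "\<dots> \<le> (\<Prod>p\<in>?L. sqrt (real p))"
  proof (rule prod_mono, intro conjI)
    fix p assume "p \<in> ?L"
    then have "real p \<ge> 16" by auto
    then show "4 \<le> sqrt (real p)" by (intro real_le_rsqrt) simp
  qed simp
  also have "\<dots> \<le> (\<Prod>p\<in>?P. sqrt (real p))"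
  proof (rule prod_mono2)
    fix p assume "p \<in> ?P - ?L"
    then have "p > 0" using prime_gt_0_nat by auto
    then show "1 \<le> sqrt (real p)" by simp
  qed auto
  also have "\<dots> \<le> (\<Prod>p\<in>?P. sqrt (real (p ^ multiplicity p q)))"
  proof (rule prod_mono, intro conjI real_sqrt_le_mono of_nat_mono)
    fix p assume p: "p \<in> ?P"
    then have "multiplicity p q > 0" using assms by (simp add: prime_factors_multiplicity)
    moreover have "p > 0" using p prime_gt_0_nat by auto
    ultimately show "p \<le> p ^ multiplicity p q" by (simp add: self_le_power)
  qed simp
  also have "\<dots> = sqrt (\<Prod>p\<in>?P. real (p ^ multiplicity p q))"
    by (rule real_sqrt_prod[symmetric])
  also have "(\<Prod>p\<in>?P. real (p ^ multiplicity p q)) = real q"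
    using prime_factorization_nat[OF assms] by (metis of_nat_prod)
  finally show ?thesis by (simp add: mult_right_mono mult_left_mono)
qed

text \<open>
  Fractions in lowest terms with a prescribed large denominator are dense: Legendre's sieve has
  error \<open>2\<^bsup>\<omega>(q)\<^esup>\<close>, and \<open>\<omega>(q)\<close> is small compared to \<open>log q\<close>.
\<close>

lemma coprime_fractions_dense:
  assumes "u < v"
  shows "\<forall>\<^sub>F q in sequentially. \<exists>a :: int. coprime a (int q) \<and> u < of_int a / real q \<and> of_int a / real q < v"
proof -
  define d where "d = v - u"
  have d: "d > 0" using assms by (simp add: d_def)
  have "filterlim (\<lambda>q. d * real q - 2 * (2 * (4 ^ 16 * sqrt (real q)) + 3)) at_top sequentially"
    using d by real_asymp
  then have "\<forall>\<^sub>F q in sequentially. d * real q - 2 * (2 * (4 ^ 16 * sqrt (real q)) + 3) \<ge> 1"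
    unfolding filterlim_at_top by blast
  then show ?thesis
    using eventually_gt_at_top[of 0]
  proof eventually_elim
    case (elim q)
    define k where "k = \<lfloor>u\<rfloor>"
    define u' where "u' = u - of_int k"
    have u': "u' \<ge> 0" by (simp add: u'_def k_def)
    define X where "X = nat \<lfloor>u' * real q\<rfloor>"
    define Y where "Y = nat \<lfloor>(u' + d / 2) * real q\<rfloor>"
    have X: "real X \<le> u' * real q" "u' * real q < real X + 1"
    proof -
      have "0 \<le> u' * real q" using u' by simp
      then show "real X \<le> u' * real q" "u' * real q < real X + 1"
        unfolding X_def by linarith+
    qed
    have Y: "real Y \<le> (u' + d / 2) * real q" "(u' + d / 2) * real q < real Y + 1"
    proof -
      have "0 \<le> (u' + d / 2) * real q" using u' d by simp
      then show "real Y \<le> (u' + d / 2) * real q" "(u' + d / 2) * real q < real Y + 1"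
        unfolding Y_def by linarith+
    qed
    let ?P = "prime_factors q"
    let ?A = "\<lambda>X. {n \<in> {1..X}. \<forall>p\<in>?P. \<not> p dvd n}"
    define w where "w = (\<Prod>p\<in>?P. 1 - 1 / real p)"
    define T where "T = (2 :: real) ^ card ?P"
    have T: "T \<ge> 1" "T * T \<le> 4 ^ 16 * sqrt (real q)"
      using four_power_omega[OF elim(2)] by (simp_all add: T_def flip: power_mult_distrib)
    have "(1 / 2) ^ card ?P \<le> w"
    proof -
      have "(\<Prod>p\<in>?P. 1 / 2) \<le> w"
        unfolding w_def
      proof (rule prod_mono, intro conjI)
        fix p assume "p \<in> ?P"
        then have "p \<ge> 2" using prime_ge_2_nat by auto
        then show "1 / 2 \<le> 1 - 1 / real p" by (simp add: field_simps)
      qed simp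
      then show ?thesis by simp
    qed
    then have w: "1 \<le> w * T" by (simp add: T_def field_simps)
    have "card (?A X) < card (?A Y)"
    proof -
      have sX: "\<bar>real (card (?A X)) - real X * w\<bar> \<le> T - 1" and sY: "\<bar>real (card (?A Y)) - real Y * w\<bar> \<le> T - 1"
        unfolding w_def T_def by (intro legendre_sieve; auto)+
      have "(real Y - real X) \<ge> d / 2 * real q - 1" using X Y by (simp add: algebra_simps)
      also have "d / 2 * real q - 1 \<ge> 2 * (T * T) + 2"
      proof -
        define V where "V = 4 ^ 16 * sqrt (real q)"
        have "1 \<le> d * real q - 2 * (2 * V + 3)" "T * T \<le> V"
          using elim(1) T(2) unfolding V_def[symmetric] by simp_all
        then show ?thesis by (simp add: field_simps)
      qed
      finally have YX: "real Y - real X \<ge> 2 * (T * T) + 2" .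
      have w0: "w \<ge> 0" using w T(1) by (metis le_less_trans linorder_not_le mult_neg_pos zero_less_one less_le_trans order.trans zero_le_one)
      have "(2 * (T * T) + 2) * w \<le> (real Y - real X) * w" using YX w0 by (rule mult_right_mono)
      moreover have "2 * T \<le> (2 * (T * T) + 2) * w"
      proof -
        have "2 * T * 1 \<le> 2 * T * (w * T)" using w T(1) by (intro mult_left_mono) auto
        also have "\<dots> \<le> (2 * (T * T) + 2) * w" using w0 by (simp add: algebra_simps)
        finally show ?thesis by simp
      qed
      ultimately have "2 * T \<le> real Y * w - real X * w" by (simp add: left_diff_distrib)
      then show ?thesis using sX sY by linarith
    qed
    then have "\<not> ?A Y \<subseteq> ?A X" using card_mono[of "?A X" "?A Y"] by fastforce
    then obtain n where n: "n \<in> ?A Y" "n \<notin> ?A X" by blast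
    then have nXY: "X < n" "n \<le> Y" by auto
    have "coprime n q"
    proof (rule ccontr)
      assume "\<not> coprime n q"
      then obtain p where "prime p" "p dvd n" "p dvd q"
        using prime_factor_nat[of "gcd n q"] by (auto simp: coprime_iff_gcd_eq_1)
      then show False using n(1) elim(2) by (auto simp: prime_factors_dvd)
    qed
    define a where "a = int n + k * int q"
    have "gcd a (int q) = gcd (int n) (int q)"
      unfolding a_def by (metis add.commute gcd.commute gcd_add_mult)
    then have "coprime a (int q)" using \<open>coprime n q\<close> by (simp add: coprime_iff_gcd_eq_1 flip: coprime_int_iff)
    moreover have "of_int a / real q = real n / real q + of_int k" using elim(2) by (simp add: a_def field_simps)
    moreover have "u' < real n / real q"
    proof -
      have "u' * real q < real n" using X(2) nXY by linarith
      then show ?thesis using elim(2) by (simp add: field_simps)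
    qed
    moreover have "real n / real q < u' + d"
    proof -
      have "real n \<le> (u' + d / 2) * real q" using Y(1) nXY by linarith
      also have "\<dots> < (u' + d) * real q" using d elim(2) by (intro mult_strict_right_mono) auto
      finally show ?thesis using elim(2) by (simp add: field_simps)
    qed
    ultimately show ?case
      by (intro exI[of _ a]) (auto simp: u'_def d_def)
  qed
qed

(*FILE dev8/Contr*)
lemma riemann_sum_bound:
  fixes H :: "real \<Rightarrow> complex"
  assumes lip: "\<And>t u. cmod (H t - H u) \<le> \<Lambda> * \<bar>t - u\<bar>" and bd: "\<And>t. cmod (H t) \<le> 2"
    and \<theta>: "0 < \<theta>" "\<theta> \<le> 1" and K: "real K * \<theta> \<le> 1" "1 < (real K + 1) * \<theta>"
  shows "cmod ((\<Sum>i<K. H (of_nat i * \<theta>)) - of_nat K * circle_mean H) \<le> \<Lambda> + 4"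
proof -
  have L0: "\<Lambda> \<ge> 0" using order_trans[OF norm_ge_zero lip[of 1 0]] by simp
  have cH: "continuous_on UNIV H"
    by (rule lipschitz_on_continuous_on[of \<Lambda>], rule lipschitz_onI) (use lip L0 in \<open>auto simp: dist_norm\<close>)
  have int: "H integrable_on {u..v}" for u v
    by (intro integrable_continuous_real continuous_on_subset[OF cH]) auto
  have piece: "cmod (integral {u..u + \<theta>} H - of_real \<theta> * H u) \<le> \<Lambda> * \<theta> * \<theta>" for u
  proof -
    have "integral {u..u + \<theta>} H - of_real \<theta> * H u = integral {u..u + \<theta>} (\<lambda>t. H t - H u)"
      using \<theta>(1) by (subst integral_diff[OF int]) (auto simp: scaleR_conv_of_real)
    also have "cmod (integral {u..u + \<theta>} (\<lambda>t. H t - H u)) \<le> integral {u..u + \<theta>} (\<lambda>_. \<Lambda> * \<theta>)"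
    proof (rule integral_norm_bound_integral)
      show "(\<lambda>t. H t - H u) integrable_on {u..u + \<theta>}" by (intro integrable_diff int) auto
      show "cmod (H t - H u) \<le> \<Lambda> * \<theta>" if "t \<in> {u..u + \<theta>}" for t
        using lip[of t u] mult_left_mono[of "\<bar>t - u\<bar>" \<theta> \<Lambda>] that L0 by auto
    qed auto
    also have "\<dots> = \<Lambda> * \<theta> * \<theta>" using \<theta>(1) by simp
    finally show ?thesis .
  qed
  have sum: "cmod (integral {0..of_nat k * \<theta>} H - of_real \<theta> * (\<Sum>i<k. H (of_nat i * \<theta>))) \<le> real k * (\<Lambda> * \<theta> * \<theta>)" for k
  proof (induction k)
    case (Suc k)
    have "integral {0..of_nat (Suc k) * \<theta>} H = integral {0..of_nat k * \<theta>} H + integral {of_nat k * \<theta>..of_nat (Suc k) * \<theta>} H"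
      by (rule Henstock_Kurzweil_Integration.integral_combine[symmetric, OF _ _ int])
        (use \<theta>(1) in \<open>auto simp: distrib_right\<close>)
    moreover have "of_nat (Suc k) * \<theta> = of_nat k * \<theta> + \<theta>" by (simp add: distrib_right)
    ultimately have "integral {0..of_nat (Suc k) * \<theta>} H - of_real \<theta> * (\<Sum>i<Suc k. H (of_nat i * \<theta>))
        = (integral {0..of_nat k * \<theta>} H - of_real \<theta> * (\<Sum>i<k. H (of_nat i * \<theta>)))
          + (integral {of_nat k * \<theta>..of_nat k * \<theta> + \<theta>} H - of_real \<theta> * H (of_nat k * \<theta>))"
      by (simp add: distrib_left)
    then have "cmod (integral {0..of_nat (Suc k) * \<theta>} H - of_real \<theta> * (\<Sum>i<Suc k. H (of_nat i * \<theta>)))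
        \<le> real k * (\<Lambda> * \<theta> * \<theta>) + \<Lambda> * \<theta> * \<theta>"
      by (simp only:) (rule norm_triangle_mono[OF Suc piece])
    then show ?case by (simp add: distrib_right)
  qed simp
  have rest: "cmod (circle_mean H - integral {0..of_nat K * \<theta>} H) \<le> 2 * \<theta>"
  proof -
    have "circle_mean H = integral {0..of_nat K * \<theta>} H + integral {of_nat K * \<theta>..1} H"
      unfolding circle_mean_def
      by (rule Henstock_Kurzweil_Integration.integral_combine[symmetric, OF _ _ int]) (use \<theta> K in auto)
    moreover have "cmod (integral {of_nat K * \<theta>..1} H) \<le> integral {of_nat K * \<theta>..1} (\<lambda>_. 2)"
      by (rule integral_norm_bound_integral) (use int bd in auto)
    moreover have "integral {of_nat K * \<theta>..1} (\<lambda>_ :: real. 2 :: real) \<le> 2 * \<theta>"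
      using K by (simp add: distrib_right)
    ultimately show ?thesis by simp
  qed
  have cm2: "cmod (circle_mean H) \<le> 2" by (rule norm_circle_mean_le[OF cH bd])
  have K1: "\<bar>1 - real K * \<theta>\<bar> \<le> \<theta>" using K by (simp add: distrib_right)
  let ?S = "\<Sum>i<K. H (of_nat i * \<theta>)"
  have A: "cmod (of_real \<theta> * ?S - circle_mean H) \<le> real K * (\<Lambda> * \<theta> * \<theta>) + 2 * \<theta>"
  proof -
    have "of_real \<theta> * ?S - circle_mean H = - (integral {0..of_nat K * \<theta>} H - of_real \<theta> * ?S)
        - (circle_mean H - integral {0..of_nat K * \<theta>} H)" by simp
    then show ?thesis
      using sum[of K] rest by (simp only:) (rule order_trans[OF norm_triangle_ineq4], simp add: norm_minus_commute)
  qed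
  have "real K * (\<Lambda> * \<theta> * \<theta>) \<le> \<Lambda> * \<theta>"
    using mult_right_mono[OF K(1), of "\<Lambda> * \<theta>"] L0 \<theta> by (simp add: mult_ac)
  with A have A': "cmod (of_real \<theta> * ?S - circle_mean H) \<le> (\<Lambda> + 2) * \<theta>" by (simp add: distrib_right)
  \<comment> \<open>Passing from \<open>\<theta> \<Sum>\<close> to \<open>1 / K \<Sum>\<close> costs \<open>1 - K \<theta> \<le> \<theta>\<close>.\<close>
  have "of_real \<theta> * (?S - of_nat K * circle_mean H) = (of_real \<theta> * ?S - circle_mean H) + of_real (1 - real K * \<theta>) * circle_mean H"
    by (simp add: algebra_simps)
  then have "cmod (of_real \<theta> * (?S - of_nat K * circle_mean H)) \<le> (\<Lambda> + 2) * \<theta> + \<theta> * 2"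
    by (simp only:) (rule norm_triangle_mono[OF A'], unfold norm_mult norm_of_real, rule mult_mono[OF K1 cm2], use \<theta> in auto)
  then have le: "\<theta> * cmod (?S - of_nat K * circle_mean H) \<le> \<theta> * (\<Lambda> + 4)"
    using \<theta> unfolding norm_mult norm_of_real by (simp add: algebra_simps)
  then show ?thesis using \<theta>(1) by simp
qed

lemma ec_linearization: "cmod (ec x - 1 - of_real (2 * pi * x) * \<i>) \<le> (2 * pi * x)\<^sup>2"
proof -
  have "cmod (exp (\<i> * of_real (2 * pi * x)) - (\<Sum>i\<le>Suc 0. (\<i> * of_real (2 * pi * x)) ^ i / fact i))
      \<le> exp \<bar>Re (\<i> * of_real (2 * pi * x))\<bar> * cmod (\<i> * of_real (2 * pi * x)) ^ Suc (Suc 0) / fact (Suc 0)"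
    by (rule Taylor_exp)
  also have "(\<Sum>i\<le>Suc 0. (\<i> * complex_of_real (2 * pi * x)) ^ i / fact i) = 1 + of_real (2 * pi * x) * \<i>"
    by (simp add: mult.commute)
  also have "exp \<bar>Re (\<i> * of_real (2 * pi * x))\<bar> * cmod (\<i> * of_real (2 * pi * x)) ^ Suc (Suc 0) / fact (Suc 0) = (2 * pi * x)\<^sup>2"
    unfolding norm_mult norm_of_real by (simp add: power2_eq_square abs_mult)
  finally show ?thesis unfolding ec_def cis_conv_exp by (simp only: diff_diff_eq)
qed

lemma geometric_sum_ec_gain:
  assumes Z: "cmod (ec g - 1) \<le> Z" "Z > 0" and k: "k > 0"
  shows "cmod (\<Sum>j<k. ec (of_nat j * g)) \<le> real k * (1 - (cmod (ec g - 1) - 2 / real k) / Z)"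
proof (cases "cmod (ec g - 1) \<le> 2 / real k")
  case True
  have "cmod (\<Sum>j<k. ec (of_nat j * g)) \<le> real k" by (rule order_trans[OF norm_sum]) simp
  moreover have "(cmod (ec g - 1) - 2 / real k) / Z \<le> 0" using True Z by (simp add: divide_le_0_iff)
  then have "real k * 1 \<le> real k * (1 - (cmod (ec g - 1) - 2 / real k) / Z)"
    by (intro mult_left_mono) auto
  ultimately show ?thesis by linarith
next
  case False
  define z where "z = cmod (ec g - 1)"
  have z: "2 / real k < z" using False by (simp add: z_def)
  have z0: "z > 0" by (rule order_le_less_trans[OF _ z]) simp
  then have "ec g \<noteq> 1" by (auto simp: z_def)
  from norm_geometric_ec[OF this, of k] have 1: "cmod (\<Sum>j<k. ec (of_nat j * g)) \<le> 2 / z"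
    by (simp only: z_def)
  have "(z - 2 / real k) / Z \<le> (z - 2 / real k) / z"
    using z z0 Z(1) by (intro divide_left_mono mult_pos_pos Z) (auto simp: z_def)
  then have "real k * (1 - (z - 2 / real k) / z) \<le> real k * (1 - (z - 2 / real k) / Z)"
    by (intro mult_left_mono) auto
  moreover have "real k * (1 - (z - 2 / real k) / z) = 2 / z" using k z0 by (simp add: field_simps)
  ultimately show ?thesis using 1 by (simp only: z_def[symmetric])
qed

(*FILE dev8/Orb*)
context periodic_C1_Hoelder
begin

lemma birkhoff_sum_lipschitz:
  assumes "\<And>x y. \<bar>f x - f y\<bar> \<le> \<Lambda> * \<bar>x - y\<bar>"
  shows "\<bar>birkhoff_sum f \<alpha> n x - birkhoff_sum f \<alpha> n y\<bar> \<le> real n * \<Lambda> * \<bar>x - y\<bar>"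
proof -
  have "\<bar>birkhoff_sum f \<alpha> n x - birkhoff_sum f \<alpha> n y\<bar> \<le> (\<Sum>j<n. \<bar>f (x + of_nat j * \<alpha>) - f (y + of_nat j * \<alpha>)\<bar>)"
    unfolding birkhoff_sum_def sum_subtractf[symmetric] by (rule sum_abs)
  also have "\<dots> \<le> (\<Sum>j<n. \<Lambda> * \<bar>x - y\<bar>)"
  proof (rule sum_mono)
    show "\<bar>f (x + of_nat j * \<alpha>) - f (y + of_nat j * \<alpha>)\<bar> \<le> \<Lambda> * \<bar>x - y\<bar>" for j
      using assms[of "x + of_nat j * \<alpha>" "y + of_nat j * \<alpha>"] by simp
  qed
  finally show ?thesis by simp
qed

lemma birkhoff_sum_drift:
  assumes "\<And>x y. \<bar>f x - f y\<bar> \<le> \<Lambda> * \<bar>x - y\<bar>"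
  shows "\<bar>birkhoff_sum f \<alpha> n x - birkhoff_sum f \<beta> n x\<bar> \<le> (real n)\<^sup>2 * (\<Lambda> * \<bar>\<alpha> - \<beta>\<bar>)"
proof -
  have L: "0 \<le> \<Lambda> * \<bar>u\<bar>" for u
    using order_trans[OF abs_ge_zero assms[of u 0]] by simp
  have "\<bar>birkhoff_sum f \<alpha> n x - birkhoff_sum f \<beta> n x\<bar> \<le> (\<Sum>j<n. \<bar>f (x + of_nat j * \<alpha>) - f (x + of_nat j * \<beta>)\<bar>)"
    unfolding birkhoff_sum_def sum_subtractf[symmetric] by (rule sum_abs)
  also have "\<dots> \<le> (\<Sum>j<n. real n * (\<Lambda> * \<bar>\<alpha> - \<beta>\<bar>))"
  proof (rule sum_mono)
    fix j assume "j \<in> {..<n}"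
    have "\<bar>f (x + of_nat j * \<alpha>) - f (x + of_nat j * \<beta>)\<bar> \<le> \<Lambda> * \<bar>of_nat j * (\<alpha> - \<beta>)\<bar>"
      using assms[of "x + of_nat j * \<alpha>" "x + of_nat j * \<beta>"] by (simp add: right_diff_distrib)
    also have "\<dots> = real j * (\<Lambda> * \<bar>\<alpha> - \<beta>\<bar>)" by (simp add: abs_mult)
    also have "\<dots> \<le> real n * (\<Lambda> * \<bar>\<alpha> - \<beta>\<bar>)"
      using \<open>j \<in> {..<n}\<close> by (intro mult_right_mono L) auto
    finally show "\<bar>f (x + of_nat j * \<alpha>) - f (x + of_nat j * \<beta>)\<bar> \<le> real n * (\<Lambda> * \<bar>\<alpha> - \<beta>\<bar>)" .
  qed
  finally show ?thesis by (simp add: power2_eq_square mult.assoc)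
qed

definition shift_sum :: "nat \<Rightarrow> real \<Rightarrow> real"
  where "shift_sum q y = (\<Sum>i<q. f (y + of_nat i / of_nat q))"

lemma shift_sum_per: "shift_sum q (y + of_int k) = shift_sum q y"
proof -
  have "f (y + of_int k + s) = f (y + s)" for s
    using periodic_int_shift[of f "y + s" k, OF per] by (simp only: add_ac)
  then show ?thesis unfolding shift_sum_def by simp
qed

lemma shift_sum_per_inverse:
  assumes "q > 0"
  shows "shift_sum q (y + 1 / of_nat q) = shift_sum q y"
proof -
  let ?h = "\<lambda>i. f (y + of_nat i / of_nat q)"
  have "shift_sum q (y + 1 / of_nat q) = (\<Sum>i<q. ?h (Suc i))"
    unfolding shift_sum_def by (rule sum.cong[OF refl]) (simp add: add_divide_distrib add_ac)
  moreover have "?h q = ?h 0" using assms per[of y] by simp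
  moreover have "(\<Sum>i<q. ?h (Suc i)) + ?h 0 = (\<Sum>i<q. ?h i) + ?h q"
    using sum.lessThan_Suc_shift[of ?h q] sum.lessThan_Suc[of ?h q] by (simp add: add.commute)
  ultimately show ?thesis by (simp add: shift_sum_def)
qed

lemma shift_sum_lipschitz:
  assumes "\<And>x y. \<bar>f x - f y\<bar> \<le> \<Lambda> * \<bar>x - y\<bar>"
  shows "\<bar>shift_sum q x - shift_sum q y\<bar> \<le> real q * \<Lambda> * \<bar>x - y\<bar>"
  using birkhoff_sum_lipschitz[OF assms, of "1 / real q" q x y]
  by (simp add: shift_sum_def birkhoff_sum_def)

lemma cont_shift_sum: "continuous_on UNIV (shift_sum q)"
  unfolding shift_sum_def by (intro continuous_intros continuous_on_compose2[OF cont]) auto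

lemma fourier_coeff_shift_sum:
  "q > 0 \<Longrightarrow> fourier_coeff (\<lambda>y. of_real (shift_sum q y)) n = (if int q dvd n then of_nat q * fourier_coeff F n else 0)"
  using fourier_coeff_sum_shifts[OF cont_F per_F, of q n] by (simp add: shift_sum_def)

lemma shift_sum_resonant:
  "resonant q \<Longrightarrow> \<bar>shift_sum q y - of_nat q * Re (coeff 0)\<bar> \<le> resonance_constant * (of_nat q * cmod (coeff q))"
  by (auto simp: resonant_def shift_sum_def)

lemma birkhoff_sum_rational:
  assumes q: "q > 0" and a: "coprime a (int q)"
  shows "birkhoff_sum f (of_int a / of_nat q) (n * q) y = of_nat n * shift_sum q y"
proof -
  let ?p = "\<lambda>j :: nat. nat ((int j * a) mod int q)"
  have inj: "inj_on ?p {..<q}"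
  proof (rule inj_onI)
    fix i j assume ij: "i \<in> {..<q}" "j \<in> {..<q}" "?p i = ?p j"
    then have "(int i * a) mod int q = (int j * a) mod int q"
      using q by (simp add: nat_eq_iff)
    then have "[a * int i = a * int j] (mod int q)" by (simp add: cong_def mult.commute)
    then have "[int i = int j] (mod int q)" using a by (simp add: cong_mult_lcancel)
    then have "[i = j] (mod q)" by (simp add: cong_int_iff)
    then show "i = j" using ij by (simp add: cong_def)
  qed
  have "?p ` {..<q} \<subseteq> {..<q}"
    using q by (auto simp: nat_less_iff)
  then have bij: "bij_betw ?p {..<q} {..<q}"
    using inj endo_inj_surj[of "{..<q}" ?p] by (simp add: bij_betw_def)
  have eq: "f (z + of_nat j * (of_int a / of_nat q)) = f (z + of_nat (?p j) / of_nat q)" for z j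
  proof -
    have "int j * a = int q * ((int j * a) div int q) + int (?p j)"
      using q by simp
    then have "of_nat j * of_int a = of_nat q * of_int ((int j * a) div int q) + (of_nat (?p j) :: real)"
      by (metis of_int_add of_int_mult of_int_of_nat_eq)
    then have "z + of_nat j * (of_int a / of_nat q) = (z + of_nat (?p j) / of_nat q) + of_int ((int j * a) div int q)"
      using q by (simp add: field_simps)
    then show ?thesis by (simp only: periodic_int_shift[of f, OF per])
  qed
  have one: "birkhoff_sum f (of_int a / of_nat q) q z = shift_sum q z" for z
    unfolding birkhoff_sum_def shift_sum_def eq
    by (rule sum.reindex_bij_betw[OF bij, of "\<lambda>i. f (z + of_nat i / of_nat q)"])
  show ?thesis
  proof (induction n)
    case (Suc n)
    have "y + of_nat (n * q) * (of_int a / of_nat q) = y + of_int (int n * a)" using q by simp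
    then have "birkhoff_sum f (of_int a / of_nat q) (n * q + q) y = of_nat n * shift_sum q y + shift_sum q y"
      unfolding birkhoff_sum_add Suc one by (simp only: shift_sum_per)
    then show ?case by (simp add: algebra_simps)
  qed (simp add: birkhoff_sum_def)
qed

end

locale two_orbits = periodic_C1_Hoelder + fixes r s :: nat and t \<alpha> :: real
begin

definition phase :: "nat \<Rightarrow> real \<Rightarrow> real \<Rightarrow> real"
  where "phase n x y = birkhoff_sum f \<alpha> (r * n) x - birkhoff_sum f \<alpha> (s * n) y + of_nat n * t"

definition phase_sum :: "nat \<Rightarrow> real \<Rightarrow> real \<Rightarrow> complex"
  where "phase_sum N x y = (\<Sum>n<N. ec (phase n x y))"

lemma phase_add:
  "phase (m + n) x y = phase m x y + phase n (x + of_nat (r * m) * \<alpha>) (y + of_nat (s * m) * \<alpha>)"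
  unfolding phase_def distrib_left birkhoff_sum_add by (simp add: algebra_simps)

lemma phase_sum_add:
  "phase_sum (M + N) x y = phase_sum M x y
    + ec (phase M x y) * phase_sum N (x + of_nat (r * M) * \<alpha>) (y + of_nat (s * M) * \<alpha>)"
  by (induction N) (simp_all add: phase_sum_def phase_add ec_add distrib_left)

lemma phase_sum_blocks:
  "phase_sum (K * L) x y = (\<Sum>i<K. ec (phase (i * L) x y)
    * phase_sum L (x + of_nat (r * (i * L)) * \<alpha>) (y + of_nat (s * (i * L)) * \<alpha>))"
proof (induction K)
  case (Suc K)
  have "phase_sum (Suc K * L) x y = phase_sum (K * L + L) x y" by (simp add: add.commute)
  then show ?case unfolding phase_sum_add Suc by simp
qed (simp add: phase_sum_def)

lemma norm_phase_sum_le: "cmod (phase_sum N x y) \<le> real N"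
  unfolding phase_sum_def by (rule order_trans[OF norm_sum]) simp

lemma phase_sum_periodic: "phase_sum N (x + of_int k) (y + of_int l) = phase_sum N x y"
  unfolding phase_sum_def phase_def birkhoff_sum_periodic[of f, OF per] ..

lemma norm_phase_sum_blocks_le:
  "cmod (phase_sum (K * L) x y) \<le> (\<Sum>i<K. cmod (phase_sum L (x + of_nat (r * (i * L)) * \<alpha>) (y + of_nat (s * (i * L)) * \<alpha>)))"
  unfolding phase_sum_blocks by (rule order_trans[OF norm_sum]) (simp add: norm_mult)

text \<open>A bound at one length propagates to all longer ones, because it is uniform in the base point.\<close>

lemma phase_sum_propagate:
  assumes "L > 0" "e \<ge> 0" and bound: "\<And>x y. cmod (phase_sum L x y) \<le> e * real L"
  shows "cmod (phase_sum N x y) \<le> e * real N + real L"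
proof -
  define K m where "K = N div L" and "m = N mod L"
  have N: "N = K * L + m" by (simp add: K_def m_def)
  have 1: "cmod (phase_sum (K * L) x y) \<le> real K * (e * real L)"
    by (rule order_trans[OF norm_phase_sum_blocks_le]) (rule sum_bounded_above[where A = "{..<K}", simplified], rule bound)
  have 2: "cmod (ec (phase (K * L) x y) * phase_sum m x' y') \<le> real L" for x' y'
    using norm_phase_sum_le[of m x' y'] \<open>L > 0\<close> by (simp add: norm_mult m_def less_imp_le order_trans)
  have 3: "real K * (e * real L) \<le> e * real N" using \<open>e \<ge> 0\<close> by (simp add: N distrib_left)
  have "cmod (phase_sum N x y) \<le> real K * (e * real L) + real L"
    unfolding N phase_sum_add by (rule norm_triangle_mono[OF 1 2])
  then show ?thesis using 3 by linarith
qed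

end

(*FILE dev8/Res*)
context two_orbits
begin

lemma phase_lipschitz:
  assumes lip: "\<And>x y. \<bar>f x - f y\<bar> \<le> \<Lambda> * \<bar>x - y\<bar>"
  shows "\<bar>phase n x y - phase n x' y'\<bar> \<le> real n * \<Lambda> * (real r * \<bar>x - x'\<bar> + real s * \<bar>y - y'\<bar>)"
proof -
  have "\<bar>birkhoff_sum f \<alpha> (r * n) x - birkhoff_sum f \<alpha> (r * n) x'\<bar> \<le> real (r * n) * \<Lambda> * \<bar>x - x'\<bar>"
    "\<bar>birkhoff_sum f \<alpha> (s * n) y - birkhoff_sum f \<alpha> (s * n) y'\<bar> \<le> real (s * n) * \<Lambda> * \<bar>y - y'\<bar>"
    by (rule birkhoff_sum_lipschitz[OF lip])+
  then have "\<bar>phase n x y - phase n x' y'\<bar> \<le> real (r * n) * \<Lambda> * \<bar>x - x'\<bar> + real (s * n) * \<Lambda> * \<bar>y - y'\<bar>"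
    unfolding phase_def by linarith
  then show ?thesis by (simp add: algebra_simps)
qed

lemma phase_sum_lipschitz:
  assumes lip: "\<And>x y. \<bar>f x - f y\<bar> \<le> \<Lambda> * \<bar>x - y\<bar>"
  shows "cmod (phase_sum N x y - phase_sum N x' y')
    \<le> 2 * pi * (real N)\<^sup>2 * \<Lambda> * (real r * \<bar>x - x'\<bar> + real s * \<bar>y - y'\<bar>)"
proof -
  let ?d = "real r * \<bar>x - x'\<bar> + real s * \<bar>y - y'\<bar>"
  have L: "0 \<le> \<Lambda>" using order_trans[OF abs_ge_zero lip[of 1 0]] by simp
  have "cmod (phase_sum N x y - phase_sum N x' y') \<le> (\<Sum>n<N. cmod (ec (phase n x y) - ec (phase n x' y')))"
    unfolding phase_sum_def sum_subtractf[symmetric] by (rule norm_sum)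
  moreover have "(\<Sum>n<N. cmod (ec (phase n x y) - ec (phase n x' y'))) \<le> (\<Sum>n<N. 2 * pi * (real N * \<Lambda> * ?d))"
  proof (rule sum_mono)
    fix n assume n: "n \<in> {..<N}"
    have "real n * \<Lambda> * ?d \<le> real N * \<Lambda> * ?d"
      using n L by (intro mult_right_mono) auto
    then have "\<bar>phase n x y - phase n x' y'\<bar> \<le> real N * \<Lambda> * ?d"
      using phase_lipschitz[OF lip, of n x y x' y'] by linarith
    then have "2 * pi * \<bar>phase n x y - phase n x' y'\<bar> \<le> 2 * pi * (real N * \<Lambda> * ?d)"
      by (intro mult_left_mono) auto
    then show "cmod (ec (phase n x y) - ec (phase n x' y')) \<le> 2 * pi * (real N * \<Lambda> * ?d)"
      using norm_ec_diff[of "phase n x y" "phase n x' y'"] by linarith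
  qed
  moreover have "(\<Sum>n<N. 2 * pi * (real N * \<Lambda> * ?d)) = 2 * pi * (real N)\<^sup>2 * \<Lambda> * ?d"
    by (simp add: power2_eq_square)
  ultimately show ?thesis by linarith
qed

definition resonant_phase :: "nat \<Rightarrow> real \<Rightarrow> real \<Rightarrow> real"
  where "resonant_phase q x y = of_nat r * shift_sum q x - of_nat s * shift_sum q y + of_nat q * t"

lemma resonant_phase_per: "resonant_phase q (x + of_int k) (y + of_int l) = resonant_phase q x y"
  by (simp add: resonant_phase_def shift_sum_per)

lemma phase_near_resonance:
  assumes lip: "\<And>x y. \<bar>f x - f y\<bar> \<le> \<Lambda> * \<bar>x - y\<bar>" and q: "q > 0" and a: "coprime a (int q)"
  shows "\<bar>phase (j * q) x y - of_nat j * resonant_phase q x y\<bar>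
    \<le> (real j * real q)\<^sup>2 * (((real r)\<^sup>2 + (real s)\<^sup>2) * (\<Lambda> * \<bar>\<alpha> - of_int a / of_nat q\<bar>))"
proof -
  let ?\<beta> = "of_int a / of_nat q" and ?e = "\<Lambda> * \<bar>\<alpha> - of_int a / of_nat q\<bar>"
  have rat: "birkhoff_sum f ?\<beta> (m * (j * q)) z = of_nat (m * j) * shift_sum q z" for m z
    using birkhoff_sum_rational[OF q a, of "m * j" z] by (simp only: mult.assoc)
  have drift: "\<bar>birkhoff_sum f \<alpha> (m * (j * q)) z - of_nat (m * j) * shift_sum q z\<bar> \<le> (real (m * (j * q)))\<^sup>2 * ?e" for m z
    unfolding rat[symmetric] by (rule birkhoff_sum_drift[OF lip])
  have "phase (j * q) x y - of_nat j * resonant_phase q x y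
      = (birkhoff_sum f \<alpha> (r * (j * q)) x - of_nat (r * j) * shift_sum q x)
        - (birkhoff_sum f \<alpha> (s * (j * q)) y - of_nat (s * j) * shift_sum q y)"
    by (simp add: phase_def resonant_phase_def algebra_simps)
  then have "\<bar>phase (j * q) x y - of_nat j * resonant_phase q x y\<bar>
      \<le> (real (r * (j * q)))\<^sup>2 * ?e + (real (s * (j * q)))\<^sup>2 * ?e"
    using drift[of r x] drift[of s y] by linarith
  then show ?thesis by (simp add: power_mult_distrib distrib_left distrib_right mult_ac)
qed

lemma phase_sum_resonant_block:
  assumes lip: "\<And>x y. \<bar>f x - f y\<bar> \<le> \<Lambda> * \<bar>x - y\<bar>" and q: "q > 0" and a: "coprime a (int q)"
  defines "e \<equiv> ((real r)\<^sup>2 + (real s)\<^sup>2) * (\<Lambda> * \<bar>\<alpha> - of_int a / of_nat q\<bar>)"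
  shows "cmod (phase_sum (k * q) x y - (\<Sum>j<k. ec (of_nat j * resonant_phase q x y)) * phase_sum q x y)
    \<le> 4 * pi * (real k * real q) ^ 3 * e"
proof -
  let ?G = "resonant_phase q x y" and ?E = "phase_sum q x y"
  let ?E' = "\<lambda>j. phase_sum q (x + of_nat (r * (j * q)) * \<alpha>) (y + of_nat (s * (j * q)) * \<alpha>)"
  define \<eta> where "\<eta> = \<alpha> - of_int a / of_nat q"
  have L: "0 \<le> \<Lambda>" using order_trans[OF abs_ge_zero lip[of 1 0]] by simp
  have e0: "e \<ge> 0" unfolding e_def using L by simp
  have shift: "z + of_nat (m * (j * q)) * \<alpha> = (z + of_nat (m * (j * q)) * \<eta>) + of_int (int (m * j) * a)" for z m j
    using q by (simp add: \<eta>_def right_diff_distrib)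
  have trm: "cmod (ec (phase (j * q) x y) * ?E' j - ec (of_nat j * ?G) * ?E) \<le> 4 * pi * ((real k)\<^sup>2 * real q ^ 3) * e"
    if j: "j < k" for j
  proof -
    have jk: "(real j)\<^sup>2 \<le> (real k)\<^sup>2" "real j \<le> (real k)\<^sup>2"
    proof -
      show "(real j)\<^sup>2 \<le> (real k)\<^sup>2" using j by (intro power_mono) auto
      have "real j \<le> real (j * j)" by (cases j) auto
      then show "real j \<le> (real k)\<^sup>2" using \<open>(real j)\<^sup>2 \<le> (real k)\<^sup>2\<close> by (simp add: power2_eq_square)
    qed
    have "cmod (ec (phase (j * q) x y) - ec (of_nat j * ?G)) \<le> 2 * pi * ((real j * real q)\<^sup>2 * e)"
    proof (rule order_trans[OF norm_ec_diff mult_left_mono])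
      show "\<bar>phase (j * q) x y - of_nat j * ?G\<bar> \<le> (real j * real q)\<^sup>2 * e"
        unfolding e_def by (rule phase_near_resonance[OF lip q a])
    qed simp
    then have "cmod (ec (phase (j * q) x y) - ec (of_nat j * ?G)) * cmod (?E' j) \<le> 2 * pi * ((real j * real q)\<^sup>2 * e) * real q"
      using e0 by (intro mult_mono norm_phase_sum_le) auto
    moreover have "2 * pi * ((real j * real q)\<^sup>2 * e) * real q \<le> 2 * pi * ((real k)\<^sup>2 * real q ^ 3) * e"
    proof -
      have "2 * pi * ((real j * real q)\<^sup>2 * e) * real q = (real j)\<^sup>2 * (2 * pi * real q ^ 3 * e)"
        by (simp add: power_mult_distrib power3_eq_cube power2_eq_square)
      also have "\<dots> \<le> (real k)\<^sup>2 * (2 * pi * real q ^ 3 * e)"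
        using e0 by (intro mult_right_mono jk) auto
      finally show ?thesis by (simp add: mult_ac)
    qed
    ultimately have 1: "cmod ((ec (phase (j * q) x y) - ec (of_nat j * ?G)) * ?E' j) \<le> 2 * pi * ((real k)\<^sup>2 * real q ^ 3) * e"
      unfolding norm_mult by linarith
    have "?E' j = phase_sum q (x + of_nat (r * (j * q)) * \<eta>) (y + of_nat (s * (j * q)) * \<eta>)"
      unfolding shift by (rule phase_sum_periodic)
    then have "cmod (?E' j - ?E) \<le> 2 * pi * (real q)\<^sup>2 * \<Lambda>
        * (real r * \<bar>of_nat (r * (j * q)) * \<eta>\<bar> + real s * \<bar>of_nat (s * (j * q)) * \<eta>\<bar>)"
      using phase_sum_lipschitz[OF lip, of q "x + of_nat (r * (j * q)) * \<eta>" "y + of_nat (s * (j * q)) * \<eta>" x y] by simp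
    moreover have "2 * pi * (real q)\<^sup>2 * \<Lambda> * (real r * \<bar>of_nat (r * (j * q)) * \<eta>\<bar> + real s * \<bar>of_nat (s * (j * q)) * \<eta>\<bar>)
        = real j * (2 * pi * real q ^ 3 * e)"
      by (simp add: e_def \<eta>_def[symmetric] abs_mult power3_eq_cube power2_eq_square algebra_simps)
    moreover have "real j * (2 * pi * real q ^ 3 * e) \<le> (real k)\<^sup>2 * (2 * pi * real q ^ 3 * e)"
      using e0 by (intro mult_right_mono jk) auto
    ultimately have 2: "cmod (ec (of_nat j * ?G) * (?E' j - ?E)) \<le> (real k)\<^sup>2 * (2 * pi * real q ^ 3 * e)"
      unfolding norm_mult norm_ec by linarith
    have "ec (phase (j * q) x y) * ?E' j - ec (of_nat j * ?G) * ?E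
        = (ec (phase (j * q) x y) - ec (of_nat j * ?G)) * ?E' j + ec (of_nat j * ?G) * (?E' j - ?E)"
      by (simp add: algebra_simps)
    then have "cmod (ec (phase (j * q) x y) * ?E' j - ec (of_nat j * ?G) * ?E)
        \<le> 2 * pi * ((real k)\<^sup>2 * real q ^ 3) * e + (real k)\<^sup>2 * (2 * pi * real q ^ 3 * e)"
      by (simp only:) (rule norm_triangle_mono[OF 1 2])
    then show ?thesis by (simp add: algebra_simps)
  qed
  have "phase_sum (k * q) x y - (\<Sum>j<k. ec (of_nat j * ?G)) * ?E
      = (\<Sum>j<k. ec (phase (j * q) x y) * ?E' j - ec (of_nat j * ?G) * ?E)"
    unfolding phase_sum_blocks sum_distrib_right sum_subtractf ..
  then have "cmod (phase_sum (k * q) x y - (\<Sum>j<k. ec (of_nat j * ?G)) * ?E)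
      \<le> (\<Sum>j<k. cmod (ec (phase (j * q) x y) * ?E' j - ec (of_nat j * ?G) * ?E))"
    by (simp only: norm_sum)
  moreover have "(\<Sum>j<k. cmod (ec (phase (j * q) x y) * ?E' j - ec (of_nat j * ?G) * ?E))
      \<le> (\<Sum>j<k. 4 * pi * ((real k)\<^sup>2 * real q ^ 3) * e)"
    by (rule sum_mono) (simp only: lessThan_iff, rule trm)
  moreover have "(\<Sum>j<k. 4 * pi * ((real k)\<^sup>2 * real q ^ 3) * e) = 4 * pi * (real k * real q) ^ 3 * e"
    by (simp add: power_mult_distrib power3_eq_cube power2_eq_square)
  ultimately show ?thesis by linarith
qed

lemma resonant_phase_lipschitz:
  assumes lip: "\<And>x y. \<bar>f x - f y\<bar> \<le> \<Lambda> * \<bar>x - y\<bar>"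
  shows "\<bar>resonant_phase q (x + of_nat r * u) (y + of_nat s * u) - resonant_phase q (x + of_nat r * v) (y + of_nat s * v)\<bar>
    \<le> real q * \<Lambda> * ((real r)\<^sup>2 + (real s)\<^sup>2) * \<bar>u - v\<bar>"
proof -
  have S: "\<bar>of_nat m * shift_sum q (z + of_nat m * u) - of_nat m * shift_sum q (z + of_nat m * v)\<bar>
      \<le> (real m)\<^sup>2 * (real q * \<Lambda> * \<bar>u - v\<bar>)" for m z
  proof -
    have "\<bar>shift_sum q (z + of_nat m * u) - shift_sum q (z + of_nat m * v)\<bar> \<le> real q * \<Lambda> * (real m * \<bar>u - v\<bar>)"
      using shift_sum_lipschitz[OF lip, of q "z + of_nat m * u" "z + of_nat m * v"]
      by (simp add: right_diff_distrib[symmetric] abs_mult)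
    then have "real m * \<bar>shift_sum q (z + of_nat m * u) - shift_sum q (z + of_nat m * v)\<bar> \<le> real m * (real q * \<Lambda> * (real m * \<bar>u - v\<bar>))"
      by (rule mult_left_mono) simp
    then show ?thesis by (simp add: right_diff_distrib[symmetric] abs_mult power2_eq_square mult_ac)
  qed
  have "\<bar>resonant_phase q (x + of_nat r * u) (y + of_nat s * u) - resonant_phase q (x + of_nat r * v) (y + of_nat s * v)\<bar>
      \<le> (real r)\<^sup>2 * (real q * \<Lambda> * \<bar>u - v\<bar>) + (real s)\<^sup>2 * (real q * \<Lambda> * \<bar>u - v\<bar>)"
    using S[of r x] S[of s y] unfolding resonant_phase_def by linarith
  then show ?thesis by (simp add: algebra_simps)
qed

lemma resonant_phase_bound:
  assumes "resonant q"
  shows "\<bar>resonant_phase q x y - ((of_nat r - of_nat s) * (of_nat q * Re (coeff 0)) + of_nat q * t)\<bar>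
    \<le> (real r + real s) * resonance_constant * (real q * cmod (coeff q))"
proof -
  let ?c = "of_nat q * Re (coeff 0)" and ?B = "resonance_constant * (of_nat q * cmod (coeff q))"
  have S: "\<bar>of_nat m * (shift_sum q z - ?c)\<bar> \<le> real m * ?B" for m z
    using mult_left_mono[OF shift_sum_resonant[OF assms, of z], of "real m"] by (simp add: abs_mult)
  have "resonant_phase q x y - ((of_nat r - of_nat s) * ?c + of_nat q * t)
      = of_nat r * (shift_sum q x - ?c) - of_nat s * (shift_sum q y - ?c)"
    by (simp add: resonant_phase_def algebra_simps)
  then have "\<bar>resonant_phase q x y - ((of_nat r - of_nat s) * ?c + of_nat q * t)\<bar> \<le> real r * ?B + real s * ?B"
    using S[of r x] S[of s y] by linarith
  then show ?thesis by (simp add: algebra_simps)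
qed

lemma cont_resonant_phase:
  "continuous_on UNIV (\<lambda>u. resonant_phase q (x + of_nat r * u) (y + of_nat s * u))"
  unfolding resonant_phase_def
  by (intro continuous_intros continuous_on_compose2[OF cont_shift_sum]) auto

lemma resonant_phase_coefficient:
  assumes q: "q > 0" and rs: "r > 0" "s > 0" "\<not> s dvd r"
  shows "circle_mean (\<lambda>u. of_real (resonant_phase q (x + of_nat r * u) (y + of_nat s * u) - g) * ec (- (of_nat (r * q) * u)))
    = of_nat r * (ec (of_nat q * x) * (of_nat q * coeff q))"
proof -
  let ?e = "\<lambda>u. ec (- (of_nat (r * q) * u))"
  define S where "S m z u = complex_of_real (shift_sum q (z + of_nat m * u)) * ?e u" for m z u
  have cS: "continuous_on UNIV (S m z)" for m z
    unfolding S_def by (intro continuous_intros continuous_on_compose2[OF cont_shift_sum]) auto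
  have e_per: "?e (u + 1) = ?e u" for u by (rule ec_cong_int) (simp add: algebra_simps)
  have S_per: "S m z (u + 1) = S m z u" for m z u
  proof -
    have "z + of_nat m * (u + 1) = (z + of_nat m * u) + of_int (int m)" by (simp add: distrib_left)
    then show ?thesis unfolding S_def e_per by (simp only: shift_sum_per)
  qed
  have r: "circle_mean (S r x) = ec (of_nat q * x) * (of_nat q * coeff q)"
  proof -
    let ?g = "\<lambda>v. complex_of_real (shift_sum q (v + x)) * ec (- (of_int (int q) * v))"
    have cg: "continuous_on UNIV ?g"
      by (intro continuous_intros continuous_on_compose2[OF cont_shift_sum]) auto
    have pg: "?g (v + 1) = ?g v" for v
    proof -
      have "ec (- (of_int (int q) * (v + 1))) = ec (- (of_int (int q) * v))" by (rule ec_cong_int) (simp add: algebra_simps)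
      moreover have "v + 1 + x = (v + x) + of_int 1" by simp
      ultimately show ?thesis by (simp only: shift_sum_per)
    qed
    have "S r x u = ?g (of_int (int r) * u + 0)" for u by (simp add: S_def mult_ac add.commute)
    then have "circle_mean (S r x) = circle_mean (\<lambda>u. ?g (of_int (int r) * u + 0))" by presburger
    also have "\<dots> = circle_mean ?g" by (rule circle_mean_affine[OF cg pg]) (use rs in simp)
    also have "\<dots> = fourier_coeff (\<lambda>v. of_real (shift_sum q (v + x))) (int q)" by (simp only: fourier_coeff_def)
    also have "\<dots> = ec (of_int (int q) * x) * fourier_coeff (\<lambda>v. of_real (shift_sum q v)) (int q)"
      by (rule fourier_coeff_shift) (use shift_sum_per[of q _ 1] in \<open>auto intro!: continuous_intros cont_shift_sum\<close>)
    finally show ?thesis using q by (simp add: fourier_coeff_shift_sum)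
  qed
  have s: "circle_mean (S s y) = 0"
  proof -
    let ?h = "1 / (of_nat s * of_nat q) :: real"
    have "S s y (u + ?h) = ec (- (of_nat r / of_nat s)) * S s y u" for u
    proof -
      have "y + of_nat s * (u + ?h) = (y + of_nat s * u) + 1 / of_nat q" using rs q by (simp add: field_simps)
      moreover have "- (of_nat (r * q) * (u + ?h)) = - (of_nat r / of_nat s) + - (of_nat (r * q) * u)"
        using rs q by (simp add: field_simps)
      ultimately show ?thesis by (simp only: S_def shift_sum_per_inverse[OF q] ec_add mult_ac)
    qed
    then have "circle_mean (\<lambda>u. S s y (of_int 1 * u + ?h)) = ec (- (of_nat r / of_nat s)) * circle_mean (S s y)"
      by (simp add: circle_mean_cmult)
    moreover have "circle_mean (\<lambda>u. S s y (of_int 1 * u + ?h)) = circle_mean (S s y)"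
      by (rule circle_mean_affine[OF cS S_per]) simp
    moreover have "ec (- (of_nat r / of_nat s)) \<noteq> 1"
    proof
      assume "ec (- (of_nat r / of_nat s)) = 1"
      then have "real r / real s \<in> \<int>" by (simp add: ec_eq_1_iff)
      then obtain n where "real r / real s = of_int n" by (auto elim: Ints_cases)
      then have "real_of_int (int r) = of_int (n * int s)" using rs by (simp add: field_simps)
      then have "int r = n * int s" by (simp only: of_int_eq_iff)
      then have "int s dvd int r" by simp
      then show False using rs(3) by simp
    qed
    ultimately show ?thesis by (metis mult_cancel_right1)
  qed
  have e: "circle_mean ?e = 0"
  proof -
    have "circle_mean (\<lambda>u. 1 * ec (of_int (- int (r * q)) * u + 0)) = 0"
      unfolding circle_mean_ec using rs q by simp
    then show ?thesis by simp
  qed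
  let ?c = "complex_of_real (of_nat q * t - g)"
  have "of_real (resonant_phase q (x + of_nat r * u) (y + of_nat s * u) - g) * ?e u
      = of_nat r * S r x u + ((- of_nat s) * S s y u + ?c * ?e u)" for u
    by (simp add: resonant_phase_def S_def algebra_simps)
  then have "circle_mean (\<lambda>u. of_real (resonant_phase q (x + of_nat r * u) (y + of_nat s * u) - g) * ?e u)
      = circle_mean (\<lambda>u. of_nat r * S r x u + ((- of_nat s) * S s y u + ?c * ?e u))" by presburger
  also have "\<dots> = of_nat r * circle_mean (S r x) + ((- of_nat s) * circle_mean (S s y) + ?c * circle_mean ?e)"
  proof -
    have ce: "continuous_on UNIV ?e" by (intro continuous_intros)
    have c1: "continuous_on UNIV (\<lambda>u. of_nat r * S r x u)" "continuous_on UNIV (\<lambda>u. (- of_nat s) * S s y u)"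
      "continuous_on UNIV (\<lambda>u. ?c * ?e u)"
      by (intro continuous_intros cS ce)+
    show ?thesis
      by (simp only: circle_mean_add[OF c1(1) continuous_on_add[OF c1(2,3)]] circle_mean_add[OF c1(2,3)] circle_mean_cmult)
  qed
  finally show ?thesis by (simp only: r s e mult_zero_right add_0_right)
qed

end

(*FILE dev9/Res2*)
context two_orbits
begin

text \<open>Test function.\<close>

lemma resonant_phase_test:
  assumes q: "resonant q" and rs: "r > 0" "s > 0" "\<not> s dvd r"
    and small: "4 * pi * ((real r + real s) * resonance_constant)\<^sup>2 * (real q * cmod (coeff q)) \<le> 1"
  shows "3 * (real q * cmod (coeff q)) \<le> cmod (circle_mean (\<lambda>u.
    (ec (resonant_phase q (x + of_nat r * u) (y + of_nat s * u)) - 1) * ec (- (of_nat (r * q) * u))))"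
proof -
  let ?G = "\<lambda>u. resonant_phase q (x + of_nat r * u) (y + of_nat s * u)"
  let ?e = "\<lambda>u. ec (- (of_nat (r * q) * u))"
  let ?H = "\<lambda>u. (ec (?G u) - 1) * ?e u"
  define A where "A = real q * cmod (coeff q)"
  define B where "B = (real r + real s) * resonance_constant"
  define g where "g = (of_nat r - of_nat s) * (of_nat q * Re (coeff 0)) + of_nat q * t"
  have q0: "q > 0" using q by (simp add: resonant_def)
  have A0: "A \<ge> 0" by (simp add: A_def)
  have B0: "B \<ge> 0" using resonance_constant_ge_1 by (simp add: B_def)
  have G: "\<bar>?G u - g\<bar> \<le> B * A" for u
    unfolding g_def B_def A_def by (rule resonant_phase_bound[OF q])
  define L where "L u = (ec g - 1) * ?e u + (ec g * (of_real (2 * pi) * \<i>)) * (of_real (?G u - g) * ?e u)" for u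
  have cG: "continuous_on UNIV ?G" by (rule cont_resonant_phase)
  have ce: "continuous_on UNIV ?e" by (intro continuous_intros)
  have cGe: "continuous_on UNIV (\<lambda>u. complex_of_real (?G u - g) * ?e u)"
    by (intro continuous_intros cG ce)
  have e0: "circle_mean ?e = 0"
  proof -
    have "circle_mean (\<lambda>u. 1 * ec (of_int (- int (r * q)) * u + 0)) = 0"
      unfolding circle_mean_ec using rs q0 by simp
    then show ?thesis by simp
  qed
  have "circle_mean L = (ec g - 1) * circle_mean ?e + (ec g * (of_real (2 * pi) * \<i>)) * circle_mean (\<lambda>u. of_real (?G u - g) * ?e u)"
    unfolding L_def circle_mean_cmult[symmetric]
    by (rule circle_mean_add) (intro continuous_intros ce cGe)+
  then have "circle_mean L = (ec g * (of_real (2 * pi) * \<i>)) * (of_nat r * (ec (of_nat q * x) * (of_nat q * coeff q)))"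
    unfolding e0 resonant_phase_coefficient[OF q0 rs] by simp
  then have L: "cmod (circle_mean L) = 2 * pi * real r * A"
    by (simp add: norm_mult A_def)
  have "cmod (?H u - L u) \<le> (2 * pi * (B * A))\<^sup>2" for u
  proof -
    have "?H u - L u = ec g * (ec (?G u - g) - 1 - of_real (2 * pi * (?G u - g)) * \<i>) * ?e u"
    proof -
      have "ec (?G u) = ec g * ec (?G u - g)" by (simp flip: ec_add)
      then show ?thesis unfolding L_def by (simp add: algebra_simps)
    qed
    then have "cmod (?H u - L u) = cmod (ec (?G u - g) - 1 - of_real (2 * pi * (?G u - g)) * \<i>)"
      by (simp only: norm_mult norm_ec mult_1_right mult_1_left)
    moreover have "(2 * pi * (?G u - g))\<^sup>2 \<le> (2 * pi * (B * A))\<^sup>2"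
      using G[of u] by (intro power2_le_iff_abs_le[THEN iffD2]) (auto simp: abs_mult A0 B0)
    ultimately show ?thesis using ec_linearization[of "?G u - g"] by linarith
  qed
  then have "cmod (circle_mean ?H - circle_mean L) \<le> (2 * pi * (B * A))\<^sup>2"
    unfolding L_def by (intro circle_mean_diff_le continuous_intros cG ce) auto
  moreover have "(2 * pi * (B * A))\<^sup>2 \<le> pi * A"
  proof -
    have "(2 * pi * (B * A))\<^sup>2 = (4 * pi * B\<^sup>2 * A) * (pi * A)" by (simp add: power2_eq_square)
    also have "\<dots> \<le> 1 * (pi * A)"
      by (rule mult_right_mono) (use small A0 in \<open>auto simp: A_def B_def\<close>)
    finally show ?thesis by simp
  qed
  moreover have "cmod (circle_mean L) - cmod (circle_mean ?H) \<le> cmod (circle_mean ?H - circle_mean L)"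
    using norm_triangle_ineq2[of "circle_mean L" "circle_mean ?H"] by (simp only: norm_minus_commute)
  moreover have "2 * pi * A \<le> 2 * pi * real r * A" using rs(1) A0 by (intro mult_right_mono) auto
  moreover have "3 * A \<le> pi * A" using pi_gt3 A0 by (intro mult_right_mono) auto
  ultimately have "3 * A \<le> cmod (circle_mean ?H)" unfolding L by linarith
  then show ?thesis by (simp only: A_def)
qed

lemma resonant_phase_displacement:
  assumes lip: "\<And>x y. \<bar>f x - f y\<bar> \<le> \<Lambda> * \<bar>x - y\<bar>"
    and q: "resonant q" and rs: "r > 0" "s > 0" "\<not> s dvd r"
    and small: "4 * pi * ((real r + real s) * resonance_constant)\<^sup>2 * (real q * cmod (coeff q)) \<le> 1"
    and \<theta>: "0 < \<bar>\<theta>\<bar>" "\<bar>\<theta>\<bar> \<le> 1" and K: "real K * \<bar>\<theta>\<bar> \<le> 1" "1 < (real K + 1) * \<bar>\<theta>\<bar>"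
    and big: "2 * pi * (real q * \<Lambda> * ((real r)\<^sup>2 + (real s)\<^sup>2)) + 4 * pi * real (r * q) + 4 \<le> real K * (real q * cmod (coeff q))"
  shows "2 * real K * (real q * cmod (coeff q))
    \<le> (\<Sum>i<K. cmod (ec (resonant_phase q (x + of_nat r * (of_nat i * \<theta>)) (y + of_nat s * (of_nat i * \<theta>))) - 1))"
proof -
  let ?G = "\<lambda>u. resonant_phase q (x + of_nat r * u) (y + of_nat s * u)"
  let ?e = "\<lambda>u. ec (- (of_nat (r * q) * u))"
  define H where "H u = (ec (?G u) - 1) * ?e u" for u
  define \<Lambda>' where "\<Lambda>' = 2 * pi * (real q * \<Lambda> * ((real r)\<^sup>2 + (real s)\<^sup>2)) + 4 * pi * real (r * q)"
  have bd: "cmod (ec v - 1) \<le> 2" for v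
    using norm_triangle_ineq4[of "ec v" 1] by simp
  have H2: "cmod (H u) \<le> 2" for u using bd[of "?G u"] by (simp add: H_def norm_mult)
  have cH: "continuous_on UNIV H"
    unfolding H_def by (intro continuous_intros cont_resonant_phase)
  have pH: "H (u + 1) = H u" for u
  proof -
    have "?e (u + 1) = ?e u" by (rule ec_cong_int) (simp add: algebra_simps)
    moreover have "x + of_nat r * (u + 1) = (x + of_nat r * u) + of_int (int r)"
      "y + of_nat s * (u + 1) = (y + of_nat s * u) + of_int (int s)" by (simp_all add: distrib_left)
    ultimately show ?thesis unfolding H_def by (simp only: resonant_phase_per)
  qed
  have lipH: "cmod (H u - H v) \<le> \<Lambda>' * \<bar>u - v\<bar>" for u v
  proof -
    have "2 * pi * \<bar>?G u - ?G v\<bar> \<le> 2 * pi * (real q * \<Lambda> * ((real r)\<^sup>2 + (real s)\<^sup>2) * \<bar>u - v\<bar>)"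
      by (rule mult_left_mono[OF resonant_phase_lipschitz[OF lip]]) simp
    then have 1: "cmod ((ec (?G u) - ec (?G v)) * ?e u) \<le> 2 * pi * (real q * \<Lambda> * ((real r)\<^sup>2 + (real s)\<^sup>2) * \<bar>u - v\<bar>)"
      using norm_ec_diff[of "?G u" "?G v"] unfolding norm_mult norm_ec by linarith
    have e: "cmod (?e u - ?e v) \<le> 2 * pi * (real (r * q) * \<bar>u - v\<bar>)"
    proof -
      have "\<bar>- (of_nat (r * q) * u) - - (of_nat (r * q) * v)\<bar> = real (r * q) * \<bar>u - v\<bar>"
      proof -
        have "- (of_nat (r * q) * u) - - (of_nat (r * q) * v) = real (r * q) * (v - u)" by (simp add: algebra_simps)
        then show ?thesis by (simp only: abs_mult abs_minus_commute abs_of_nat)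
      qed
      then show ?thesis using norm_ec_diff[of "- (of_nat (r * q) * u)" "- (of_nat (r * q) * v)"] by (simp only:)
    qed
    have 2: "cmod ((ec (?G v) - 1) * (?e u - ?e v)) \<le> 2 * (2 * pi * (real (r * q) * \<bar>u - v\<bar>))"
      unfolding norm_mult by (rule mult_mono[OF bd e]) auto
    have "H u - H v = (ec (?G u) - ec (?G v)) * ?e u + (ec (?G v) - 1) * (?e u - ?e v)"
      by (simp add: H_def algebra_simps)
    then have "cmod (H u - H v) \<le> 2 * pi * (real q * \<Lambda> * ((real r)\<^sup>2 + (real s)\<^sup>2) * \<bar>u - v\<bar>) + 2 * (2 * pi * (real (r * q) * \<bar>u - v\<bar>))"
      by (simp only:) (rule norm_triangle_mono[OF 1 2])
    then show ?thesis by (simp add: \<Lambda>'_def algebra_simps)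
  qed
  have "cmod ((\<Sum>i<K. H (of_nat i * \<theta>)) - of_nat K * circle_mean H) \<le> \<Lambda>' + 4"
  proof (cases "\<theta> > 0")
    case True
    then show ?thesis using riemann_sum_bound[OF lipH H2] \<theta> K by simp
  next
    case False
    define H' where "H' u = H (- u)" for u
    have "circle_mean H' = circle_mean H"
      using circle_mean_affine[OF cH pH, of "- 1" 0] by (simp add: H'_def[abs_def])
    moreover have "cmod ((\<Sum>i<K. H' (of_nat i * (- \<theta>))) - of_nat K * circle_mean H') \<le> \<Lambda>' + 4"
    proof (rule riemann_sum_bound)
      show "cmod (H' u - H' v) \<le> \<Lambda>' * \<bar>u - v\<bar>" for u v
        using lipH[of "- u" "- v"] by (simp add: H'_def abs_minus_commute)
    qed (use False \<theta> K H2 in \<open>auto simp: H'_def\<close>)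
    ultimately show ?thesis by (simp add: H'_def)
  qed
  moreover have "cmod (of_nat K * circle_mean H) - cmod (\<Sum>i<K. H (of_nat i * \<theta>))
      \<le> cmod ((\<Sum>i<K. H (of_nat i * \<theta>)) - of_nat K * circle_mean H)"
    using norm_triangle_ineq2[of "of_nat K * circle_mean H" "\<Sum>i<K. H (of_nat i * \<theta>)"] by (simp only: norm_minus_commute)
  moreover have "real K * (3 * (real q * cmod (coeff q))) \<le> cmod (of_nat K * circle_mean H)"
    unfolding norm_mult norm_of_nat H_def by (rule mult_left_mono[OF resonant_phase_test[OF q rs small]]) simp
  moreover have "\<Lambda>' + 4 \<le> real K * (real q * cmod (coeff q))" using big by (simp add: \<Lambda>'_def)
  moreover have "real K * (3 * (real q * cmod (coeff q))) = 2 * real K * (real q * cmod (coeff q)) + real K * (real q * cmod (coeff q))"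
    by simp
  moreover have "cmod (\<Sum>i<K. H (of_nat i * \<theta>)) \<le> (\<Sum>i<K. cmod (ec (?G (of_nat i * \<theta>)) - 1))"
    by (rule order_trans[OF norm_sum]) (simp add: H_def norm_mult)
  ultimately show ?thesis by linarith
qed

definition contraction_factor :: real
  where "contraction_factor = 1 / (6 * pi * ((real r + real s) * resonance_constant))"

lemma contraction_factor:
  assumes "r > 0"
  shows "0 < contraction_factor" "contraction_factor \<le> 1 / 2"
proof -
  let ?B = "(real r + real s) * resonance_constant"
  have "1 * 1 \<le> ?B" using assms resonance_constant_ge_1 by (intro mult_mono) auto
  then have P: "1 * 1 \<le> pi * ?B" using pi_gt3 by (intro mult_mono) auto
  have eq: "contraction_factor = 1 / (6 * (pi * ?B))" by (simp only: contraction_factor_def mult.assoc)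
  have *: "0 < 1 / (6 * P)" "1 / (6 * P) \<le> 1 / 2" if "1 * 1 \<le> P" for P :: real
    using that by (simp_all add: divide_simps)
  show "0 < contraction_factor" "contraction_factor \<le> 1 / 2" unfolding eq by (rule *[OF P])+
qed

lemma resonant_average:
  assumes q: "resonant q" and r: "r > 0" and k: "2 / real k \<le> real q * cmod (coeff q)" "k > 0"
    and disp: "2 * real K * (real q * cmod (coeff q)) \<le> (\<Sum>i<K. cmod (ec (resonant_phase q (X i) (Y i)) - 1))"
  shows "(\<Sum>i<K. cmod (\<Sum>j<k. ec (of_nat j * resonant_phase q (X i) (Y i)))) \<le> (1 - contraction_factor) * (real k * real K)"
proof -
  let ?G = "\<lambda>i. resonant_phase q (X i) (Y i)"
  let ?w = "\<lambda>i. cmod (\<Sum>j<k. ec (of_nat j * ?G i))"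
  define A where "A = real q * cmod (coeff q)"
  define \<Gamma> where "\<Gamma> = (real r + real s) * resonance_constant * A"
  define g where "g = (of_nat r - of_nat s) * (of_nat q * Re (coeff 0)) + of_nat q * t"
  have A0: "A > 0" using q by (simp add: A_def resonant_def)
  have B1: "1 \<le> (real r + real s) * resonance_constant"
    using mult_mono[of 1 "real r + real s" 1 resonance_constant] r resonance_constant_ge_1 by simp
  have \<Gamma>A: "A \<le> \<Gamma>" using mult_right_mono[OF B1, of A] A0 by (simp add: \<Gamma>_def)
  have \<Gamma>: "\<Gamma> \<le> pi * \<Gamma>" "0 < \<Gamma>" using \<Gamma>A A0 pi_gt3 mult_right_mono[of 1 pi \<Gamma>] by auto
  have "\<bar>?G i - g\<bar> \<le> \<Gamma>" for i
    using resonant_phase_bound[OF q, of "X i" "Y i"] by (simp only: g_def \<Gamma>_def A_def)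
  then have "2 * pi * \<bar>?G i - g\<bar> \<le> 2 * pi * \<Gamma>" for i by (intro mult_left_mono) auto
  then have near: "cmod (ec (?G i) - ec g) \<le> 2 * pi * \<Gamma>" for i
    using norm_ec_diff[of "?G i" g] order_trans by blast
  have tri: "cmod (ec g - 1) \<le> cmod (ec (?G i) - ec g) + cmod (ec (?G i) - 1)"
    "cmod (ec (?G i) - 1) \<le> cmod (ec (?G i) - ec g) + cmod (ec g - 1)" for i
    using norm_triangle_ineq4[of "ec (?G i) - 1" "ec (?G i) - ec g"] norm_triangle_ineq[of "ec (?G i) - ec g" "ec g - 1"]
    by simp_all
  show ?thesis
  proof (cases "cmod (ec g - 1) \<ge> 4 * pi * \<Gamma>")
    case True
    have "?w i \<le> real k * (1 / 2)" for i
    proof -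
      have z: "2 * pi * \<Gamma> \<le> cmod (ec (?G i) - 1)" using True near[of i] tri(1)[of i] by linarith
      then have z': "2 * \<Gamma> \<le> cmod (ec (?G i) - 1)" using \<Gamma> by linarith
      then have "ec (?G i) \<noteq> 1" using \<Gamma>(2) by auto
      then have "?w i \<le> 2 / cmod (ec (?G i) - 1)" by (rule norm_geometric_ec)
      moreover have "2 / cmod (ec (?G i) - 1) \<le> 2 / (2 * \<Gamma>)"
        using z' \<Gamma>(2) by (intro divide_left_mono mult_pos_pos) auto
      moreover have "2 / (2 * \<Gamma>) \<le> real k * (1 / 2)"
      proof -
        have "2 / real k \<le> \<Gamma>" using k(1) \<Gamma>A by (simp add: A_def)
        then show ?thesis using k(2) \<Gamma>(2) by (simp add: field_simps)
      qed
      ultimately show ?thesis by linarith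
    qed
    then have "(\<Sum>i<K. ?w i) \<le> (\<Sum>i<K. real k * (1 / 2))" by (intro sum_mono)
    then have "(\<Sum>i<K. ?w i) \<le> (1 / 2) * (real k * real K)" by (simp add: mult_ac)
    moreover have "(1 / 2) * (real k * real K) \<le> (1 - contraction_factor) * (real k * real K)"
      using contraction_factor(2)[OF r] by (intro mult_right_mono) auto
    ultimately show ?thesis by linarith
  next
    case False
    define Z where "Z = 6 * pi * \<Gamma>"
    have Z0: "Z > 0" using \<Gamma> by (simp add: Z_def)
    have "cmod (ec (?G i) - 1) \<le> Z" for i
      using False near[of i] tri(2)[of i] unfolding Z_def by linarith
    then have "?w i \<le> real k * (1 - (cmod (ec (?G i) - 1) - 2 / real k) / Z)" for i
      by (intro geometric_sum_ec_gain Z0 k(2))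
    then have "(\<Sum>i<K. ?w i) \<le> (\<Sum>i<K. real k * (1 - (cmod (ec (?G i) - 1) - 2 / real k) / Z))" by (intro sum_mono)
    also have "\<dots> = real k * (real K - ((\<Sum>i<K. cmod (ec (?G i) - 1)) - real K * (2 / real k)) / Z)"
      by (simp add: sum_distrib_left[symmetric] sum_subtractf sum_divide_distrib[symmetric])
    also have "\<dots> \<le> real k * (real K - (real K * A) / Z)"
    proof -
      have "real K * (2 / real k) \<le> real K * A" using k(1) by (intro mult_left_mono) (auto simp: A_def)
      moreover have "2 * real K * A = real K * A + real K * A" by simp
      ultimately have "real K * A \<le> (\<Sum>i<K. cmod (ec (?G i) - 1)) - real K * (2 / real k)"
        using disp unfolding A_def[symmetric] by linarith
      then show ?thesis using Z0 by (intro mult_left_mono diff_left_mono divide_right_mono) auto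
    qed
    also have "(real K * A) / Z = contraction_factor * real K"
      using A0 by (simp add: Z_def \<Gamma>_def contraction_factor_def)
    also have "real k * (real K - contraction_factor * real K) = (1 - contraction_factor) * (real k * real K)"
      by (simp add: algebra_simps)
    finally show ?thesis .
  qed
qed

lemma resonance_contraction:
  assumes lip: "\<And>x y. \<bar>f x - f y\<bar> \<le> \<Lambda> * \<bar>x - y\<bar>"
    and q: "resonant q" and rs: "r > 0" "s > 0" "\<not> s dvd r"
    and small: "4 * pi * ((real r + real s) * resonance_constant)\<^sup>2 * (real q * cmod (coeff q)) \<le> 1"
    and a: "coprime a (int q)" and k: "2 / real k \<le> real q * cmod (coeff q)" "k > 0"
  defines "\<eta> \<equiv> \<alpha> - of_int a / of_nat q"
    and "\<Lambda>' \<equiv> 2 * pi * (real q * \<Lambda> * ((real r)\<^sup>2 + (real s)\<^sup>2)) + 4 * pi * real (r * q) + 4"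
  assumes \<eta>: "\<eta> \<noteq> 0"
    "4 * pi * (real k * real q) ^ 3 * (((real r)\<^sup>2 + (real s)\<^sup>2) * (\<Lambda> * \<bar>\<eta>\<bar>)) \<le> 1"
    "real (k * q) * \<bar>\<eta>\<bar> * (\<Lambda>' + real q * cmod (coeff q)) \<le> real q * cmod (coeff q)"
    and B: "\<And>x y. cmod (phase_sum q x y) \<le> B"
  shows "\<exists>N\<ge>1. \<forall>x y. cmod (phase_sum N x y) \<le> ((1 - contraction_factor) * (B / real q) + 1 / real q) * real N"
proof -
  define A where "A = real q * cmod (coeff q)"
  define \<theta> where "\<theta> = real (k * q) * \<eta>"
  define K where "K = nat \<lfloor>1 / \<bar>\<theta>\<bar>\<rfloor>"
  have q0: "q > 0" and A0: "A > 0" using q by (auto simp: resonant_def A_def)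
  have L: "0 \<le> \<Lambda>" using order_trans[OF abs_ge_zero lip[of 1 0]] by simp
  have L': "\<Lambda>' \<ge> 4" unfolding \<Lambda>'_def using L by simp
  have \<theta>0: "\<bar>\<theta>\<bar> > 0" using \<eta>(1) k q0 by (simp add: \<theta>_def)
  have \<theta>A: "\<bar>\<theta>\<bar> * (\<Lambda>' + A) \<le> A" using \<eta>(3) by (simp add: \<theta>_def A_def abs_mult)
  have \<theta>1: "\<bar>\<theta>\<bar> \<le> 1"
  proof -
    have "\<bar>\<theta>\<bar> * A \<le> \<bar>\<theta>\<bar> * (\<Lambda>' + A)" using L' by (intro mult_left_mono) auto
    then have "\<bar>\<theta>\<bar> * A \<le> 1 * A" using \<theta>A by linarith
    then show ?thesis using A0 by (simp only: mult_le_cancel_right_pos)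
  qed
  have K: "real K \<le> 1 / \<bar>\<theta>\<bar>" "1 / \<bar>\<theta>\<bar> < real K + 1"
  proof -
    have "0 \<le> \<lfloor>1 / \<bar>\<theta>\<bar>\<rfloor>" by simp
    then have "real K = of_int \<lfloor>1 / \<bar>\<theta>\<bar>\<rfloor>" by (simp add: K_def)
    then show "real K \<le> 1 / \<bar>\<theta>\<bar>" "1 / \<bar>\<theta>\<bar> < real K + 1" by linarith+
  qed
  have K': "real K * \<bar>\<theta>\<bar> \<le> 1" "1 < (real K + 1) * \<bar>\<theta>\<bar>"
    using K \<theta>0 by (simp_all add: field_simps)
  have K0: "K > 0"
  proof -
    have "1 \<le> 1 / \<bar>\<theta>\<bar>" using \<theta>0 \<theta>1 by simp
    then show ?thesis using K(2) by (cases K) auto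
  qed
  have big: "\<Lambda>' \<le> real K * A"
  proof -
    have "(\<Lambda>' + A) \<le> A / \<bar>\<theta>\<bar>" using \<theta>A \<theta>0 by (simp add: field_simps)
    also have "A / \<bar>\<theta>\<bar> = A * (1 / \<bar>\<theta>\<bar>)" by simp
    also have "\<dots> \<le> A * (real K + 1)" using K(2) A0 by (intro mult_left_mono) auto
    finally show ?thesis by (simp add: algebra_simps)
  qed
  have B0: "B \<ge> 0" using order_trans[OF norm_ge_zero B] .
  have main: "cmod (phase_sum (K * (k * q)) x y) \<le> ((1 - contraction_factor) * (B / real q) + 1 / real q) * real (K * (k * q))" for x y
  proof -
    let ?X = "\<lambda>i. x + of_nat r * (of_nat i * \<theta>)" and ?Y = "\<lambda>i. y + of_nat s * (of_nat i * \<theta>)"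
    let ?w = "\<lambda>i. cmod (\<Sum>j<k. ec (of_nat j * resonant_phase q (?X i) (?Y i)))"
    have block: "cmod (phase_sum (k * q) x' y') \<le> cmod (\<Sum>j<k. ec (of_nat j * resonant_phase q x' y')) * B + 1" for x' y'
    proof -
      let ?S = "\<Sum>j<k. ec (of_nat j * resonant_phase q x' y')"
      have 1: "cmod (?S * phase_sum q x' y') \<le> cmod ?S * B"
        unfolding norm_mult by (rule mult_left_mono[OF B]) simp
      have 2: "cmod (phase_sum (k * q) x' y' - ?S * phase_sum q x' y') \<le> 1"
        using phase_sum_resonant_block[OF lip q0 a, of k x' y'] \<eta>(2) unfolding \<eta>_def by (rule order_trans)
      have "phase_sum (k * q) x' y' = ?S * phase_sum q x' y' + (phase_sum (k * q) x' y' - ?S * phase_sum q x' y')"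
        by simp
      then show ?thesis using norm_triangle_mono[OF 1 2] by (simp only: add_diff_cancel_left' add_diff_eq diff_add_cancel)
    qed
    have start: "z + of_nat (m * (i * (k * q))) * \<alpha> = (z + of_nat m * (of_nat i * \<theta>)) + of_int (int (m * i * k) * a)" for z m i
    proof -
      have "\<alpha> = \<eta> + of_int a / of_nat q" by (simp add: \<eta>_def)
      then have "of_nat (m * (i * (k * q))) * \<alpha> = of_nat (m * (i * (k * q))) * \<eta> + of_nat (m * (i * (k * q))) * (of_int a / of_nat q)"
        by (simp only: distrib_left)
      then show ?thesis using q0 by (simp add: \<theta>_def mult_ac)
    qed
    have "cmod (phase_sum (K * (k * q)) x y) \<le> (\<Sum>i<K. cmod (phase_sum (k * q) (x + of_nat (r * (i * (k * q))) * \<alpha>) (y + of_nat (s * (i * (k * q))) * \<alpha>)))"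
      by (rule norm_phase_sum_blocks_le)
    also have "\<dots> \<le> (\<Sum>i<K. ?w i * B + 1)"
    proof (rule sum_mono)
      show "cmod (phase_sum (k * q) (x + of_nat (r * (i * (k * q))) * \<alpha>) (y + of_nat (s * (i * (k * q))) * \<alpha>)) \<le> ?w i * B + 1" for i
        unfolding start phase_sum_periodic by (rule block)
    qed
    also have "\<dots> = (\<Sum>i<K. ?w i) * B + real K" by (simp add: sum.distrib sum_distrib_right)
    also have "\<dots> \<le> ((1 - contraction_factor) * (real k * real K)) * B + real k * real K"
    proof (rule add_mono[OF mult_right_mono[OF _ B0]])
      show "(\<Sum>i<K. ?w i) \<le> (1 - contraction_factor) * (real k * real K)"
      proof (rule resonant_average[OF q rs(1) k])
        show "2 * real K * (real q * cmod (coeff q)) \<le> (\<Sum>i<K. cmod (ec (resonant_phase q (?X i) (?Y i)) - 1))"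
          by (rule resonant_phase_displacement[OF lip q rs small \<theta>0 \<theta>1 K'])
            (use big in \<open>simp add: \<Lambda>'_def A_def\<close>)
      qed
      show "real K \<le> real k * real K" using mult_right_mono[of 1 "real k" "real K"] k(2) by simp
    qed
    also have "\<dots> = ((1 - contraction_factor) * (B / real q) + 1 / real q) * real (K * (k * q))"
      using q0 by (simp add: field_simps)
    finally show ?thesis .
  qed
  have "K * (k * q) \<ge> 1" using K0 k(2) q0 by (simp add: Suc_le_eq)
  with main show ?thesis by blast
qed

text \<open>Infimum argument.\<close>

lemma phase_mean_zero_if_contracting:
  assumes \<kappa>: "0 < \<kappa>" "\<kappa> \<le> 1" and contr: "\<And>j :: nat. \<exists>q\<ge>j. q > 0 \<and> (\<forall>B. (\<forall>x y. cmod (phase_sum q x y) \<le> B) \<longrightarrow>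
      (\<exists>N\<ge>1. \<forall>x y. cmod (phase_sum N x y) \<le> ((1 - \<kappa>) * (B / real q) + 1 / real q) * real N))"
  shows "mean_zero (\<lambda>n. ec (phase n x y))"
proof -
  define S where "S = {e. 0 \<le> e \<and> (\<exists>M\<ge>0. \<forall>N x y. cmod (phase_sum N x y) \<le> e * real N + M)}"
  have "1 \<in> S" unfolding S_def using norm_phase_sum_le by (auto intro!: exI[of _ 0])
  then have ne: "S \<noteq> {}" by blast
  have bdd: "bdd_below S" by (rule bdd_belowI[of _ 0]) (auto simp: S_def)
  have "Inf S \<le> 0"
  proof (rule ccontr)
    define I where "I = Inf S"
    assume "\<not> Inf S \<le> 0"
    then have I: "I > 0" by (simp add: I_def)
    have "I < I * (1 + \<kappa> / 2)" using I \<kappa> by (simp add: distrib_left)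
    then obtain e where e: "e \<in> S" "e < I * (1 + \<kappa> / 2)" unfolding I_def using cInf_lessD[OF ne] by blast
    then obtain M where M: "M \<ge> 0" "\<And>N x y. cmod (phase_sum N x y) \<le> e * real N + M" and e0: "e \<ge> 0"
      by (auto simp: S_def)
    define j where "j = nat \<lceil>(M + 1) / (I * \<kappa> / 4)\<rceil>"
    obtain q where q: "q \<ge> j" "q > 0" and contr_q: "\<And>B. (\<forall>x y. cmod (phase_sum q x y) \<le> B) \<Longrightarrow>
      (\<exists>N\<ge>1. \<forall>x y. cmod (phase_sum N x y) \<le> ((1 - \<kappa>) * (B / real q) + 1 / real q) * real N)"
      using contr[of j] by blast
    have "(M + 1) / (I * \<kappa> / 4) \<le> real j" unfolding j_def by (rule real_nat_ceiling_ge)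
    then have "(M + 1) / (I * \<kappa> / 4) \<le> real q" using q(1) by linarith
    then have Mq: "(M + 1) / real q \<le> I * \<kappa> / 4" using q(2) I \<kappa> by (simp add: field_simps)
    define e' where "e' = (1 - \<kappa>) * ((e * real q + M) / real q) + 1 / real q"
    obtain N where N: "N \<ge> 1" "\<And>x y. cmod (phase_sum N x y) \<le> e' * real N"
      using contr_q[of "e * real q + M"] M(2) unfolding e'_def by blast
    have e'0: "e' \<ge> 0" using \<kappa> e0 M(1) by (simp add: e'_def)
    have "e' \<in> S"
      unfolding S_def using e'0 phase_sum_propagate[OF _ e'0 N(2)] N(1) by (auto intro!: exI[of _ "real N"])
    then have "I \<le> e'" unfolding I_def by (rule cInf_lower[OF _ bdd])
    moreover have "e' \<le> (1 - \<kappa>) * e + (M + 1) / real q"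
    proof -
      have "(1 - \<kappa>) * (M / real q) \<le> 1 * (M / real q)" using \<kappa> M(1) by (intro mult_right_mono) auto
      moreover have "e' = (1 - \<kappa>) * e + (1 - \<kappa>) * (M / real q) + 1 / real q"
        using q(2) by (simp add: e'_def add_divide_distrib distrib_left)
      ultimately show ?thesis by (simp add: add_divide_distrib)
    qed
    moreover have "(1 - \<kappa>) * e \<le> (1 - \<kappa>) * (I * (1 + \<kappa> / 2))" using e(2) \<kappa> by (intro mult_left_mono) auto
    moreover have "(1 - \<kappa>) * (I * (1 + \<kappa> / 2)) = I - I * \<kappa> / 2 - I * \<kappa>\<^sup>2 / 2" by (simp add: field_simps power2_eq_square)
    moreover have "I * \<kappa>\<^sup>2 / 2 \<ge> 0" "I * \<kappa> > 0" using I \<kappa> by auto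
    ultimately show False using Mq by linarith
  qed
  show ?thesis
    unfolding mean_zero_iff
  proof (intro allI impI)
    fix \<epsilon> :: real assume \<epsilon>: "\<epsilon> > 0"
    have "Inf S < \<epsilon> / 2" using \<open>Inf S \<le> 0\<close> \<epsilon> by simp
    then obtain e where e: "e \<in> S" "e < \<epsilon> / 2" using cInf_lessD[OF ne] by blast
    then obtain M where M: "M \<ge> 0" "\<And>N x y. cmod (phase_sum N x y) \<le> e * real N + M"
      by (auto simp: S_def)
    show "\<forall>\<^sub>F N in sequentially. cmod (\<Sum>n = 1..N. ec (phase n x y)) \<le> \<epsilon> * real N"
      using eventually_ge_at_top[of "nat \<lceil>2 * (e + M + 1) / \<epsilon>\<rceil>"]
    proof eventually_elim
      case (elim N)
      have "2 * (e + M + 1) / \<epsilon> \<le> real N"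
        using real_nat_ceiling_ge[of "2 * (e + M + 1) / \<epsilon>"] elim by linarith
      then have N: "e + M + 1 \<le> \<epsilon> / 2 * real N" using \<epsilon> by (simp add: field_simps)
      have "{..<Suc N} = insert 0 {1..N}" by auto
      then have "(\<Sum>n = 1..N. ec (phase n x y)) = phase_sum (Suc N) x y - ec (phase 0 x y)"
        by (simp add: phase_sum_def)
      then have "cmod (\<Sum>n = 1..N. ec (phase n x y)) \<le> e * real (Suc N) + M + 1"
        using M(2)[of "Suc N" x y] norm_triangle_ineq4[of "phase_sum (Suc N) x y" "ec (phase 0 x y)"] by simp
      moreover have "e * real N \<le> \<epsilon> / 2 * real N" using e(2) by (intro mult_right_mono) auto
      moreover have "e * real (Suc N) = e * real N + e" by (simp add: distrib_left)
      moreover have "\<epsilon> / 2 * real N + \<epsilon> / 2 * real N = \<epsilon> * real N" by simp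
      ultimately show ?case using N by linarith
    qed
  qed
qed

end

(*FILE dev9/Final*)
context periodic_C1_Hoelder
begin

lemma contraction_radius:
  fixes r s :: nat
  assumes q: "resonant q" and rs: "r > 0" "s > 0" "\<not> s dvd r"
    and small: "4 * pi * ((real r + real s) * resonance_constant)\<^sup>2 * (real q * cmod (coeff q)) \<le> 1"
  obtains \<rho> where "\<rho> > 0"
    "\<And>\<alpha> t a B. coprime a (int q) \<Longrightarrow> \<alpha> \<noteq> of_int a / of_nat q \<Longrightarrow> \<bar>\<alpha> - of_int a / of_nat q\<bar> < \<rho> \<Longrightarrow>
      (\<forall>x y. cmod (two_orbits.phase_sum f r s t \<alpha> q x y) \<le> B) \<Longrightarrow>
      \<exists>N\<ge>1. \<forall>x y. cmod (two_orbits.phase_sum f r s t \<alpha> N x y)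
        \<le> ((1 - two_orbits.contraction_factor \<delta> r s) * (B / real q) + 1 / real q) * real N"
proof -
  obtain \<Lambda> where \<Lambda>: "\<Lambda> > 0" "\<And>x y. \<bar>f x - f y\<bar> \<le> \<Lambda> * \<bar>x - y\<bar>" by (rule lipschitz, rule that)
  define A where "A = real q * cmod (coeff q)"
  have A: "A > 0" using q by (simp add: A_def resonant_def)
  have q0: "q > 0" using q by (simp add: resonant_def)
  define k where "k = nat \<lceil>2 / A\<rceil>"
  have kA: "2 / A \<le> real k" unfolding k_def by (rule real_nat_ceiling_ge)
  then have k0: "k > 0" using A by (cases k) (auto simp: divide_le_0_iff)
  have k: "2 / real k \<le> A" using kA k0 A by (simp add: field_simps)
  define D where "D = 4 * pi * (real k * real q) ^ 3 * (((real r)\<^sup>2 + (real s)\<^sup>2) * \<Lambda>)"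
  define D' where "D' = real (k * q) * (2 * pi * (real q * \<Lambda> * ((real r)\<^sup>2 + (real s)\<^sup>2)) + 4 * pi * real (r * q) + 4 + A)"
  have pos: "D > 0" "D' > 0" using \<Lambda>(1) rs k0 q0 A by (auto simp: D_def D'_def add_pos_pos add_nonneg_pos)
  define \<rho> where "\<rho> = min (1 / D) (A / D')"
  have \<rho>: "\<rho> > 0" using pos A by (simp add: \<rho>_def)
  show ?thesis
  proof (rule that[OF \<rho>])
    fix \<alpha> t :: real and a :: int and B :: real
    assume a: "coprime a (int q)" and \<alpha>: "\<alpha> \<noteq> of_int a / of_nat q" "\<bar>\<alpha> - of_int a / of_nat q\<bar> < \<rho>"
      and B: "\<forall>x y. cmod (two_orbits.phase_sum f r s t \<alpha> q x y) \<le> B"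
    interpret two_orbits f f' \<delta> C r s t \<alpha> by unfold_locales
    have e: "D * \<bar>\<alpha> - of_int a / of_nat q\<bar> \<le> 1" "D' * \<bar>\<alpha> - of_int a / of_nat q\<bar> \<le> A"
      using \<alpha>(2) pos by (auto simp: \<rho>_def field_simps)
    show "\<exists>N\<ge>1. \<forall>x y. cmod (phase_sum N x y) \<le> ((1 - contraction_factor) * (B / real q) + 1 / real q) * real N"
    proof (rule resonance_contraction[OF \<Lambda>(2) q rs small a k[unfolded A_def] k0])
      show "\<alpha> - of_int a / of_nat q \<noteq> 0" using \<alpha>(1) by simp
      show "4 * pi * (real k * real q) ^ 3 * (((real r)\<^sup>2 + (real s)\<^sup>2) * (\<Lambda> * \<bar>\<alpha> - of_int a / of_nat q\<bar>)) \<le> 1"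
        using e(1) by (simp add: D_def mult.assoc)
      have "real (k * q) * \<bar>\<alpha> - of_int a / of_nat q\<bar> * (2 * pi * (real q * \<Lambda> * ((real r)\<^sup>2 + (real s)\<^sup>2)) + 4 * pi * real (r * q) + 4 + A)
          = D' * \<bar>\<alpha> - of_int a / of_nat q\<bar>" unfolding D'_def by (simp only: mult_ac)
      then show "real (k * q) * \<bar>\<alpha> - of_int a / of_nat q\<bar> * (2 * pi * (real q * \<Lambda> * ((real r)\<^sup>2 + (real s)\<^sup>2)) + 4 * pi * real (r * q) + 4
          + real q * cmod (coeff q)) \<le> real q * cmod (coeff q)"
        using e(2) by (simp only: A_def)
      show "cmod (phase_sum q x y) \<le> B" for x y using B by blast
    qed
  qed
qed

theorem generic_phase_mean_zero:
  fixes r s :: nat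
  assumes inf: "\<And>j. \<exists>n\<ge>j. coeff n \<noteq> 0" and rs: "r > 0" "s > 0" "\<not> s dvd r"
  shows "\<exists>U :: nat \<Rightarrow> real set. (\<forall>j. open (U j) \<and> closure (U j) = UNIV) \<and>
    (\<forall>\<alpha>. (\<forall>j. \<alpha> \<in> U j) \<longrightarrow> (\<forall>t x y. mean_zero (\<lambda>n. ec (birkhoff_sum f \<alpha> (r * n) x - birkhoff_sum f \<alpha> (s * n) y + of_nat n * t))))"
proof -
  define good where "good q \<longleftrightarrow> resonant q \<and> 4 * pi * ((real r + real s) * resonance_constant)\<^sup>2 * (real q * cmod (coeff q)) \<le> 1" for q
  have goods: "\<exists>q\<ge>j. good q" for j
  proof -
    have "(\<lambda>q. 4 * pi * ((real r + real s) * resonance_constant)\<^sup>2 * (real q * cmod (coeff q))) \<longlonglongrightarrow> 0"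
      by (rule tendsto_mult_right_zero[OF coeff_times_tendsto_0])
    then have "\<forall>\<^sub>F q in sequentially. 4 * pi * ((real r + real s) * resonance_constant)\<^sup>2 * (real q * cmod (coeff q)) < 1"
      by (rule order_tendstoD(2)) simp
    then obtain n where n: "\<And>q. q \<ge> n \<Longrightarrow> 4 * pi * ((real r + real s) * resonance_constant)\<^sup>2 * (real q * cmod (coeff q)) < 1"
      unfolding eventually_sequentially by blast
    obtain q where "q \<ge> max j n" "resonant q" using infinitely_many_resonant[OF inf] by blast
    then show ?thesis using n[of q] by (auto simp: good_def intro!: exI[of _ q])
  qed
  define contracting where "contracting \<rho> q \<longleftrightarrow> (\<forall>\<alpha> t a B. coprime a (int q) \<longrightarrow> \<alpha> \<noteq> of_int a / of_nat q \<longrightarrow> \<bar>\<alpha> - of_int a / of_nat q\<bar> < \<rho> \<longrightarrow>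
      (\<forall>x y. cmod (two_orbits.phase_sum f r s t \<alpha> q x y) \<le> B) \<longrightarrow>
      (\<exists>N\<ge>1. \<forall>x y. cmod (two_orbits.phase_sum f r s t \<alpha> N x y)
        \<le> ((1 - two_orbits.contraction_factor \<delta> r s) * (B / real q) + 1 / real q) * real N))" for \<rho> q
  have "\<exists>\<rho>>0. contracting \<rho> q" if "good q" for q
  proof -
    have q: "resonant q" "4 * pi * ((real r + real s) * resonance_constant)\<^sup>2 * (real q * cmod (coeff q)) \<le> 1"
      using that by (auto simp: good_def)
    show ?thesis
    proof (rule contraction_radius[OF q(1) rs q(2)])
      fix \<rho> :: real
      assume \<rho>: "\<rho> > 0" and *: "\<And>\<alpha> t a B. coprime a (int q) \<Longrightarrow> \<alpha> \<noteq> of_int a / of_nat q \<Longrightarrow> \<bar>\<alpha> - of_int a / of_nat q\<bar> < \<rho> \<Longrightarrow>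
        (\<forall>x y. cmod (two_orbits.phase_sum f r s t \<alpha> q x y) \<le> B) \<Longrightarrow>
        \<exists>N\<ge>1. \<forall>x y. cmod (two_orbits.phase_sum f r s t \<alpha> N x y)
          \<le> ((1 - two_orbits.contraction_factor \<delta> r s) * (B / real q) + 1 / real q) * real N"
      show "\<exists>\<rho>>0. contracting \<rho> q" unfolding contracting_def by (rule exI[of _ \<rho>], intro conjI \<rho> allI impI, rule *)
    qed
  qed
  then obtain \<rho> where \<rho>: "\<And>q. good q \<Longrightarrow> \<rho> q > 0" "\<And>q. good q \<Longrightarrow> contracting (\<rho> q) q" by metis
  define W where "W q a = ball (of_int a / of_nat q) (\<rho> q) - {of_int a / of_nat q :: real}" for q and a :: int
  define U where "U j = (\<Union>q\<in>{q. q \<ge> j \<and> good q}. \<Union>a\<in>{a. coprime a (int q)}. W q a)" for j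
  have op: "open (U j)" for j
    unfolding U_def W_def by (intro open_UN ballI open_Diff open_ball finite_imp_closed) simp
  have dense: "closure (U j) = UNIV" for j
  proof -
    have "x \<in> closure (U j)" for x
      unfolding closure_approachable
    proof (intro allI impI)
      fix e :: real assume e: "e > 0"
      have "\<forall>\<^sub>F q in sequentially. \<exists>a :: int. coprime a (int q) \<and> x - e < of_int a / real q \<and> of_int a / real q < x + e"
        by (rule coprime_fractions_dense) (use e in simp)
      then obtain n where n: "\<And>q. q \<ge> n \<Longrightarrow> \<exists>a :: int. coprime a (int q) \<and> x - e < of_int a / real q \<and> of_int a / real q < x + e"
        unfolding eventually_sequentially by blast
      obtain q where q: "q \<ge> max n j" "good q" using goods by blast
      then obtain a :: int where a: "coprime a (int q)" "x - e < of_int a / real q" "of_int a / real q < x + e"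
        using n[of q] by auto
      define d where "d = min (\<rho> q) (x + e - of_int a / real q) / 2"
      have d: "d > 0" "d < \<rho> q" "d < x + e - of_int a / real q"
        using \<rho>(1)[OF q(2)] a(3) by (auto simp: d_def min_def)
      have "of_int a / real q + d \<in> W q a" using d by (simp add: W_def dist_real_def)
      then have "of_int a / real q + d \<in> U j" unfolding U_def using q a(1) by auto
      moreover have "dist (of_int a / real q + d) x < e" using a d by (simp add: dist_real_def abs_less_iff)
      ultimately show "\<exists>y\<in>U j. dist y x < e" by blast
    qed
    then show ?thesis by blast
  qed
  have "mean_zero (\<lambda>n. ec (birkhoff_sum f \<alpha> (r * n) x - birkhoff_sum f \<alpha> (s * n) y + of_nat n * t))"
    if \<alpha>: "\<forall>j. \<alpha> \<in> U j" for \<alpha> t x y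
  proof -
    interpret two_orbits f f' \<delta> C r s t \<alpha> by unfold_locales
    have "mean_zero (\<lambda>n. ec (phase n x y))"
    proof (rule phase_mean_zero_if_contracting[of contraction_factor])
      show "0 < contraction_factor" "contraction_factor \<le> 1" using contraction_factor[OF rs(1)] by simp_all
      fix j :: nat
      obtain q a where q: "q \<ge> j" "good q" "coprime a (int q)" "\<alpha> \<in> W q a" using \<alpha> unfolding U_def by blast
      then have "\<alpha> \<noteq> of_int a / of_nat q" "\<bar>\<alpha> - of_int a / of_nat q\<bar> < \<rho> q"
        by (auto simp: W_def dist_real_def abs_minus_commute)
      moreover have "q > 0" using q(2) by (simp add: good_def resonant_def)
      ultimately show "\<exists>q\<ge>j. q > 0 \<and> (\<forall>B. (\<forall>x y. cmod (phase_sum q x y) \<le> B) \<longrightarrow>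
          (\<exists>N\<ge>1. \<forall>x y. cmod (phase_sum N x y) \<le> ((1 - contraction_factor) * (B / real q) + 1 / real q) * real N))"
        using \<rho>(2)[OF q(2), unfolded contracting_def, rule_format, OF q(3)] q(1) by blast
    qed
    then show ?thesis by (simp only: phase_def)
  qed
  then show ?thesis using op dense by blast
qed

end

text \<open>Katai\<close>

lemma birkhoff_sum_cmult: "birkhoff_sum (\<lambda>x. c * f x) \<alpha> n x = c * birkhoff_sum f \<alpha> n x"
  by (simp add: birkhoff_sum_def sum_distrib_left)

lemma moebius_mean_zero_if_phases:
  fixes a b :: int
  assumes phases: "\<And>p p' t. prime p \<Longrightarrow> prime p' \<Longrightarrow> p \<noteq> p' \<Longrightarrow>
    mean_zero (\<lambda>n. ec (of_int b * birkhoff_sum f \<alpha> (p * n) x - of_int b * birkhoff_sum f \<alpha> (p' * n) x + of_nat n * t))"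
  shows "mean_zero (\<lambda>n. ec (of_int a * (x + of_nat n * \<alpha>) + of_int b * (y + birkhoff_sum f \<alpha> n x)) * of_int (moebius n))"
proof (rule katai_criterion)
  fix p p' :: nat assume p: "prime p" "prime p'" "p \<noteq> p'"
  have "of_int a * (x + of_nat (p * n) * \<alpha>) + of_int b * (y + birkhoff_sum f \<alpha> (p * n) x)
      + - (of_int a * (x + of_nat (p' * n) * \<alpha>) + of_int b * (y + birkhoff_sum f \<alpha> (p' * n) x))
    = of_int b * birkhoff_sum f \<alpha> (p * n) x - of_int b * birkhoff_sum f \<alpha> (p' * n) x
      + of_nat n * (of_int a * \<alpha> * (real p - real p'))" for n
    by (simp add: algebra_simps)
  then show "mean_zero (\<lambda>n. ec (of_int a * (x + of_nat (p * n) * \<alpha>) + of_int b * (y + birkhoff_sum f \<alpha> (p * n) x))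
      * cnj (ec (of_int a * (x + of_nat (p' * n) * \<alpha>) + of_int b * (y + birkhoff_sum f \<alpha> (p' * n) x))))"
    using phases[OF p, of "of_int a * \<alpha> * (real p - real p')"] by (simp only: cnj_ec ec_add[symmetric])
qed simp

lemma linear_phase_mean_zero:
  fixes a :: int
  shows "mean_zero (\<lambda>n. ec (of_int a * (x + of_nat n * \<alpha>)) * of_int (moebius n))"
proof -
  have "ec (of_int a * (x + of_nat n * \<alpha>)) * of_int (moebius n)
      = ec (of_int a * x) * (ec (of_nat n * (of_int a * \<alpha>)) * of_int (moebius n))" for n
    by (simp add: distrib_left ec_add mult_ac)
  then show ?thesis using mean_zero_cmult[OF moebius_ec_mean_zero] by (simp only:)
qed

lemma residual_countable_Inter:
  assumes "countable \<U>" "\<And>U. U \<in> \<U> \<Longrightarrow> open U \<and> closure U = UNIV" "\<Inter>\<U> \<subseteq> S"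
  shows "residual S"
  unfolding residual_def using assms by blast

lemma C1_Hoelder_locale:
  assumes "\<forall>x. f (x + 1) = f x" "\<delta> > 0" "C1_Hoelder \<delta> f"
  obtains f' C where "periodic_C1_Hoelder f f' \<delta> C"
proof -
  obtain f' C where f': "\<And>x. (f has_real_derivative f' x) (at x)" and C: "\<And>x y. \<bar>f' x - f' y\<bar> \<le> C * \<bar>x - y\<bar> powr \<delta>"
    using assms(3) unfolding C1_Hoelder_def by blast
  have "(f' \<longlongrightarrow> f' x) (at x)" for x
  proof (rule Lim_null_comparison[of "\<lambda>y. f' y - f' x" "\<lambda>y. C * \<bar>y - x\<bar> powr \<delta>", THEN LIM_zero_cancel])
    show "\<forall>\<^sub>F y in at x. norm (f' y - f' x) \<le> C * \<bar>y - x\<bar> powr \<delta>" using C by simp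
    have "((\<lambda>y. \<bar>y - x\<bar>) \<longlongrightarrow> 0) (at x)"
      using tendsto_rabs[OF LIM_zero[OF tendsto_ident_at]] by simp
    then have "((\<lambda>y. \<bar>y - x\<bar> powr \<delta>) \<longlongrightarrow> 0 powr \<delta>) (at x)"
      using assms(2) by (intro tendsto_powr') auto
    then show "((\<lambda>y. C * \<bar>y - x\<bar> powr \<delta>) \<longlongrightarrow> 0) (at x)" by (intro tendsto_mult_right_zero) simp
  qed
  then have "continuous_on UNIV f'" by (simp add: continuous_on_def)
  then have "periodic_C1_Hoelder f f' \<delta> C"
    by unfold_locales (use assms f' C in auto)
  then show ?thesis by (rule that)
qed

lemma (in periodic_C1_Hoelder) scaled: "periodic_C1_Hoelder (\<lambda>x. c * f x) (\<lambda>x. c * f' x) \<delta> (\<bar>c\<bar> * C)"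
proof
  show "((\<lambda>x. c * f x) has_real_derivative c * f' x) (at x)" for x by (rule DERIV_cmult[OF deriv])
  show "\<bar>c * f' x - c * f' y\<bar> \<le> \<bar>c\<bar> * C * \<bar>x - y\<bar> powr \<delta>" for x y
    using mult_left_mono[OF Hoelder[of x y], of "\<bar>c\<bar>"] by (simp add: right_diff_distrib[symmetric] abs_mult mult.assoc)
qed (auto simp: per \<delta> intro!: continuous_intros cont_deriv)

lemma (in periodic_C1_Hoelder) fourier_coeff_scaled: "fourier_coeff (\<lambda>x. of_real (c * f x)) n = of_real c * fourier_coeff F n"
  by (simp add: fourier_coeff_def circle_mean_cmult[symmetric] mult.assoc)

lemma irrational_complement_singleton: "open (- {x :: real})" "closure (- {x :: real}) = UNIV"
proof -
  show "open (- {x})" by (simp add: open_Compl)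
  have "x islimpt - {x}" using islimpt_punctured[of x UNIV] by (simp add: islimpt_UNIV Compl_eq_Diff_UNIV)
  then show "closure (- {x}) = UNIV" by (auto simp: closure_def)
qed

theorem theorem1p0p3:
  fixes f :: "real \<Rightarrow> real" and \<delta> :: real and c :: int
  assumes "\<forall>x. f (x + 1) = f x"
    and "\<delta> > 0"
    and "C1_Hoelder \<delta> f"
  shows "residual {\<alpha>. moebius_disjoint (skew_map \<alpha> c f)}"
proof -
  obtain f' C where loc: "periodic_C1_Hoelder f f' \<delta> C" by (rule C1_Hoelder_locale[OF assms])
  interpret periodic_C1_Hoelder f f' \<delta> C by (rule loc)
  define irr where "irr = (\<lambda>x :: real. - {x}) ` \<rat>"
  have irr: "countable irr" "\<And>U. U \<in> irr \<Longrightarrow> open U \<and> closure U = UNIV" "\<And>\<alpha>. \<alpha> \<in> \<Inter>irr \<Longrightarrow> \<alpha> \<notin> \<rat>"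
    by (auto simp: irr_def countable_rat irrational_complement_singleton)
  show ?thesis
  proof (cases "c = 0 \<and> (\<forall>j. \<exists>n\<ge>j. coeff n \<noteq> 0)")
    case False
    have "moebius_disjoint (skew_map \<alpha> c f)" if \<alpha>: "\<alpha> \<notin> \<rat>" for \<alpha>
    proof (rule moebius_disjoint_skew_mapI[OF assms(1)])
      fix a b :: int and x y :: real
      show "mean_zero (\<lambda>n. ec (of_int a * (x + of_nat n * \<alpha>)
        + of_int b * (y + birkhoff_sum (\<lambda>t. of_int c * t + f t) \<alpha> n x)) * of_int (moebius n))"
      proof (cases "c = 0")
        case True
        then obtain J where "\<And>n. n \<ge> J \<Longrightarrow> coeff n = 0" using False by blast
        then show ?thesis using trigonometric_polynomial_mean_zero[OF \<alpha>, of J] True by simp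
      next
        case False
        show ?thesis
        proof (cases "b = 0")
          case True
          then show ?thesis using linear_phase_mean_zero[of a x \<alpha>] by simp
        next
          case False
          then show ?thesis using nonzero_degree_mean_zero[OF \<alpha> False \<open>c \<noteq> 0\<close>] by simp
        qed
      qed
    qed
    then show ?thesis by (intro residual_countable_Inter[OF irr(1,2)]) (use irr(3) in auto)
  next
    case True
    then have c: "c = 0" and inf: "\<And>j. \<exists>n\<ge>j. coeff n \<noteq> 0" by blast+
    let ?good = "\<lambda>b (p :: nat) p' \<alpha>. \<forall>t x y. mean_zero (\<lambda>n. ec (birkhoff_sum (\<lambda>x. of_int b * f x) \<alpha> (p * n) x
        - birkhoff_sum (\<lambda>x. of_int b * f x) \<alpha> (p' * n) y + of_nat n * t))"
    define I where "I = {(b :: int, p :: nat, p' :: nat). b \<noteq> 0 \<and> prime p \<and> prime p' \<and> p \<noteq> p'}"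
    have "\<exists>U :: nat \<Rightarrow> real set. (\<forall>j. open (U j) \<and> closure (U j) = UNIV) \<and> (\<forall>\<alpha>. (\<forall>j. \<alpha> \<in> U j) \<longrightarrow> ?good b p p' \<alpha>)"
      if i: "(b, p, p') \<in> I" for b p p'
    proof (rule periodic_C1_Hoelder.generic_phase_mean_zero[OF scaled])
      show "\<exists>n\<ge>j. fourier_coeff (\<lambda>x. complex_of_real (of_int b * f x)) (int n) \<noteq> 0" for j
        using inf[of j] i unfolding fourier_coeff_scaled by (auto simp: I_def)
      show "p > 0" "p' > 0" using i prime_gt_0_nat by (auto simp: I_def)
      show "\<not> p' dvd p" using i primes_dvd_imp_eq[of p' p] by (auto simp: I_def)
    qed
    note family = this
    define nice where "nice i U \<longleftrightarrow> (\<forall>j. open (U j) \<and> closure (U j) = UNIV)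
        \<and> (\<forall>\<alpha>. (\<forall>j. \<alpha> \<in> U j) \<longrightarrow> ?good (fst i) (fst (snd i)) (snd (snd i)) \<alpha>)"
      for i and U :: "nat \<Rightarrow> real set"
    define U where "U i = (SOME U. nice i U)" for i
    have nice: "nice i (U i)" if "i \<in> I" for i
    proof -
      obtain b p p' where i: "i = (b, p, p')" by (cases i)
      show ?thesis unfolding U_def
        by (rule someI_ex[of "nice i"]) (simp only: nice_def i fst_conv snd_conv, rule family, use that i in simp)
    qed
    have U: "open (U i j) \<and> closure (U i j) = UNIV" if "i \<in> I" for i j
      by (rule spec[OF conjunct1[OF nice[OF that, unfolded nice_def]]])
    have good: "?good (fst i) (fst (snd i)) (snd (snd i)) \<alpha>" if "i \<in> I" "\<forall>j. \<alpha> \<in> U i j" for i \<alpha>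
      by (rule mp[OF spec[OF conjunct2[OF nice[OF that(1), unfolded nice_def]]] that(2)])
    define \<U> where "\<U> = irr \<union> (\<lambda>(i, j). U i j) ` (I \<times> UNIV)"
    show ?thesis
    proof (rule residual_countable_Inter[of \<U>])
      show "countable \<U>" unfolding \<U>_def using irr(1) by (intro countable_Un countable_image) auto
      show "open V \<and> closure V = UNIV" if "V \<in> \<U>" for V using that irr(2) U by (auto simp: \<U>_def)
      show "\<Inter>\<U> \<subseteq> {\<alpha>. moebius_disjoint (skew_map \<alpha> c f)}"
      proof (intro subsetI CollectI)
        fix \<alpha> assume \<alpha>: "\<alpha> \<in> \<Inter>\<U>"
        show "moebius_disjoint (skew_map \<alpha> c f)"
        proof (rule moebius_disjoint_skew_mapI[OF assms(1)])
          fix a b :: int and x y :: real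
          show "mean_zero (\<lambda>n. ec (of_int a * (x + of_nat n * \<alpha>)
            + of_int b * (y + birkhoff_sum (\<lambda>t. of_int c * t + f t) \<alpha> n x)) * of_int (moebius n))"
          proof (cases "b = 0")
            case True
            then show ?thesis using linear_phase_mean_zero[of a x \<alpha>] by simp
          next
            case False
            have "mean_zero (\<lambda>n. ec (of_int a * (x + of_nat n * \<alpha>) + of_int b * (y + birkhoff_sum f \<alpha> n x)) * of_int (moebius n))"
            proof (rule moebius_mean_zero_if_phases)
              fix p p' :: nat and t :: real assume p: "prime p" "prime p'" "p \<noteq> p'"
              then have i: "(b, p, p') \<in> I" using False by (simp add: I_def)
              then have "\<forall>j. \<alpha> \<in> U (b, p, p') j" using \<alpha> by (auto simp: \<U>_def)
              from good[OF i this]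
              show "mean_zero (\<lambda>n. ec (of_int b * birkhoff_sum f \<alpha> (p * n) x - of_int b * birkhoff_sum f \<alpha> (p' * n) x + of_nat n * t))"
                by (simp add: birkhoff_sum_cmult)
            qed
            then show ?thesis using c by simp
          qed
        qed
      qed
    qed
  qed
qed

end
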